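(* Let $d\ge1$. For $K>0$, $\varepsilon>0$ and $(\psi_{1,0},\psi_{2,0})\in L^2(\mathbb{R}^d,\mathbb{C})\oplus L^2(\mathbb{R}^d,\mathbb{C})$ with $\|\psi_{1,0}\|=\|\psi_{2,0}\|=1$, let $(\psi_1,\psi_2)$ be the unique $\{\mathcal{F}_t\}_{t\ge0}$-adapted solution with paths in $C([0,\infty),L^2(\mathbb{R}^d,\mathbb{C})\oplus L^2(\mathbb{R}^d,\mathbb{C}))$ of $$\begin{cases}d\psi_1=i\Delta\psi_1\,dt+\frac K2\big(\psi_2-\langle\psi_1,\psi_2\rangle\psi_1\big)dt+i\varepsilon\,\psi_1\circ d\beta_1\\ d\psi_2=i\Delta\psi_2\,dt+\frac K2\big(\psi_1-\langle\psi_2,\psi_1\rangle\psi_2\big)dt+i\varepsilon\,\psi_2\circ d\beta_2\end{cases}$$ with $(\psi_1(0),\psi_2(0))=(\psi_{1,0},\psi_{2,0})$. Then: (i) There exists a probability measure $\nu_{K,\varepsilon}$ on $\mathbb{R}$ such that $\mathrm{Law}(\|\psi_1(t)-\psi_2(t)\|)\to\nu_{K,\varepsilon}$ in distribution as $t\to+\infty$. The limit $\nu_{K,\varepsilon}$ depends only on $\varepsilon^2/K$ and not on $(\psi_{1,0},\psi_{2,0})$. (ii) Moreover, $\displaystyle\lim_{t\to\infty}\inf_{\theta\in\mathbb{R}}\|\psi_1(t)-e^{i\theta}\psi_2(t)\|=0$ almost surely.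
   Context: $(\Omega,\mathcal{F},\mathbb{P})$ is a probability space with a standard complete filtration $\{\mathcal{F}_t\}_{t\ge0}$; $\beta_1,\beta_2$ are independent one-dimensional Brownian motions associated to it. $\langle\psi,\varphi\rangle=\int_{\mathbb{R}^d}\psi\overline{\varphi}\,dx$, $\|\cdot\|$ is the $L^2(\mathbb{R}^d,\mathbb{C})$ norm, $\circ$ is the Stratonovich product. Solutions are understood via the gauge transform: $\phi_j=e^{-i\varepsilon\beta_j}\psi_j$ solve pathwise, in the mild sense (with the group $U(t)=e^{it\Delta}$), the random PDE $\partial_t\phi_j=i\Delta\phi_j+\frac K2\big(e^{-i\varepsilon(\beta_j-\beta_k)}\phi_k-e^{i\varepsilon(\beta_j-\beta_k)}\langle\phi_j,\phi_k\rangle\phi_j\big)$ for $(j,k)\in\{(1,2),(2,1)\}$. Such a solution exists, is unique, and satisfies $\|\psi_1(t)\|=\|\psi_2(t)\|=1$ for all $t\ge0$ almost surely. *)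

theory Defs
  imports "HOL-Probability.Probability"
begin

definition square_integrable :: "('a::euclidean_space \<Rightarrow> complex) \<Rightarrow> bool" where
  "square_integrable f \<longleftrightarrow>
     f \<in> borel_measurable lborel \<and> integrable lborel (\<lambda>x. (cmod (f x))\<^sup>2)"

definition L2_rel :: "('a::euclidean_space \<Rightarrow> complex) \<Rightarrow> ('a \<Rightarrow> complex) \<Rightarrow> bool" where
  "L2_rel f g \<longleftrightarrow> square_integrable f \<and> square_integrable g \<and> (AE x in lborel. f x = g x)"

lemma square_integrable_zero: "square_integrable (\<lambda>_. 0)"
  by (simp add: square_integrable_def)

lemma square_integrable_mult:
  assumes f: "square_integrable f" and g: "square_integrable g"
  shows "integrable lborel (\<lambda>x. f x * cnj (g x))"
proof (rule Bochner_Integration.integrable_bound)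
  show "integrable lborel (\<lambda>x. (cmod (f x))\<^sup>2 + (cmod (g x))\<^sup>2)"
    using f g by (simp add: square_integrable_def)
  have [measurable]: "f \<in> borel_measurable lborel" "g \<in> borel_measurable lborel"
    using f g by (simp_all add: square_integrable_def)
  have [measurable]: "(\<lambda>x. cnj (g x)) \<in> borel_measurable lborel"
    by (rule borel_measurable_continuous_on[where f = cnj]) (auto intro: continuous_intros)
  show "(\<lambda>x. f x * cnj (g x)) \<in> borel_measurable lborel"
    by measurable
  have "norm (f x * cnj (g x)) \<le> norm ((cmod (f x))\<^sup>2 + (cmod (g x))\<^sup>2)" for x
  proof -
    have "2 * cmod (f x) * cmod (g x) \<le> (cmod (f x))\<^sup>2 + (cmod (g x))\<^sup>2"
      by (rule sum_squares_bound)
    moreover have "0 \<le> cmod (f x) * cmod (g x)"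
      by simp
    ultimately have "cmod (f x) * cmod (g x) \<le> (cmod (f x))\<^sup>2 + (cmod (g x))\<^sup>2"
      by linarith
    then show ?thesis
      by (simp add: norm_mult)
  qed
  then show "AE x in lborel. norm (f x * cnj (g x)) \<le> norm ((cmod (f x))\<^sup>2 + (cmod (g x))\<^sup>2)"
    by simp
qed

lemma square_integrable_add:
  assumes f: "square_integrable f" and g: "square_integrable g"
  shows "square_integrable (\<lambda>x. f x + g x)"
  unfolding square_integrable_def
proof
  have [measurable]: "f \<in> borel_measurable lborel" "g \<in> borel_measurable lborel"
    using f g by (simp_all add: square_integrable_def)
  show "(\<lambda>x. f x + g x) \<in> borel_measurable lborel"
    by measurable
  show "integrable lborel (\<lambda>x. (cmod (f x + g x))\<^sup>2)"
  proof (rule Bochner_Integration.integrable_bound)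
    show "integrable lborel (\<lambda>x. 2 * (cmod (f x))\<^sup>2 + 2 * (cmod (g x))\<^sup>2)"
      using f g by (simp add: square_integrable_def)
    show "(\<lambda>x. (cmod (f x + g x))\<^sup>2) \<in> borel_measurable lborel"
      by measurable
    have "(cmod (f x + g x))\<^sup>2 \<le> 2 * (cmod (f x))\<^sup>2 + 2 * (cmod (g x))\<^sup>2" for x
    proof -
      have "(cmod (f x + g x))\<^sup>2 \<le> (cmod (f x) + cmod (g x))\<^sup>2"
        by (intro power_mono norm_triangle_ineq) simp
      moreover have "2 * cmod (f x) * cmod (g x) \<le> (cmod (f x))\<^sup>2 + (cmod (g x))\<^sup>2"
        by (rule sum_squares_bound)
      ultimately show ?thesis
        by (simp add: power2_sum)
    qed
    then show "AE x in lborel. norm ((cmod (f x + g x))\<^sup>2)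
                 \<le> norm (2 * (cmod (f x))\<^sup>2 + 2 * (cmod (g x))\<^sup>2)"
      by simp
  qed
qed

lemma square_integrable_cmult:
  assumes f: "square_integrable f"
  shows "square_integrable (\<lambda>x. c * f x)"
proof -
  have [measurable]: "f \<in> borel_measurable lborel"
    using f by (simp add: square_integrable_def)
  have "(\<lambda>x. c * f x) \<in> borel_measurable lborel"
    by measurable
  then show ?thesis
    using f by (simp add: square_integrable_def norm_mult power_mult_distrib)
qed

lemma square_integrable_cis:
  assumes f: "square_integrable f"
  shows "square_integrable (\<lambda>x. cis (- (t * (norm x)\<^sup>2)) * f x)"
proof -
  have [measurable]: "f \<in> borel_measurable lborel"
    using f by (simp add: square_integrable_def)
  have [measurable]: "(\<lambda>x::'a. cis (- (t * (norm x)\<^sup>2))) \<in> borel_measurable lborel"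
    by (simp, intro borel_measurable_continuous_onI continuous_intros)
  show ?thesis
    using f by (simp add: square_integrable_def norm_mult)
qed

quotient_type (overloaded) 'a L2 = "'a::euclidean_space \<Rightarrow> complex" / partial: L2_rel
proof (rule part_equivpI)
  show "\<exists>f::'a \<Rightarrow> complex. L2_rel f f"
    using square_integrable_zero by (auto simp: L2_rel_def)
  show "symp (L2_rel :: ('a \<Rightarrow> complex) \<Rightarrow> _)"
    by (auto simp: symp_def L2_rel_def)
  show "transp (L2_rel :: ('a \<Rightarrow> complex) \<Rightarrow> _)"
    by (auto simp: transp_def L2_rel_def)
qed

lift_definition cinner_L2 :: "'a::euclidean_space L2 \<Rightarrow> 'a L2 \<Rightarrow> complex"
  is "\<lambda>f g. \<integral>x. f x * cnj (g x) \<partial>lborel"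
proof (rule integral_cong_AE)
  fix f f' g g' :: "'a \<Rightarrow> complex"
  assume f: "L2_rel f f'" and g: "L2_rel g g'"
  show "(\<lambda>x. f x * cnj (g x)) \<in> borel_measurable lborel"
    using f g by (intro borel_measurable_integrable square_integrable_mult) (auto simp: L2_rel_def)
  show "(\<lambda>x. f' x * cnj (g' x)) \<in> borel_measurable lborel"
    using f g by (intro borel_measurable_integrable square_integrable_mult) (auto simp: L2_rel_def)
  show "AE x in lborel. f x * cnj (g x) = f' x * cnj (g' x)"
    using f g by (auto simp: L2_rel_def)
qed

lift_definition scaleC_L2 :: "complex \<Rightarrow> 'a::euclidean_space L2 \<Rightarrow> 'a L2"  (infixr "*\<^sub>C" 75)
  is "\<lambda>c f x. c * f x"
  by (auto simp: L2_rel_def intro: square_integrable_cmult)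

instantiation L2 :: (euclidean_space) real_inner
begin

lift_definition zero_L2 :: "'a L2" is "\<lambda>_. 0"
  by (simp add: L2_rel_def square_integrable_zero)

lift_definition plus_L2 :: "'a L2 \<Rightarrow> 'a L2 \<Rightarrow> 'a L2" is "\<lambda>f g x. f x + g x"
  by (auto simp: L2_rel_def intro: square_integrable_add)

definition scaleR_L2 :: "real \<Rightarrow> 'a L2 \<Rightarrow> 'a L2" where
  "scaleR_L2 r f = complex_of_real r *\<^sub>C f"

definition uminus_L2 :: "'a L2 \<Rightarrow> 'a L2" where
  "uminus_L2 f = (-1) *\<^sub>C f"

definition minus_L2 :: "'a L2 \<Rightarrow> 'a L2 \<Rightarrow> 'a L2" where
  "minus_L2 f g = f + - g"

definition inner_L2 :: "'a L2 \<Rightarrow> 'a L2 \<Rightarrow> real" where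
  "inner_L2 f g = Re (cinner_L2 f g)"

definition norm_L2 :: "'a L2 \<Rightarrow> real" where
  "norm_L2 f = sqrt (inner f f)"

definition sgn_L2 :: "'a L2 \<Rightarrow> 'a L2" where
  "sgn_L2 f = scaleR (inverse (norm f)) f"

definition dist_L2 :: "'a L2 \<Rightarrow> 'a L2 \<Rightarrow> real" where
  "dist_L2 f g = norm (f - g)"

definition uniformity_L2 :: "('a L2 \<times> 'a L2) filter" where
  "uniformity_L2 = (INF e\<in>{0<..}. principal {(f, g). dist f g < e})"

definition open_L2 :: "'a L2 set \<Rightarrow> bool" where
  "open_L2 S \<longleftrightarrow> (\<forall>f\<in>S. \<forall>\<^sub>F (f', g) in uniformity. f' = f \<longrightarrow> g \<in> S)"

instance
proof
  fix f g h :: "'a L2" and a b r :: real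
  show "f + g + h = f + (g + h)"
    by transfer (auto simp: L2_rel_def algebra_simps intro!: square_integrable_add)
  show "f + g = g + f"
    by transfer (auto simp: L2_rel_def algebra_simps intro!: square_integrable_add)
  show "0 + f = f"
    by transfer (auto simp: L2_rel_def)
  show "- f + f = 0"
    unfolding uminus_L2_def
    by transfer (auto simp: L2_rel_def square_integrable_zero)
  show "f - g = f + - g"
    by (simp add: minus_L2_def)
  show "a *\<^sub>R (f + g) = a *\<^sub>R f + a *\<^sub>R g"
    unfolding scaleR_L2_def
    by transfer (auto simp: L2_rel_def distrib_left distrib_right
          intro!: square_integrable_add square_integrable_cmult)
  show "(a + b) *\<^sub>R f = a *\<^sub>R f + b *\<^sub>R f"
    unfolding scaleR_L2_def
    by transfer (auto simp: L2_rel_def distrib_left distrib_right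
          intro!: square_integrable_add square_integrable_cmult)
  show "a *\<^sub>R b *\<^sub>R f = (a * b) *\<^sub>R f"
    unfolding scaleR_L2_def
    by transfer (auto simp: L2_rel_def mult.assoc intro!: square_integrable_cmult)
  show "1 *\<^sub>R f = f"
    unfolding scaleR_L2_def by transfer (auto simp: L2_rel_def)
  show "sgn f = inverse (norm f) *\<^sub>R f"
    by (simp add: sgn_L2_def)
  show "dist f g = norm (f - g)"
    by (simp add: dist_L2_def)
  show "(uniformity :: ('a L2 \<times> 'a L2) filter) = (INF e\<in>{0<..}. principal {(x, y). dist x y < e})"
    by (simp add: uniformity_L2_def)
  show "open S \<longleftrightarrow> (\<forall>x\<in>S. \<forall>\<^sub>F (x', y) in uniformity. x' = x \<longrightarrow> y \<in> S)" for S :: "'a L2 set"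
    by (simp add: open_L2_def)
  have "cinner_L2 f g = cnj (cinner_L2 g f)"
  proof transfer
    fix f g :: "'a \<Rightarrow> complex"
    assume "L2_rel f f" "L2_rel g g"
    then have "integrable lborel (\<lambda>x. g x * cnj (f x))"
      by (intro square_integrable_mult) (auto simp: L2_rel_def)
    from integral_bounded_linear[OF bounded_linear_cnj this]
    show "(\<integral>x. f x * cnj (g x) \<partial>lborel) = cnj (\<integral>x. g x * cnj (f x) \<partial>lborel)"
      by (simp add: mult.commute)
  qed
  then show "inner f g = inner g f"
    by (simp add: inner_L2_def)
  have "cinner_L2 (f + g) h = cinner_L2 f h + cinner_L2 g h"
    by transfer (auto simp: L2_rel_def distrib_right square_integrable_mult)
  then show "inner (f + g) h = inner f h + inner g h"
    by (simp add: inner_L2_def)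
  have "cinner_L2 (complex_of_real r *\<^sub>C f) g = complex_of_real r * cinner_L2 f g"
    by transfer (simp add: mult.assoc)
  then show "inner (r *\<^sub>R f) g = r * inner f g"
    by (simp add: inner_L2_def scaleR_L2_def)
  have *: "inner f f \<ge> 0 \<and> (inner f f = 0 \<longleftrightarrow> f = 0)"
    unfolding inner_L2_def
  proof transfer
    fix f :: "'a \<Rightarrow> complex"
    assume "L2_rel f f"
    then have f: "square_integrable f"
      by (simp add: L2_rel_def)
    have [simp]: "(\<integral>x. f x * cnj (f x) \<partial>lborel) = complex_of_real (\<integral>x. (cmod (f x))\<^sup>2 \<partial>lborel)"
      by (simp flip: complex_norm_square of_real_power)
    have "(\<integral>x. (cmod (f x))\<^sup>2 \<partial>lborel) = 0 \<longleftrightarrow> (AE x in lborel. (cmod (f x))\<^sup>2 = 0)"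
      using f by (intro integral_nonneg_eq_0_iff_AE) (auto simp: square_integrable_def)
    then show "0 \<le> Re (\<integral>x. f x * cnj (f x) \<partial>lborel) \<and>
        (Re (\<integral>x. f x * cnj (f x) \<partial>lborel) = 0 \<longleftrightarrow> L2_rel f (\<lambda>_. 0))"
      using f by (simp add: L2_rel_def square_integrable_zero)
  qed
  show "0 \<le> inner f f" "inner f f = 0 \<longleftrightarrow> f = 0"
    using * by auto
  show "norm f = sqrt (inner f f)"
    by (simp add: norm_L2_def)
qed

end

lift_definition truncated_fourier :: "nat \<Rightarrow> 'a::euclidean_space L2 \<Rightarrow> 'a \<Rightarrow> complex"
  is "\<lambda>n f \<xi>. \<integral>x. indicator (cball 0 (real n)) x *\<^sub>R (cis (- (\<xi> \<bullet> x)) * f x) \<partial>lborel"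
proof
  fix n and f g :: "'a \<Rightarrow> complex" and \<xi> :: 'a
  assume fg: "L2_rel f g"
  have fg_meas: "f \<in> borel_measurable lborel" "g \<in> borel_measurable lborel"
    using fg by (simp_all add: L2_rel_def square_integrable_def)
  have cis: "(\<lambda>x. cis (- (\<xi> \<bullet> x))) \<in> borel_measurable lborel"
    by (simp, intro borel_measurable_continuous_onI continuous_intros)
  show "(\<integral>x. indicator (cball 0 (real n)) x *\<^sub>R (cis (- (\<xi> \<bullet> x)) * f x) \<partial>lborel) =
        (\<integral>x. indicator (cball 0 (real n)) x *\<^sub>R (cis (- (\<xi> \<bullet> x)) * g x) \<partial>lborel)"
  proof (rule integral_cong_AE)
    show "(\<lambda>x. indicator (cball 0 (real n)) x *\<^sub>R (cis (- (\<xi> \<bullet> x)) * f x)) \<in> borel_measurable lborel"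
      using cis fg_meas by (intro borel_measurable_scaleR borel_measurable_indicator borel_measurable_times) auto
    show "(\<lambda>x. indicator (cball 0 (real n)) x *\<^sub>R (cis (- (\<xi> \<bullet> x)) * g x)) \<in> borel_measurable lborel"
      using cis fg_meas by (intro borel_measurable_scaleR borel_measurable_indicator borel_measurable_times) auto
    show "AE x in lborel. indicator (cball 0 (real n)) x *\<^sub>R (cis (- (\<xi> \<bullet> x)) * f x) =
            indicator (cball 0 (real n)) x *\<^sub>R (cis (- (\<xi> \<bullet> x)) * g x)"
      using fg by (auto simp: L2_rel_def)
  qed
qed

text \<open>
  The Fourier--Plancherel transform, as the limit in mean of the (absolutely convergent) Fourier
  integrals over balls. These integrals are square-integrable functions of the frequency by
  Plancherel's theorem, so \<^const>\<open>abs_L2\<close> is only used on its proper domain.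
\<close>

definition fourier_L2 :: "'a::euclidean_space L2 \<Rightarrow> 'a L2" where
  "fourier_L2 f = lim (\<lambda>n. abs_L2 (truncated_fourier n f))"

lift_definition schroedinger_multiplier :: "real \<Rightarrow> 'a::euclidean_space L2 \<Rightarrow> 'a L2"
  is "\<lambda>t f \<xi>. cis (- (t * (norm \<xi>)\<^sup>2)) * f \<xi>"
  by (auto simp: L2_rel_def intro: square_integrable_cis)

text \<open>
  This is \<open>exp (i t \<Delta>)\<close>: with the kernel \<open>exp (- i \<xi> \<bullet> x)\<close>, the Laplacian has symbol
  \<open>- (norm \<xi>)\<^sup>2\<close>.
\<close>

definition schroedinger_group :: "real \<Rightarrow> 'a::euclidean_space L2 \<Rightarrow> 'a L2" where
  "schroedinger_group t f = inv fourier_L2 (schroedinger_multiplier t (fourier_L2 f))"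

text \<open>
  The filtrations of the library are indexed by a whole type. Only times \<open>t \<ge> 0\<close> matter below;
  a filtration on \<open>[0, \<infinity>)\<close> can be extended by its value at \<open>0\<close>.
\<close>

locale complete_filtered_space = prob_space M + complete_measure M + filtration "space M" F
  for M :: "'w measure" and F :: "real \<Rightarrow> 'w measure" +
  assumes subalgebra_F: "0 \<le> t \<Longrightarrow> subalgebra M (F t)"
    and null_sets_F: "null_sets M \<subseteq> sets (F 0)"
    and right_continuous_F: "0 \<le> t \<Longrightarrow> sets (F t) = (\<Inter>s\<in>{t<..}. sets (F s))"
begin

definition brownian_motion :: "(real \<Rightarrow> 'w \<Rightarrow> real) \<Rightarrow> bool" where
  "brownian_motion \<beta> \<longleftrightarrow>
     (\<forall>t\<ge>0. \<beta> t \<in> borel_measurable (F t)) \<and>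
     (AE \<omega> in M. \<beta> 0 \<omega> = 0 \<and> continuous_on {0..} (\<lambda>t. \<beta> t \<omega>)) \<and>
     (\<forall>s t. 0 \<le> s \<and> s < t \<longrightarrow>
        distributed M lborel (\<lambda>\<omega>. \<beta> t \<omega> - \<beta> s \<omega>) (normal_density 0 (sqrt (t - s))) \<and>
        indep_set (sets (F s))
          (sigma_sets (space M) {(\<lambda>\<omega>. \<beta> t \<omega> - \<beta> s \<omega>) -` A \<inter> space M | A. A \<in> sets borel}))"

definition indep_processes :: "(real \<Rightarrow> 'w \<Rightarrow> real) \<Rightarrow> (real \<Rightarrow> 'w \<Rightarrow> real) \<Rightarrow> bool" where
  "indep_processes X Y \<longleftrightarrow>
     indep_var (\<Pi>\<^sub>M t\<in>{0..}. borel) (\<lambda>\<omega>. \<lambda>t\<in>{0..}. X t \<omega>)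
               (\<Pi>\<^sub>M t\<in>{0..}. borel) (\<lambda>\<omega>. \<lambda>t\<in>{0..}. Y t \<omega>)"

end

locale brownian_pair = complete_filtered_space M F
  for M :: "'w measure" and F :: "real \<Rightarrow> 'w measure" and \<beta>\<^sub>1 \<beta>\<^sub>2 :: "real \<Rightarrow> 'w \<Rightarrow> real" +
  assumes brownian_1: "brownian_motion \<beta>\<^sub>1"
    and brownian_2: "brownian_motion \<beta>\<^sub>2"
    and independent: "indep_processes \<beta>\<^sub>1 \<beta>\<^sub>2"

definition gauged_coupling ::
    "real \<Rightarrow> real \<Rightarrow> real \<Rightarrow> 'a::euclidean_space L2 \<Rightarrow> 'a L2 \<Rightarrow> 'a L2" where
  "gauged_coupling K \<epsilon> b u v =
     (K / 2) *\<^sub>R (cis (- (\<epsilon> * b)) *\<^sub>C v - (cis (\<epsilon> * b) * cinner_L2 u v) *\<^sub>C u)"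

text \<open>
  The mild (Duhamel) form of the equation for one component \<open>u\<close>, coupled to \<open>v\<close>; here \<open>b\<close> is the
  difference of the driving path of \<open>u\<close> and that of \<open>v\<close>. For continuous \<open>b\<close>, \<open>u\<close> and \<open>v\<close> the integrand
  is continuous, so that the integral is an ordinary vector-valued Riemann integral.
\<close>

definition mild_equation ::
    "real \<Rightarrow> real \<Rightarrow> (real \<Rightarrow> real) \<Rightarrow> (real \<Rightarrow> 'a::euclidean_space L2) \<Rightarrow> (real \<Rightarrow> 'a L2) \<Rightarrow> bool" where
  "mild_equation K \<epsilon> b u v \<longleftrightarrow>
     (\<forall>t\<ge>0. ((\<lambda>s. schroedinger_group (t - s) (gauged_coupling K \<epsilon> (b s) (u s) (v s)))
        has_integral (u t - schroedinger_group t (u 0))) {0..t})"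

definition gauge_transform :: "real \<Rightarrow> (real \<Rightarrow> 'w \<Rightarrow> real) \<Rightarrow> (real \<Rightarrow> 'w \<Rightarrow> 'a::euclidean_space L2) \<Rightarrow>
    real \<Rightarrow> 'w \<Rightarrow> 'a L2" where
  "gauge_transform \<epsilon> \<beta> \<psi> t \<omega> = cis (- (\<epsilon> * \<beta> t \<omega>)) *\<^sub>C \<psi> t \<omega>"

text \<open>
  Solutions of
  \<open>d\<psi>\<^sub>j = i \<Delta> \<psi>\<^sub>j dt + K/2 (\<psi>\<^sub>k - \<langle>\<psi>\<^sub>j, \<psi>\<^sub>k\<rangle> \<psi>\<^sub>j) dt + i \<epsilon> \<psi>\<^sub>j \<circ> d\<beta>\<^sub>j\<close> (Stratonovich noise): the processes
  \<open>exp (- i \<epsilon> \<beta>\<^sub>j) \<psi>\<^sub>j\<close> satisfy pathwise the random equation obtained by removing the noise.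
\<close>

definition schroedinger_lohe_solution ::
    "'w measure \<Rightarrow> (real \<Rightarrow> 'w measure) \<Rightarrow> (real \<Rightarrow> 'w \<Rightarrow> real) \<Rightarrow> (real \<Rightarrow> 'w \<Rightarrow> real) \<Rightarrow>
     real \<Rightarrow> real \<Rightarrow> 'a::euclidean_space L2 \<Rightarrow> 'a L2 \<Rightarrow>
     (real \<Rightarrow> 'w \<Rightarrow> 'a L2) \<Rightarrow> (real \<Rightarrow> 'w \<Rightarrow> 'a L2) \<Rightarrow> bool" where
  "schroedinger_lohe_solution M F \<beta>\<^sub>1 \<beta>\<^sub>2 K \<epsilon> f\<^sub>1 f\<^sub>2 \<psi>\<^sub>1 \<psi>\<^sub>2 \<longleftrightarrow>
     (\<forall>t\<ge>0. (\<lambda>\<omega>. (\<psi>\<^sub>1 t \<omega>, \<psi>\<^sub>2 t \<omega>)) \<in> borel_measurable (F t)) \<and>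
     (AE \<omega> in M.
        continuous_on {0..} (\<lambda>t. (\<psi>\<^sub>1 t \<omega>, \<psi>\<^sub>2 t \<omega>)) \<and>
        \<psi>\<^sub>1 0 \<omega> = f\<^sub>1 \<and> \<psi>\<^sub>2 0 \<omega> = f\<^sub>2 \<and>
        mild_equation K \<epsilon> (\<lambda>t. \<beta>\<^sub>1 t \<omega> - \<beta>\<^sub>2 t \<omega>)
          (\<lambda>t. gauge_transform \<epsilon> \<beta>\<^sub>1 \<psi>\<^sub>1 t \<omega>) (\<lambda>t. gauge_transform \<epsilon> \<beta>\<^sub>2 \<psi>\<^sub>2 t \<omega>) \<and>
        mild_equation K \<epsilon> (\<lambda>t. \<beta>\<^sub>2 t \<omega> - \<beta>\<^sub>1 t \<omega>)
          (\<lambda>t. gauge_transform \<epsilon> \<beta>\<^sub>2 \<psi>\<^sub>2 t \<omega>) (\<lambda>t. gauge_transform \<epsilon> \<beta>\<^sub>1 \<psi>\<^sub>1 t \<omega>))"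

definition weak_conv_along :: "('i \<Rightarrow> real measure) \<Rightarrow> real measure \<Rightarrow> 'i filter \<Rightarrow> bool" where
  "weak_conv_along \<mu> \<nu> G \<longleftrightarrow>
     (\<forall>x. isCont (cdf \<nu>) x \<longrightarrow> ((\<lambda>t. cdf (\<mu> t) x) \<longlongrightarrow> cdf \<nu> x) G)"

lemma weak_conv_along_sequentially: "weak_conv_along \<mu> \<nu> sequentially \<longleftrightarrow> weak_conv_m \<mu> \<nu>"
  by (simp add: weak_conv_along_def weak_conv_m_def weak_conv_def)

end

theory Submission
  imports Defs
begin

text \<open>After the gauge transform the overlap \<open>z = \<langle>\<psi>\<^sub>1, \<psi>\<^sub>2\<rangle>\<close> alone solves the equation
  \<open>d z = K (1 - z\<^sup>2) dt + i \<epsilon> z \<circ> d (\<beta>\<^sub>1 - \<beta>\<^sub>2)\<close> on the closed unit disk, because the free group is unitary.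
  The defect \<open>1 - \<bar>z\<bar>\<^sup>2\<close> solves a linear equation with rate \<open>- 2 K Re z\<close>; a small power of it, corrected
  by a trigonometric polynomial in \<open>z\<close>, has exponentially decaying expectation, so that \<open>\<bar>z\<bar> \<longlongrightarrow> 1\<close> almost
  surely. The moments \<open>E z\<^sup>n\<close> form a closed hierarchy whose differences to its stationary solution, the moments
  of the von Mises density proportional to \<open>exp ((2 K / \<epsilon>\<^sup>2) cos \<theta>)\<close>, are dissipated. Hence \<open>z\<close>
  converges in law to a von Mises point of the unit circle, and the distance is \<open>sqrt (2 - 2 Re z)\<close>.\<close>

section \<open>The Hilbert space of square-integrable functions\<close>

text \<open>No stochastic integral appears: the noise enters only through expectations of a factor
  from the past times \<open>cis\<close> of an increment of
  \<open>\<beta>\<^sub>1 - \<beta>\<^sub>2\<close>, and these turn the evolution of moments into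
  ordinary differential equations. The von Mises density comes from the dynamics on the unit circle.
  There z = exp (i \<theta>) with d \<theta> = - 2 K sin \<theta> dt + \<epsilon> d (beta1 - beta2).
  The difference has variance 2 t, so the generator is \<epsilon>^2 D^2 - 2 K sin \<theta> D with D
  = d/d\<theta>, and its density of zero flux is proportional to exp ((2 K / \<epsilon>^2) cos
  \<theta>). Inside the disk the moments E z^n test only holomorphic functions of z and cannot
  identify a limit law by themselves. The convergence of |z| to 1 is what upgrades them to all mixed
  moments in z and its conjugate; it is also the content of (ii). The free group is defined through
  the inverse of the Fourier-Plancherel map, so completeness of the space, Plancherel's theorem and
  surjectivity have to come before unitarity.\<close>

lemma square_integrable_measurable: "square_integrable f \<Longrightarrow> f \<in> borel_measurable borel"
  by (simp add: square_integrable_def)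

lemma L2_cases:
  obtains r where "square_integrable r" "f = abs_L2 r"
proof
  show "square_integrable (rep_L2 f)"
    using Quotient_rep_reflp[OF Quotient_L2] by (auto simp: L2_rel_def)
  show "f = abs_L2 (rep_L2 f)"
    by (simp add: Quotient_abs_rep[OF Quotient_L2])
qed

lemma cinner_abs_L2:
  assumes "square_integrable f" "square_integrable g"
  shows "cinner_L2 (abs_L2 f) (abs_L2 g) = (\<integral>x. f x * cnj (g x) \<partial>lborel)"
  using assms by (intro cinner_L2.abs_eq) (auto simp: L2_rel_def)

lemma add_abs_L2:
  assumes "square_integrable f" "square_integrable g"
  shows "abs_L2 f + abs_L2 g = abs_L2 (\<lambda>x. f x + g x)"
  using assms by (intro plus_L2.abs_eq) (auto simp: L2_rel_def)

lemma scaleC_abs_L2: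
  assumes "square_integrable f"
  shows "c *\<^sub>C abs_L2 f = abs_L2 (\<lambda>x. c * f x)"
  using assms by (intro scaleC_L2.abs_eq) (auto simp: L2_rel_def)

lemma square_integrable_diff:
  assumes "square_integrable f" "square_integrable g"
  shows "square_integrable (\<lambda>x. f x - g x)"
  using square_integrable_add[OF assms(1) square_integrable_cmult[OF assms(2), of "-1"]] by simp

lemma diff_abs_L2:
  assumes "square_integrable f" "square_integrable g"
  shows "abs_L2 f - abs_L2 g = abs_L2 (\<lambda>x. f x - g x)"
  using assms square_integrable_cmult[OF assms(2), of "-1"]
  by (simp add: minus_L2_def uminus_L2_def scaleC_abs_L2 add_abs_L2)

lemma norm_abs_L2:
  assumes "square_integrable f"
  shows "(norm (abs_L2 f))\<^sup>2 = (\<integral>x. (cmod (f x))\<^sup>2 \<partial>lborel)"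
proof -
  have "(\<integral>x. f x * cnj (f x) \<partial>lborel) = complex_of_real (\<integral>x. (cmod (f x))\<^sup>2 \<partial>lborel)"
    by (simp flip: complex_norm_square of_real_power)
  then show ?thesis
    using assms by (simp add: power2_norm_eq_inner inner_L2_def cinner_abs_L2)
qed

lemma nn_integral_norm_abs_L2:
  assumes "square_integrable f"
  shows "(\<integral>\<^sup>+x. ennreal ((cmod (f x))\<^sup>2) \<partial>lborel) = ennreal ((norm (abs_L2 f))\<^sup>2)"
  using assms by (subst norm_abs_L2) (auto intro!: nn_integral_eq_integral simp: square_integrable_def)

lemma square_integrableI_nn_integral:
  assumes [measurable]: "f \<in> borel_measurable borel"
    and "(\<integral>\<^sup>+x. ennreal ((cmod (f x))\<^sup>2) \<partial>lborel) < \<infinity>"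
  shows "square_integrable f"
  unfolding square_integrable_def
  using assms(2) by (intro conjI integrableI_bounded) (auto simp: )

section \<open>The complex inner product and the Cauchy-Schwarz inequality\<close>

lemma cinner_L2_commute: "cnj (cinner_L2 f g) = cinner_L2 g f"
proof -
  obtain r s where rs: "square_integrable r" "f = abs_L2 r" "square_integrable s" "g = abs_L2 s"
    by (metis L2_cases)
  have "(\<integral>x. cnj (r x * cnj (s x)) \<partial>lborel) = cnj (\<integral>x. r x * cnj (s x) \<partial>lborel)"
    using rs by (intro integral_bounded_linear[OF bounded_linear_cnj] square_integrable_mult)
  then show ?thesis
    using rs by (simp add: cinner_abs_L2 mult.commute)
qed

lemma cinner_L2_add_left: "cinner_L2 (f + g) h = cinner_L2 f h + cinner_L2 g h"
  by transfer (auto simp: L2_rel_def distrib_right square_integrable_mult)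

lemma cinner_L2_scaleC_left: "cinner_L2 (c *\<^sub>C f) g = c * cinner_L2 f g"
  by transfer (simp add: mult.assoc)

lemma cinner_L2_add_right: "cinner_L2 h (f + g) = cinner_L2 h f + cinner_L2 h g"
  by (metis cinner_L2_add_left cinner_L2_commute complex_cnj_add)

lemma cinner_L2_scaleC_right: "cinner_L2 f (c *\<^sub>C g) = cnj c * cinner_L2 f g"
  by (metis cinner_L2_scaleC_left cinner_L2_commute complex_cnj_mult)

lemma cinner_L2_scaleR_left: "cinner_L2 (c *\<^sub>R f) g = c *\<^sub>R cinner_L2 f g"
  by (simp add: scaleR_L2_def cinner_L2_scaleC_left scaleR_conv_of_real)

lemma cinner_L2_scaleR_right: "cinner_L2 f (c *\<^sub>R g) = c *\<^sub>R cinner_L2 f g"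
  by (simp add: scaleR_L2_def cinner_L2_scaleC_right scaleR_conv_of_real)

lemma cinner_L2_diff_left: "cinner_L2 (f - g) h = cinner_L2 f h - cinner_L2 g h"
  by (simp add: minus_L2_def uminus_L2_def cinner_L2_add_left cinner_L2_scaleC_left)

lemma cinner_L2_self: "cinner_L2 f f = complex_of_real ((norm f)\<^sup>2)"
proof -
  have "Im (cinner_L2 f f) = 0"
    using cinner_L2_commute[of f f] by (simp add: complex_eq_iff)
  then show ?thesis
    by (simp add: complex_eq_iff power2_norm_eq_inner inner_L2_def)
qed

lemma norm_scaleC_L2: "norm (c *\<^sub>C f) = cmod c * norm f"
proof -
  have "complex_of_real ((norm (c *\<^sub>C f))\<^sup>2) = of_real ((cmod c * norm f)\<^sup>2)"
    by (simp add: cinner_L2_self[symmetric] cinner_L2_scaleC_left cinner_L2_scaleC_right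
        power_mult_distrib complex_norm_square mult_ac flip: of_real_power)
  then show ?thesis
    by (metis of_real_eq_iff norm_ge_zero mult_nonneg_nonneg power2_eq_iff_nonneg)
qed

text \<open>Rotating \<open>f\<close> by the phase of the inner product makes the latter real and
  nonnegative; it is then the real inner product of the type class, for which Cauchy-Schwarz is
  known.\<close>

lemma cinner_L2_bound: "cmod (cinner_L2 f g) \<le> norm f * norm g"
proof -
  define z where "z = cinner_L2 f g"
  have "cmod z = Re (cis (- Arg z) * z)"
    by (subst (3) rcis_cmod_Arg[of z, symmetric]) (simp add: rcis_def cis_mult mult.left_commute)
  also have "\<dots> = inner (cis (- Arg z) *\<^sub>C f) g"
    by (simp add: inner_L2_def cinner_L2_scaleC_left z_def)
  also have "\<dots> \<le> norm f * norm g"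
    using norm_cauchy_schwarz[of "cis (- Arg z) *\<^sub>C f" g] by (simp add: norm_scaleC_L2)
  finally show ?thesis
    by (simp add: z_def)
qed

text \<open>Bilinearity is meant over the reals, so conjugate linearity in the second argument is
  compatible with it. This is the source of continuity and of the product rule for inner products of
  curves.\<close>

lemma bounded_bilinear_cinner_L2: "bounded_bilinear cinner_L2"
  by (rule bounded_bilinear.intro)
    (auto simp: cinner_L2_add_left cinner_L2_add_right cinner_L2_scaleR_left cinner_L2_scaleR_right
      intro!: exI[of _ 1] cinner_L2_bound)

lemma scaleC_L2_add_right: "c *\<^sub>C (f + g) = c *\<^sub>C f + c *\<^sub>C g"
  by transfer (auto simp: L2_rel_def distrib_left intro!: square_integrable_add square_integrable_cmult)

lemma scaleC_L2_add_left: "(c + d) *\<^sub>C f = c *\<^sub>C f + d *\<^sub>C f"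
  by transfer (auto simp: L2_rel_def distrib_right intro!: square_integrable_add square_integrable_cmult)

lemma scaleC_scaleC_L2: "c *\<^sub>C d *\<^sub>C f = (c * d) *\<^sub>C f"
  by transfer (auto simp: L2_rel_def mult.assoc intro!: square_integrable_cmult)

lemma scaleC_one_L2: "1 *\<^sub>C f = f"
  by transfer (auto simp: L2_rel_def)

lemma bounded_bilinear_scaleC_L2: "bounded_bilinear (*\<^sub>C)"
  by (rule bounded_bilinear.intro)
    (auto simp: scaleC_L2_add_left scaleC_L2_add_right scaleC_scaleC_L2 scaleR_L2_def norm_scaleC_L2
      scaleR_conv_of_real mult_ac intro!: exI[of _ 1])

lemma norm_diff_squared_L2:
  fixes f g :: "'a::euclidean_space L2"
  shows "(norm (f - g))\<^sup>2 = (norm f)\<^sup>2 + (norm g)\<^sup>2 - 2 * Re (cinner_L2 f g)"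
  by (simp add: power2_norm_eq_inner inner_diff_left inner_diff_right inner_commute inner_L2_def[symmetric])

text \<open>A Cauchy sequence with \<open>\<parallel>X\<^sub>k\<^sub>+\<^sub>1 - X\<^sub>k\<parallel> \<le> 2\<^sup>-\<^sup>k\<close> converges almost everywhere since
  \<open>\<bar>h\<bar> \<le> 2\<^sup>-\<^sup>k + 2\<^sup>k \<bar>h\<bar>\<^sup>2\<close>; the limit in mean is then identified with Fatou's lemma.\<close>

lemma L2_fast_Cauchy_convergent:
  fixes X :: "nat \<Rightarrow> 'a::euclidean_space L2"
  assumes fast: "\<And>k. norm (X (Suc k) - X k) \<le> (1/2) ^ k" and "Cauchy X"
  shows "convergent X"
proof -
  have "\<exists>r. square_integrable r \<and> X k = abs_L2 r" for k
    by (rule L2_cases[of "X k"]) blast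
  then obtain r where r: "\<And>k. square_integrable (r k)" "\<And>k. X k = abs_L2 (r k)"
    by metis
  have [measurable]: "r k \<in> borel_measurable borel" for k
    using r(1)[of k] by (rule square_integrable_measurable)
  define h where "h k x = r (Suc k) x - r k x" for k x
  have [measurable]: "h k \<in> borel_measurable borel" for k
    unfolding h_def by measurable
  have h: "square_integrable (h k)" for k
    unfolding h_def[abs_def] by (intro square_integrable_diff r)
  have nh: "norm (abs_L2 (h k)) \<le> (1/2) ^ k" for k
    using fast[of k] by (simp add: r(2) diff_abs_L2 r(1) h_def[abs_def])
  \<comment> \<open>The squared norms are at most 4^-k, so the weight 2^k still leaves a geometric
    series.\<close>
  have "(\<integral>\<^sup>+x. (\<Sum>k. ennreal (2 ^ k * (cmod (h k x))\<^sup>2)) \<partial>lborel)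
      = (\<Sum>k. \<integral>\<^sup>+x. ennreal (2 ^ k * (cmod (h k x))\<^sup>2) \<partial>lborel)"
    by (rule nn_integral_suminf) measurable
  also have "\<dots> = (\<Sum>k. ennreal (2 ^ k * (norm (abs_L2 (h k)))\<^sup>2))"
    by (simp add: ennreal_mult nn_integral_cmult nn_integral_norm_abs_L2[OF h])
  also have "\<dots> \<le> (\<Sum>k. ennreal ((1/2) ^ k))"
  proof (intro suminf_le ennreal_leI)
    fix k
    have "2 ^ k * (norm (abs_L2 (h k)))\<^sup>2 \<le> 2 ^ k * ((1/2) ^ k)\<^sup>2"
      by (intro mult_left_mono power_mono nh) auto
    also have "\<dots> = (1/2) ^ k"
      by (simp add: power2_eq_square power_divide)
    finally show "2 ^ k * (norm (abs_L2 (h k)))\<^sup>2 \<le> (1/2) ^ k" .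
  qed auto
  also have "\<dots> = ennreal (\<Sum>k. (1/2) ^ k)"
    by (intro suminf_ennreal2) (auto intro: summable_geometric)
  also have "\<dots> < \<infinity>"
    by simp
  finally have "AE x in lborel. (\<Sum>k. ennreal (2 ^ k * (cmod (h k x))\<^sup>2)) \<noteq> \<infinity>"
    by (intro nn_integral_PInf_AE) auto
  then have lim: "AE x in lborel. convergent (\<lambda>n. r n x)"
  proof eventually_elim
    case (elim x)
    have s: "summable (\<lambda>k. 2 ^ k * (cmod (h k x))\<^sup>2)"
      using elim by (intro summable_suminf_not_top) auto
    have "summable (\<lambda>k. cmod (h k x))"
    proof (rule summable_comparison_test')
      show "summable (\<lambda>k. (1/2) ^ k + 2 ^ k * (cmod (h k x))\<^sup>2)"
        by (intro summable_add s summable_geometric) auto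
      fix k :: nat
      have "cmod (h k x) \<le> (1/2) ^ k + 2 ^ k * (cmod (h k x))\<^sup>2"
      proof (cases "cmod (h k x) \<le> (1/2) ^ k")
        case False
        then have "1 \<le> 2 ^ k * cmod (h k x)"
          by (simp add: power_divide field_simps)
        then have "1 * cmod (h k x) \<le> (2 ^ k * cmod (h k x)) * cmod (h k x)"
          by (intro mult_right_mono) auto
        then show ?thesis
          by (simp add: power2_eq_square mult.assoc add_increasing)
      qed (simp add: add_increasing2)
      then show "norm (cmod (h k x)) \<le> (1/2) ^ k + 2 ^ k * (cmod (h k x))\<^sup>2"
        by simp
    qed
    then have "summable (\<lambda>k. h k x)"
      by (rule summable_norm_cancel)
    then have "convergent (\<lambda>n. \<Sum>k<n. h k x)"
      by (simp add: summable_iff_convergent)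
    moreover have "(\<Sum>k<n. h k x) = r n x - r 0 x" for n
      unfolding h_def by (rule sum_lessThan_telescope)
    ultimately have "convergent (\<lambda>n. r n x - r 0 x)"
      by simp
    then have "convergent (\<lambda>n. (r n x - r 0 x) + r 0 x)"
      by (intro convergent_add convergent_const)
    then show ?case
      by simp
  qed
  define g where "g x = lim (\<lambda>n. r n x)" for x
  have [measurable]: "g \<in> borel_measurable borel"
    unfolding g_def[abs_def] by (rule borel_measurable_lim_metric) simp
  \<comment> \<open>Fatou's lemma in \<open>m\<close>. The nonnegative integral is essential here,
    because square integrability of \<open>g\<close> is only deduced from this estimate.\<close>
  have est: "(\<integral>\<^sup>+x. ennreal ((cmod (r n x - g x))\<^sup>2) \<partial>lborel) \<le> ennreal (e\<^sup>2)"
    if "\<And>m. m \<ge> n \<Longrightarrow> norm (X n - X m) \<le> e" for n e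
  proof -
    have "(\<integral>\<^sup>+x. ennreal ((cmod (r n x - g x))\<^sup>2) \<partial>lborel) =
        (\<integral>\<^sup>+x. liminf (\<lambda>m. ennreal ((cmod (r n x - r m x))\<^sup>2)) \<partial>lborel)"
    proof (rule nn_integral_cong_AE)
      show "AE x in lborel. ennreal ((cmod (r n x - g x))\<^sup>2) = liminf (\<lambda>m. ennreal ((cmod (r n x - r m x))\<^sup>2))"
        using lim
      proof eventually_elim
        case (elim x)
        then have "(\<lambda>m. r m x) \<longlonglongrightarrow> g x"
          by (simp add: convergent_LIMSEQ_iff g_def)
        then have "(\<lambda>m. ennreal ((cmod (r n x - r m x))\<^sup>2)) \<longlonglongrightarrow> ennreal ((cmod (r n x - g x))\<^sup>2)"
          by (intro tendsto_ennrealI tendsto_intros)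
        then show ?case
          by (intro lim_imp_Liminf[symmetric]) auto
      qed
    qed
    also have "\<dots> \<le> liminf (\<lambda>m. \<integral>\<^sup>+x. ennreal ((cmod (r n x - r m x))\<^sup>2) \<partial>lborel)"
      by (rule nn_integral_liminf) measurable
    also have "\<dots> \<le> ennreal (e\<^sup>2)"
    proof (rule Liminf_le)
      show "\<forall>\<^sub>F m in sequentially. (\<integral>\<^sup>+x. ennreal ((cmod (r n x - r m x))\<^sup>2) \<partial>lborel) \<le> ennreal (e\<^sup>2)"
        using eventually_ge_at_top[of n]
      proof eventually_elim
        case (elim m)
        have "(\<integral>\<^sup>+x. ennreal ((cmod (r n x - r m x))\<^sup>2) \<partial>lborel) = ennreal ((norm (X n - X m))\<^sup>2)"
          by (simp add: nn_integral_norm_abs_L2 square_integrable_diff diff_abs_L2 r)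
        also have "\<dots> \<le> ennreal (e\<^sup>2)"
          using that[OF elim] by (intro ennreal_leI power_mono) auto
        finally show ?case .
      qed
    qed simp
    finally show ?thesis .
  qed
  have cau: "\<exists>N. \<forall>n\<ge>N. \<forall>m\<ge>n. norm (X n - X m) \<le> e" if "e > 0" for e
  proof -
    obtain N where "\<And>n m. n \<ge> N \<Longrightarrow> m \<ge> N \<Longrightarrow> norm (X n - X m) < e"
      using \<open>Cauchy X\<close> \<open>e > 0\<close> unfolding Cauchy_def dist_norm by metis
    then show ?thesis
      by (intro exI[of _ N]) (auto intro!: less_imp_le)
  qed
  obtain N where N: "\<And>m. m \<ge> N \<Longrightarrow> norm (X N - X m) \<le> 1"
    using cau[of 1] by auto
  \<comment> \<open>The estimate with bound 1 suffices to place \<open>g\<close> in the space; small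
    bounds then give convergence.\<close>
  have "square_integrable (\<lambda>x. r N x - g x)"
    using le_less_trans[OF est[OF N]] by (intro square_integrableI_nn_integral) auto
  then have g: "square_integrable g"
    using square_integrable_diff[OF r(1)[of N]] by fastforce
  have "X \<longlonglongrightarrow> abs_L2 g"
  proof (rule LIMSEQ_I)
    fix e :: real assume e: "0 < e"
    obtain N where N: "\<And>n m. n \<ge> N \<Longrightarrow> m \<ge> n \<Longrightarrow> norm (X n - X m) \<le> e / 2"
      using cau[of "e/2"] e by auto
    have "norm (X n - abs_L2 g) < e" if "n \<ge> N" for n
    proof -
      have "ennreal ((norm (X n - abs_L2 g))\<^sup>2) \<le> ennreal ((e/2)\<^sup>2)"
        using est[OF N[OF that]]
        by (simp add: r(2) diff_abs_L2 r(1) g nn_integral_norm_abs_L2 square_integrable_diff)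
      then have "(norm (X n - abs_L2 g))\<^sup>2 \<le> (e/2)\<^sup>2"
        by (subst (asm) ennreal_le_iff) auto
      then have "norm (X n - abs_L2 g) \<le> e/2"
        using e by (simp add: power2_le_iff_abs_le)
      then show ?thesis
        using e by simp
    qed
    then show "\<exists>N. \<forall>n\<ge>N. norm (X n - abs_L2 g) < e"
      by blast
  qed
  then show ?thesis
    by (rule convergentI)
qed

text \<open>A Cauchy sequence converges as soon as one subsequence does, and a subsequence with
  geometrically small gaps always exists.\<close>

instance L2 :: (euclidean_space) banach
proof
  fix X :: "nat \<Rightarrow> 'a L2"
  assume "Cauchy X"
  have "\<exists>N. \<forall>n\<ge>N. \<forall>m\<ge>N. norm (X n - X m) < (1/2) ^ k" for k
    using CauchyD[OF \<open>Cauchy X\<close>, of "(1/2) ^ k"] by simp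
  then obtain N where N: "\<And>k n m. n \<ge> N k \<Longrightarrow> m \<ge> N k \<Longrightarrow> norm (X n - X m) < (1/2) ^ k"
    by metis
  \<comment> \<open>The summand \<open>k\<close> makes \<open>s\<close> strictly increasing, and the
    partial sum keeps both \<open>s k\<close> and \<open>s (Suc k)\<close> above the threshold
    \<open>N k\<close>.\<close>
  define s where "s k = k + (\<Sum>i\<le>k. N i)" for k
  have s: "strict_mono s"
    by (rule strict_monoI_Suc) (simp add: s_def)
  have sN: "s k \<ge> N k" "s (Suc k) \<ge> N k" for k
    using member_le_sum[of k "{..k}" N] by (simp_all add: s_def)
  have "Cauchy (X \<circ> s)"
    using \<open>Cauchy X\<close> s by (rule Cauchy_subseq_Cauchy)
  then have "convergent (X \<circ> s)"
    using less_imp_le[OF N[OF sN(2,1)]] by (intro L2_fast_Cauchy_convergent) auto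
  then obtain l where "(X \<circ> s) \<longlonglongrightarrow> l"
    by (auto simp: convergent_def)
  have "X \<longlonglongrightarrow> l"
  proof (rule metric_LIMSEQ_I)
    fix e :: real assume "e > 0"
    then obtain M1 where M1: "\<And>n m. n \<ge> M1 \<Longrightarrow> m \<ge> M1 \<Longrightarrow> dist (X n) (X m) < e/2"
      using metric_CauchyD[OF \<open>Cauchy X\<close>, of "e/2"] by auto
    obtain M2 where M2: "\<And>n. n \<ge> M2 \<Longrightarrow> dist (X (s n)) l < e/2"
      using metric_LIMSEQ_D[OF \<open>(X \<circ> s) \<longlonglongrightarrow> l\<close>, of "e/2"] \<open>e > 0\<close> by auto
    have "dist (X n) l < e" if "n \<ge> M1" for n
    proof -
      have "M1 \<le> s (max M1 M2)"
        using strict_mono_imp_increasing[OF s, of "max M1 M2"] by simp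
      then have "dist (X n) (X (s (max M1 M2))) < e/2"
        using M1 that by blast
      moreover have "dist (X (s (max M1 M2))) l < e/2"
        by (rule M2) simp
      ultimately show ?thesis
        using dist_triangle_half_r by (metis dist_commute dist_triangle_half_l)
    qed
    then show "\<exists>no. \<forall>n\<ge>no. dist (X n) l < e"
      by blast
  qed
  then show "convergent X"
    by (rule convergentI)
qed

section \<open>Continuity of translations\<close>

lemma nn_integral_lborel_translate:
  fixes f :: "'a::euclidean_space \<Rightarrow> ennreal"
  assumes [measurable]: "f \<in> borel_measurable borel"
  shows "(\<integral>\<^sup>+x. f (x + h) \<partial>lborel) = (\<integral>\<^sup>+x. f x \<partial>lborel)"
proof -
  have "(\<integral>\<^sup>+x. f x \<partial>lborel) = (\<integral>\<^sup>+x. f x \<partial>distr lborel borel ((+) h))"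
    by (simp add: lborel_distr_plus)
  also have "\<dots> = (\<integral>\<^sup>+x. f (x + h) \<partial>lborel)"
    by (subst nn_integral_distr) (simp_all add: add.commute)
  finally show ?thesis ..
qed

lemma integrable_lborel_translate:
  fixes f :: "'a::euclidean_space \<Rightarrow> 'b::{banach, second_countable_topology}"
  assumes "integrable lborel f"
  shows "integrable lborel (\<lambda>x. f (x + h))"
proof -
  have [measurable]: "f \<in> borel_measurable borel"
    using borel_measurable_integrable[OF assms] by simp
  show ?thesis
    using assms nn_integral_lborel_translate[of "\<lambda>x. ennreal (norm (f x))" h]
    by (auto simp: integrable_iff_bounded)
qed

lemma integral_lborel_translate:
  fixes f :: "'a::euclidean_space \<Rightarrow> 'b::{banach, second_countable_topology}"
  assumes [measurable]: "f \<in> borel_measurable borel"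
  shows "(\<integral>x. f (x + h) \<partial>lborel) = (\<integral>x. f x \<partial>lborel)"
proof -
  have "(\<integral>x. f x \<partial>lborel) = (\<integral>x. f x \<partial>distr lborel borel ((+) h))"
    by (simp add: lborel_distr_plus)
  also have "\<dots> = (\<integral>x. f (x + h) \<partial>lborel)"
    by (subst integral_distr) (simp_all add: add.commute)
  finally show ?thesis ..
qed

text \<open>A point of an open set stays in it under small translations, so the overlap of
  \<open>U\<close> with its translates tends to the measure of \<open>U\<close> by dominated
  convergence. The integral is twice that measure minus twice the overlap.\<close>

lemma integral_indicator_translate_open:
  fixes U :: "'a::euclidean_space set"
  assumes U: "open U" "emeasure lborel U < \<infinity>" and h: "h \<longlonglongrightarrow> 0"
  shows "(\<lambda>n. \<integral>x. \<bar>indicator U (x + h n) - indicator U x\<bar> \<partial>lborel) \<longlonglongrightarrow> (0::real)"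
proof -
  have [measurable]: "U \<in> sets borel" using U by simp
  have intU: "integrable lborel (indicator U :: 'a \<Rightarrow> real)"
    using U by (intro integrable_real_indicator) auto
  have lim: "(\<lambda>n. \<integral>x. indicator U (x + h n) * indicator U x \<partial>lborel) \<longlonglongrightarrow> (\<integral>x. indicator U x \<partial>lborel :: real)"
  proof (rule integral_dominated_convergence[where w="indicator U"])
    show "AE x in lborel. (\<lambda>n. indicator U (x + h n) * indicator U x) \<longlonglongrightarrow> (indicator U x :: real)"
    proof (rule AE_I2)
      fix x :: 'a
      show "(\<lambda>n. indicator U (x + h n) * indicator U x) \<longlonglongrightarrow> (indicator U x :: real)"
      proof (cases "x \<in> U")
        case True
        have "(\<lambda>n. x + h n) \<longlonglongrightarrow> x"
          using tendsto_add[OF tendsto_const[of x] h] by simp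
        then have "\<forall>\<^sub>F n in sequentially. x + h n \<in> U"
          using topological_tendstoD[OF _ U(1) True] by blast
        then show ?thesis
          by (intro tendsto_eventually) (auto elim!: eventually_mono simp: True)
      qed simp
    qed
  qed (auto simp: indicator_def intU)
  have int2: "integrable lborel (\<lambda>x. indicator U (x + h n) * indicator U x :: real)" for n
    by (rule Bochner_Integration.integrable_bound[OF intU]) (auto simp: indicator_def)
  have "(\<integral>x. \<bar>indicator U (x + h n) - indicator U x\<bar> \<partial>lborel)
      = 2 * (\<integral>x. indicator U x \<partial>lborel) - 2 * (\<integral>x. indicator U (x + h n) * indicator U x \<partial>lborel :: real)" for n
  proof -
    have "(\<integral>x. \<bar>indicator U (x + h n) - indicator U x\<bar> \<partial>lborel) =
      (\<integral>x. (indicator U (x + h n) + indicator U x) - 2 * (indicator U (x + h n) * indicator U x :: real) \<partial>lborel)"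
      by (intro Bochner_Integration.integral_cong) (auto simp: indicator_def)
    also have "\<dots> = (\<integral>x. indicator U (x + h n) \<partial>lborel) + (\<integral>x. indicator U x \<partial>lborel)
        - 2 * (\<integral>x. indicator U (x + h n) * indicator U x \<partial>lborel :: real)"
      using intU integrable_lborel_translate[OF intU, of "h n"] int2 by simp
    also have "(\<integral>x. indicator U (x + h n) \<partial>lborel :: real) = (\<integral>x. indicator U x \<partial>lborel)"
      by (rule integral_lborel_translate) simp
    finally show ?thesis by simp
  qed
  moreover have "(\<lambda>n. 2 * (\<integral>x. indicator U x \<partial>lborel) - 2 * (\<integral>x. indicator U (x + h n) * indicator U x \<partial>lborel :: real))
     \<longlonglongrightarrow> 2 * (\<integral>x. indicator U x \<partial>lborel) - 2 * (\<integral>x. indicator U x \<partial>lborel)"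
    by (intro tendsto_intros lim)
  ultimately show ?thesis by simp
qed

text \<open>Outer regularity supplies an open superset \<open>U\<close> with excess below e/4. The
  excess is paid twice, once translated, and the open case pays the remaining e/2.\<close>

lemma integral_indicator_translate:
  fixes A :: "'a::euclidean_space set"
  assumes [measurable]: "A \<in> sets borel" and A: "emeasure lborel A < \<infinity>" and h: "h \<longlonglongrightarrow> 0"
  shows "(\<lambda>n. \<integral>x. \<bar>indicator A (x + h n) - indicator A x\<bar> \<partial>lborel) \<longlonglongrightarrow> (0::real)"
proof (rule LIMSEQ_I)
  fix e :: real assume e: "0 < e"
  obtain U where U: "open U" "A \<subseteq> U" "emeasure lborel (U - A) < ennreal (e/4)"
    using outer_regular_lborel[of A "e/4"] e by auto
  have [measurable]: "U \<in> sets borel" using U by simp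
  have "emeasure lborel U \<le> emeasure lborel (U - A) + emeasure lborel A"
    using U by (subst plus_emeasure) (auto simp: Un_absorb2)
  also have "\<dots> < \<infinity>"
    using less_trans[OF U(3) ennreal_less_top] A by (auto simp: less_top[symmetric])
  finally have Ufin: "emeasure lborel U < \<infinity>" .
  have intU: "integrable lborel (indicator U :: 'a \<Rightarrow> real)" and intA: "integrable lborel (indicator A :: 'a \<Rightarrow> real)"
    using Ufin A by (auto intro!: integrable_real_indicator)
  have "(\<integral>x. indicator U x - indicator A x \<partial>lborel) = (\<integral>x. indicator (U - A) x \<partial>lborel :: real)"
    using U by (intro Bochner_Integration.integral_cong) (auto simp: indicator_def)
  also have "\<dots> = measure lborel (U - A)"
    by simp
  also have "\<dots> < e/4"
    using U(3) less_trans[OF U(3) ennreal_less_top]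
    by (subst (asm) emeasure_eq_ennreal_measure) (auto simp: ennreal_less_iff less_top[symmetric])
  finally have d: "(\<integral>x. indicator U x - indicator A x \<partial>lborel) < e/4" .
  obtain N where N: "\<And>n. n \<ge> N \<Longrightarrow> (\<integral>x. \<bar>indicator U (x + h n) - indicator U x\<bar> \<partial>lborel) < e/2"
    using LIMSEQ_D[OF integral_indicator_translate_open[OF U(1) Ufin h], of "e/2"] e by auto
  have "(\<integral>x. \<bar>indicator A (x + h n) - indicator A x\<bar> \<partial>lborel) < e" if "n \<ge> N" for n
  proof -
    note tr = integrable_lborel_translate[of _ "h n"]
    have "(\<integral>x. \<bar>indicator A (x + h n) - indicator A x\<bar> \<partial>lborel) \<le>
      (\<integral>x. (indicator U (x + h n) - indicator A (x + h n)) + \<bar>indicator U (x + h n) - indicator U x\<bar>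
          + (indicator U x - indicator A x :: real) \<partial>lborel)"
      by (intro integral_mono Bochner_Integration.integrable_add Bochner_Integration.integrable_diff integrable_abs
          intU intA tr) (use U(2) in \<open>auto simp: indicator_def\<close>)
    also have "\<dots> = (\<integral>x. indicator U (x + h n) - indicator A (x + h n) \<partial>lborel)
        + (\<integral>x. \<bar>indicator U (x + h n) - indicator U x\<bar> \<partial>lborel) + (\<integral>x. indicator U x - indicator A x \<partial>lborel)"
      using intU intA tr[OF intU] tr[OF intA] by simp
    also have "(\<integral>x. indicator U (x + h n) - indicator A (x + h n) \<partial>lborel) = (\<integral>x. indicator U x - indicator A x \<partial>lborel :: real)"
      by (rule integral_lborel_translate[of "\<lambda>x. indicator U x - indicator A x"]) simp
    finally show ?thesis
      using d N[OF that] by simp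
  qed
  then show "\<exists>N. \<forall>n\<ge>N. norm ((\<integral>x. \<bar>indicator A (x + h n) - indicator A x\<bar> \<partial>lborel) - 0 :: real) < e"
    by (intro exI[of _ N]) auto
qed

text \<open>Continuity of translations in L1, by induction over integrable functions. The limit step
  works because translation invariance makes the approximation error the same before and after the
  shift.\<close>

lemma integral_translate_tendsto_0:
  fixes f :: "'a::euclidean_space \<Rightarrow> 'b::{banach, second_countable_topology}"
  assumes "integrable lborel f" and h: "h \<longlonglongrightarrow> 0"
  shows "(\<lambda>n. \<integral>x. norm (f (x + h n) - f x) \<partial>lborel) \<longlonglongrightarrow> 0"
  using assms(1)
proof induction
  case (base A c)
  have "(\<lambda>n. norm c * (\<integral>x. \<bar>indicator A (x + h n) - indicator A x\<bar> \<partial>lborel)) \<longlonglongrightarrow> norm c * 0"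
    using base h by (intro tendsto_intros integral_indicator_translate) auto
  moreover have "norm (indicator A (x + h n) *\<^sub>R c - indicator A x *\<^sub>R c) =
     norm c * \<bar>indicator A (x + h n) - indicator A x\<bar>" for n x
    by (simp add: scaleR_diff_left[symmetric])
  ultimately show ?case
    by simp
next
  case (add f g)
  show ?case
  proof (rule tendsto_sandwich[OF _ _ tendsto_const])
    show "(\<lambda>n. (\<integral>x. norm (f (x + h n) - f x) \<partial>lborel) + (\<integral>x. norm (g (x + h n) - g x) \<partial>lborel)) \<longlonglongrightarrow> 0"
      using tendsto_add[OF add.IH] by simp
    have "(\<integral>x. norm (f (x + h n) + g (x + h n) - (f x + g x)) \<partial>lborel) \<le>
      (\<integral>x. norm (f (x + h n) - f x) + norm (g (x + h n) - g x) \<partial>lborel)" for n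
      using add.hyps integrable_lborel_translate[OF add.hyps(1)] integrable_lborel_translate[OF add.hyps(2)]
      by (intro integral_mono Bochner_Integration.integrable_add integrable_norm Bochner_Integration.integrable_diff)
        (auto simp: add_diff_add norm_triangle_ineq)
    then show "\<forall>\<^sub>F n in sequentially. (\<integral>x. norm (f (x + h n) + g (x + h n) - (f x + g x)) \<partial>lborel) \<le>
      (\<integral>x. norm (f (x + h n) - f x) \<partial>lborel) + (\<integral>x. norm (g (x + h n) - g x) \<partial>lborel)"
      using add.hyps integrable_lborel_translate[OF add.hyps(1)] integrable_lborel_translate[OF add.hyps(2)]
      by (simp add: Bochner_Integration.integral_add)
  qed (auto intro!: always_eventually)
next
  case (lim f s)
  have [measurable]: "f \<in> borel_measurable borel" "s i \<in> borel_measurable borel" for i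
    using borel_measurable_integrable[OF lim.hyps(4)] borel_measurable_integrable[OF lim.hyps(1)] by auto
  \<comment> \<open>The approximants are bounded by twice the modulus of \<open>f\<close>, hence the
    dominating function \<open>3 * norm (f x)\<close>.\<close>
  have conv: "(\<lambda>i. \<integral>x. norm (s i x - f x) \<partial>lborel) \<longlonglongrightarrow> (\<integral>x. norm (f x - f x) \<partial>lborel)"
  proof (rule integral_dominated_convergence[where w="\<lambda>x. 3 * norm (f x)"])
    show "AE x in lborel. (\<lambda>i. norm (s i x - f x)) \<longlonglongrightarrow> norm (f x - f x)"
      using lim.hyps(2) by (intro AE_I2 tendsto_intros) auto
    show "AE x in lborel. norm (norm (s i x - f x)) \<le> 3 * norm (f x)" for i
    proof (rule AE_I2)
      fix x :: 'a
      have "norm (s i x - f x) \<le> norm (s i x) + norm (f x)"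
        by (rule norm_triangle_ineq4)
      then show "norm (norm (s i x - f x)) \<le> 3 * norm (f x)"
        using lim.hyps(3)[of x i] by simp
    qed
  qed (use lim.hyps(4) in auto)
  show ?case
  proof (rule LIMSEQ_I)
    fix e :: real assume e: "0 < e"
    obtain i where i: "(\<integral>x. norm (s i x - f x) \<partial>lborel) < e/4"
      using LIMSEQ_D[OF conv, of "e/4"] e by auto
    obtain N where N: "\<And>n. n \<ge> N \<Longrightarrow> (\<integral>x. norm (s i (x + h n) - s i x) \<partial>lborel) < e/2"
      using LIMSEQ_D[OF lim.IH[of i], of "e/2"] e by auto
    have "(\<integral>x. norm (f (x + h n) - f x) \<partial>lborel) < e" if "n \<ge> N" for n
    proof -
      note [simp, intro] = lim.hyps(4) lim.hyps(1)[of i] integrable_lborel_translate[OF lim.hyps(4), of "h n"]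
         integrable_lborel_translate[OF lim.hyps(1), of i "h n"]
      have "(\<integral>x. norm (f (x + h n) - f x) \<partial>lborel) \<le> (\<integral>x. norm (s i (x + h n) - f (x + h n))
          + norm (s i (x + h n) - s i x) + norm (s i x - f x) \<partial>lborel)"
      proof (rule integral_mono)
        fix x :: 'a
        have "f (x + h n) - f x = - (s i (x + h n) - f (x + h n)) + (s i (x + h n) - s i x) + (s i x - f x)"
          by simp
        then show "norm (f (x + h n) - f x) \<le> norm (s i (x + h n) - f (x + h n))
          + norm (s i (x + h n) - s i x) + norm (s i x - f x)"
          using norm_triangle_ineq[of "- (s i (x + h n) - f (x + h n)) + (s i (x + h n) - s i x)" "s i x - f x"]
            norm_triangle_ineq[of "- (s i (x + h n) - f (x + h n))" "s i (x + h n) - s i x"]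
          by (simp only: norm_minus_cancel)
      qed auto
      also have "\<dots> = (\<integral>x. norm (s i (x + h n) - f (x + h n)) \<partial>lborel)
          + (\<integral>x. norm (s i (x + h n) - s i x) \<partial>lborel) + (\<integral>x. norm (s i x - f x) \<partial>lborel)"
        by simp
      also have "(\<integral>x. norm (s i (x + h n) - f (x + h n)) \<partial>lborel) = (\<integral>x. norm (s i x - f x) \<partial>lborel)"
        by (rule integral_lborel_translate[of "\<lambda>x. norm (s i x - f x)"]) simp
      finally show ?thesis
        using i N[OF that] by simp
    qed
    then show "\<exists>N. \<forall>n\<ge>N. norm ((\<integral>x. norm (f (x + h n) - f x) \<partial>lborel) - 0) < e"
      by auto
  qed
qed

section \<open>The Fourier transform of a Gaussian\<close>

lemma cis_sum: "finite A \<Longrightarrow> cis (\<Sum>a\<in>A. f a) = (\<Prod>a\<in>A. cis (f a))"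
  by (induction rule: finite_induct) (auto simp: cis_mult[symmetric])

lemma borel_measurable_cis [measurable]: "cis \<in> borel_measurable borel"
  by (intro borel_measurable_continuous_onI continuous_intros)

lemma integrable_gaussian_real: "integrable lborel (\<lambda>x::real. exp (- x\<^sup>2 / 2))"
proof -
  have "integrable lborel (\<lambda>x::real. sqrt (2 * pi) * std_normal_density x)"
    by simp
  then show ?thesis
    by (simp add: std_normal_density_def)
qed

lemma integrable_cis_mult:
  assumes "integrable M f" and [measurable]: "g \<in> borel_measurable M"
  shows "integrable M (\<lambda>x. cis (g x) * f x)"
proof (rule Bochner_Integration.integrable_bound[OF assms(1)])
  have [measurable]: "f \<in> borel_measurable M"
    using assms(1) by (rule borel_measurable_integrable)
  show "(\<lambda>x. cis (g x) * f x) \<in> borel_measurable M"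
    by measurable
qed (simp add: norm_mult)

text \<open>This is the characteristic function of the standard normal law at \<open>- a\<close>,
  with the normalizing constant of the density moved to the other side.\<close>

lemma fourier_gaussian_real:
  "(\<integral>x. cis (- (x * a)) * complex_of_real (exp (- x\<^sup>2 / 2)) \<partial>lborel) =
     complex_of_real (sqrt (2 * pi) * exp (- a\<^sup>2 / 2))"
proof -
  have "complex_of_real (exp (- ((- a)\<^sup>2) / 2)) = char std_normal_distribution (- a)"
    by (simp only: char_std_normal_distribution)
  also have "\<dots> = (\<integral>x. std_normal_density x *\<^sub>R iexp (- a * x) \<partial>lborel)"
    unfolding char_def by (rule integral_density) (auto simp: normal_density_nonneg)
  also have "\<dots> = (\<integral>x. complex_of_real (1 / sqrt (2 * pi)) * (cis (- (x * a)) * complex_of_real (exp (- x\<^sup>2 / 2))) \<partial>lborel)"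
    by (intro Bochner_Integration.integral_cong)
       (simp_all add: std_normal_density_def cis_conv_exp scaleR_conv_of_real mult_ac)
  also have "\<dots> = complex_of_real (1 / sqrt (2 * pi)) * (\<integral>x. cis (- (x * a)) * complex_of_real (exp (- x\<^sup>2 / 2)) \<partial>lborel)"
    by (rule integral_mult_right_zero)
  finally show ?thesis
    by (simp add: field_simps)
qed

definition gaussian :: "'a::real_normed_vector \<Rightarrow> real" where
  "gaussian x = exp (- (norm x)\<^sup>2 / 2)"

text \<open>Lebesgue measure is the image of a product measure over \<open>Basis\<close>; once the
  integrand factorizes over the coordinates, its integral is a product of one-dimensional
  ones.\<close>

lemma prod_Basis_gaussian:
  fixes x w :: "'a::euclidean_space"
  shows "cis (- (x \<bullet> w)) * complex_of_real (gaussian x) =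
    (\<Prod>b\<in>Basis. cis (- ((x \<bullet> b) * (w \<bullet> b))) * complex_of_real (exp (- (x \<bullet> b)\<^sup>2 / 2)))"
proof -
  have "cis (- (x \<bullet> w)) = (\<Prod>b\<in>Basis. cis (- ((x \<bullet> b) * (w \<bullet> b))))"
    by (subst euclidean_inner) (simp add: cis_sum sum_negf[symmetric])
  moreover have "(norm x)\<^sup>2 = (\<Sum>b\<in>Basis. (x \<bullet> b)\<^sup>2)"
    by (subst power2_norm_eq_inner, subst euclidean_inner) (simp add: power2_eq_square)
  then have "- (norm x)\<^sup>2 / 2 = (\<Sum>b\<in>Basis. - (x \<bullet> b)\<^sup>2 / 2)"
    by (simp add: sum_divide_distrib[symmetric] sum_negf)
  then have "gaussian x = (\<Prod>b\<in>Basis. exp (- (x \<bullet> b)\<^sup>2 / 2))"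
    by (simp add: gaussian_def exp_sum)
  ultimately show ?thesis
    by (simp add: prod.distrib)
qed

lemma
  fixes w :: "'a::euclidean_space"
  shows integrable_fourier_gaussian:
      "integrable lborel (\<lambda>x::'a. cis (- (x \<bullet> w)) * complex_of_real (gaussian x))"
    and fourier_gaussian:
      "(\<integral>x. cis (- (x \<bullet> w)) * complex_of_real (gaussian x) \<partial>lborel) =
        complex_of_real (sqrt (2 * pi) ^ DIM('a) * gaussian w)"
proof -
  interpret P: product_sigma_finite "\<lambda>_::'a. lborel :: real measure"
    by standard
  define F where "F x = cis (- (x \<bullet> w)) * complex_of_real (gaussian x)" for x :: 'a
  define G where "G b y = cis (- (y * (w \<bullet> b))) * complex_of_real (exp (- y\<^sup>2 / 2))" for b y
  have G: "integrable lborel (G b)" for b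
    unfolding G_def by (intro integrable_cis_mult integrable_of_real integrable_gaussian_real) auto
  have [measurable]: "F \<in> borel_measurable borel"
    unfolding F_def gaussian_def by (intro borel_measurable_times measurable_compose[OF _ borel_measurable_cis]
       borel_measurable_continuous_onI) (auto intro!: continuous_intros)
  have FG: "F (\<Sum>b\<in>Basis. x b *\<^sub>R b) = (\<Prod>b\<in>Basis. G b (x b))" for x
    unfolding F_def G_def prod_Basis_gaussian by (intro prod.cong) auto
  have "integrable (\<Pi>\<^sub>M b\<in>(Basis::'a set). lborel) (\<lambda>x. \<Prod>b\<in>Basis. G b (x b))"
    by (intro P.product_integrable_prod G) auto
  then have "integrable lborel F"
    by (subst lborel_eq) (simp add: integrable_distr_eq FG)
  then show "integrable lborel (\<lambda>x::'a. cis (- (x \<bullet> w)) * complex_of_real (gaussian x))"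
    by (simp add: F_def[abs_def])
  have "(\<integral>x. F x \<partial>lborel) = (\<integral>x. (\<Prod>b\<in>Basis. G b (x b)) \<partial>(\<Pi>\<^sub>M b\<in>(Basis::'a set). lborel))"
    by (subst lborel_eq) (simp add: integral_distr FG)
  also have "\<dots> = (\<Prod>b\<in>Basis. \<integral>y. G b y \<partial>lborel)"
    by (intro P.product_integral_prod G) auto
  also have "\<dots> = (\<Prod>b\<in>(Basis::'a set). complex_of_real (sqrt (2 * pi)) * complex_of_real (exp (- (w \<bullet> b)\<^sup>2 / 2)))"
    by (intro prod.cong) (simp_all only: G_def fourier_gaussian_real of_real_mult)
  also have "\<dots> = complex_of_real (sqrt (2 * pi) ^ DIM('a)) * (\<Prod>b\<in>(Basis::'a set). complex_of_real (exp (- (w \<bullet> b)\<^sup>2 / 2)))"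
    by (simp add: prod.distrib)
  also have "(\<Prod>b\<in>(Basis::'a set). complex_of_real (exp (- (w \<bullet> b)\<^sup>2 / 2))) = complex_of_real (gaussian w)"
    using prod_Basis_gaussian[of w 0] by simp
  finally show "(\<integral>x. cis (- (x \<bullet> w)) * complex_of_real (gaussian x) \<partial>lborel) =
        complex_of_real (sqrt (2 * pi) ^ DIM('a) * gaussian w)"
    by (simp add: F_def)
qed

lemma integral_lborel_scaleR:
  fixes f :: "'a::euclidean_space \<Rightarrow> 'b::{banach, second_countable_topology}"
  assumes [measurable]: "f \<in> borel_measurable borel" and c: "c > 0"
  shows "(\<integral>x. f x \<partial>lborel) = c ^ DIM('a) *\<^sub>R (\<integral>x. f (t + c *\<^sub>R x) \<partial>lborel)"
  using c by (subst lborel_affine[of c t])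
    (simp_all add: integral_density integral_distr)

lemma integrable_lborel_scaleR:
  fixes f :: "'a::euclidean_space \<Rightarrow> 'b::{banach, second_countable_topology}"
  assumes c: "c > 0" and f: "integrable lborel f"
  shows "integrable lborel (\<lambda>x. f (t + c *\<^sub>R x))"
proof -
  have [measurable]: "f \<in> borel_measurable borel"
    using borel_measurable_integrable[OF f] by simp
  have "integrable (density (distr lborel borel (\<lambda>x. t + c *\<^sub>R x)) (\<lambda>_. ennreal (c ^ DIM('a)))) f"
    using f c by (subst (asm) lborel_affine[of c t]) (simp_all add: ennreal_power)
  then have "integrable lborel (\<lambda>x. c ^ DIM('a) *\<^sub>R f (t + c *\<^sub>R x))"
    using c by (simp add: integrable_density integrable_distr_eq)
  then have "integrable lborel (\<lambda>x. (1 / c ^ DIM('a)) *\<^sub>R (c ^ DIM('a) *\<^sub>R f (t + c *\<^sub>R x)))"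
    by (rule integrable_scaleR_right)
  then show ?thesis
    using c by simp
qed

lemma borel_measurable_gaussian [measurable]: "gaussian \<in> borel_measurable (borel :: 'a::euclidean_space measure)"
  unfolding gaussian_def by (intro borel_measurable_continuous_onI continuous_intros) auto

lemma gaussian_pos: "gaussian x > 0" and gaussian_le_1: "gaussian x \<le> 1"
  by (simp_all add: gaussian_def)

lemma integrable_gaussian: "integrable lborel (gaussian :: 'a::euclidean_space \<Rightarrow> real)"
  using integrable_Re[OF integrable_fourier_gaussian[of "0::'a"]] by simp

lemma integral_gaussian: "(\<integral>x. gaussian (x::'a::euclidean_space) \<partial>lborel) = sqrt (2 * pi) ^ DIM('a)"
proof -
  have "complex_of_real (\<integral>x. gaussian (x::'a) \<partial>lborel) = complex_of_real (sqrt (2 * pi) ^ DIM('a))"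
    using fourier_gaussian[of "0::'a"] by (simp add: gaussian_def)
  then show ?thesis
    by (simp only: of_real_eq_iff)
qed

lemma integrable_gaussian_scaleR:
  "\<sigma> > 0 \<Longrightarrow> integrable lborel (\<lambda>x::'a::euclidean_space. gaussian (\<sigma> *\<^sub>R x))"
  using integrable_lborel_scaleR[OF _ integrable_gaussian, of \<sigma> 0] by simp

section \<open>Plancherel's theorem\<close>

text \<open>For a function bounded by k, the squared increment is at most 2 k times its modulus, so
  continuity in L1 is enough. What is cut off, where the modulus of \<open>f\<close> exceeds k, is
  small in L2, and translating it does not change its norm.\<close>

lemma translate_L2_tendsto_0:
  fixes f :: "'a::euclidean_space \<Rightarrow> complex"
  assumes f: "square_integrable f" "integrable lborel f" and h: "h \<longlonglongrightarrow> 0"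
  shows "(\<lambda>n. \<integral>x. (cmod (f (x + h n) - f x))\<^sup>2 \<partial>lborel) \<longlonglongrightarrow> 0"
proof (rule LIMSEQ_I)
  fix e :: real assume e: "0 < e"
  have [measurable]: "f \<in> borel_measurable borel"
    using f(1) by (rule square_integrable_measurable)
  have f2: "integrable lborel (\<lambda>x. (cmod (f x))\<^sup>2)"
    using f(1) by (simp add: square_integrable_def)
  define r where "r B x = (if cmod (f x) \<le> B then 0 else f x)" for B x
  have [measurable]: "r B \<in> borel_measurable borel" for B
    unfolding r_def[abs_def] by measurable
  have "(\<lambda>k. \<integral>x. (cmod (r (real k) x))\<^sup>2 \<partial>lborel) \<longlonglongrightarrow> (\<integral>x. 0 \<partial>(lborel :: 'a measure))"
  proof (rule integral_dominated_convergence[OF _ _ f2])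
    have "(\<lambda>k. (cmod (r (real k) x))\<^sup>2) \<longlonglongrightarrow> 0" for x
    proof (rule tendsto_eventually)
      obtain k where "cmod (f x) \<le> real k"
        using real_arch_simple by blast
      then show "\<forall>\<^sub>F k in sequentially. (cmod (r (real k) x))\<^sup>2 = 0"
        by (intro eventually_sequentiallyI[of k]) (auto simp: r_def)
    qed
    then show "AE x in lborel. (\<lambda>k. (cmod (r (real k) x))\<^sup>2) \<longlonglongrightarrow> 0"
      by simp
  qed (auto simp: r_def)
  \<comment> \<open>The remainder occurs twice with factor 3, so the bound e/12 costs e/2 in
    total.\<close>
  then obtain k where k: "(\<integral>x. (cmod (r (real k) x))\<^sup>2 \<partial>lborel) < e / 12"
    using LIMSEQ_D[of _ 0 "e/12"] e by fastforce
  define g where "g x = f x - r (real k) x" for x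
  have [measurable]: "g \<in> borel_measurable borel"
    unfolding g_def[abs_def] by measurable
  have g: "integrable lborel g" and gk: "cmod (g x) \<le> real k" for x
    using f(2) by (auto simp: g_def r_def intro: Bochner_Integration.integrable_bound[OF f(2)])
  have r2: "integrable lborel (\<lambda>x. (cmod (r (real k) x))\<^sup>2)"
    by (rule Bochner_Integration.integrable_bound[OF f2]) (auto simp: r_def)
  have "(\<lambda>n. 6 * real k * (\<integral>x. cmod (g (x + h n) - g x) \<partial>lborel)) \<longlonglongrightarrow> 6 * real k * 0"
    by (intro tendsto_intros integral_translate_tendsto_0 g h)
  then obtain N where N: "\<And>n. n \<ge> N \<Longrightarrow> 6 * real k * (\<integral>x. cmod (g (x + h n) - g x) \<partial>lborel) < e / 2"
    using LIMSEQ_D[of _ 0 "e/2"] e by fastforce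
  have "(\<integral>x. (cmod (f (x + h n) - f x))\<^sup>2 \<partial>lborel) < e" if "n \<ge> N" for n
  proof -
    let ?R = "\<lambda>x. (cmod (r (real k) x))\<^sup>2"
    note gt = integrable_lborel_translate[OF g, of "h n"]
    note rt = integrable_lborel_translate[OF r2, of "h n"]
    have int: "integrable lborel (\<lambda>x. 6 * real k * cmod (g (x + h n) - g x) + 3 * ?R (x + h n) + 3 * ?R x)"
      using g gt r2 rt by auto
    have pt: "(cmod (f (x + h n) - f x))\<^sup>2 \<le> 6 * real k * cmod (g (x + h n) - g x) + 3 * ?R (x + h n) + 3 * ?R x" for x
    proof -
      let ?a = "cmod (g (x + h n) - g x)" and ?b = "cmod (r (real k) (x + h n))" and ?c = "cmod (r (real k) x)"
      have "f (x + h n) - f x = (g (x + h n) - g x) + r (real k) (x + h n) - r (real k) x"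
        by (simp add: g_def)
      then have "cmod (f (x + h n) - f x) \<le> ?a + ?b + ?c"
        by (metis (no_types, opaque_lifting) norm_triangle_ineq norm_triangle_ineq4 add_right_mono order_trans)
      then have "(cmod (f (x + h n) - f x))\<^sup>2 \<le> (?a + ?b + ?c)\<^sup>2"
        by (intro power_mono) auto
      also have "\<dots> \<le> 3 * ?a\<^sup>2 + 3 * ?b\<^sup>2 + 3 * ?c\<^sup>2"
        using sum_squares_bound[of ?a ?b] sum_squares_bound[of ?a ?c] sum_squares_bound[of ?b ?c]
        by (simp add: power2_eq_square algebra_simps)
      also have "?a\<^sup>2 \<le> 2 * real k * ?a"
      proof -
        have "?a \<le> real k + real k"
          by (rule order_trans[OF norm_triangle_ineq4 add_mono[OF gk gk]])
        then show ?thesis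
          unfolding power2_eq_square by (intro mult_right_mono) auto
      qed
      finally show ?thesis by simp
    qed
    have "(\<integral>x. (cmod (f (x + h n) - f x))\<^sup>2 \<partial>lborel) \<le>
       (\<integral>x. 6 * real k * cmod (g (x + h n) - g x) + 3 * ?R (x + h n) + 3 * ?R x \<partial>lborel)"
    proof (rule integral_mono[OF _ int pt])
      show "integrable lborel (\<lambda>x. (cmod (f (x + h n) - f x))\<^sup>2)"
        by (rule Bochner_Integration.integrable_bound[OF int]) (auto intro!: AE_I2 order_trans[OF pt])
    qed
    also have "\<dots> = 6 * real k * (\<integral>x. cmod (g (x + h n) - g x) \<partial>lborel) + 3 * (\<integral>x. ?R (x + h n) \<partial>lborel) + 3 * (\<integral>x. ?R x \<partial>lborel)"
      using g gt r2 rt by simp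
    also have "(\<integral>x. ?R (x + h n) \<partial>lborel) = (\<integral>x. ?R x \<partial>lborel)"
      by (rule integral_lborel_translate[of ?R]) simp
    finally show ?thesis
      using k N[OF that] by simp
  qed
  then show "\<exists>N. \<forall>n\<ge>N. norm ((\<integral>x. (cmod (f (x + h n) - f x))\<^sup>2 \<partial>lborel) - 0) < e"
    by auto
qed

section \<open>Translations and the autocorrelation\<close>

lemma square_integrable_translate:
  assumes "square_integrable f"
  shows "square_integrable (\<lambda>x. f (x + h))"
  unfolding square_integrable_def
proof
  have [measurable]: "f \<in> borel_measurable borel"
    using assms by (rule square_integrable_measurable)
  show "(\<lambda>x. f (x + h)) \<in> borel_measurable lborel"
    by simp
  show "integrable lborel (\<lambda>x. (cmod (f (x + h)))\<^sup>2)"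
    using assms integrable_lborel_translate[of "\<lambda>x. (cmod (f x))\<^sup>2" h] by (simp add: square_integrable_def)
qed

lemma square_integrable_cnj:
  assumes "square_integrable f"
  shows "square_integrable (\<lambda>x. cnj (f x))"
proof -
  have [measurable]: "f \<in> borel_measurable borel"
    using assms by (rule square_integrable_measurable)
  have "(\<lambda>x. cnj (f x)) \<in> borel_measurable borel"
    by (rule borel_measurable_continuous_on[where f = cnj]) (auto intro: continuous_intros)
  then show ?thesis
    using assms by (simp add: square_integrable_def)
qed

lemma square_integrable_mult_bound:
  assumes "square_integrable f" "square_integrable g"
  shows "cmod (\<integral>x. f x * cnj (g x) \<partial>lborel) \<le> norm (abs_L2 f) * norm (abs_L2 g)"
  using cinner_L2_bound[of "abs_L2 f" "abs_L2 g"] assms by (simp add: cinner_abs_L2)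

text \<open>Its value at 0 is the squared norm, and its Fourier transform is, up to reflection, the
  squared modulus of the transform of \<open>f\<close>. Plancherel's theorem is thus Fourier
  inversion for this function at the origin.\<close>

definition autocorrelation :: "('a::euclidean_space \<Rightarrow> complex) \<Rightarrow> 'a \<Rightarrow> complex" where
  "autocorrelation f h = (\<integral>x. f x * cnj (f (x + h)) \<partial>lborel)"

lemma norm_translate_L2:
  assumes "square_integrable f"
  shows "norm (abs_L2 (\<lambda>x. f (x + h))) = norm (abs_L2 f)"
proof -
  have [measurable]: "f \<in> borel_measurable borel"
    using assms by (rule square_integrable_measurable)
  have "(norm (abs_L2 (\<lambda>x. f (x + h))))\<^sup>2 = (norm (abs_L2 f))\<^sup>2"
    using assms square_integrable_translate[OF assms, of h]
      integral_lborel_translate[of "\<lambda>x. (cmod (f x))\<^sup>2" h]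
    by (simp add: norm_abs_L2)
  then show ?thesis
    by (simp add: power2_eq_iff_nonneg)
qed

lemma autocorrelation_bound:
  assumes "square_integrable f"
  shows "cmod (autocorrelation f h) \<le> (norm (abs_L2 f))\<^sup>2"
  using square_integrable_mult_bound[OF assms square_integrable_translate[OF assms], of h]
  by (simp add: autocorrelation_def norm_translate_L2[OF assms] power2_eq_square)

lemma autocorrelation_0:
  assumes "square_integrable f"
  shows "autocorrelation f 0 = complex_of_real ((norm (abs_L2 f))\<^sup>2)"
  using assms by (simp add: autocorrelation_def cinner_L2_self flip: cinner_abs_L2)

text \<open>By Cauchy-Schwarz the increment is at most the norm of \<open>f\<close> times the L2
  distance between \<open>f\<close> and its translate.\<close>

lemma autocorrelation_tendsto:
  fixes f :: "'a::euclidean_space \<Rightarrow> complex"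
  assumes f: "square_integrable f" "integrable lborel f" and h: "h \<longlonglongrightarrow> 0"
  shows "(\<lambda>n. autocorrelation f (h n)) \<longlonglongrightarrow> autocorrelation f 0"
proof (rule LIM_zero_cancel, rule Lim_null_comparison)
  note ft = square_integrable_translate[OF f(1)]
  show "(\<lambda>n. norm (abs_L2 f) * sqrt (\<integral>x. (cmod (f (x + h n) - f x))\<^sup>2 \<partial>lborel)) \<longlonglongrightarrow> 0"
    using tendsto_mult[OF tendsto_const tendsto_real_sqrt[OF translate_L2_tendsto_0[OF f h]], of "norm (abs_L2 f)"]
    by simp
  show "\<forall>\<^sub>F n in sequentially. cmod (autocorrelation f (h n) - autocorrelation f 0) \<le>
      norm (abs_L2 f) * sqrt (\<integral>x. (cmod (f (x + h n) - f x))\<^sup>2 \<partial>lborel)"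
  proof (rule always_eventually, rule allI)
    fix n
    have "autocorrelation f (h n) - autocorrelation f 0 = (\<integral>x. f x * cnj (f (x + h n) - f x) \<partial>lborel)"
      using square_integrable_mult[OF f(1) ft[of "h n"]] square_integrable_mult[OF f(1) f(1)]
      by (simp add: autocorrelation_def right_diff_distrib flip: Bochner_Integration.integral_diff)
    moreover have "cmod \<dots> \<le> norm (abs_L2 f) * norm (abs_L2 (\<lambda>x. f (x + h n) - f x))"
      by (intro square_integrable_mult_bound f square_integrable_diff ft)
    moreover have "norm (abs_L2 (\<lambda>x. f (x + h n) - f x)) = sqrt (\<integral>x. (cmod (f (x + h n) - f x))\<^sup>2 \<partial>lborel)"
      by (simp add: norm_abs_L2[symmetric] square_integrable_diff f ft)
    ultimately show "cmod (autocorrelation f (h n) - autocorrelation f 0) \<le>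
      norm (abs_L2 f) * sqrt (\<integral>x. (cmod (f (x + h n) - f x))\<^sup>2 \<partial>lborel)"
      by simp
  qed
qed

section \<open>The Fourier integral of integrable functions and the regularized Plancherel
  identity\<close>

definition fourier_integral :: "('a::euclidean_space \<Rightarrow> complex) \<Rightarrow> 'a \<Rightarrow> complex" where
  "fourier_integral f \<xi> = (\<integral>x. cis (- (\<xi> \<bullet> x)) * f x \<partial>lborel)"

lemma borel_measurable_fourier_integral [measurable]:
  assumes [measurable]: "f \<in> borel_measurable borel"
  shows "fourier_integral f \<in> borel_measurable (borel :: 'a::euclidean_space measure)"
proof -
  have "(\<lambda>p::'a \<times> 'a. cis (- (fst p \<bullet> snd p)) * f (snd p)) \<in> borel_measurable (borel \<Otimes>\<^sub>M lborel)"
    by measurable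
  then show ?thesis
    unfolding fourier_integral_def[abs_def]
    by (intro sigma_finite_measure.borel_measurable_lebesgue_integral lborel.sigma_finite_measure_axioms)
       (simp add: case_prod_beta')
qed

lemma integrable_cis_inner:
  assumes "integrable lborel f"
  shows "integrable lborel (\<lambda>x. cis (- (\<xi> \<bullet> x)) * f x)"
  using assms by (intro integrable_cis_mult) auto

lemma fourier_integral_bound:
  assumes "integrable lborel f"
  shows "cmod (fourier_integral f \<xi>) \<le> (\<integral>x. cmod (f x) \<partial>lborel)"
  unfolding fourier_integral_def
  using integral_norm_bound[of lborel "\<lambda>x. cis (- (\<xi> \<bullet> x)) * f x"] by (simp add: norm_mult)

lemma (in pair_sigma_finite) integrable_mult_pair:
  fixes f :: "'a \<Rightarrow> complex" and g :: "'b \<Rightarrow> complex"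
  assumes f: "integrable M1 f" and g: "integrable M2 g"
  shows "integrable (M1 \<Otimes>\<^sub>M M2) (\<lambda>p. f (fst p) * g (snd p))"
proof (rule Fubini_integrable)
  have [measurable]: "f \<in> borel_measurable M1" "g \<in> borel_measurable M2"
    using f g by auto
  show "(\<lambda>p. f (fst p) * g (snd p)) \<in> borel_measurable (M1 \<Otimes>\<^sub>M M2)"
    by measurable
  show "integrable M1 (\<lambda>x. \<integral>y. norm (f (fst (x, y)) * g (snd (x, y))) \<partial>M2)"
    using f by (simp add: norm_mult)
  show "AE x in M1. integrable M2 (\<lambda>y. f (fst (x, y)) * g (snd (x, y)))"
    using g by simp
qed

text \<open>Written as a double integral, the squared modulus depends on the frequency through a
  single phase, and a later integration over frequencies acts on that phase alone.\<close>

lemma fourier_integral_squared: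
  fixes f :: "'a::euclidean_space \<Rightarrow> complex"
  assumes f: "integrable lborel f"
  shows "complex_of_real ((cmod (fourier_integral f \<xi>))\<^sup>2) =
    (\<integral>p. cis (- (\<xi> \<bullet> (fst p - snd p))) * (f (fst p) * cnj (f (snd p))) \<partial>(lborel \<Otimes>\<^sub>M lborel))"
proof -
  define F where "F x = cis (- (\<xi> \<bullet> x)) * f x" for x
  have F: "integrable lborel F"
    unfolding F_def by (rule integrable_cis_inner[OF f])
  have cF: "integrable lborel (\<lambda>x. cnj (F x))"
    using integrable_cnj F by auto
  have "complex_of_real ((cmod (fourier_integral f \<xi>))\<^sup>2) = (\<integral>x. F x \<partial>lborel) * cnj (\<integral>y. F y \<partial>lborel)"
    unfolding fourier_integral_def F_def complex_norm_square ..
  also have "cnj (\<integral>y. F y \<partial>lborel) = (\<integral>y. cnj (F y) \<partial>lborel)"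
    by (rule integral_bounded_linear[OF bounded_linear_cnj F, symmetric])
  also have "(\<integral>x. F x \<partial>lborel) * \<dots> = (\<integral>x. \<integral>y. F x * cnj (F y) \<partial>lborel \<partial>lborel)"
    by simp
  also have "\<dots> = (\<integral>p. F (fst p) * cnj (F (snd p)) \<partial>(lborel \<Otimes>\<^sub>M lborel))"
    using lborel_pair.integral_fst[of "\<lambda>x y. F x * cnj (F y)"] lborel_pair.integrable_mult_pair[OF F cF]
    by (simp add: case_prod_beta')
  also have "\<dots> = (\<integral>p. cis (- (\<xi> \<bullet> (fst p - snd p))) * (f (fst p) * cnj (f (snd p))) \<partial>(lborel \<Otimes>\<^sub>M lborel))"
  proof (intro Bochner_Integration.integral_cong refl)
    fix p :: "'a \<times> 'a"
    have "cis (- (\<xi> \<bullet> (fst p - snd p))) = cis (- (\<xi> \<bullet> fst p)) * cnj (cis (- (\<xi> \<bullet> snd p)))"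
      by (simp add: cis_cnj cis_mult inner_diff_right)
    then show "F (fst p) * cnj (F (snd p)) = cis (- (\<xi> \<bullet> (fst p - snd p))) * (f (fst p) * cnj (f (snd p)))"
      by (simp add: F_def)
  qed
  finally show ?thesis .
qed

lemma fourier_gaussian_scaled:
  fixes w :: "'a::euclidean_space"
  assumes \<sigma>: "\<sigma> > 0"
  shows "(\<integral>\<xi>. complex_of_real (gaussian (\<sigma> *\<^sub>R \<xi>)) * cis (- (\<xi> \<bullet> w)) \<partial>lborel) =
    complex_of_real ((sqrt (2 * pi) / \<sigma>) ^ DIM('a) * gaussian (w /\<^sub>R \<sigma>))"
proof -
  have "complex_of_real (sqrt (2 * pi) ^ DIM('a) * gaussian (w /\<^sub>R \<sigma>)) =
      \<sigma> ^ DIM('a) *\<^sub>R (\<integral>\<xi>. cis (- ((0 + \<sigma> *\<^sub>R \<xi>) \<bullet> (w /\<^sub>R \<sigma>))) * complex_of_real (gaussian (0 + \<sigma> *\<^sub>R \<xi>)) \<partial>lborel)"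
    unfolding fourier_gaussian[symmetric] using \<sigma> by (intro integral_lborel_scaleR) auto
  also have "\<dots> = \<sigma> ^ DIM('a) *\<^sub>R (\<integral>\<xi>. complex_of_real (gaussian (\<sigma> *\<^sub>R \<xi>)) * cis (- (\<xi> \<bullet> w)) \<partial>lborel)"
  proof -
    have "(\<sigma> *\<^sub>R \<xi>) \<bullet> (w /\<^sub>R \<sigma>) = \<xi> \<bullet> w" for \<xi>
      using \<sigma> by (simp add: field_simps)
    then show ?thesis
      by (simp only: add_0_left mult.commute)
  qed
  finally show ?thesis
    using \<sigma> by (simp add: power_divide scaleR_conv_of_real field_simps)
qed

text \<open>The Gaussian factor makes the three-fold integral absolutely convergent.\<close>

lemma regularized_Plancherel:
  fixes f :: "'a::euclidean_space \<Rightarrow> complex"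
  assumes f: "square_integrable f" "integrable lborel f" and \<sigma>: "\<sigma> > 0"
  shows "complex_of_real (\<integral>\<xi>. gaussian (\<sigma> *\<^sub>R \<xi>) * (cmod (fourier_integral f \<xi>))\<^sup>2 \<partial>lborel) =
    complex_of_real (sqrt (2 * pi) ^ DIM('a)) *
      (\<integral>u. complex_of_real (gaussian u) * autocorrelation f (\<sigma> *\<^sub>R u) \<partial>lborel)"
proof -
  let ?P = "lborel \<Otimes>\<^sub>M lborel :: ('a \<times> 'a) measure"
  interpret Q: pair_sigma_finite "lborel :: 'a measure" ?P
    by (intro pair_sigma_finite.intro lborel.sigma_finite_measure_axioms lborel_pair.sigma_finite_measure_axioms)
  have [measurable]: "f \<in> borel_measurable borel"
    using f(1) by (rule square_integrable_measurable)
  have [measurable]: "(\<lambda>x. cnj (f x)) \<in> borel_measurable borel"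
    using square_integrable_measurable[OF square_integrable_cnj[OF f(1)]] .
  have cf: "integrable lborel (\<lambda>x. cnj (f x))"
    using integrable_cnj f by auto
  define h where "h p = f (fst p) * cnj (f (snd p))" for p :: "'a \<times> 'a"
  have h: "integrable ?P h"
    unfolding h_def by (rule lborel_pair.integrable_mult_pair[OF f(2) cf])
  have [measurable]: "h \<in> borel_measurable ?P"
    using h by auto
  let ?g = "\<lambda>\<xi>. complex_of_real (gaussian (\<sigma> *\<^sub>R \<xi>))"
  have g: "integrable lborel ?g"
    using integrable_gaussian_scaleR[OF \<sigma>] by (rule integrable_of_real)
  define T where "T \<xi> p = ?g \<xi> * (cis (- (\<xi> \<bullet> (fst p - snd p))) * h p)" for \<xi> and p :: "'a \<times> 'a"
  have T: "integrable (lborel \<Otimes>\<^sub>M ?P) (case_prod T)"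
  proof (rule Bochner_Integration.integrable_bound[OF Q.integrable_mult_pair[OF g h]])
    have [measurable]: "(\<lambda>q::'a \<times> 'a \<times> 'a. cis (- (fst q \<bullet> (fst (snd q) - snd (snd q))))) \<in> borel_measurable (borel \<Otimes>\<^sub>M (borel \<Otimes>\<^sub>M borel))"
      unfolding borel_prod by (intro borel_measurable_continuous_onI continuous_intros)
    show "case_prod T \<in> borel_measurable (lborel \<Otimes>\<^sub>M ?P)"
      unfolding T_def case_prod_beta' by measurable
    show "AE q in lborel \<Otimes>\<^sub>M ?P. norm (case_prod T q) \<le> norm (?g (fst q) * h (snd q))"
      by (auto simp: T_def norm_mult)
  qed
  have "complex_of_real (\<integral>\<xi>. gaussian (\<sigma> *\<^sub>R \<xi>) * (cmod (fourier_integral f \<xi>))\<^sup>2 \<partial>lborel) =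
      (\<integral>\<xi>. ?g \<xi> * complex_of_real ((cmod (fourier_integral f \<xi>))\<^sup>2) \<partial>lborel)"
    by (simp flip: integral_complex_of_real)
  also have "\<dots> = (\<integral>\<xi>. (\<integral>p. T \<xi> p \<partial>?P) \<partial>lborel)"
    unfolding T_def h_def fourier_integral_squared[OF f(2)] by simp
  \<comment> \<open>With the frequency integral innermost, the Gaussian factor is transformed into
    an approximate identity in the difference of the two space variables.\<close>
  also have "\<dots> = (\<integral>p. (\<integral>\<xi>. T \<xi> p \<partial>lborel) \<partial>?P)"
    by (rule Q.Fubini_integral[OF T, symmetric])
  also have "(\<lambda>p. \<integral>\<xi>. T \<xi> p \<partial>lborel) = (\<lambda>p. complex_of_real ((sqrt (2 * pi) / \<sigma>) ^ DIM('a) *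
      gaussian ((fst p - snd p) /\<^sub>R \<sigma>)) * h p)"
    unfolding T_def fourier_gaussian_scaled[OF \<sigma>, symmetric]
    by (simp add: mult.assoc flip: integral_mult_left_zero)
  also have "(\<integral>p. complex_of_real ((sqrt (2 * pi) / \<sigma>) ^ DIM('a) * gaussian ((fst p - snd p) /\<^sub>R \<sigma>)) * h p \<partial>?P) =
      (\<integral>x. (\<integral>y. complex_of_real ((sqrt (2 * pi) / \<sigma>) ^ DIM('a) * gaussian ((x - y) /\<^sub>R \<sigma>)) * h (x, y) \<partial>lborel) \<partial>lborel)"
    (is "integral\<^sup>L _ ?H = _")
  proof -
    have "integrable ?P ?H"
    proof (rule Bochner_Integration.integrable_bound)
      show "integrable ?P (\<lambda>p. complex_of_real ((sqrt (2 * pi) / \<sigma>) ^ DIM('a)) * h p)"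
        using h by (rule integrable_mult_right)
      show "?H \<in> borel_measurable ?P"
        by measurable
      show "AE p in ?P. norm (?H p) \<le> norm (complex_of_real ((sqrt (2 * pi) / \<sigma>) ^ DIM('a)) * h p)"
        using \<sigma> by (intro AE_I2) (simp add: norm_mult gaussian_le_1 less_imp_le[OF gaussian_pos] mult_left_le mult_right_mono abs_mult)
    qed
    then show ?thesis
      using lborel_pair.integral_fst'[of ?H] by simp
  qed
  \<comment> \<open>The substitution y = x + \<sigma> u cancels the powers of \<sigma> and leaves a
    fixed Gaussian in \<open>u\<close>; the parameter survives only in the shift.\<close>
  also have "\<dots> = (\<integral>x. complex_of_real (sqrt (2 * pi) ^ DIM('a)) *
      (\<integral>u. complex_of_real (gaussian u) * (f x * cnj (f (x + \<sigma> *\<^sub>R u))) \<partial>lborel) \<partial>lborel)"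
  proof (intro Bochner_Integration.integral_cong refl)
    fix x :: 'a
    have "(\<integral>y. complex_of_real ((sqrt (2 * pi) / \<sigma>) ^ DIM('a) * gaussian ((x - y) /\<^sub>R \<sigma>)) * h (x, y) \<partial>lborel) =
      \<sigma> ^ DIM('a) *\<^sub>R (\<integral>u. complex_of_real ((sqrt (2 * pi) / \<sigma>) ^ DIM('a) * gaussian ((x - (x + \<sigma> *\<^sub>R u)) /\<^sub>R \<sigma>)) * h (x, x + \<sigma> *\<^sub>R u) \<partial>lborel)"
      using \<sigma> by (intro integral_lborel_scaleR) (auto simp: h_def)
    also have "(\<lambda>u. complex_of_real ((sqrt (2 * pi) / \<sigma>) ^ DIM('a) * gaussian ((x - (x + \<sigma> *\<^sub>R u)) /\<^sub>R \<sigma>)) * h (x, x + \<sigma> *\<^sub>R u)) =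
       (\<lambda>u. complex_of_real ((sqrt (2 * pi) / \<sigma>) ^ DIM('a)) * (complex_of_real (gaussian u) * (f x * cnj (f (x + \<sigma> *\<^sub>R u)))))"
      using \<sigma> by (auto simp: gaussian_def h_def)
    also have "\<sigma> ^ DIM('a) *\<^sub>R integral\<^sup>L lborel \<dots> = complex_of_real (sqrt (2 * pi) ^ DIM('a)) *
      (\<integral>u. complex_of_real (gaussian u) * (f x * cnj (f (x + \<sigma> *\<^sub>R u))) \<partial>lborel)"
      using \<sigma> by (subst integral_mult_right_zero) (simp add: power_divide scaleR_conv_of_real)
    finally show "(\<integral>y. complex_of_real ((sqrt (2 * pi) / \<sigma>) ^ DIM('a) * gaussian ((x - y) /\<^sub>R \<sigma>)) * h (x, y) \<partial>lborel) =
       complex_of_real (sqrt (2 * pi) ^ DIM('a)) *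
      (\<integral>u. complex_of_real (gaussian u) * (f x * cnj (f (x + \<sigma> *\<^sub>R u))) \<partial>lborel)" .
  qed
  also have "\<dots> = complex_of_real (sqrt (2 * pi) ^ DIM('a)) *
      (\<integral>x. (\<integral>u. complex_of_real (gaussian u) * (f x * cnj (f (x + \<sigma> *\<^sub>R u))) \<partial>lborel) \<partial>lborel)"
    by (rule integral_mult_right_zero)
  also have "(\<integral>x. (\<integral>u. complex_of_real (gaussian u) * (f x * cnj (f (x + \<sigma> *\<^sub>R u))) \<partial>lborel) \<partial>lborel) =
     (\<integral>u. (\<integral>x. complex_of_real (gaussian u) * (f x * cnj (f (x + \<sigma> *\<^sub>R u))) \<partial>lborel) \<partial>lborel)"
  proof (rule lborel_pair.Fubini_integral)
    define k where "k p = complex_of_real (gaussian (fst p)) * (f (snd p) * cnj (f (snd p + \<sigma> *\<^sub>R fst p)))" for p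
    have [measurable]: "k \<in> borel_measurable (lborel \<Otimes>\<^sub>M lborel)"
      unfolding k_def[abs_def] by measurable
    have "integrable (lborel \<Otimes>\<^sub>M lborel) k"
    proof (rule lborel_pair.Fubini_integrable)
      have fm: "integrable lborel (\<lambda>x. f x * cnj (f (x + h)))" for h
        by (intro square_integrable_mult f square_integrable_translate)
      show "integrable lborel (\<lambda>u. \<integral>x. norm (k (u, x)) \<partial>lborel)"
      proof (rule Bochner_Integration.integrable_bound)
        show "integrable lborel (\<lambda>u. gaussian (u::'a) * (\<integral>x. (cmod (f x))\<^sup>2 \<partial>lborel))"
          using integrable_gaussian by (rule integrable_mult_left)
        show "(\<lambda>u. \<integral>x. norm (k (u, x)) \<partial>lborel) \<in> borel_measurable lborel"
          by measurable
        have "norm (\<integral>x. norm (k (u, x)) \<partial>lborel) \<le> norm (gaussian u * (\<integral>x. (cmod (f x))\<^sup>2 \<partial>lborel))" for u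
        proof -
          have f2: "integrable lborel (\<lambda>x. (cmod (f x))\<^sup>2)"
            using f(1) by (simp add: square_integrable_def)
          note f2t = integrable_lborel_translate[OF f2, of "\<sigma> *\<^sub>R u"]
          \<comment> \<open>The product is bounded by the mean of the two squares, and translation
            invariance makes the result independent of \<open>u\<close>.\<close>
          have "(\<integral>x. norm (f x * cnj (f (x + \<sigma> *\<^sub>R u))) \<partial>lborel) \<le>
              (\<integral>x. ((cmod (f x))\<^sup>2 + (cmod (f (x + \<sigma> *\<^sub>R u)))\<^sup>2) / 2 \<partial>lborel)"
          proof (rule integral_mono)
            fix x show "norm (f x * cnj (f (x + \<sigma> *\<^sub>R u))) \<le> ((cmod (f x))\<^sup>2 + (cmod (f (x + \<sigma> *\<^sub>R u)))\<^sup>2) / 2"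
              using sum_squares_bound[of "cmod (f x)" "cmod (f (x + \<sigma> *\<^sub>R u))"] by (simp add: norm_mult)
          qed (use fm f2 f2t in auto)
          also have "\<dots> = ((\<integral>x. (cmod (f x))\<^sup>2 \<partial>lborel) + (\<integral>x. (cmod (f (x + \<sigma> *\<^sub>R u)))\<^sup>2 \<partial>lborel)) / 2"
            using f2 f2t by simp
          also have "(\<integral>x. (cmod (f (x + \<sigma> *\<^sub>R u)))\<^sup>2 \<partial>lborel) = (\<integral>x. (cmod (f x))\<^sup>2 \<partial>lborel)"
            by (rule integral_lborel_translate[of "\<lambda>x. (cmod (f x))\<^sup>2"]) simp
          finally have "(\<integral>x. norm (f x * cnj (f (x + \<sigma> *\<^sub>R u))) \<partial>lborel) \<le> (\<integral>x. (cmod (f x))\<^sup>2 \<partial>lborel)"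
            by simp
          moreover have "(\<integral>x. norm (k (u, x)) \<partial>lborel) = gaussian u * (\<integral>x. norm (f x * cnj (f (x + \<sigma> *\<^sub>R u))) \<partial>lborel)"
            by (simp add: k_def norm_mult less_imp_le[OF gaussian_pos])
          ultimately show ?thesis
            by (simp add: less_imp_le[OF gaussian_pos] mult_left_mono abs_mult)
        qed
        then show "AE u in lborel. norm (\<integral>x. norm (k (u, x)) \<partial>lborel) \<le> norm (gaussian u * (\<integral>x. (cmod (f x))\<^sup>2 \<partial>lborel))"
          by simp
      qed
      show "AE u in lborel. integrable lborel (\<lambda>x. k (u, x))"
        using fm by (simp add: k_def)
    qed simp
    then show "integrable (lborel \<Otimes>\<^sub>M lborel) (\<lambda>(u, x). complex_of_real (gaussian u) * (f x * cnj (f (x + \<sigma> *\<^sub>R u))))"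
      by (simp add: k_def[abs_def] case_prod_beta')
  qed
  finally show ?thesis
    by (simp add: autocorrelation_def)
qed

text \<open>As the Gaussian regularization is removed, the frequency side converges monotonically
  and the autocorrelation side by dominated convergence. The left side is a nonnegative integral
  because its finiteness is part of the conclusion.\<close>

lemma nn_integral_fourier_integral:
  fixes f :: "'a::euclidean_space \<Rightarrow> complex"
  assumes f: "square_integrable f" "integrable lborel f"
  shows "(\<integral>\<^sup>+\<xi>. ennreal ((cmod (fourier_integral f \<xi>))\<^sup>2) \<partial>lborel) =
    ennreal ((2 * pi) ^ DIM('a) * (norm (abs_L2 f))\<^sup>2)"
proof -
  have [measurable]: "f \<in> borel_measurable borel"
    using f(1) by (rule square_integrable_measurable)
  \<comment> \<open>A decreasing scale lets the Gaussian factors increase to 1, as monotone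
    convergence requires.\<close>
  define s where "s n = 1 / real (Suc n)" for n
  have s0: "s n > 0" for n
    by (simp add: s_def)
  have s: "s \<longlonglongrightarrow> 0"
    unfolding s_def using LIMSEQ_inverse_real_of_nat by (simp add: inverse_eq_divide)
  have smono: "s (Suc n) \<le> s n" for n
    by (simp add: s_def field_simps)
  define I where "I n = (\<integral>\<xi>. gaussian (s n *\<^sub>R \<xi>) * (cmod (fourier_integral f \<xi>))\<^sup>2 \<partial>lborel)" for n
  define C where "C = (\<integral>x. cmod (f x) \<partial>lborel)"
  have int: "integrable lborel (\<lambda>\<xi>. gaussian (s n *\<^sub>R \<xi>) * (cmod (fourier_integral f \<xi>))\<^sup>2)" for n
  proof (rule Bochner_Integration.integrable_bound)
    show "integrable lborel (\<lambda>\<xi>::'a. gaussian (s n *\<^sub>R \<xi>) * C\<^sup>2)"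
      by (intro integrable_mult_left integrable_gaussian_scaleR s0)
    show "AE \<xi> in lborel. norm (gaussian (s n *\<^sub>R \<xi>) * (cmod (fourier_integral f \<xi>))\<^sup>2) \<le> norm (gaussian (s n *\<^sub>R \<xi>) * C\<^sup>2)"
      using fourier_integral_bound[OF f(2)]
      by (intro AE_I2) (simp add: C_def abs_mult less_imp_le[OF gaussian_pos] mult_left_mono power_mono)
  qed measurable
  have "(\<integral>\<^sup>+\<xi>. ennreal ((cmod (fourier_integral f \<xi>))\<^sup>2) \<partial>lborel) =
      (\<integral>\<^sup>+\<xi>. (SUP n. ennreal (gaussian (s n *\<^sub>R \<xi>) * (cmod (fourier_integral f \<xi>))\<^sup>2)) \<partial>lborel)"
  proof (intro nn_integral_cong)
    fix \<xi> :: 'a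
    have inc: "incseq (\<lambda>n. ennreal (gaussian (s n *\<^sub>R \<xi>) * (cmod (fourier_integral f \<xi>))\<^sup>2))"
    proof (intro incseq_SucI ennreal_leI mult_right_mono)
      fix n
      have "norm (s (Suc n) *\<^sub>R \<xi>) \<le> norm (s n *\<^sub>R \<xi>)"
        using smono[of n] s0[of "Suc n"] s0[of n] by (simp add: mult_right_mono)
      then show "gaussian (s n *\<^sub>R \<xi>) \<le> gaussian (s (Suc n) *\<^sub>R \<xi>)"
        unfolding gaussian_def by (simp add: power_mono)
    qed simp
    have "(\<lambda>n. gaussian (s n *\<^sub>R \<xi>) * (cmod (fourier_integral f \<xi>))\<^sup>2) \<longlonglongrightarrow>
        exp (- (norm (0 *\<^sub>R \<xi>))\<^sup>2 / 2) * (cmod (fourier_integral f \<xi>))\<^sup>2"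
      unfolding gaussian_def by (intro tendsto_intros s) simp
    then have "(\<lambda>n. ennreal (gaussian (s n *\<^sub>R \<xi>) * (cmod (fourier_integral f \<xi>))\<^sup>2)) \<longlonglongrightarrow> ennreal ((cmod (fourier_integral f \<xi>))\<^sup>2)"
      by (intro tendsto_ennrealI) simp
    then show "ennreal ((cmod (fourier_integral f \<xi>))\<^sup>2) = (SUP n. ennreal (gaussian (s n *\<^sub>R \<xi>) * (cmod (fourier_integral f \<xi>))\<^sup>2))"
      using LIMSEQ_unique LIMSEQ_SUP[OF inc] by blast
  qed
  also have "\<dots> = (SUP n. \<integral>\<^sup>+\<xi>. ennreal (gaussian (s n *\<^sub>R \<xi>) * (cmod (fourier_integral f \<xi>))\<^sup>2) \<partial>lborel)"
  proof (rule nn_integral_monotone_convergence_SUP_AE)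
    show "AE \<xi> in lborel. ennreal (gaussian (s i *\<^sub>R \<xi>) * (cmod (fourier_integral f \<xi>))\<^sup>2)
        \<le> ennreal (gaussian (s (Suc i) *\<^sub>R \<xi>) * (cmod (fourier_integral f \<xi>))\<^sup>2)" for i
    proof (intro AE_I2 ennreal_leI mult_right_mono)
      fix \<xi> :: 'a
      have "norm (s (Suc i) *\<^sub>R \<xi>) \<le> norm (s i *\<^sub>R \<xi>)"
        using smono[of i] s0[of "Suc i"] s0[of i] by (simp add: mult_right_mono)
      then show "gaussian (s i *\<^sub>R \<xi>) \<le> gaussian (s (Suc i) *\<^sub>R \<xi>)"
        unfolding gaussian_def by (simp add: power_mono)
    qed simp
  qed measurable
  also have "\<dots> = (SUP n. ennreal (I n))"
    unfolding I_def by (intro SUP_cong refl nn_integral_eq_integral int AE_I2) (simp add: less_imp_le[OF gaussian_pos])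
  also have "\<dots> = ennreal ((2 * pi) ^ DIM('a) * (norm (abs_L2 f))\<^sup>2)"
  proof (rule LIMSEQ_unique)
    have mono: "incseq I"
      unfolding I_def
    proof (intro incseq_SucI integral_mono int mult_right_mono)
      fix i and \<xi> :: 'a
      have "norm (s (Suc i) *\<^sub>R \<xi>) \<le> norm (s i *\<^sub>R \<xi>)"
        using smono[of i] s0[of "Suc i"] s0[of i] by (simp add: mult_right_mono)
      then show "gaussian (s i *\<^sub>R \<xi>) \<le> gaussian (s (Suc i) *\<^sub>R \<xi>)"
        unfolding gaussian_def by (simp add: power_mono)
    qed simp
    then show "(\<lambda>n. ennreal (I n)) \<longlonglongrightarrow> (SUP n. ennreal (I n))"
      by (intro LIMSEQ_SUP) (auto simp: incseq_def intro: ennreal_leI)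
    define J where "J n = (\<integral>u. complex_of_real (gaussian u) * autocorrelation f (s n *\<^sub>R u) \<partial>lborel)" for n
    have "J \<longlonglongrightarrow> (\<integral>u. complex_of_real (gaussian (u::'a)) * autocorrelation f 0 \<partial>lborel)"
      unfolding J_def
    proof (rule integral_dominated_convergence[where w="\<lambda>u. gaussian u * (norm (abs_L2 f))\<^sup>2"])
      show "integrable lborel (\<lambda>u::'a. gaussian u * (norm (abs_L2 f))\<^sup>2)"
        using integrable_gaussian by (rule integrable_mult_left)
      show "AE u in lborel. (\<lambda>n. complex_of_real (gaussian u) * autocorrelation f (s n *\<^sub>R u)) \<longlonglongrightarrow> complex_of_real (gaussian u) * autocorrelation f 0"
        using tendsto_scaleR[OF s tendsto_const]
        by (intro AE_I2 tendsto_mult tendsto_const autocorrelation_tendsto f) simp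
      show "AE u in lborel. cmod (complex_of_real (gaussian u) * autocorrelation f (s n *\<^sub>R u)) \<le> gaussian u * (norm (abs_L2 f))\<^sup>2" for n
        using autocorrelation_bound[OF f(1)]
        by (intro AE_I2) (simp add: norm_mult less_imp_le[OF gaussian_pos] mult_left_mono)
      have [measurable]: "(\<lambda>x. cnj (f x)) \<in> borel_measurable borel"
        using square_integrable_measurable[OF square_integrable_cnj[OF f(1)]] .
      show "(\<lambda>u. complex_of_real (gaussian u) * autocorrelation f (s n *\<^sub>R u)) \<in> borel_measurable lborel" for n
        unfolding autocorrelation_def by measurable
    qed simp
    \<comment> \<open>The mass of the Gaussian contributes a second factor sqrt (2 pi)^d besides the
      one in \<open>regularized_Plancherel\<close>; together they form the constant (2 pi)^d of the
      kernel without normalization.\<close>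
    also have "(\<integral>u. complex_of_real (gaussian (u::'a)) * autocorrelation f 0 \<partial>lborel) =
        complex_of_real (sqrt (2 * pi) ^ DIM('a) * (norm (abs_L2 f))\<^sup>2)"
      using integrable_gaussian by (simp add: integral_gaussian autocorrelation_0[OF f(1)])
    finally have "(\<lambda>n. complex_of_real (sqrt (2 * pi) ^ DIM('a)) * J n) \<longlonglongrightarrow>
        complex_of_real (sqrt (2 * pi) ^ DIM('a)) * complex_of_real (sqrt (2 * pi) ^ DIM('a) * (norm (abs_L2 f))\<^sup>2)"
      by (intro tendsto_intros)
    moreover have "complex_of_real (sqrt (2 * pi) ^ DIM('a)) * J n = complex_of_real (I n)" for n
      unfolding I_def J_def by (rule regularized_Plancherel[OF f s0, symmetric])
    ultimately have "(\<lambda>n. complex_of_real (I n)) \<longlonglongrightarrow> complex_of_real (sqrt (2 * pi) ^ DIM('a) * (sqrt (2 * pi) ^ DIM('a) * (norm (abs_L2 f))\<^sup>2))"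
      by (simp only: of_real_mult)
    then have "I \<longlonglongrightarrow> sqrt (2 * pi) ^ DIM('a) * (sqrt (2 * pi) ^ DIM('a) * (norm (abs_L2 f))\<^sup>2)"
      by (simp only: tendsto_of_real_iff)
    also have "sqrt (2 * pi) ^ DIM('a) * (sqrt (2 * pi) ^ DIM('a) * (norm (abs_L2 f))\<^sup>2) = (2 * pi) ^ DIM('a) * (norm (abs_L2 f))\<^sup>2"
    proof -
      have "sqrt (2 * pi) ^ DIM('a) * sqrt (2 * pi) ^ DIM('a) = (2 * pi) ^ DIM('a)"
        by (subst power_mult_distrib[symmetric]) simp
      then show ?thesis
        by (metis mult.assoc)
    qed
    finally show "(\<lambda>n. ennreal (I n)) \<longlonglongrightarrow> ennreal ((2 * pi) ^ DIM('a) * (norm (abs_L2 f))\<^sup>2)"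
      by (rule tendsto_ennrealI)
  qed
  finally show ?thesis .
qed

lemma square_integrable_fourier_integral:
  assumes "square_integrable f" "integrable lborel f"
  shows "square_integrable (fourier_integral f)"
proof (rule square_integrableI_nn_integral)
  show "fourier_integral f \<in> borel_measurable borel"
    by (intro borel_measurable_fourier_integral square_integrable_measurable assms)
  show "(\<integral>\<^sup>+x. ennreal ((cmod (fourier_integral f x))\<^sup>2) \<partial>lborel) < \<infinity>"
    unfolding nn_integral_fourier_integral[OF assms] by simp
qed

lemma norm_fourier_integral:
  fixes f :: "'a::euclidean_space \<Rightarrow> complex"
  assumes "square_integrable f" "integrable lborel f"
  shows "(norm (abs_L2 (fourier_integral f)))\<^sup>2 = (2 * pi) ^ DIM('a) * (norm (abs_L2 f))\<^sup>2"
  using nn_integral_fourier_integral[OF assms]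
  unfolding nn_integral_norm_abs_L2[OF square_integrable_fourier_integral[OF assms]]
  by (subst (asm) ennreal_inj) auto

text \<open>The kernel is symmetric in its two variables, so Fubini moves the transform from one
  factor to the other. Passing to the limit, this identifies the adjoint of the transform, on which
  surjectivity rests.\<close>

lemma integral_fourier_integral_swap:
  fixes f g :: "'a::euclidean_space \<Rightarrow> complex"
  assumes f: "integrable lborel f" and g: "integrable lborel g"
  shows "(\<integral>\<xi>. fourier_integral f \<xi> * g \<xi> \<partial>lborel) = (\<integral>x. f x * fourier_integral g x \<partial>lborel)"
proof -
  have [measurable]: "f \<in> borel_measurable borel"
    using borel_measurable_integrable[OF f] by simp
  have [measurable]: "g \<in> borel_measurable borel"
    using borel_measurable_integrable[OF g] by simp
  define k where "k \<xi> x = cis (- (\<xi> \<bullet> x)) * f x * g \<xi>" for \<xi> x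
  have k: "integrable (lborel \<Otimes>\<^sub>M lborel) (case_prod k)"
  proof (rule Bochner_Integration.integrable_bound[OF lborel_pair.integrable_mult_pair[OF g f]])
    show "case_prod k \<in> borel_measurable (lborel \<Otimes>\<^sub>M lborel)"
      unfolding k_def case_prod_beta' by measurable
  qed (auto simp: k_def norm_mult)
  have "(\<integral>\<xi>. fourier_integral f \<xi> * g \<xi> \<partial>lborel) = (\<integral>\<xi>. (\<integral>x. k \<xi> x \<partial>lborel) \<partial>lborel)"
    by (simp add: fourier_integral_def k_def)
  also have "\<dots> = (\<integral>x. (\<integral>\<xi>. k \<xi> x \<partial>lborel) \<partial>lborel)"
    by (rule lborel_pair.Fubini_integral[OF k, symmetric])
  also have "(\<lambda>x. \<integral>\<xi>. k \<xi> x \<partial>lborel) = (\<lambda>x. \<integral>\<xi>. f x * (cis (- (x \<bullet> \<xi>)) * g \<xi>) \<partial>lborel)"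
    by (simp add: k_def inner_commute mult_ac)
  finally show ?thesis
    by (simp add: fourier_integral_def)
qed

section \<open>The Fourier--Plancherel transform and the Schroedinger group\<close>

text \<open>The cut of a square-integrable function to a ball is also integrable, so the Plancherel
  identity applies to it. These are the truncations in the definition of
  \<open>fourier_L2\<close>.\<close>

definition ball_cut :: "nat \<Rightarrow> ('a::euclidean_space \<Rightarrow> complex) \<Rightarrow> 'a \<Rightarrow> complex" where
  "ball_cut n r x = indicator (cball 0 (real n)) x *\<^sub>R r x"

lemma truncated_fourier_abs_L2:
  assumes "square_integrable r"
  shows "truncated_fourier n (abs_L2 r) = fourier_integral (ball_cut n r)"
proof
  fix \<xi> :: 'a
  have "truncated_fourier n (abs_L2 r) \<xi> = (\<integral>x. indicator (cball 0 (real n)) x *\<^sub>R (cis (- (\<xi> \<bullet> x)) * r x) \<partial>lborel)"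
    using assms by (subst truncated_fourier.abs_eq) (auto simp: L2_rel_def)
  then show "truncated_fourier n (abs_L2 r) \<xi> = fourier_integral (ball_cut n r) \<xi>"
    by (simp add: fourier_integral_def ball_cut_def)
qed

lemma square_integrable_ball_cut:
  assumes "square_integrable r"
  shows "square_integrable (ball_cut n r)"
proof -
  have [measurable]: "r \<in> borel_measurable borel"
    using assms by (rule square_integrable_measurable)
  have r2: "integrable lborel (\<lambda>x. (cmod (r x))\<^sup>2)"
    using assms by (simp add: square_integrable_def)
  have "integrable lborel (\<lambda>x. (cmod (ball_cut n r x))\<^sup>2)"
    by (rule Bochner_Integration.integrable_bound[OF r2]) (auto simp: ball_cut_def[abs_def] indicator_def)
  moreover have "ball_cut n r \<in> borel_measurable lborel"
    unfolding ball_cut_def[abs_def] using square_integrable_measurable[OF assms]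
    by (intro borel_measurable_scaleR borel_measurable_indicator) auto
  ultimately show ?thesis
    by (simp add: square_integrable_def)
qed

lemma integrable_ball_cut:
  assumes "square_integrable r"
  shows "integrable lborel (ball_cut n r)"
proof (rule Bochner_Integration.integrable_bound)
  have [measurable]: "r \<in> borel_measurable borel"
    using assms by (rule square_integrable_measurable)
  have "emeasure lborel (cball (0::'a) (real n)) < \<infinity>"
    by (rule emeasure_lborel_cball_finite)
  then show "integrable lborel (\<lambda>x. indicator (cball 0 (real n)) x + (cmod (r x))\<^sup>2)"
    using assms
    by (intro Bochner_Integration.integrable_add integrable_real_indicator)
      (auto simp: square_integrable_def)
  show "ball_cut n r \<in> borel_measurable lborel"
    unfolding ball_cut_def[abs_def] using square_integrable_measurable[OF assms]
    by (intro borel_measurable_scaleR borel_measurable_indicator) auto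
  have "cmod (r x) \<le> 1 + (cmod (r x))\<^sup>2" for x
    using sum_squares_bound[of 1 "cmod (r x)"] norm_ge_zero[of "r x"]
    by (simp del: norm_ge_zero)
  then show "AE x in lborel. norm (ball_cut n r x) \<le> norm (indicator (cball 0 (real n)) x + (cmod (r x))\<^sup>2 :: real)"
    by (auto simp: ball_cut_def indicator_def abs_of_nonneg intro!: AE_I2)
qed

lemma ball_cut_tendsto:
  assumes r: "square_integrable r"
  shows "(\<lambda>n. abs_L2 (ball_cut n r)) \<longlonglongrightarrow> abs_L2 r"
proof (rule LIM_zero_cancel, rule tendsto_norm_zero_cancel)
  have [measurable]: "r \<in> borel_measurable borel"
    using assms by (rule square_integrable_measurable)
  have r2: "integrable lborel (\<lambda>x. (cmod (r x))\<^sup>2)"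
    using assms by (simp add: square_integrable_def)
  have "(\<lambda>n. \<integral>x. (cmod (ball_cut n r x - r x))\<^sup>2 \<partial>lborel) \<longlonglongrightarrow> (\<integral>x. 0 \<partial>(lborel :: 'a measure))"
  proof (rule integral_dominated_convergence[OF _ _ r2])
    have "(\<lambda>n. (cmod (ball_cut n r x - r x))\<^sup>2) \<longlonglongrightarrow> 0" for x
    proof (rule tendsto_eventually)
      obtain k where "norm x \<le> real k"
        using real_arch_simple by blast
      then show "\<forall>\<^sub>F n in sequentially. (cmod (ball_cut n r x - r x))\<^sup>2 = 0"
        by (intro eventually_sequentiallyI[of k]) (auto simp: ball_cut_def)
    qed
    then show "AE x in lborel. (\<lambda>n. (cmod (ball_cut n r x - r x))\<^sup>2) \<longlonglongrightarrow> 0"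
      by simp
  qed (auto simp: ball_cut_def[abs_def] indicator_def)
  then have "(\<lambda>n. (norm (abs_L2 (ball_cut n r) - abs_L2 r))\<^sup>2) \<longlonglongrightarrow> 0"
    using r by (simp add: diff_abs_L2 norm_abs_L2 square_integrable_ball_cut square_integrable_diff)
  from tendsto_real_sqrt[OF this] show "(\<lambda>n. norm (abs_L2 (ball_cut n r) - abs_L2 r)) \<longlonglongrightarrow> 0"
    by simp
qed

lemma fourier_integral_diff:
  assumes "integrable lborel f" "integrable lborel g"
  shows "fourier_integral (\<lambda>x. f x - g x) = (\<lambda>\<xi>. fourier_integral f \<xi> - fourier_integral g \<xi>)"
  using integrable_cis_inner[OF assms(1)] integrable_cis_inner[OF assms(2)]
  by (auto simp: fourier_integral_def right_diff_distrib)

lemma fourier_integral_add: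
  assumes "integrable lborel f" "integrable lborel g"
  shows "fourier_integral (\<lambda>x. f x + g x) = (\<lambda>\<xi>. fourier_integral f \<xi> + fourier_integral g \<xi>)"
  using integrable_cis_inner[OF assms(1)] integrable_cis_inner[OF assms(2)]
  by (auto simp: fourier_integral_def distrib_left)

lemma fourier_integral_cmult: "fourier_integral (\<lambda>x. c * f x) = (\<lambda>\<xi>. c * fourier_integral f \<xi>)"
proof
  fix \<xi> :: 'a
  have "fourier_integral (\<lambda>x. c * f x) \<xi> = (\<integral>x. c * (cis (- (\<xi> \<bullet> x)) * f x) \<partial>lborel)"
    unfolding fourier_integral_def by (simp add: mult.left_commute)
  then show "fourier_integral (\<lambda>x. c * f x) \<xi> = c * fourier_integral f \<xi>"
    by (simp add: fourier_integral_def)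
qed

lemma norm_fourier_integral_diff:
  fixes f g :: "'a::euclidean_space \<Rightarrow> complex"
  assumes "square_integrable f" "integrable lborel f" "square_integrable g" "integrable lborel g"
  shows "norm (abs_L2 (fourier_integral f) - abs_L2 (fourier_integral g)) =
    sqrt ((2 * pi) ^ DIM('a)) * norm (abs_L2 f - abs_L2 g)"
proof -
  have "norm (abs_L2 (fourier_integral f) - abs_L2 (fourier_integral g)) =
      norm (abs_L2 (fourier_integral (\<lambda>x. f x - g x)))"
    using assms by (simp add: diff_abs_L2 square_integrable_fourier_integral fourier_integral_diff)
  also have "\<dots> = sqrt ((2 * pi) ^ DIM('a) * (norm (abs_L2 (\<lambda>x. f x - g x)))\<^sup>2)"
    using assms by (subst norm_fourier_integral[symmetric]) (auto intro: square_integrable_diff)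
  also have "\<dots> = sqrt ((2 * pi) ^ DIM('a)) * norm (abs_L2 f - abs_L2 g)"
    using assms by (simp add: real_sqrt_mult diff_abs_L2)
  finally show ?thesis .
qed

text \<open>Plancherel makes the transform an isometry up to a constant on the integrable functions
  of the space, so two approximations of the same \<open>f\<close> have transforms whose distance
  tends to 0. The limit is therefore not tied to truncation over balls, and algebraic identities
  pass to it.\<close>

lemma fourier_L2_tendsto:
  fixes g :: "nat \<Rightarrow> 'a::euclidean_space \<Rightarrow> complex"
  assumes g: "\<And>n. square_integrable (g n)" "\<And>n. integrable lborel (g n)"
    and lim: "(\<lambda>n. abs_L2 (g n)) \<longlonglongrightarrow> f"
  shows "(\<lambda>n. abs_L2 (fourier_integral (g n))) \<longlonglongrightarrow> fourier_L2 f"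
proof -
  obtain r where r: "square_integrable r" "f = abs_L2 r"
    by (rule L2_cases)
  note c = square_integrable_ball_cut[OF r(1)] integrable_ball_cut[OF r(1)]
  let ?C = "sqrt ((2 * pi) ^ DIM('a))"
  let ?X = "\<lambda>n. abs_L2 (fourier_integral (ball_cut n r))"
  have cut: "(\<lambda>n. abs_L2 (ball_cut n r)) \<longlonglongrightarrow> f"
    unfolding r(2) by (rule ball_cut_tendsto[OF r(1)])
  have "Cauchy ?X"
  proof (rule CauchyI)
    fix e :: real assume "e > 0"
    then have "e / ?C > 0"
      by simp
    then obtain M where "\<And>m n. m \<ge> M \<Longrightarrow> n \<ge> M \<Longrightarrow> norm (abs_L2 (ball_cut m r) - abs_L2 (ball_cut n r)) < e / ?C"
      using CauchyD[OF LIMSEQ_imp_Cauchy[OF cut]] by metis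
    then show "\<exists>M. \<forall>m\<ge>M. \<forall>n\<ge>M. norm (?X m - ?X n) < e"
      by (intro exI[of _ M]) (simp add: norm_fourier_integral_diff c pos_less_divide_eq mult.commute)
  qed
  then have "convergent ?X"
    by (rule Cauchy_convergent)
  then have X: "?X \<longlonglongrightarrow> fourier_L2 f"
    by (simp add: convergent_LIMSEQ_iff fourier_L2_def r truncated_fourier_abs_L2)
  have "(\<lambda>n. ?C * norm (abs_L2 (g n) - abs_L2 (ball_cut n r))) \<longlonglongrightarrow> ?C * norm (f - f)"
    by (intro tendsto_intros lim cut)
  then have "(\<lambda>n. norm (abs_L2 (fourier_integral (g n)) - ?X n)) \<longlonglongrightarrow> 0"
    by (simp add: norm_fourier_integral_diff g c)
  then have "(\<lambda>n. abs_L2 (fourier_integral (g n)) - ?X n) \<longlonglongrightarrow> 0"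
    by (rule tendsto_norm_zero_cancel)
  from tendsto_add[OF this X] show ?thesis
    by simp
qed

lemma L2_approximation:
  "\<exists>g. (\<forall>n. square_integrable (g n)) \<and> (\<forall>n. integrable lborel (g n)) \<and> (\<lambda>n. abs_L2 (g n)) \<longlonglongrightarrow> f \<and>
    (\<lambda>n. abs_L2 (fourier_integral (g n))) \<longlonglongrightarrow> fourier_L2 f"
proof -
  obtain r where r: "square_integrable r" "f = abs_L2 r"
    by (rule L2_cases)
  note g = square_integrable_ball_cut[OF r(1)] integrable_ball_cut[OF r(1)]
    ball_cut_tendsto[OF r(1), folded r(2)]
  show ?thesis
    by (intro exI[of _ "\<lambda>n. ball_cut n r"] conjI allI g fourier_L2_tendsto[OF g])
qed

lemma fourier_L2_add: "fourier_L2 (f + g) = fourier_L2 f + fourier_L2 g"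
proof -
  obtain a where a: "\<And>n. square_integrable (a n)" "\<And>n. integrable lborel (a n)" "(\<lambda>n. abs_L2 (a n)) \<longlonglongrightarrow> f"
    "(\<lambda>n. abs_L2 (fourier_integral (a n))) \<longlonglongrightarrow> fourier_L2 f"
    using L2_approximation[of f] by blast
  obtain b where b: "\<And>n. square_integrable (b n)" "\<And>n. integrable lborel (b n)" "(\<lambda>n. abs_L2 (b n)) \<longlonglongrightarrow> g"
    "(\<lambda>n. abs_L2 (fourier_integral (b n))) \<longlonglongrightarrow> fourier_L2 g"
    using L2_approximation[of g] by blast
  have "(\<lambda>n. abs_L2 (fourier_integral (\<lambda>x. a n x + b n x))) \<longlonglongrightarrow> fourier_L2 (f + g)"
    using tendsto_add[OF a(3) b(3)] a b
    by (intro fourier_L2_tendsto) (auto simp: add_abs_L2 intro: square_integrable_add)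
  moreover have "(\<lambda>n. abs_L2 (fourier_integral (\<lambda>x. a n x + b n x))) \<longlonglongrightarrow> fourier_L2 f + fourier_L2 g"
    using tendsto_add[OF a(4) b(4)] a b
    by (simp add: fourier_integral_add add_abs_L2 square_integrable_fourier_integral)
  ultimately show ?thesis
    by (rule LIMSEQ_unique)
qed

lemma tendsto_scaleC_L2: "(f \<longlongrightarrow> l) F \<Longrightarrow> ((\<lambda>x. c *\<^sub>C f x) \<longlongrightarrow> c *\<^sub>C l) F"
  by (rule bounded_bilinear.tendsto[OF bounded_bilinear_scaleC_L2 tendsto_const])

lemma fourier_L2_scaleC: "fourier_L2 (c *\<^sub>C f) = c *\<^sub>C fourier_L2 f"
proof -
  obtain a where a: "\<And>n. square_integrable (a n)" "\<And>n. integrable lborel (a n)" "(\<lambda>n. abs_L2 (a n)) \<longlonglongrightarrow> f"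
    "(\<lambda>n. abs_L2 (fourier_integral (a n))) \<longlonglongrightarrow> fourier_L2 f"
    using L2_approximation[of f] by blast
  have "(\<lambda>n. abs_L2 (fourier_integral (\<lambda>x. c * a n x))) \<longlonglongrightarrow> fourier_L2 (c *\<^sub>C f)"
    using tendsto_scaleC_L2[OF a(3), of c] a
    by (intro fourier_L2_tendsto) (auto simp: scaleC_abs_L2 intro: square_integrable_cmult)
  moreover have "(\<lambda>n. abs_L2 (fourier_integral (\<lambda>x. c * a n x))) \<longlonglongrightarrow> c *\<^sub>C fourier_L2 f"
    using tendsto_scaleC_L2[OF a(4), of c] a
    by (simp add: fourier_integral_cmult scaleC_abs_L2 square_integrable_fourier_integral)
  ultimately show ?thesis
    by (rule LIMSEQ_unique)
qed

lemma norm_fourier_L2: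
  fixes f :: "'a::euclidean_space L2"
  shows "(norm (fourier_L2 f))\<^sup>2 = (2 * pi) ^ DIM('a) * (norm f)\<^sup>2"
proof -
  obtain a where a: "\<And>n. square_integrable (a n)" "\<And>n. integrable lborel (a n)" "(\<lambda>n. abs_L2 (a n)) \<longlonglongrightarrow> f"
    "(\<lambda>n. abs_L2 (fourier_integral (a n))) \<longlonglongrightarrow> fourier_L2 f"
    using L2_approximation[of f] by blast
  have "(\<lambda>n. (norm (abs_L2 (fourier_integral (a n))))\<^sup>2) \<longlonglongrightarrow> (norm (fourier_L2 f))\<^sup>2"
    by (intro tendsto_intros a)
  moreover have "(\<lambda>n. (norm (abs_L2 (fourier_integral (a n))))\<^sup>2) \<longlonglongrightarrow> (2 * pi) ^ DIM('a) * (norm f)\<^sup>2"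
    unfolding norm_fourier_integral[OF a(1,2)] by (intro tendsto_intros a)
  ultimately show ?thesis
    by (rule LIMSEQ_unique)
qed

text \<open>With it, \<open>cinner_L2 f (cnj_L2 g)\<close> is the bilinear pairing, the integral of
  f g, in which the transform is symmetric.\<close>

lift_definition cnj_L2 :: "'a::euclidean_space L2 \<Rightarrow> 'a L2" is "\<lambda>f x. cnj (f x)"
  by (auto simp: L2_rel_def intro: square_integrable_cnj)

lemma cnj_abs_L2: "square_integrable f \<Longrightarrow> cnj_L2 (abs_L2 f) = abs_L2 (\<lambda>x. cnj (f x))"
  by (intro cnj_L2.abs_eq) (auto simp: L2_rel_def)

lemma cnj_cnj_L2 [simp]: "cnj_L2 (cnj_L2 f) = f"
  by transfer (simp add: L2_rel_def)

lemma norm_cnj_L2 [simp]: "norm (cnj_L2 f) = norm f"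
proof -
  obtain r where r: "square_integrable r" "f = abs_L2 r"
    by (rule L2_cases)
  have "(norm (cnj_L2 f))\<^sup>2 = (norm f)\<^sup>2"
    using r by (simp add: cnj_abs_L2 norm_abs_L2 square_integrable_cnj)
  then show ?thesis
    by (simp add: power2_eq_iff_nonneg)
qed

lemma cnj_L2_diff: "cnj_L2 (f - g) = cnj_L2 f - cnj_L2 g"
proof -
  obtain r s where rs: "square_integrable r" "f = abs_L2 r" "square_integrable s" "g = abs_L2 s"
    by (metis L2_cases)
  then show ?thesis
    by (simp add: cnj_abs_L2 diff_abs_L2 square_integrable_cnj square_integrable_diff)
qed

lemma tendsto_cnj_L2:
  assumes "(f \<longlongrightarrow> l) F"
  shows "((\<lambda>x. cnj_L2 (f x)) \<longlongrightarrow> cnj_L2 l) F"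
proof -
  have "((\<lambda>x. norm (f x - l)) \<longlongrightarrow> 0) F"
    using assms by (simp add: LIM_zero_iff tendsto_norm_zero_iff)
  then have "((\<lambda>x. norm (cnj_L2 (f x) - cnj_L2 l)) \<longlongrightarrow> 0) F"
    by (simp flip: cnj_L2_diff)
  then show ?thesis
    by (simp add: LIM_zero_iff tendsto_norm_zero_iff)
qed

lemma tendsto_cinner_L2:
  "(f \<longlongrightarrow> a) F \<Longrightarrow> (g \<longlongrightarrow> b) F \<Longrightarrow> ((\<lambda>x. cinner_L2 (f x) (g x)) \<longlongrightarrow> cinner_L2 a b) F"
  by (rule bounded_bilinear.tendsto[OF bounded_bilinear_cinner_L2])

lemma cinner_fourier_L2_swap: "cinner_L2 (fourier_L2 f) (cnj_L2 g) = cinner_L2 f (cnj_L2 (fourier_L2 g))"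
proof -
  obtain a where a: "\<And>n. square_integrable (a n)" "\<And>n. integrable lborel (a n)" "(\<lambda>n. abs_L2 (a n)) \<longlonglongrightarrow> f"
    "(\<lambda>n. abs_L2 (fourier_integral (a n))) \<longlonglongrightarrow> fourier_L2 f"
    using L2_approximation[of f] by blast
  obtain b where b: "\<And>n. square_integrable (b n)" "\<And>n. integrable lborel (b n)" "(\<lambda>n. abs_L2 (b n)) \<longlonglongrightarrow> g"
    "(\<lambda>n. abs_L2 (fourier_integral (b n))) \<longlonglongrightarrow> fourier_L2 g"
    using L2_approximation[of g] by blast
  have "cinner_L2 (abs_L2 (fourier_integral (a n))) (cnj_L2 (abs_L2 (b n))) =
      cinner_L2 (abs_L2 (a n)) (cnj_L2 (abs_L2 (fourier_integral (b n))))" for n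
    using integral_fourier_integral_swap[OF a(2) b(2)] a b
    by (simp add: cnj_abs_L2 cinner_abs_L2 square_integrable_cnj square_integrable_fourier_integral)
  moreover have "(\<lambda>n. cinner_L2 (abs_L2 (fourier_integral (a n))) (cnj_L2 (abs_L2 (b n)))) \<longlonglongrightarrow> cinner_L2 (fourier_L2 f) (cnj_L2 g)"
    by (intro tendsto_cinner_L2 tendsto_cnj_L2 a b)
  moreover have "(\<lambda>n. cinner_L2 (abs_L2 (a n)) (cnj_L2 (abs_L2 (fourier_integral (b n))))) \<longlonglongrightarrow> cinner_L2 f (cnj_L2 (fourier_L2 g))"
    by (intro tendsto_cinner_L2 tendsto_cnj_L2 a b)
  ultimately show ?thesis
    using LIMSEQ_unique by simp
qed

lemma fourier_L2_diff: "fourier_L2 (f - g) = fourier_L2 f - fourier_L2 g"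
  by (simp add: minus_L2_def uminus_L2_def fourier_L2_add fourier_L2_scaleC)

text \<open>Surjectivity: \<open>(2 \<pi>)\<^sup>-\<^sup>d F\<^sup>* g\<close> is a preimage of \<open>g\<close>, where \<open>F\<^sup>* g\<close> is the conjugate of the
  transform of the conjugate of \<open>g\<close>.\<close>

lemma bij_fourier_L2: "bij (fourier_L2 :: 'a::euclidean_space L2 \<Rightarrow> 'a L2)"
proof (rule bijI)
  define C where "C = (2 * pi) ^ DIM('a)"
  have C: "C > 0"
    by (simp add: C_def)
  show "inj (fourier_L2 :: 'a L2 \<Rightarrow> 'a L2)"
  proof (rule injI)
    fix f g :: "'a L2" assume "fourier_L2 f = fourier_L2 g"
    then have "(norm (fourier_L2 (f - g)))\<^sup>2 = 0"
      by (simp add: fourier_L2_diff)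
    then have "C * (norm (f - g))\<^sup>2 = 0"
      by (simp only: C_def norm_fourier_L2)
    then show "f = g"
      using C by simp
  qed
  show "surj (fourier_L2 :: 'a L2 \<Rightarrow> 'a L2)"
  proof (rule surjI)
    fix g :: "'a L2"
    define k where "k = cnj_L2 (fourier_L2 (cnj_L2 g))"
    define h where "h = complex_of_real (1 / C) *\<^sub>C k"
    have k: "(norm k)\<^sup>2 = C * (norm g)\<^sup>2"
      by (simp add: k_def norm_fourier_L2 C_def)
    have h: "(norm h)\<^sup>2 = (norm g)\<^sup>2 / C"
    proof -
      have "(norm h)\<^sup>2 = (1 / C)\<^sup>2 * (norm k)\<^sup>2"
        using C by (simp add: h_def norm_scaleC_L2 power_mult_distrib norm_divide power_divide)
      then show ?thesis
        unfolding k using C by (simp add: power2_eq_square)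
    qed
    have "cinner_L2 (fourier_L2 h) g = cinner_L2 h k"
      using cinner_fourier_L2_swap[of h "cnj_L2 g"] by (simp add: k_def)
    also have "\<dots> = complex_of_real ((norm g)\<^sup>2)"
      using C by (simp only: h_def cinner_L2_scaleC_left cinner_L2_self k) simp
    \<comment> \<open>The square expands to |g|^2 + |g|^2 - 2 |g|^2. Only norms and one inner
      product enter, so no pointwise inversion formula is required.\<close>
    finally have "(norm (fourier_L2 h - g))\<^sup>2 = 0"
      using h C norm_fourier_L2[of h, folded C_def] by (simp add: norm_diff_squared_L2)
    then have "fourier_L2 h = g"
      by simp
    then show "fourier_L2 (complex_of_real (1 / C) *\<^sub>C cnj_L2 (fourier_L2 (cnj_L2 g))) = g"
      by (simp add: h_def k_def)
  qed
qed

section \<open>The multiplier and the free group\<close>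

lemma schroedinger_multiplier_abs_L2:
  "square_integrable f \<Longrightarrow> schroedinger_multiplier t (abs_L2 f) = abs_L2 (\<lambda>\<xi>. cis (- (t * (norm \<xi>)\<^sup>2)) * f \<xi>)"
  by (intro schroedinger_multiplier.abs_eq) (auto simp: L2_rel_def)

lemma schroedinger_multiplier_add: "schroedinger_multiplier t (f + g) = schroedinger_multiplier t f + schroedinger_multiplier t g"
  by transfer (auto simp: L2_rel_def distrib_left intro!: square_integrable_add square_integrable_cis)

lemma schroedinger_multiplier_scaleC: "schroedinger_multiplier t (c *\<^sub>C f) = c *\<^sub>C schroedinger_multiplier t f"
  by transfer (auto simp: L2_rel_def mult.left_commute intro!: square_integrable_cmult square_integrable_cis)

lemma schroedinger_multiplier_plus: "schroedinger_multiplier (s + t) f = schroedinger_multiplier s (schroedinger_multiplier t f)"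
proof -
  have cis: "cis (- ((s + t) * x)) = cis (- (s * x)) * cis (- (t * x))" for s t x :: real
    by (simp add: cis_mult algebra_simps)
  show ?thesis
    by transfer (auto simp: L2_rel_def cis mult.assoc intro!: square_integrable_cis)
qed

lemma schroedinger_multiplier_0: "schroedinger_multiplier 0 f = f"
  by transfer (auto simp: L2_rel_def)

lemma norm_schroedinger_multiplier: "norm (schroedinger_multiplier t f) = norm f"
proof -
  obtain r where r: "square_integrable r" "f = abs_L2 r"
    by (rule L2_cases)
  have "(norm (schroedinger_multiplier t f))\<^sup>2 = (norm f)\<^sup>2"
    using r by (simp add: schroedinger_multiplier_abs_L2 norm_abs_L2 square_integrable_cis norm_mult)
  then show ?thesis
    by (simp add: power2_eq_iff_nonneg)
qed

text \<open>Pointwise convergence of the phases suffices by dominated convergence: two phases of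
  modulus 1 differ by at most 2, whence the bound 4 |r|^2.\<close>

lemma continuous_schroedinger_multiplier: "continuous_on UNIV (\<lambda>t. schroedinger_multiplier t f)"
proof (unfold continuous_on_sequentially, intro allI ballI impI, elim conjE)
  fix x and t :: real assume x: "x \<longlonglongrightarrow> t"
  obtain r where r: "square_integrable r" "f = abs_L2 r"
    by (rule L2_cases)
  have [measurable]: "r \<in> borel_measurable borel"
    using r(1) by (rule square_integrable_measurable)
  have r2: "integrable lborel (\<lambda>x. (cmod (r x))\<^sup>2)"
    using r by (simp add: square_integrable_def)
  let ?e = "\<lambda>t \<xi>::'a. cis (- (t * (norm \<xi>)\<^sup>2))"
  have [measurable]: "(\<lambda>\<xi>::'a. ?e t \<xi>) \<in> borel_measurable borel" for t
    by (intro borel_measurable_continuous_onI continuous_intros)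
  have "(\<lambda>n. \<integral>\<xi>. (cmod (?e (x n) \<xi> * r \<xi> - ?e t \<xi> * r \<xi>))\<^sup>2 \<partial>lborel) \<longlonglongrightarrow> (\<integral>\<xi>. 0 \<partial>(lborel :: 'a measure))"
  proof (rule integral_dominated_convergence[where w="\<lambda>\<xi>. 4 * (cmod (r \<xi>))\<^sup>2"])
    have "(\<lambda>n. (cmod (?e (x n) \<xi> * r \<xi> - ?e t \<xi> * r \<xi>))\<^sup>2) \<longlonglongrightarrow> (cmod (?e t \<xi> * r \<xi> - ?e t \<xi> * r \<xi>))\<^sup>2" for \<xi>
    proof -
      have "continuous_on UNIV (\<lambda>s. (cmod (?e s \<xi> * r \<xi> - ?e t \<xi> * r \<xi>))\<^sup>2)"
        by (intro continuous_intros)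
      then have "isCont (\<lambda>s. (cmod (?e s \<xi> * r \<xi> - ?e t \<xi> * r \<xi>))\<^sup>2) t"
        by (simp add: continuous_on_eq_continuous_at)
      then show ?thesis
        using x by (rule isCont_tendsto_compose)
    qed
    then show "AE \<xi> in lborel. (\<lambda>n. (cmod (?e (x n) \<xi> * r \<xi> - ?e t \<xi> * r \<xi>))\<^sup>2) \<longlonglongrightarrow> 0"
      by simp
    have "(cmod (?e (x n) \<xi> * r \<xi> - ?e t \<xi> * r \<xi>))\<^sup>2 \<le> 4 * (cmod (r \<xi>))\<^sup>2" for n \<xi>
    proof -
      have "cmod (?e (x n) \<xi> * r \<xi> - ?e t \<xi> * r \<xi>) \<le> 2 * cmod (r \<xi>)"
        using norm_triangle_ineq4[of "?e (x n) \<xi> * r \<xi>" "?e t \<xi> * r \<xi>"] by (simp add: norm_mult)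
      then have "(cmod (?e (x n) \<xi> * r \<xi> - ?e t \<xi> * r \<xi>))\<^sup>2 \<le> (2 * cmod (r \<xi>))\<^sup>2"
        by (intro power_mono) auto
      then show ?thesis
        by (simp add: power_mult_distrib)
    qed
    then show "AE \<xi> in lborel. norm ((cmod (?e (x n) \<xi> * r \<xi> - ?e t \<xi> * r \<xi>))\<^sup>2) \<le> 4 * (cmod (r \<xi>))\<^sup>2" for n
      by simp
  qed (use r2 in auto)
  then have "(\<lambda>n. (norm (schroedinger_multiplier (x n) f - schroedinger_multiplier t f))\<^sup>2) \<longlonglongrightarrow> 0"
    using r by (simp add: schroedinger_multiplier_abs_L2 diff_abs_L2 norm_abs_L2 square_integrable_cis square_integrable_diff)
  from tendsto_real_sqrt[OF this]
  show "((\<lambda>t. schroedinger_multiplier t f) \<circ> x) \<longlonglongrightarrow> schroedinger_multiplier t f"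
    by (simp add: tendsto_norm_zero_iff LIM_zero_iff comp_def)
qed

text \<open>Surjectivity makes \<open>inv\<close> a right inverse. From here on the group is treated
  on the Fourier side, and injectivity carries identities back.\<close>

lemma fourier_schroedinger_group: "fourier_L2 (schroedinger_group t f) = schroedinger_multiplier t (fourier_L2 f)"
  unfolding schroedinger_group_def by (rule surj_f_inv_f[OF bij_is_surj[OF bij_fourier_L2]])

lemma fourier_L2_eq_iff: "fourier_L2 f = fourier_L2 g \<longleftrightarrow> f = g"
  by (rule inj_eq[OF bij_is_inj[OF bij_fourier_L2]])

lemma schroedinger_group_add: "schroedinger_group t (f + g) = schroedinger_group t f + schroedinger_group t g"
  by (rule iffD1[OF fourier_L2_eq_iff]) (simp add: fourier_schroedinger_group fourier_L2_add schroedinger_multiplier_add)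

lemma schroedinger_group_scaleC: "schroedinger_group t (c *\<^sub>C f) = c *\<^sub>C schroedinger_group t f"
  by (rule iffD1[OF fourier_L2_eq_iff]) (simp add: fourier_schroedinger_group fourier_L2_scaleC schroedinger_multiplier_scaleC)

lemma schroedinger_group_plus: "schroedinger_group (s + t) f = schroedinger_group s (schroedinger_group t f)"
  by (rule iffD1[OF fourier_L2_eq_iff]) (simp add: fourier_schroedinger_group schroedinger_multiplier_plus)

lemma schroedinger_group_0: "schroedinger_group 0 f = f"
  by (rule iffD1[OF fourier_L2_eq_iff]) (simp add: fourier_schroedinger_group schroedinger_multiplier_0)

lemma schroedinger_group_diff: "schroedinger_group t (f - g) = schroedinger_group t f - schroedinger_group t g"
  by (simp add: minus_L2_def uminus_L2_def schroedinger_group_add schroedinger_group_scaleC)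

lemma norm_fourier_L2_eq: "norm (fourier_L2 f) = sqrt ((2 * pi) ^ DIM('a)) * norm (f :: 'a::euclidean_space L2)"
proof -
  have "norm (fourier_L2 f) = sqrt ((2 * pi) ^ DIM('a) * (norm f)\<^sup>2)"
    by (intro real_sqrt_unique[symmetric] norm_fourier_L2) simp
  then show ?thesis
    by (simp add: real_sqrt_mult)
qed

lemma norm_schroedinger_group: "norm (schroedinger_group t f) = norm f"
proof -
  have "norm (fourier_L2 (schroedinger_group t f)) = norm (fourier_L2 f)"
    by (simp add: fourier_schroedinger_group norm_schroedinger_multiplier)
  then show ?thesis
    by (simp add: norm_fourier_L2_eq)
qed

lemma inner_schroedinger_group: "inner (schroedinger_group t f) (schroedinger_group t g) = inner f g"
  by (simp add: dot_norm norm_schroedinger_group flip: schroedinger_group_add)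

text \<open>The real inner product is preserved by polarization. Since the group commutes with
  multiplication by \<open>\<i>\<close>, applying this to \<open>f\<close> and to
  \<open>\<i> *\<^sub>C f\<close> gives both the real and the imaginary part.\<close>

lemma cinner_schroedinger_group: "cinner_L2 (schroedinger_group t f) (schroedinger_group t g) = cinner_L2 f g"
proof -
  have "Re (cinner_L2 (schroedinger_group t f) (schroedinger_group t g)) = Re (cinner_L2 f g)" for f
    using inner_schroedinger_group[of t f g] by (simp add: inner_L2_def)
  from this[of f] this[of "\<i> *\<^sub>C f"] show ?thesis
    by (simp add: complex_eq_iff schroedinger_group_scaleC cinner_L2_scaleC_left)
qed

lemma bounded_linear_schroedinger_group: "bounded_linear (schroedinger_group t)"
  by (rule bounded_linear_intro[of _ 1])
    (auto simp: schroedinger_group_add schroedinger_group_scaleC scaleR_L2_def norm_schroedinger_group)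

lemma continuous_schroedinger_group: "continuous_on UNIV (\<lambda>t. schroedinger_group t f)"
  unfolding continuous_on_def
proof (intro ballI, simp)
  fix s
  let ?C = "sqrt ((2 * pi) ^ DIM('a))"
  have "((\<lambda>t. norm (schroedinger_multiplier t (fourier_L2 f) - schroedinger_multiplier s (fourier_L2 f)) / ?C) \<longlongrightarrow> 0 / ?C) (at s)"
    using continuous_schroedinger_multiplier[of "fourier_L2 f"]
    by (intro tendsto_divide tendsto_const) (auto simp: continuous_on_def tendsto_norm_zero_iff LIM_zero_iff)
  moreover have "norm (schroedinger_multiplier t (fourier_L2 f) - schroedinger_multiplier s (fourier_L2 f)) / ?C =
      norm (schroedinger_group t f - schroedinger_group s f)" for t
    by (simp add: norm_fourier_L2_eq flip: fourier_schroedinger_group fourier_L2_diff)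
  ultimately show "(\<lambda>t. schroedinger_group t f) \<midarrow>s\<rightarrow> schroedinger_group s f"
    by (simp add: tendsto_norm_zero_iff LIM_zero_iff)
qed

text \<open>Joint continuity: the isometry property controls a change of the vector uniformly in
  time, and strong continuity controls a change of time at a fixed vector.\<close>

lemma continuous_on_schroedinger_group:
  assumes "continuous_on S g" "continuous_on S h"
  shows "continuous_on S (\<lambda>s. schroedinger_group (h s) (g s))"
  unfolding continuous_on_def
proof
  fix x assume x: "x \<in> S"
  have g: "(g \<longlongrightarrow> g x) (at x within S)" and h: "(h \<longlongrightarrow> h x) (at x within S)"
    using assms x by (auto simp: continuous_on_def)
  have "((\<lambda>s. norm (g s - g x)) \<longlongrightarrow> 0) (at x within S)"
    using g by (simp add: tendsto_norm_zero_iff LIM_zero_iff)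
  then have 1: "((\<lambda>s. schroedinger_group (h s) (g s) - schroedinger_group (h s) (g x)) \<longlongrightarrow> 0) (at x within S)"
    by (subst tendsto_norm_zero_iff[symmetric]) (simp add: norm_schroedinger_group flip: schroedinger_group_diff)
  have "isCont (\<lambda>t. schroedinger_group t (g x)) (h x)"
    using continuous_schroedinger_group[of "g x"] by (simp add: continuous_on_eq_continuous_at)
  then have 2: "((\<lambda>s. schroedinger_group (h s) (g x)) \<longlongrightarrow> schroedinger_group (h x) (g x)) (at x within S)"
    using h by (rule isCont_tendsto_compose)
  from tendsto_add[OF 1 2] show "((\<lambda>s. schroedinger_group (h s) (g s)) \<longlongrightarrow> schroedinger_group (h x) (g x)) (at x within S)"
    by simp
qed

section \<open>The overlap of a pair of solutions\<close>

lemma at_within_atLeast: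
  fixes x :: real
  assumes "a \<le> x" "x < b"
  shows "at x within {a..b} = at x within {a..}"
  using assms by (intro at_within_nhd[of x "{..<b}"]) auto

lemma has_vector_derivative_integral_atLeast:
  fixes f :: "real \<Rightarrow> 'a::banach"
  assumes f: "continuous_on {0..} f" and t: "t \<ge> 0"
  shows "((\<lambda>t. integral {0..t} f) has_vector_derivative f t) (at t within {0..})"
proof -
  have "((\<lambda>t. integral {0..t} f) has_vector_derivative f t) (at t within {0..t + 1})"
    using t by (intro integral_has_vector_derivative continuous_on_subset[OF f]) auto
  then show ?thesis
    using at_within_atLeast[of 0 t "t + 1"] t by simp
qed

text \<open>The exponential of the integrated rate is an integrating factor. The formula serves
  twice: for the deviation of a norm from 1, which starts at 0, and for the overlap defect, whose
  sign it preserves.\<close>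

lemma linear_ode_solution:
  fixes n a :: "real \<Rightarrow> real"
  assumes a: "continuous_on {0..} a"
    and n: "\<And>t. t \<ge> 0 \<Longrightarrow> (n has_real_derivative a t * n t) (at t within {0..})" and t: "t \<ge> 0"
  shows "n t = n 0 * exp (integral {0..t} a)"
proof -
  define I where "I t = integral {0..t} a" for t
  have I: "(I has_real_derivative a t) (at t within {0..})" if "t \<ge> 0" for t
    using has_vector_derivative_integral_atLeast[OF a that]
    by (simp add: I_def[abs_def] has_real_derivative_iff_has_vector_derivative)
  have "\<exists>c. \<forall>t\<in>{0..}. n t * exp (- I t) = c"
  proof (rule has_field_derivative_zero_constant)
    fix t :: real assume "t \<in> {0..}"
    then show "((\<lambda>t. n t * exp (- I t)) has_real_derivative 0) (at t within {0..})"
      by (auto intro!: derivative_eq_intros n I simp: algebra_simps)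
  qed auto
  then have "n t * exp (- I t) = n 0 * exp (- I 0)"
    using t by fastforce
  then show ?thesis
    by (simp add: I_def exp_minus field_simps)
qed

lemma cinner_gauged_coupling_left:
  "cinner_L2 (gauged_coupling K \<epsilon> b u v) w =
    (K / 2) *\<^sub>R (cis (- (\<epsilon> * b)) * cinner_L2 v w - cis (\<epsilon> * b) * cinner_L2 u v * cinner_L2 u w)"
  by (simp add: gauged_coupling_def cinner_L2_scaleR_left cinner_L2_diff_left cinner_L2_scaleC_left)

text \<open>A mild solution need not be differentiable in L2, because the group is only strongly
  continuous. Applying the group at time \<open>- t\<close> to the Duhamel formula removes the outer
  time from the integrand; what is left is the integral of a continuous function, to which the
  fundamental theorem of calculus applies.\<close>

lemma mild_equation_interaction_picture:
  fixes u v :: "real \<Rightarrow> 'a::euclidean_space L2"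
  assumes cont: "continuous_on {0..} b" "continuous_on {0..} u" "continuous_on {0..} v"
    and mild: "mild_equation K \<epsilon> b u v" and t: "t \<ge> 0"
  shows "((\<lambda>t. schroedinger_group (- t) (u t)) has_vector_derivative
    schroedinger_group (- t) (gauged_coupling K \<epsilon> (b t) (u t) (v t))) (at t within {0..})"
proof -
  define G where "G s = gauged_coupling K \<epsilon> (b s) (u s) (v s)" for s
  have "continuous_on {0..} G"
    unfolding G_def gauged_coupling_def
    by (intro bounded_bilinear.continuous_on[OF bounded_bilinear_scaleC_L2]
        bounded_bilinear.continuous_on[OF bounded_bilinear_cinner_L2] continuous_intros cont)
  then have w: "continuous_on {0..} (\<lambda>s. schroedinger_group (- s) (G s))"
    by (intro continuous_on_schroedinger_group continuous_intros)
  have eq: "schroedinger_group (- t) (u t) = u 0 + integral {0..t} (\<lambda>s. schroedinger_group (- s) (G s))"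
    if "t \<ge> 0" for t
  proof -
    have "((\<lambda>s. schroedinger_group (t - s) (G s)) has_integral (u t - schroedinger_group t (u 0))) {0..t}"
      using mild that by (simp add: mild_equation_def G_def)
    then have "((schroedinger_group (- t) \<circ> (\<lambda>s. schroedinger_group (t - s) (G s))) has_integral
        schroedinger_group (- t) (u t - schroedinger_group t (u 0))) {0..t}"
      using bounded_linear_schroedinger_group by (rule has_integral_linear)
    moreover have "schroedinger_group (- t) \<circ> (\<lambda>s. schroedinger_group (t - s) (G s)) = (\<lambda>s. schroedinger_group (- s) (G s))"
      by (simp add: fun_eq_iff flip: schroedinger_group_plus)
    moreover have "schroedinger_group (- t) (u t - schroedinger_group t (u 0)) = schroedinger_group (- t) (u t) - u 0"
      by (simp add: schroedinger_group_diff schroedinger_group_0 flip: schroedinger_group_plus)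
    ultimately show ?thesis
      by (simp add: integral_unique)
  qed
  have "((\<lambda>t. u 0 + integral {0..t} (\<lambda>s. schroedinger_group (- s) (G s))) has_vector_derivative
      schroedinger_group (- t) (G t)) (at t within {0..})"
    using has_vector_derivative_integral_atLeast[OF w t] has_vector_derivative_add[OF has_vector_derivative_const]
    by fastforce
  then show ?thesis
    unfolding G_def[symmetric]
    by (rule has_vector_derivative_transform[rotated 2]) (use t eq in auto)
qed

text \<open>The product rule is applied in the interaction picture, at the same time for both
  factors, and unitarity then removes the group from every inner product. This is why no Laplacian
  is left.\<close>

lemma mild_equation_cinner:
  fixes u v u' v' :: "real \<Rightarrow> 'a::euclidean_space L2"
  assumes "continuous_on {0..} b" "continuous_on {0..} u" "continuous_on {0..} v" "mild_equation K \<epsilon> b u v"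
    and "continuous_on {0..} b'" "continuous_on {0..} u'" "continuous_on {0..} v'" "mild_equation K' \<epsilon>' b' u' v'"
    and t: "t \<ge> 0"
  shows "((\<lambda>t. cinner_L2 (u t) (u' t)) has_vector_derivative
    cinner_L2 (u t) (gauged_coupling K' \<epsilon>' (b' t) (u' t) (v' t)) +
    cinner_L2 (gauged_coupling K \<epsilon> (b t) (u t) (v t)) (u' t)) (at t within {0..})"
  using bounded_bilinear.has_vector_derivative[OF bounded_bilinear_cinner_L2
      mild_equation_interaction_picture[OF assms(1-4) t] mild_equation_interaction_picture[OF assms(5-8) t]]
  by (simp add: cinner_schroedinger_group)

text \<open>The coupling term is built so that the squared norm minus 1 solves a homogeneous linear
  equation; starting at 0, it stays there.\<close>

lemma mild_solution_norm:
  fixes u v :: "real \<Rightarrow> 'a::euclidean_space L2"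
  assumes cont: "continuous_on {0..} b" "continuous_on {0..} u" "continuous_on {0..} v"
    and mild: "mild_equation K \<epsilon> b u v" and "norm (u 0) = 1" and t: "t \<ge> 0"
  shows "norm (u t) = 1"
proof -
  define a where "a t = - K * Re (cis (\<epsilon> * b t) * cinner_L2 (u t) (v t))" for t
  have a: "continuous_on {0..} a"
    unfolding a_def by (intro continuous_intros cont bounded_bilinear.continuous_on[OF bounded_bilinear_cinner_L2])
  have "((\<lambda>t. (norm (u t))\<^sup>2 - 1) has_real_derivative a t * ((norm (u t))\<^sup>2 - 1)) (at t within {0..})" if t: "t \<ge> 0" for t
  proof -
    let ?G = "gauged_coupling K \<epsilon> (b t) (u t) (v t)"
    have "((\<lambda>t. Re (cinner_L2 (u t) (u t))) has_vector_derivative Re (cinner_L2 (u t) ?G + cinner_L2 ?G (u t))) (at t within {0..})"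
      by (rule bounded_linear.has_vector_derivative[OF bounded_linear_Re
            mild_equation_cinner[OF cont mild cont mild t]])
    then have "((\<lambda>t. (norm (u t))\<^sup>2) has_real_derivative Re (cinner_L2 (u t) ?G + cinner_L2 ?G (u t))) (at t within {0..})"
      by (simp add: cinner_L2_self has_real_derivative_iff_has_vector_derivative)
    moreover have "Re (cinner_L2 (u t) ?G + cinner_L2 ?G (u t)) = a t * ((norm (u t))\<^sup>2 - 1)"
    proof -
      have "Re (cinner_L2 (u t) ?G) = Re (cinner_L2 ?G (u t))"
        by (metis cinner_L2_commute complex_cnj(1) complex_cnj_cnj cnj.sel(1))
      moreover have "Re (cis (- (\<epsilon> * b t)) * cinner_L2 (v t) (u t)) = Re (cis (\<epsilon> * b t) * cinner_L2 (u t) (v t))"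
      proof -
        have "cis (- (\<epsilon> * b t)) * cinner_L2 (v t) (u t) = cnj (cis (\<epsilon> * b t) * cinner_L2 (u t) (v t))"
          by (simp add: cinner_L2_commute cis_cnj)
        then show ?thesis
          by (simp only: cnj.sel)
      qed
      moreover have "Re (cis (\<epsilon> * b t) * cinner_L2 (u t) (v t) * cinner_L2 (u t) (u t)) =
          Re (cis (\<epsilon> * b t) * cinner_L2 (u t) (v t)) * (norm (u t))\<^sup>2"
        by (simp add: cinner_L2_self del: of_real_power)
      ultimately show ?thesis
        by (simp add: cinner_gauged_coupling_left a_def algebra_simps del: cis.sel times_complex.sel)
    qed
    ultimately show ?thesis
      using DERIV_diff[OF _ DERIV_const] by fastforce
  qed
  from linear_ode_solution[OF a this t] have "(norm (u t))\<^sup>2 = 1"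
    by (simp add: assms(5))
  then show ?thesis
    by (simp add: power2_eq_1_iff) (metis norm_ge_zero not_one_le_zero neg_0_le_iff_le le_minus_one_simps(3))
qed

text \<open>With unit norms the inner products of a component with itself become 1, so the equation
  closes in the overlap. Both components contribute the same half of the right side, which is a
  Riccati equation with the noise phases as coefficients.\<close>

lemma mild_solution_overlap:
  fixes u v :: "real \<Rightarrow> 'a::euclidean_space L2"
  assumes cont: "continuous_on {0..} b" "continuous_on {0..} u" "continuous_on {0..} v"
    and u: "mild_equation K \<epsilon> b u v" and v: "mild_equation K \<epsilon> (\<lambda>t. - b t) v u"
    and init: "norm (u 0) = 1" "norm (v 0) = 1" and t: "t \<ge> 0"
  shows "((\<lambda>t. cinner_L2 (u t) (v t)) has_vector_derivative
    K *\<^sub>R (cis (- (\<epsilon> * b t)) - cis (\<epsilon> * b t) * (cinner_L2 (u t) (v t))\<^sup>2)) (at t within {0..})"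
proof -
  have cont': "continuous_on {0..} (\<lambda>t. - b t)"
    by (intro continuous_intros cont)
  have nu: "norm (u t) = 1" and nv: "norm (v t) = 1"
    using mild_solution_norm[OF cont u init(1) t] mild_solution_norm[OF cont' cont(3,2) v init(2) t] by auto
  have "cinner_L2 (u t) (gauged_coupling K \<epsilon> (- b t) (v t) (u t)) =
      cnj ((K / 2) *\<^sub>R (cis (\<epsilon> * b t) - cis (- (\<epsilon> * b t)) * (cinner_L2 (v t) (u t))\<^sup>2))"
    by (subst cinner_L2_commute[symmetric])
      (simp add: cinner_gauged_coupling_left cinner_L2_self nu power2_eq_square mult.assoc)
  also have "\<dots> = (K / 2) *\<^sub>R (cis (- (\<epsilon> * b t)) - cis (\<epsilon> * b t) * (cinner_L2 (u t) (v t))\<^sup>2)"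
    by (simp add: cinner_L2_commute cis_cnj)
  finally have "cinner_L2 (u t) (gauged_coupling K \<epsilon> (- b t) (v t) (u t)) +
      cinner_L2 (gauged_coupling K \<epsilon> (b t) (u t) (v t)) (v t) =
      K *\<^sub>R (cis (- (\<epsilon> * b t)) - cis (\<epsilon> * b t) * (cinner_L2 (u t) (v t))\<^sup>2)"
    by (simp add: cinner_gauged_coupling_left cinner_L2_self nv power2_eq_square mult.assoc flip: scaleR_left.add)
  with mild_equation_cinner[OF cont u cont' cont(3,2) v t] show ?thesis
    by simp
qed

section \<open>Increments of a pair of independent Brownian motions\<close>

context complete_filtered_space
begin

section \<open>A single increment of one Brownian motion\<close>

lemma measurable_F_mono:
  assumes "f \<in> measurable (F s) N" "s \<le> t"
  shows "f \<in> measurable (F t) N"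
  using assms sets_F_mono[of s t] space_F by (auto simp: measurable_def)

lemma measurable_F_M:
  assumes "f \<in> measurable (F s) N" "0 \<le> s"
  shows "f \<in> measurable M N"
  using measurable_from_subalg[OF subalgebra_F] assms by blast

lemma brownian_motion_measurable:
  assumes "brownian_motion \<beta>" "0 \<le> s"
  shows "s \<le> t \<Longrightarrow> \<beta> s \<in> borel_measurable (F t)" "\<beta> s \<in> borel_measurable M"
proof -
  have "\<beta> s \<in> borel_measurable (F s)"
    using assms unfolding brownian_motion_def by blast
  then show "s \<le> t \<Longrightarrow> \<beta> s \<in> borel_measurable (F t)" "\<beta> s \<in> borel_measurable M"
    using measurable_F_mono measurable_F_M assms by blast+
qed

lemma brownian_increment_char:
  assumes \<beta>: "brownian_motion \<beta>" and st: "0 \<le> s" "s < t"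
  shows "(\<integral>\<omega>. cis (\<theta> * (\<beta> t \<omega> - \<beta> s \<omega>)) \<partial>M) = complex_of_real (exp (- \<theta>\<^sup>2 * (t - s) / 2))"
proof -
  define \<sigma> where "\<sigma> = sqrt (t - s)"
  have \<sigma>: "\<sigma> > 0" "\<sigma>\<^sup>2 = t - s"
    using st by (simp_all add: \<sigma>_def)
  define X where "X \<omega> = (\<beta> t \<omega> - \<beta> s \<omega> - 0) / \<sigma>" for \<omega>
  have "distributed M lborel (\<lambda>\<omega>. \<beta> t \<omega> - \<beta> s \<omega>) (normal_density 0 \<sigma>)"
    using \<beta> st unfolding brownian_motion_def \<sigma>_def by blast
  then have X: "distributed M lborel X std_normal_density"
    unfolding X_def by (rule normal_standard_normal_convert[OF \<sigma>(1), THEN iffD1])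
  have [measurable]: "X \<in> borel_measurable M"
    using distributed_measurable[OF X] by simp
  have "complex_of_real (exp (- (\<theta> * \<sigma>)\<^sup>2 / 2)) = char std_normal_distribution (\<theta> * \<sigma>)"
    by (simp only: char_std_normal_distribution)
  also have "\<dots> = char (distr M lborel X) (\<theta> * \<sigma>)"
    by (simp only: distributed_distr_eq_density[OF X])
  also have "\<dots> = (\<integral>\<omega>. iexp (\<theta> * \<sigma> * X \<omega>) \<partial>M)"
    unfolding char_def by (rule integral_distr) simp_all
  also have "\<dots> = (\<integral>\<omega>. cis (\<theta> * (\<beta> t \<omega> - \<beta> s \<omega>)) \<partial>M)"
    using \<sigma>(1) by (simp add: X_def cis_conv_exp mult.assoc)
  finally show ?thesis
    by (simp add: power_mult_distrib \<sigma>(2))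
qed

text \<open>\<open>Z\<close> and the phase of the increment generate smaller sigma-algebras than the
  two that are independent by the definition of Brownian motion, so the expectation factorizes. The
  case \<open>s = t\<close> is separate because the normal density of an increment is given for
  \<open>s < t\<close> only.\<close>

lemma brownian_increment_expectation:
  fixes Z :: "'w \<Rightarrow> complex"
  assumes \<beta>: "brownian_motion \<beta>" and st: "0 \<le> s" "s \<le> t"
    and Z: "Z \<in> borel_measurable (F s)" "\<And>\<omega>. cmod (Z \<omega>) \<le> B"
  shows "(\<integral>\<omega>. Z \<omega> * cis (\<theta> * (\<beta> t \<omega> - \<beta> s \<omega>)) \<partial>M) = complex_of_real (exp (- \<theta>\<^sup>2 * (t - s) / 2)) * (\<integral>\<omega>. Z \<omega> \<partial>M)"
proof (cases "s = t")
  case False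
  then have "s < t"
    using st by simp
  define D where "D \<omega> = \<beta> t \<omega> - \<beta> s \<omega>" for \<omega>
  have ZM [measurable]: "Z \<in> borel_measurable M"
    using measurable_F_M Z st by blast
  have [measurable]: "\<beta> t \<in> borel_measurable M" "\<beta> s \<in> borel_measurable M"
    using st by (auto intro!: brownian_motion_measurable(2)[OF \<beta>])
  have D [measurable]: "D \<in> borel_measurable M"
    unfolding D_def by measurable
  have cis: "(\<lambda>x. cis (\<theta> * x)) \<in> borel_measurable borel"
    by measurable
  define C where "C \<omega> = cis (\<theta> * D \<omega>)" for \<omega>
  have [measurable]: "C \<in> borel_measurable M"
    unfolding C_def by measurable
  have "indep_set (sets (F s)) (sigma_sets (space M) {D -` A \<inter> space M | A. A \<in> sets borel})"
    using \<beta> st \<open>s < t\<close> unfolding brownian_motion_def D_def by blast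
  moreover have "sigma_sets (space M) {Z -` A \<inter> space M | A. A \<in> sets borel} \<subseteq> sets (F s)"
    using Z(1) sets.sigma_sets_subset[of "{Z -` A \<inter> space M | A. A \<in> sets borel}" "F s"]
    by (auto simp: space_F measurable_def)
  moreover have "sigma_sets (space M) {C -` A \<inter> space M | A. A \<in> sets borel} \<subseteq>
      sigma_sets (space M) {D -` A \<inter> space M | A. A \<in> sets borel}"
  proof (rule sigma_sets_mono', safe)
    fix A :: "complex set" assume "A \<in> sets borel"
    then have "(\<lambda>x. cis (\<theta> * x)) -` A \<inter> space borel \<in> sets borel"
      by (intro measurable_sets[OF cis]) auto
    then show "\<exists>B. C -` A \<inter> space M = D -` B \<inter> space M \<and> B \<in> sets borel"
      by (intro exI[of _ "(\<lambda>x. cis (\<theta> * x)) -` A"]) (auto simp: C_def)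
  qed
  ultimately have "indep_set (sigma_sets (space M) {Z -` A \<inter> space M | A. A \<in> sets borel})
      (sigma_sets (space M) {C -` A \<inter> space M | A. A \<in> sets borel})"
    unfolding indep_set_def by (elim indep_sets_mono_sets) (auto split: bool.split)
  then have "indep_var borel Z borel C"
    by (simp add: indep_var_eq)
  moreover have "integrable M Z"
    using Z(2) by (intro integrable_const_bound[of _ B]) auto
  moreover have "integrable M C"
    by (intro integrable_const_bound[of _ 1]) (auto simp: C_def)
  ultimately have "(\<integral>\<omega>. Z \<omega> * C \<omega> \<partial>M) = (\<integral>\<omega>. Z \<omega> \<partial>M) * (\<integral>\<omega>. C \<omega> \<partial>M)"
    by (intro indep_var_lebesgue_integral)
  also have "(\<integral>\<omega>. C \<omega> \<partial>M) = complex_of_real (exp (- \<theta>\<^sup>2 * (t - s) / 2))"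
    unfolding C_def D_def by (rule brownian_increment_char[OF \<beta> st(1) \<open>s < t\<close>])
  finally show ?thesis
    by (simp add: C_def D_def mult.commute)
qed simp

end

text \<open>The increment over \<open>[a, b]\<close> of the martingale \<open>exp (i \<theta> (x t - x s) + \<theta>\<^sup>2 (t - s) / 2)\<close>, up to
  a deterministic factor.\<close>

definition exp_increment :: "real \<Rightarrow> real \<Rightarrow> real \<Rightarrow> real \<Rightarrow> (real \<Rightarrow> real) \<Rightarrow> complex" where
  "exp_increment \<theta> s a b x =
     cis (\<theta> * (x a - x s)) * (cis (\<theta> * (x b - x a)) - complex_of_real (exp (- \<theta>\<^sup>2 * (b - a) / 2)))"

lemma cmod_exp_increment_le:
  assumes "a \<le> b"
  shows "cmod (exp_increment \<theta> s a b x) \<le> 2"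
proof -
  define g where "g = exp (- \<theta>\<^sup>2 * (b - a) / 2)"
  have g: "0 \<le> g" "g \<le> 1"
    using assms by (simp_all add: g_def)
  have "cmod (cis (\<theta> * (x b - x a)) - complex_of_real g) \<le> cmod (cis (\<theta> * (x b - x a))) + cmod (complex_of_real g)"
    by (rule norm_triangle_ineq4)
  also have "\<dots> \<le> 2"
    using g by simp
  finally show ?thesis
    by (simp add: exp_increment_def norm_mult g_def)
qed

lemma exp_increment_telescope:
  "cis (\<theta> * (x b - x s)) = exp_increment \<theta> s a b x + complex_of_real (exp (- \<theta>\<^sup>2 * (b - a) / 2)) * cis (\<theta> * (x a - x s))"
proof -
  have "cis (\<theta> * (x b - x s)) = cis (\<theta> * (x a - x s)) * cis (\<theta> * (x b - x a))"
    by (simp add: cis_mult algebra_simps)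
  then show ?thesis
    by (simp add: exp_increment_def algebra_simps)
qed

lemma borel_measurable_exp_increment:
  assumes "\<beta> s \<in> borel_measurable N" "\<beta> a \<in> borel_measurable N" "\<beta> b \<in> borel_measurable N"
  shows "(\<lambda>\<omega>. exp_increment \<theta> s a b (\<lambda>t. \<beta> t \<omega>)) \<in> borel_measurable N"
proof -
  note [measurable] = assms
  show ?thesis
    unfolding exp_increment_def by measurable
qed

context complete_filtered_space
begin

text \<open>The martingale property: the constant subtracted in \<open>exp_increment\<close> is the
  mean of the phase of the increment, and the phase accumulated up to \<open>a\<close> belongs to
  the past and is absorbed into \<open>Z\<close>.\<close>

lemma expectation_exp_increment:
  fixes Z :: "'w \<Rightarrow> complex"
  assumes \<beta>: "brownian_motion \<beta>" and st: "0 \<le> s" "s \<le> a" "a \<le> b"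
    and Z: "Z \<in> borel_measurable (F a)" "\<And>\<omega>. cmod (Z \<omega>) \<le> B"
  shows "(\<integral>\<omega>. Z \<omega> * exp_increment \<theta> s a b (\<lambda>t. \<beta> t \<omega>) \<partial>M) = 0"
proof -
  have [measurable]: "\<beta> s \<in> borel_measurable (F a)" "\<beta> a \<in> borel_measurable (F a)"
    "\<beta> a \<in> borel_measurable M" "\<beta> b \<in> borel_measurable M"
    using st by (auto intro!: brownian_motion_measurable[OF \<beta>])
  note [measurable] = Z(1)
  define Y where "Y \<omega> = Z \<omega> * cis (\<theta> * (\<beta> a \<omega> - \<beta> s \<omega>))" for \<omega>
  have YF: "Y \<in> borel_measurable (F a)"
    unfolding Y_def by measurable
  then have YM [measurable]: "Y \<in> borel_measurable M"
    by (rule measurable_F_M) (use st in simp)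
  have YB: "cmod (Y \<omega>) \<le> B" for \<omega>
    using Z(2) by (simp add: Y_def norm_mult)
  have int: "integrable M Y" "integrable M (\<lambda>\<omega>. Y \<omega> * cis (\<theta> * (\<beta> b \<omega> - \<beta> a \<omega>)))"
    using YB by (auto intro!: integrable_const_bound[of _ B] simp: norm_mult)
  have "(\<integral>\<omega>. Z \<omega> * exp_increment \<theta> s a b (\<lambda>t. \<beta> t \<omega>) \<partial>M) =
      (\<integral>\<omega>. Y \<omega> * cis (\<theta> * (\<beta> b \<omega> - \<beta> a \<omega>)) - Y \<omega> * complex_of_real (exp (- \<theta>\<^sup>2 * (b - a) / 2)) \<partial>M)"
    by (simp add: Y_def exp_increment_def algebra_simps)
  also have "\<dots> = 0"
    using int brownian_increment_expectation[OF \<beta> _ st(3) YF YB] st by simp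
  finally show ?thesis .
qed

text \<open>A variable of modulus 1 with mean g has variance 1 - g^2. This is of order b - a, so a
  product of two independent increments has mean square of order (b - a)^2.\<close>

lemma expectation_norm_exp_increment:
  assumes \<beta>: "brownian_motion \<beta>" and st: "0 \<le> s" "s \<le> a" "a \<le> b"
  shows "(\<integral>\<omega>. (cmod (exp_increment \<theta> s a b (\<lambda>t. \<beta> t \<omega>)))\<^sup>2 \<partial>M) = 1 - exp (- \<theta>\<^sup>2 * (b - a))"
proof -
  define g where "g = exp (- \<theta>\<^sup>2 * (b - a) / 2)"
  have [measurable]: "\<beta> a \<in> borel_measurable M" "\<beta> b \<in> borel_measurable M"
    using st by (auto intro!: brownian_motion_measurable[OF \<beta>])
  have int: "integrable M (\<lambda>\<omega>. cis (\<theta> * (\<beta> b \<omega> - \<beta> a \<omega>)))"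
    by (rule integrable_const_bound[of _ 1]) auto
  have "(cmod (exp_increment \<theta> s a b (\<lambda>t. \<beta> t \<omega>)))\<^sup>2 = (1 + g\<^sup>2) - 2 * g * Re (cis (\<theta> * (\<beta> b \<omega> - \<beta> a \<omega>)))" for \<omega>
  proof -
    have "(cmod (cis x - complex_of_real g))\<^sup>2 = (1 + g\<^sup>2) - 2 * g * Re (cis x)" for x
      using sin_cos_squared_add[of x] by (simp add: cmod_power2 power2_diff algebra_simps)
    then show ?thesis
      by (simp add: exp_increment_def norm_mult g_def)
  qed
  then have "(\<integral>\<omega>. (cmod (exp_increment \<theta> s a b (\<lambda>t. \<beta> t \<omega>)))\<^sup>2 \<partial>M) =
      (\<integral>\<omega>. (1 + g\<^sup>2) - 2 * g * Re (cis (\<theta> * (\<beta> b \<omega> - \<beta> a \<omega>))) \<partial>M)"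
    by simp
  also have "\<dots> = (1 + g\<^sup>2) - 2 * g * Re (\<integral>\<omega>. cis (\<theta> * (\<beta> b \<omega> - \<beta> a \<omega>)) \<partial>M)"
    using integrable_Re[OF int] by (simp add: prob_space integral_Re[OF int, symmetric] del: cis.sel)
  also have "(\<integral>\<omega>. cis (\<theta> * (\<beta> b \<omega> - \<beta> a \<omega>)) \<partial>M) = complex_of_real g"
    using brownian_increment_expectation[OF \<beta> _ st(3), of "\<lambda>_. 1" 1 \<theta>] st by (simp add: g_def prob_space)
  also have "(1 + g\<^sup>2) - 2 * g * Re (complex_of_real g) = 1 - g\<^sup>2"
    by (simp add: power2_eq_square)
  also have "g\<^sup>2 = exp (- \<theta>\<^sup>2 * (b - a))"
    by (simp add: g_def power2_eq_square flip: exp_add)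
  finally show ?thesis .
qed

end

context brownian_pair
begin

lemma independent_functionals:
  fixes f g :: "(real \<Rightarrow> real) \<Rightarrow> complex"
  assumes [measurable]: "f \<in> borel_measurable (\<Pi>\<^sub>M t\<in>{0..}. borel)" "g \<in> borel_measurable (\<Pi>\<^sub>M t\<in>{0..}. borel)"
    and bound: "\<And>x. cmod (f x) \<le> B" "\<And>x. cmod (g x) \<le> B"
    and local: "\<And>x. f (restrict x {0..}) = f x" "\<And>x. g (restrict x {0..}) = g x"
  shows "(\<integral>\<omega>. f (\<lambda>t. \<beta>\<^sub>1 t \<omega>) * g (\<lambda>t. \<beta>\<^sub>2 t \<omega>) \<partial>M) =
    (\<integral>\<omega>. f (\<lambda>t. \<beta>\<^sub>1 t \<omega>) \<partial>M) * (\<integral>\<omega>. g (\<lambda>t. \<beta>\<^sub>2 t \<omega>) \<partial>M)"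
proof -
  let ?X = "\<lambda>\<omega>. \<lambda>t\<in>{0..}. \<beta>\<^sub>1 t \<omega>" and ?Y = "\<lambda>\<omega>. \<lambda>t\<in>{0..}. \<beta>\<^sub>2 t \<omega>"
  have XY: "indep_var (\<Pi>\<^sub>M t\<in>{0..}. borel) ?X (\<Pi>\<^sub>M t\<in>{0..}. borel) ?Y"
    using independent by (simp add: indep_processes_def)
  have [measurable]: "?X \<in> measurable M (\<Pi>\<^sub>M t\<in>{0..}. borel)" "?Y \<in> measurable M (\<Pi>\<^sub>M t\<in>{0..}. borel)"
    using indep_var_rv1[OF XY] indep_var_rv2[OF XY] by auto
  have "indep_var borel (f \<circ> ?X) borel (g \<circ> ?Y)"
    by (rule indep_var_compose[OF XY]) simp_all
  moreover have "integrable M (f \<circ> ?X)" "integrable M (g \<circ> ?Y)"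
    using bound by (auto intro!: integrable_const_bound[of _ B] simp: comp_def)
  ultimately have "(\<integral>\<omega>. (f \<circ> ?X) \<omega> * (g \<circ> ?Y) \<omega> \<partial>M) = (\<integral>\<omega>. (f \<circ> ?X) \<omega> \<partial>M) * (\<integral>\<omega>. (g \<circ> ?Y) \<omega> \<partial>M)"
    by (rule indep_var_lebesgue_integral)
  then show ?thesis
    by (simp add: local)
qed

text \<open>Levy's characterization of planar Brownian motion, in the form of a martingale property: the
  filtration is not assumed to make the increments of the pair jointly independent of the past.
  Along a partition of \<open>[s, T]\<close> the error is a sum of products of increments of the two exponential
  martingales, which is small in mean square because the processes are independent.\<close>

context
  fixes \<theta> s T :: real and N :: nat
  assumes sT: "0 \<le> s" "s \<le> T" and N: "N > 0"
begin

definition mesh :: real where "mesh = (T - s) / real N"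

definition node :: "nat \<Rightarrow> real" where "node k = s + real k * mesh"

definition step_1 :: "nat \<Rightarrow> (real \<Rightarrow> real) \<Rightarrow> complex" where
  "step_1 k = exp_increment \<theta> s (node k) (node (Suc k))"

definition step_2 :: "nat \<Rightarrow> (real \<Rightarrow> real) \<Rightarrow> complex" where
  "step_2 k = exp_increment (- \<theta>) s (node k) (node (Suc k))"

text \<open>The mean of the phase over one step, for either process. A step of the pair costs its
  square, and N steps multiply to exp (- \<theta>^2 (T - s)).\<close>

definition decay :: real where "decay = exp (- \<theta>\<^sup>2 * mesh / 2)"

abbreviation P :: "nat \<Rightarrow> 'w \<Rightarrow> complex" where "P k \<omega> \<equiv> step_1 k (\<lambda>t. \<beta>\<^sub>1 t \<omega>)"
abbreviation Q :: "nat \<Rightarrow> 'w \<Rightarrow> complex" where "Q k \<omega> \<equiv> step_2 k (\<lambda>t. \<beta>\<^sub>2 t \<omega>)"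

text \<open>Collects the products of a fluctuation of the first process with one of the second in
  the same step. Against a variable of the past only a single fluctuation averages to zero; the
  product is instead controlled in mean square.\<close>

primrec err :: "nat \<Rightarrow> 'w \<Rightarrow> complex" where
  "err 0 \<omega> = 0"
| "err (Suc n) \<omega> = complex_of_real (decay\<^sup>2) * err n \<omega> + P n \<omega> * Q n \<omega>"

lemma mesh_nonneg: "mesh \<ge> 0"
  using sT N by (simp add: mesh_def)

lemma node_mono: "j \<le> k \<Longrightarrow> node j \<le> node k"
  using mesh_nonneg by (simp add: node_def mult_right_mono)

lemma node_ge: "s \<le> node k" and node_nonneg: "0 \<le> node k"
  using mesh_nonneg sT by (simp_all add: node_def)

lemma node_0: "node 0 = s" and node_N: "node N = T"
  using N by (simp_all add: node_def mesh_def)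

lemma node_Suc: "node (Suc k) - node k = mesh"
  by (simp add: node_def algebra_simps)

lemma decay: "0 < decay" "decay \<le> 1"
  using mesh_nonneg by (simp_all add: decay_def)

lemma cmod_step: "cmod (step_1 k x) \<le> 2" "cmod (step_2 k x) \<le> 2"
  unfolding step_1_def step_2_def using node_mono[of k "Suc k"] by (auto intro: cmod_exp_increment_le)

lemma step_measurable_F: 
  assumes "Suc j \<le> k"
  shows "P j \<in> borel_measurable (F (node k))" "Q j \<in> borel_measurable (F (node k))"
proof -
  have le: "s \<le> node k" "node j \<le> node k" "node (Suc j) \<le> node k"
    using assms by (auto intro: node_ge node_mono)
  have b: "\<beta>\<^sub>1 t \<in> borel_measurable (F (node k))" "\<beta>\<^sub>2 t \<in> borel_measurable (F (node k))" if "0 \<le> t" "t \<le> node k" for t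
    using brownian_motion_measurable(1)[OF brownian_1 that] brownian_motion_measurable(1)[OF brownian_2 that] .
  show "P j \<in> borel_measurable (F (node k))"
    unfolding step_1_def by (intro borel_measurable_exp_increment b le sT(1) node_nonneg)
  show "Q j \<in> borel_measurable (F (node k))"
    unfolding step_2_def by (intro borel_measurable_exp_increment b le sT(1) node_nonneg)
qed

lemma step_measurable [measurable]: "P j \<in> borel_measurable M" "Q j \<in> borel_measurable M"
  by (rule measurable_F_M[OF step_measurable_F(1)[OF order_refl] node_nonneg])
    (rule measurable_F_M[OF step_measurable_F(2)[OF order_refl] node_nonneg])

lemma step_orthogonal_1:
  assumes "Z \<in> borel_measurable (F (node k))" "\<And>\<omega>. cmod (Z \<omega>) \<le> B"
  shows "(\<integral>\<omega>. Z \<omega> * P k \<omega> \<partial>M) = 0"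
  unfolding step_1_def
  by (rule expectation_exp_increment[OF brownian_1 sT(1) node_ge node_mono assms]) simp

lemma step_orthogonal_2:
  assumes "Z \<in> borel_measurable (F (node k))" "\<And>\<omega>. cmod (Z \<omega>) \<le> B"
  shows "(\<integral>\<omega>. Z \<omega> * Q k \<omega> \<partial>M) = 0"
  unfolding step_2_def
  by (rule expectation_exp_increment[OF brownian_2 sT(1) node_ge node_mono assms]) simp

lemma step_measurable_path [measurable]:
  "step_1 k \<in> borel_measurable (\<Pi>\<^sub>M t\<in>{0..}. borel)" "step_2 k \<in> borel_measurable (\<Pi>\<^sub>M t\<in>{0..}. borel)"
proof -
  have [measurable]: "(\<lambda>x. x t) \<in> borel_measurable (\<Pi>\<^sub>M t\<in>{0::real..}. borel :: real measure)" if "t \<ge> 0" for t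
    using that by (intro measurable_component_singleton) auto
  show "step_1 k \<in> borel_measurable (\<Pi>\<^sub>M t\<in>{0..}. borel)" "step_2 k \<in> borel_measurable (\<Pi>\<^sub>M t\<in>{0..}. borel)"
    using sT node_nonneg unfolding step_1_def step_2_def exp_increment_def[abs_def] by measurable
qed

lemma step_restrict: "step_1 k (restrict x {0..}) = step_1 k x" "step_2 k (restrict x {0..}) = step_2 k x"
  using sT node_nonneg[of k] node_nonneg[of "Suc k"] by (simp_all add: step_1_def step_2_def exp_increment_def)

text \<open>The four factors are regrouped by process instead of by step, after which independence
  of the two paths applies.\<close>

lemma expectation_step_product:
  "(\<integral>\<omega>. (P j \<omega> * Q j \<omega>) * cnj (P k \<omega> * Q k \<omega>) \<partial>M) =
    (\<integral>\<omega>. P j \<omega> * cnj (P k \<omega>) \<partial>M) * (\<integral>\<omega>. Q j \<omega> * cnj (Q k \<omega>) \<partial>M)"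
proof -
  have [measurable]: "cnj \<in> borel_measurable borel"
    by (intro borel_measurable_continuous_onI continuous_intros)
  have bound: "cmod (step_1 j x * cnj (step_1 k x)) \<le> 2 * 2" "cmod (step_2 j x * cnj (step_2 k x)) \<le> 2 * 2" for x
    unfolding norm_mult complex_mod_cnj by ((intro mult_mono cmod_step; simp)+)
  have "(\<integral>\<omega>. (P j \<omega> * cnj (P k \<omega>)) * (Q j \<omega> * cnj (Q k \<omega>)) \<partial>M) =
    (\<integral>\<omega>. P j \<omega> * cnj (P k \<omega>) \<partial>M) * (\<integral>\<omega>. Q j \<omega> * cnj (Q k \<omega>) \<partial>M)"
    by (rule independent_functionals[OF _ _ bound], measurable, measurable) (simp_all only: step_restrict)
  then show ?thesis
    by (simp add: mult_ac)
qed

text \<open>It is enough that the factor of the first process vanishes. There \<open>P j\<close>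
  belongs to the past of step \<open>k\<close>, and the martingale property of one Brownian motion
  decides.\<close>

lemma step_uncorrelated:
  assumes "j < k"
  shows "(\<integral>\<omega>. (P j \<omega> * Q j \<omega>) * cnj (P k \<omega> * Q k \<omega>) \<partial>M) = 0"
proof -
  have [measurable]: "cnj \<in> borel_measurable borel"
    by (intro borel_measurable_continuous_onI continuous_intros)
  have [measurable]: "P j \<in> borel_measurable (F (node k))"
    using assms by (intro step_measurable_F) simp
  have "(\<integral>\<omega>. cnj (P j \<omega>) * P k \<omega> \<partial>M) = 0"
    by (rule step_orthogonal_1[of _ _ 2]) (use cmod_step in auto)
  moreover have "(\<integral>\<omega>. P j \<omega> * cnj (P k \<omega>) \<partial>M) = cnj (\<integral>\<omega>. cnj (P j \<omega>) * P k \<omega> \<partial>M)"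
    using Bochner_Integration.integral_cnj[of M "\<lambda>\<omega>. cnj (P j \<omega>) * P k \<omega>"] by simp
  ultimately show ?thesis
    unfolding expectation_step_product by simp
qed

lemma err_measurable [measurable]: "err n \<in> borel_measurable M"
  by (induction n) simp_all

lemma cmod_err: "cmod (err n \<omega>) \<le> 4 * real n"
proof (induction n)
  case (Suc n)
  have "cmod (err (Suc n) \<omega>) \<le> decay\<^sup>2 * cmod (err n \<omega>) + cmod (P n \<omega>) * cmod (Q n \<omega>)"
    using norm_triangle_ineq[of "complex_of_real (decay\<^sup>2) * err n \<omega>" "P n \<omega> * Q n \<omega>"] by (simp add: norm_mult norm_power)
  also have "\<dots> \<le> 1 * (4 * real n) + 2 * 2"
    using decay by (intro add_mono mult_mono Suc cmod_step) (auto simp: power_le_one)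
  finally show ?case by simp
qed simp

lemma err_uncorrelated:
  assumes "n \<le> k"
  shows "(\<integral>\<omega>. err n \<omega> * cnj (P k \<omega> * Q k \<omega>) \<partial>M) = 0"
  using assms
proof (induction n)
  case (Suc n)
  have [measurable]: "cnj \<in> borel_measurable borel"
    by (intro borel_measurable_continuous_onI continuous_intros)
  have "integrable M (\<lambda>\<omega>. err n \<omega> * cnj (P k \<omega> * Q k \<omega>))"
  proof (rule integrable_const_bound[of _ "4 * real n * (2 * 2)"])
    show "AE \<omega> in M. cmod (err n \<omega> * cnj (P k \<omega> * Q k \<omega>)) \<le> 4 * real n * (2 * 2)"
      unfolding norm_mult complex_mod_cnj by (intro AE_I2 mult_mono cmod_err cmod_step) auto
  qed measurable
  moreover have "integrable M (\<lambda>\<omega>. (P n \<omega> * Q n \<omega>) * cnj (P k \<omega> * Q k \<omega>))"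
  proof (rule integrable_const_bound[of _ "(2 * 2) * (2 * 2)"])
    show "AE \<omega> in M. cmod ((P n \<omega> * Q n \<omega>) * cnj (P k \<omega> * Q k \<omega>)) \<le> (2 * 2) * (2 * 2)"
      unfolding norm_mult complex_mod_cnj by (intro AE_I2 mult_mono cmod_step) auto
  qed measurable
  ultimately have "(\<integral>\<omega>. err (Suc n) \<omega> * cnj (P k \<omega> * Q k \<omega>) \<partial>M) =
      complex_of_real (decay\<^sup>2) * (\<integral>\<omega>. err n \<omega> * cnj (P k \<omega> * Q k \<omega>) \<partial>M) +
      (\<integral>\<omega>. (P n \<omega> * Q n \<omega>) * cnj (P k \<omega> * Q k \<omega>) \<partial>M)"
    by (simp add: distrib_right mult.assoc)
  with Suc step_uncorrelated[of n k] show ?case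
    by simp
qed simp

text \<open>Pythagoras: the products \<open>P n * Q n\<close> are uncorrelated with the error made
  before, each has mean square (1 - exp (- \<theta>^2 mesh))^2, and \<open>decay\<close> only
  shrinks earlier contributions. With N steps of length (T - s) / N the total is of order
  1/N.\<close>

lemma expectation_err_squared: "(\<integral>\<omega>. (cmod (err n \<omega>))\<^sup>2 \<partial>M) \<le> real n * (\<theta>\<^sup>2 * mesh)\<^sup>2"
proof (induction n)
  case (Suc n)
  have [measurable]: "cnj \<in> borel_measurable borel"
    by (intro borel_measurable_continuous_onI continuous_intros)
  have int1: "integrable M (\<lambda>\<omega>. (cmod (err n \<omega>))\<^sup>2)"
  proof (rule integrable_const_bound[of _ "(4 * real n)\<^sup>2"])
    have "(cmod (err n \<omega>))\<^sup>2 \<le> (4 * real n)\<^sup>2" for \<omega>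
      by (intro power_mono cmod_err) simp
    then show "AE \<omega> in M. norm ((cmod (err n \<omega>))\<^sup>2) \<le> (4 * real n)\<^sup>2"
      by simp
  qed measurable
  have int2: "integrable M (\<lambda>\<omega>. (cmod (P n \<omega> * Q n \<omega>))\<^sup>2)"
  proof (rule integrable_const_bound[of _ "(2 * 2)\<^sup>2"])
    have "(cmod (P n \<omega> * Q n \<omega>))\<^sup>2 \<le> (2 * 2)\<^sup>2" for \<omega>
      unfolding norm_mult by (intro mult_mono power_mono cmod_step) auto
    then show "AE \<omega> in M. norm ((cmod (P n \<omega> * Q n \<omega>))\<^sup>2) \<le> (2 * 2)\<^sup>2"
      by simp
  qed measurable
  have int3: "integrable M (\<lambda>\<omega>. err n \<omega> * cnj (P n \<omega> * Q n \<omega>))"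
  proof (rule integrable_const_bound[of _ "4 * real n * (2 * 2)"])
    show "AE \<omega> in M. cmod (err n \<omega> * cnj (P n \<omega> * Q n \<omega>)) \<le> 4 * real n * (2 * 2)"
      unfolding norm_mult complex_mod_cnj by (intro AE_I2 mult_mono cmod_err cmod_step) auto
  qed measurable
  have "(cmod (err (Suc n) \<omega>))\<^sup>2 = decay ^ 4 * (cmod (err n \<omega>))\<^sup>2 + (cmod (P n \<omega> * Q n \<omega>))\<^sup>2
      + 2 * decay\<^sup>2 * Re (err n \<omega> * cnj (P n \<omega> * Q n \<omega>))" for \<omega>
  proof -
    have "(cmod (complex_of_real r * x + y))\<^sup>2 = r\<^sup>2 * (cmod x)\<^sup>2 + (cmod y)\<^sup>2 + 2 * r * Re (x * cnj y)" for r x y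
      unfolding cmod_power2 by (simp add: power2_eq_square algebra_simps)
    from this[of "decay\<^sup>2" "err n \<omega>" "P n \<omega> * Q n \<omega>"] show ?thesis
      by simp
  qed
  then have "(\<integral>\<omega>. (cmod (err (Suc n) \<omega>))\<^sup>2 \<partial>M) = decay ^ 4 * (\<integral>\<omega>. (cmod (err n \<omega>))\<^sup>2 \<partial>M)
      + (\<integral>\<omega>. (cmod (P n \<omega> * Q n \<omega>))\<^sup>2 \<partial>M) + 2 * decay\<^sup>2 * Re (\<integral>\<omega>. err n \<omega> * cnj (P n \<omega> * Q n \<omega>) \<partial>M)"
    using int1 int2 integrable_Re[OF int3] integral_Re[OF int3] by (simp del: complex_cnj_mult times_complex.sel)
  also have "(\<integral>\<omega>. err n \<omega> * cnj (P n \<omega> * Q n \<omega>) \<partial>M) = 0"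
    by (rule err_uncorrelated) simp
  also have "(\<integral>\<omega>. (cmod (P n \<omega> * Q n \<omega>))\<^sup>2 \<partial>M) = (1 - exp (- \<theta>\<^sup>2 * mesh))\<^sup>2"
  proof -
    have "complex_of_real (\<integral>\<omega>. (cmod (P n \<omega> * Q n \<omega>))\<^sup>2 \<partial>M) = (\<integral>\<omega>. (P n \<omega> * Q n \<omega>) * cnj (P n \<omega> * Q n \<omega>) \<partial>M)"
      unfolding integral_complex_of_real[symmetric] complex_norm_square ..
    also have "\<dots> = complex_of_real (\<integral>\<omega>. (cmod (P n \<omega>))\<^sup>2 \<partial>M) * complex_of_real (\<integral>\<omega>. (cmod (Q n \<omega>))\<^sup>2 \<partial>M)"
      unfolding expectation_step_product integral_complex_of_real[symmetric] complex_norm_square ..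
    also have "(\<integral>\<omega>. (cmod (P n \<omega>))\<^sup>2 \<partial>M) = 1 - exp (- \<theta>\<^sup>2 * mesh)"
      unfolding step_1_def using sT node_ge[of n] node_mono[of n "Suc n"]
      by (subst expectation_norm_exp_increment[OF brownian_1]) (auto simp: node_Suc)
    also have "(\<integral>\<omega>. (cmod (Q n \<omega>))\<^sup>2 \<partial>M) = 1 - exp (- \<theta>\<^sup>2 * mesh)"
      unfolding step_2_def using sT node_ge[of n] node_mono[of n "Suc n"]
      by (subst expectation_norm_exp_increment[OF brownian_2]) (auto simp: node_Suc)
    finally show ?thesis
      by (simp only: of_real_eq_iff power2_eq_square flip: of_real_mult)
  qed
  also have "decay ^ 4 * (\<integral>\<omega>. (cmod (err n \<omega>))\<^sup>2 \<partial>M) + (1 - exp (- \<theta>\<^sup>2 * mesh))\<^sup>2 + 2 * decay\<^sup>2 * Re 0 \<le>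
      1 * (\<integral>\<omega>. (cmod (err n \<omega>))\<^sup>2 \<partial>M) + (\<theta>\<^sup>2 * mesh)\<^sup>2"
  proof -
    have "1 - exp (- \<theta>\<^sup>2 * mesh) \<le> \<theta>\<^sup>2 * mesh"
      using exp_ge_add_one_self[of "- \<theta>\<^sup>2 * mesh"] by simp
    moreover have "0 \<le> 1 - exp (- \<theta>\<^sup>2 * mesh)"
      using mesh_nonneg by simp
    ultimately have "(1 - exp (- \<theta>\<^sup>2 * mesh))\<^sup>2 \<le> (\<theta>\<^sup>2 * mesh)\<^sup>2"
      by (intro power_mono)
    moreover have "decay ^ 4 * (\<integral>\<omega>. (cmod (err n \<omega>))\<^sup>2 \<partial>M) \<le> 1 * (\<integral>\<omega>. (cmod (err n \<omega>))\<^sup>2 \<partial>M)"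
      using decay by (intro mult_right_mono power_le_one) auto
    ultimately show ?thesis
      by simp
  qed
  finally show ?case
    using Suc by (simp add: algebra_simps)
qed simp

text \<open>Both phases are split as fluctuation plus \<open>decay\<close> times the previous phase.
  In the expanded product the two terms with a single fluctuation vanish, their cofactors
  \<open>Z V\<close> and \<open>Z U\<close> being in the past; the product of previous phases
  continues the induction and the product of fluctuations goes into \<open>err\<close>.\<close>

lemma expectation_telescope:
  fixes Z :: "'w \<Rightarrow> complex"
  assumes Z: "Z \<in> borel_measurable (F s)" "\<And>\<omega>. cmod (Z \<omega>) \<le> B"
  shows "(\<integral>\<omega>. Z \<omega> * (cis (\<theta> * (\<beta>\<^sub>1 (node n) \<omega> - \<beta>\<^sub>1 s \<omega>)) * cis (- \<theta> * (\<beta>\<^sub>2 (node n) \<omega> - \<beta>\<^sub>2 s \<omega>))) \<partial>M) =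
    complex_of_real (decay ^ (2 * n)) * (\<integral>\<omega>. Z \<omega> \<partial>M) + (\<integral>\<omega>. Z \<omega> * err n \<omega> \<partial>M)"
proof (induction n)
  case 0
  then show ?case by (simp add: node_0)
next
  case (Suc n)
  define U where "U k \<omega> = cis (\<theta> * (\<beta>\<^sub>1 (node k) \<omega> - \<beta>\<^sub>1 s \<omega>))" for k \<omega>
  define V where "V k \<omega> = cis (- \<theta> * (\<beta>\<^sub>2 (node k) \<omega> - \<beta>\<^sub>2 s \<omega>))" for k \<omega>
  have [measurable]: "\<beta>\<^sub>1 (node n) \<in> borel_measurable (F (node n))" "\<beta>\<^sub>1 s \<in> borel_measurable (F (node n))"
    "\<beta>\<^sub>2 (node n) \<in> borel_measurable (F (node n))" "\<beta>\<^sub>2 s \<in> borel_measurable (F (node n))"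
    using brownian_motion_measurable(1)[OF brownian_1] brownian_motion_measurable(1)[OF brownian_2] sT node_ge[of n] node_nonneg[of n]
    by auto
  have ZF [measurable]: "Z \<in> borel_measurable (F (node n))"
    using measurable_F_mono[OF Z(1) node_ge] .
  have UVF [measurable]: "U n \<in> borel_measurable (F (node n))" "V n \<in> borel_measurable (F (node n))"
    unfolding U_def V_def by measurable
  have [measurable]: "Z \<in> borel_measurable M" "U n \<in> borel_measurable M" "V n \<in> borel_measurable M"
    using ZF UVF measurable_F_M[OF _ node_nonneg] by blast+
  have B: "B \<ge> 0"
    using Z(2) norm_ge_zero order_trans by blast
  have U: "U (Suc n) \<omega> = P n \<omega> + complex_of_real decay * U n \<omega>" and V: "V (Suc n) \<omega> = Q n \<omega> + complex_of_real decay * V n \<omega>" for \<omega>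
    using exp_increment_telescope[of \<theta> "\<lambda>t. \<beta>\<^sub>1 t \<omega>" "node (Suc n)" s "node n"]
      exp_increment_telescope[of "- \<theta>" "\<lambda>t. \<beta>\<^sub>2 t \<omega>" "node (Suc n)" s "node n"]
    by (simp_all add: U_def V_def step_1_def step_2_def decay_def node_Suc)
  have UV1: "cmod (U n \<omega>) = 1" "cmod (V n \<omega>) = 1" for \<omega>
    by (simp_all add: U_def V_def)
  have ZUV: "cmod (Z \<omega> * U n \<omega>) \<le> B" "cmod (Z \<omega> * V n \<omega>) \<le> B" for \<omega>
    using Z(2) by (simp_all add: norm_mult UV1)
  have 1: "(\<integral>\<omega>. (Z \<omega> * V n \<omega>) * P n \<omega> \<partial>M) = 0"
    by (rule step_orthogonal_1[OF _ ZUV(2)]) measurable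
  have 2: "(\<integral>\<omega>. (Z \<omega> * U n \<omega>) * Q n \<omega> \<partial>M) = 0"
    by (rule step_orthogonal_2[OF _ ZUV(1)]) measurable
  have i1: "integrable M (\<lambda>\<omega>. (Z \<omega> * V n \<omega>) * P n \<omega>)"
  proof (rule integrable_const_bound[of _ "B * 2"])
    show "AE \<omega> in M. cmod ((Z \<omega> * V n \<omega>) * P n \<omega>) \<le> B * 2"
      unfolding norm_mult[of "Z _ * V n _"] using B by (intro AE_I2 mult_mono ZUV cmod_step) auto
  qed measurable
  have i2: "integrable M (\<lambda>\<omega>. (Z \<omega> * U n \<omega>) * Q n \<omega>)"
  proof (rule integrable_const_bound[of _ "B * 2"])
    show "AE \<omega> in M. cmod ((Z \<omega> * U n \<omega>) * Q n \<omega>) \<le> B * 2"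
      unfolding norm_mult[of "Z _ * U n _"] using B by (intro AE_I2 mult_mono ZUV cmod_step) auto
  qed measurable
  have i3: "integrable M (\<lambda>\<omega>. Z \<omega> * (U n \<omega> * V n \<omega>))"
    by (rule integrable_const_bound[of _ B]) (use Z in \<open>auto simp: norm_mult UV1\<close>)
  have i4: "integrable M (\<lambda>\<omega>. Z \<omega> * (P n \<omega> * Q n \<omega>))"
  proof (rule integrable_const_bound[of _ "B * (2 * 2)"])
    show "AE \<omega> in M. cmod (Z \<omega> * (P n \<omega> * Q n \<omega>)) \<le> B * (2 * 2)"
      unfolding norm_mult using B by (intro AE_I2 mult_mono Z cmod_step) auto
  qed measurable
  have i5: "integrable M (\<lambda>\<omega>. Z \<omega> * err n \<omega>)"
  proof (rule integrable_const_bound[of _ "B * (4 * real n)"])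
    show "AE \<omega> in M. cmod (Z \<omega> * err n \<omega>) \<le> B * (4 * real n)"
      unfolding norm_mult using B by (intro AE_I2 mult_mono Z cmod_err) auto
  qed measurable
  have "(\<integral>\<omega>. Z \<omega> * (U (Suc n) \<omega> * V (Suc n) \<omega>) \<partial>M) =
      (\<integral>\<omega>. Z \<omega> * (P n \<omega> * Q n \<omega>) + complex_of_real decay * ((Z \<omega> * V n \<omega>) * P n \<omega>)
        + complex_of_real decay * ((Z \<omega> * U n \<omega>) * Q n \<omega>) + complex_of_real (decay\<^sup>2) * (Z \<omega> * (U n \<omega> * V n \<omega>)) \<partial>M)"
    unfolding U V by (intro Bochner_Integration.integral_cong refl) (simp add: algebra_simps power2_eq_square)
  also have "\<dots> = (\<integral>\<omega>. Z \<omega> * (P n \<omega> * Q n \<omega>) \<partial>M) + complex_of_real (decay\<^sup>2) * (\<integral>\<omega>. Z \<omega> * (U n \<omega> * V n \<omega>) \<partial>M)"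
    using i1 i2 i3 i4 1 2 by simp
  also have "(\<integral>\<omega>. Z \<omega> * (U n \<omega> * V n \<omega>) \<partial>M) = complex_of_real (decay ^ (2 * n)) * (\<integral>\<omega>. Z \<omega> \<partial>M) + (\<integral>\<omega>. Z \<omega> * err n \<omega> \<partial>M)"
    using Suc by (simp add: U_def V_def)
  also have "(\<integral>\<omega>. Z \<omega> * (P n \<omega> * Q n \<omega>) \<partial>M) + complex_of_real (decay\<^sup>2) * (complex_of_real (decay ^ (2 * n)) * (\<integral>\<omega>. Z \<omega> \<partial>M) + (\<integral>\<omega>. Z \<omega> * err n \<omega> \<partial>M)) =
     complex_of_real (decay ^ (2 * Suc n)) * (\<integral>\<omega>. Z \<omega> \<partial>M) + (\<integral>\<omega>. Z \<omega> * err (Suc n) \<omega> \<partial>M)"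
  proof -
    have "(\<integral>\<omega>. Z \<omega> * err (Suc n) \<omega> \<partial>M) =
        (\<integral>\<omega>. complex_of_real (decay\<^sup>2) * (Z \<omega> * err n \<omega>) + Z \<omega> * (P n \<omega> * Q n \<omega>) \<partial>M)"
      by (simp add: algebra_simps)
    also have "\<dots> = complex_of_real (decay\<^sup>2) * (\<integral>\<omega>. Z \<omega> * err n \<omega> \<partial>M) + (\<integral>\<omega>. Z \<omega> * (P n \<omega> * Q n \<omega>) \<partial>M)"
      using i4 i5 by simp
    finally have e: "(\<integral>\<omega>. Z \<omega> * err (Suc n) \<omega> \<partial>M) =
      complex_of_real (decay\<^sup>2) * (\<integral>\<omega>. Z \<omega> * err n \<omega> \<partial>M) + (\<integral>\<omega>. Z \<omega> * (P n \<omega> * Q n \<omega>) \<partial>M)" .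
    show ?thesis
      unfolding e by (simp add: algebra_simps power2_eq_square)
  qed
  finally show ?case
    by (simp add: U_def V_def)
qed

lemma expectation_partition_bound:
  fixes Z :: "'w \<Rightarrow> complex"
  assumes Z: "Z \<in> borel_measurable (F s)" "\<And>\<omega>. cmod (Z \<omega>) \<le> B"
  shows "cmod ((\<integral>\<omega>. Z \<omega> * cis (\<theta> * ((\<beta>\<^sub>1 T \<omega> - \<beta>\<^sub>2 T \<omega>) - (\<beta>\<^sub>1 s \<omega> - \<beta>\<^sub>2 s \<omega>))) \<partial>M) -
    complex_of_real (exp (- \<theta>\<^sup>2 * (T - s))) * (\<integral>\<omega>. Z \<omega> \<partial>M)) \<le> B * sqrt (\<theta> ^ 4 * (T - s)\<^sup>2 / real N)"
proof -
  have [measurable]: "Z \<in> borel_measurable M"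
    using measurable_F_M[OF Z(1) sT(1)] .
  have B: "B \<ge> 0"
    using Z(2) norm_ge_zero order_trans by blast
  have "cis (\<theta> * ((\<beta>\<^sub>1 T \<omega> - \<beta>\<^sub>2 T \<omega>) - (\<beta>\<^sub>1 s \<omega> - \<beta>\<^sub>2 s \<omega>))) =
      cis (\<theta> * (\<beta>\<^sub>1 T \<omega> - \<beta>\<^sub>1 s \<omega>)) * cis (- \<theta> * (\<beta>\<^sub>2 T \<omega> - \<beta>\<^sub>2 s \<omega>))" for \<omega>
    by (simp add: cis_mult algebra_simps)
  moreover have "decay ^ (2 * N) = exp (- \<theta>\<^sup>2 * (T - s))"
    using N by (simp add: decay_def mesh_def exp_of_nat_mult[symmetric])
  ultimately have "cmod ((\<integral>\<omega>. Z \<omega> * cis (\<theta> * ((\<beta>\<^sub>1 T \<omega> - \<beta>\<^sub>2 T \<omega>) - (\<beta>\<^sub>1 s \<omega> - \<beta>\<^sub>2 s \<omega>))) \<partial>M) -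
      complex_of_real (exp (- \<theta>\<^sup>2 * (T - s))) * (\<integral>\<omega>. Z \<omega> \<partial>M)) = cmod (\<integral>\<omega>. Z \<omega> * err N \<omega> \<partial>M)"
    using expectation_telescope[OF Z, of N] by (simp add: node_N)
  also have "\<dots> \<le> (\<integral>\<omega>. cmod (Z \<omega> * err N \<omega>) \<partial>M)"
    by (rule integral_norm_bound)
  also have "\<dots> \<le> (\<integral>\<omega>. B * cmod (err N \<omega>) \<partial>M)"
  proof (rule integral_mono)
    have ie: "integrable M (err N)"
      using cmod_err by (intro integrable_const_bound[of _ "4 * real N"]) auto
    then show "integrable M (\<lambda>\<omega>. B * cmod (err N \<omega>))"
      by simp
    show "integrable M (\<lambda>\<omega>. cmod (Z \<omega> * err N \<omega>))"
    proof (rule integrable_const_bound[of _ "B * (4 * real N)"])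
      have "cmod (Z \<omega> * err N \<omega>) \<le> B * (4 * real N)" for \<omega>
        unfolding norm_mult using B by (intro mult_mono Z cmod_err) auto
      then show "AE \<omega> in M. norm (cmod (Z \<omega> * err N \<omega>)) \<le> B * (4 * real N)"
        by simp
    qed measurable
    show "cmod (Z \<omega> * err N \<omega>) \<le> B * cmod (err N \<omega>)" for \<omega>
      unfolding norm_mult by (intro mult_right_mono Z) auto
  qed
  also have "\<dots> = B * (\<integral>\<omega>. cmod (err N \<omega>) \<partial>M)"
    by simp
  also have "\<dots> \<le> B * sqrt (\<theta> ^ 4 * (T - s)\<^sup>2 / real N)"
  proof (rule mult_left_mono[OF _ B], rule real_le_rsqrt)
    have sq: "(cmod (err N \<omega>))\<^sup>2 \<le> (4 * real N)\<^sup>2" for \<omega>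
      by (intro power_mono cmod_err) simp
    have "integrable M (\<lambda>\<omega>. cmod (err N \<omega>))"
      by (rule integrable_const_bound[of _ "4 * real N"]) (use cmod_err in auto)
    moreover have "integrable M (\<lambda>\<omega>. (cmod (err N \<omega>))\<^sup>2)"
      by (rule integrable_const_bound[of _ "(4 * real N)\<^sup>2"]) (use sq in auto)
    \<comment> \<open>Nonnegativity of the variance of the modulus: the square of the mean is at
      most the mean square.\<close>
    ultimately have "(\<integral>\<omega>. cmod (err N \<omega>) \<partial>M)\<^sup>2 \<le> (\<integral>\<omega>. (cmod (err N \<omega>))\<^sup>2 \<partial>M)"
      using variance_positive[of "\<lambda>\<omega>. cmod (err N \<omega>)"] by (subst (asm) variance_eq) auto
    also have "\<dots> \<le> real N * (\<theta>\<^sup>2 * mesh)\<^sup>2"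
      by (rule expectation_err_squared)
    also have "\<dots> = \<theta> ^ 4 * (T - s)\<^sup>2 / real N"
      using N by (simp add: mesh_def power_mult_distrib power_divide power2_eq_square power4_eq_xxxx)
    finally show "(\<integral>\<omega>. cmod (err N \<omega>) \<partial>M)\<^sup>2 \<le> \<theta> ^ 4 * (T - s)\<^sup>2 / real N" .
  qed
  finally show ?thesis .
qed

end

text \<open>Neither side depends on the partition, so the number of steps is sent to infinity. The
  exponent lacks the factor 1/2 of one Brownian motion because the variances of the two add
  up.\<close>

lemma expectation_difference_increment:
  fixes Z :: "'w \<Rightarrow> complex"
  assumes sT: "0 \<le> s" "s \<le> T" and Z: "Z \<in> borel_measurable (F s)" "\<And>\<omega>. cmod (Z \<omega>) \<le> B"
  shows "(\<integral>\<omega>. Z \<omega> * cis (\<theta> * ((\<beta>\<^sub>1 T \<omega> - \<beta>\<^sub>2 T \<omega>) - (\<beta>\<^sub>1 s \<omega> - \<beta>\<^sub>2 s \<omega>))) \<partial>M) =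
    complex_of_real (exp (- \<theta>\<^sup>2 * (T - s))) * (\<integral>\<omega>. Z \<omega> \<partial>M)" (is "?L = ?R")
proof -
  have "cmod (?L - ?R) \<le> 0"
  proof (rule LIMSEQ_le_const)
    have "(\<lambda>n. \<theta> ^ 4 * (T - s)\<^sup>2 / real (Suc n)) \<longlonglongrightarrow> 0"
      by (rule LIMSEQ_Suc[OF lim_const_over_n])
    then have "(\<lambda>n. B * sqrt (\<theta> ^ 4 * (T - s)\<^sup>2 / real (Suc n))) \<longlonglongrightarrow> B * sqrt 0"
      by (intro tendsto_intros)
    then show "(\<lambda>n. B * sqrt (\<theta> ^ 4 * (T - s)\<^sup>2 / real (Suc n))) \<longlonglongrightarrow> 0"
      by simp
    show "\<exists>N. \<forall>n\<ge>N. cmod (?L - ?R) \<le> B * sqrt (\<theta> ^ 4 * (T - s)\<^sup>2 / real (Suc n))"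
      using expectation_partition_bound[OF sT _ Z] by blast
  qed
  then show ?thesis
    by simp
qed

end

section \<open>Stability of the moment hierarchy\<close>

lemma at_within_atLeast_0: "0 < (t::real) \<Longrightarrow> at t within {0..} = at t"
  by (rule at_within_interior) simp

text \<open>Gronwall's inequality with constant forcing; the quotient of \<kappa> by l is the level
  at which damping and forcing balance.\<close>

lemma linear_differential_inequality:
  fixes f f' :: "real \<Rightarrow> real"
  assumes f: "\<And>t. a \<le> t \<Longrightarrow> (f has_real_derivative f' t) (at t)" "\<And>t. a \<le> t \<Longrightarrow> f' t \<le> \<kappa> - l * f t"
    and "l > 0" "a \<le> t"
  shows "f t \<le> exp (- l * (t - a)) * (f a - \<kappa> / l) + \<kappa> / l"
proof -
  define g where "g t = exp (l * t) * (f t - \<kappa> / l)" for t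
  have "g t \<le> g a"
  proof (rule DERIV_nonpos_imp_nonincreasing[OF \<open>a \<le> t\<close>])
    fix x assume x: "a \<le> x" "x \<le> t"
    have "(g has_real_derivative exp (l * x) * (l * (f x - \<kappa> / l) + f' x)) (at x)"
      unfolding g_def by (auto intro!: derivative_eq_intros f(1) x simp: algebra_simps)
    moreover have "exp (l * x) * (l * (f x - \<kappa> / l) + f' x) \<le> 0"
      using f(2)[OF x(1)] \<open>l > 0\<close> by (intro mult_nonneg_nonpos) (auto simp: algebra_simps)
    ultimately show "\<exists>y. (g has_real_derivative y) (at x) \<and> y \<le> 0"
      by blast
  qed
  then have "exp (- l * t) * g t \<le> exp (- l * t) * g a"
    by (intro mult_left_mono) auto
  moreover have "exp (- l * t) * g t = f t - \<kappa> / l"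
    by (simp add: g_def exp_minus)
  moreover have "exp (- l * t) * g a = exp (- l * (t - a)) * (f a - \<kappa> / l)"
    by (simp add: g_def algebra_simps flip: exp_add mult.assoc)
  ultimately show ?thesis
    by linarith
qed

lemma has_real_derivative_cmod_squared:
  assumes "(f has_vector_derivative f') (at t within S)"
  shows "((\<lambda>t. (cmod (f t))\<^sup>2) has_real_derivative 2 * Re (cnj (f t) * f')) (at t within S)"
proof -
  have "((\<lambda>t. f t * cnj (f t)) has_vector_derivative f t * cnj f' + f' * cnj (f t)) (at t within S)"
    by (intro has_vector_derivative_mult assms has_vector_derivative_cnj)
  from bounded_linear.has_vector_derivative[OF bounded_linear_Re this]
  have "((\<lambda>t. Re (f t * cnj (f t))) has_real_derivative Re (f t * cnj f' + f' * cnj (f t))) (at t within S)"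
    by (simp add: has_real_derivative_iff_has_vector_derivative)
  moreover have "Re (f t * cnj (f t)) = (cmod (f t))\<^sup>2" for t
    by (simp flip: complex_norm_square of_real_power)
  moreover have "Re (f t * cnj f' + f' * cnj (f t)) = 2 * Re (cnj (f t) * f')"
    by (simp add: algebra_simps)
  ultimately show ?thesis
    by (simp only:)
qed

text \<open>The weights \<open>1/n\<close> make the transport part of the hierarchy telescope, so that
  \<open>\<Sum>\<^sub>n\<^sub>\<le>\<^sub>N \<bar>u\<^sub>n\<bar>\<^sup>2 / n\<close> is dissipated up to a boundary term of order \<open>1/N\<^sup>2\<close>.\<close>

context
  fixes u :: "nat \<Rightarrow> real \<Rightarrow> complex" and K \<epsilon> :: real
  assumes pos: "K > 0" "\<epsilon> > 0"
    and u0: "\<And>t. t \<ge> 0 \<Longrightarrow> u 0 t = 0" and bound: "\<And>n t. t \<ge> 0 \<Longrightarrow> cmod (u n t) \<le> 2"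
    and ode: "\<And>n t. n > 0 \<Longrightarrow> t \<ge> 0 \<Longrightarrow> (u n has_vector_derivative
      complex_of_real (n * K) * (u (n - 1) t - u (Suc n) t) - complex_of_real (\<epsilon>\<^sup>2 * n\<^sup>2) * u n t) (at t within {0..})"
begin

text \<open>Variation of constants: forcing of size 4 n K against damping \<epsilon>^2 n^2 leaves a
  term of order 1/n, and after time 1 the initial value has been damped to the same order. This
  bound makes the boundary term of a truncation at level N negligible.\<close>

lemma hierarchy_decay:
  assumes n: "n > 0" and t: "t \<ge> 1"
  shows "cmod (u n t) \<le> (2 + 4 * K) / \<epsilon>\<^sup>2 / real n"
proof -
  define l where "l = \<epsilon>\<^sup>2 * (real n)\<^sup>2"
  have l: "l > 0"
    using pos n by (simp add: l_def)
  define w where "w t = complex_of_real (exp (l * t)) * u n t" for t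
  define w' where "w' t = complex_of_real (exp (l * t)) * (complex_of_real (n * K) * (u (n - 1) t - u (Suc n) t))" for t
  have w: "(w has_vector_derivative w' t) (at t within {0..})" if "t \<ge> 0" for t
  proof -
    have "((\<lambda>t. complex_of_real (exp (l * t))) has_vector_derivative complex_of_real (l * exp (l * t))) (at t within {0..})"
      by (intro has_vector_derivative_of_real) (auto intro!: derivative_eq_intros simp flip: has_real_derivative_iff_has_vector_derivative)
    from has_vector_derivative_mult[OF this ode[OF n that]] show ?thesis
      unfolding w_def[abs_def] w'_def by (rule has_vector_derivative_eq_rhs) (simp add: l_def algebra_simps)
  qed
  have "norm (w t - w 0) \<le> 4 * n * K / l * exp (l * t) - 4 * n * K / l * exp (l * 0)"
  proof (rule differentiable_bound_general[where f' = w' and \<phi>' = "\<lambda>t. 4 * n * K * exp (l * t)"])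
    show "0 < t"
      using t by simp
    show "continuous_on {0..t} w"
      by (rule continuous_on_vector_derivative[where f' = w'])
        (auto intro: has_vector_derivative_within_subset[OF w])
    show "continuous_on {0..t} (\<lambda>t. 4 * n * K / l * exp (l * t))"
      by (intro continuous_intros)
    fix x assume x: "0 < x" "x < t"
    show "(w has_vector_derivative w' x) (at x)"
      using w[of x] x at_within_atLeast_0 by simp
    show "((\<lambda>t. 4 * n * K / l * exp (l * t)) has_vector_derivative 4 * n * K * exp (l * x)) (at x)"
      using l by (auto intro!: derivative_eq_intros simp flip: has_real_derivative_iff_has_vector_derivative)
    have "cmod (u (n - 1) x - u (Suc n) x) \<le> 4"
      using norm_triangle_ineq4[of "u (n - 1) x" "u (Suc n) x"] bound[of x "n - 1"] bound[of x "Suc n"] x by simp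
    then have "n * K * cmod (u (n - 1) x - u (Suc n) x) \<le> n * K * 4"
      using pos by (intro mult_left_mono) auto
    then show "norm (w' x) \<le> 4 * n * K * exp (l * x)"
      using pos by (simp add: w'_def norm_mult)
  qed
  then have "cmod (w t) \<le> 4 * n * K / l * exp (l * t) + cmod (w 0)"
    using norm_triangle_sub[of "w t" "w 0"] pos l by (simp add: algebra_simps) (smt (verit) divide_nonneg_pos mult_nonneg_nonneg of_nat_0_le_iff)
  also have "cmod (w 0) \<le> 2"
    using bound[of 0 n] by (simp add: w_def)
  finally have "exp (l * t) * cmod (u n t) \<le> exp (l * t) * (4 * n * K / l + 2 * exp (- (l * t)))"
    by (simp add: w_def norm_mult algebra_simps exp_minus)
  then have "cmod (u n t) \<le> 4 * n * K / l + 2 * exp (- (l * t))"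
    by simp
  also have "exp (- (l * t)) \<le> 1 / (\<epsilon>\<^sup>2 * n)"
  proof -
    have "\<epsilon>\<^sup>2 * n * 1 * 1 \<le> \<epsilon>\<^sup>2 * n * n * t"
      using n t pos by (intro mult_mono) auto
    also have "\<dots> = l * t"
      by (simp add: l_def power2_eq_square)
    also have "\<dots> \<le> exp (l * t)"
      using exp_ge_add_one_self[of "l * t"] by linarith
    finally have "\<epsilon>\<^sup>2 * n \<le> exp (l * t)"
      by simp
    then show ?thesis
      using pos n by (simp add: exp_minus inverse_eq_divide frac_le)
  qed
  also have "4 * n * K / l + 2 * (1 / (\<epsilon>\<^sup>2 * n)) = (2 + 4 * K) / \<epsilon>\<^sup>2 / real n"
    using pos n by (simp add: l_def field_simps power2_eq_square)
  finally show ?thesis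
    by simp
qed

text \<open>The lower end of the telescoping sum vanishes because \<open>u 0\<close> does. This is
  why the hierarchy is studied for a difference of two moment sequences: both have zeroth moment
  1.\<close>

lemma hierarchy_energy_derivative:
  assumes t: "t > 0"
  shows "((\<lambda>t. \<Sum>n=1..N. (cmod (u n t))\<^sup>2 / n) has_real_derivative
    - 2 * K * Re (cnj (u N t) * u (Suc N) t) - 2 * \<epsilon>\<^sup>2 * (\<Sum>n=1..N. n * (cmod (u n t))\<^sup>2)) (at t)"
proof -
  define r where "r n = Re (cnj (u n t) * u (Suc n) t)" for n
  have "((\<lambda>t. (cmod (u n t))\<^sup>2 / n) has_real_derivative
      2 * K * (r (n - 1) - r n) - 2 * \<epsilon>\<^sup>2 * (n * (cmod (u n t))\<^sup>2)) (at t)" if n: "n \<in> {1..N}" for n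
  proof -
    have "(u n has_vector_derivative complex_of_real (n * K) * (u (n - 1) t - u (Suc n) t) - complex_of_real (\<epsilon>\<^sup>2 * n\<^sup>2) * u n t) (at t)"
      using ode[of n t] n t at_within_atLeast_0[OF t] by simp
    from DERIV_cdivide[OF has_real_derivative_cmod_squared[OF this], of "real n"]
    show ?thesis
    proof (rule DERIV_cong)
      have "r (n - 1) = Re (cnj (u n t) * u (n - 1) t)"
        using n by (simp add: r_def)
      moreover have "Re (cnj (u n t) * u n t) = (cmod (u n t))\<^sup>2"
        unfolding cmod_power2 by (simp add: power2_eq_square)
      moreover have "Re (cnj (u n t) * (complex_of_real (n * K) * (u (n - 1) t - u (Suc n) t) - complex_of_real (\<epsilon>\<^sup>2 * n\<^sup>2) * u n t)) =
         n * K * (Re (cnj (u n t) * u (n - 1) t) - Re (cnj (u n t) * u (Suc n) t)) - \<epsilon>\<^sup>2 * n\<^sup>2 * Re (cnj (u n t) * u n t)"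
        by (simp add: algebra_simps)
      ultimately show "2 * Re (cnj (u n t) * (complex_of_real (n * K) * (u (n - 1) t - u (Suc n) t) - complex_of_real (\<epsilon>\<^sup>2 * n\<^sup>2) * u n t)) / n =
         2 * K * (r (n - 1) - r n) - 2 * \<epsilon>\<^sup>2 * (n * (cmod (u n t))\<^sup>2)"
        using n by (simp add: r_def[of n] field_simps power2_eq_square)
    qed
  qed
  then have "((\<lambda>t. \<Sum>n=1..N. (cmod (u n t))\<^sup>2 / n) has_real_derivative
      (\<Sum>n=1..N. 2 * K * (r (n - 1) - r n) - 2 * \<epsilon>\<^sup>2 * (n * (cmod (u n t))\<^sup>2))) (at t)"
    by (intro DERIV_sum) auto
  moreover have "(\<Sum>n=1..N. r (n - 1) - r n) = - r N"
    using u0[of t] t by (induction N) (auto simp: r_def)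
  then have "(\<Sum>n=1..N. 2 * K * (r (n - 1) - r n) - 2 * \<epsilon>\<^sup>2 * (n * (cmod (u n t))\<^sup>2)) =
      - 2 * K * r N - 2 * \<epsilon>\<^sup>2 * (\<Sum>n=1..N. n * (cmod (u n t))\<^sup>2)"
    by (simp only: sum_subtractf sum_distrib_left[symmetric])
  ultimately show ?thesis
    by (simp add: r_def)
qed

text \<open>The level N is chosen first, so that the balance level of the truncated energy is below
  e / (2 n); only then does time grow, and the fixed truncation decays exponentially to that level.
  The division by n in the targets reflects the weight of \<open>u n\<close> in the energy.\<close>

lemma hierarchy_tendsto_0:
  assumes n: "n > 0"
  shows "(u n \<longlongrightarrow> 0) at_top"
proof -
  define C where "C = (2 + 4 * K) / \<epsilon>\<^sup>2"
  have C: "C > 0"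
    using pos by (simp add: C_def)
  define E where "E N t = (\<Sum>n=1..N. (cmod (u n t))\<^sup>2 / n)" for N t
  have est: "E N t \<le> exp (- (2 * \<epsilon>\<^sup>2) * (t - 1)) * (E N 1 - (2 * K * C\<^sup>2 / (real N)\<^sup>2) / (2 * \<epsilon>\<^sup>2)) + (2 * K * C\<^sup>2 / (real N)\<^sup>2) / (2 * \<epsilon>\<^sup>2)"
    if N: "N > 0" and t: "t \<ge> 1" for N t
  proof (rule linear_differential_inequality[where f' = "\<lambda>t. - 2 * K * Re (cnj (u N t) * u (Suc N) t) - 2 * \<epsilon>\<^sup>2 * (\<Sum>n=1..N. n * (cmod (u n t))\<^sup>2)"])
    fix t :: real assume t: "1 \<le> t"
    show "(E N has_real_derivative - 2 * K * Re (cnj (u N t) * u (Suc N) t) - 2 * \<epsilon>\<^sup>2 * (\<Sum>n=1..N. n * (cmod (u n t))\<^sup>2)) (at t)"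
      unfolding E_def using t by (intro hierarchy_energy_derivative) simp
    have "- Re (cnj (u N t) * u (Suc N) t) \<le> cmod (u N t) * cmod (u (Suc N) t)"
      using abs_Re_le_cmod[of "cnj (u N t) * u (Suc N) t"] by (simp add: norm_mult)
    also have "\<dots> \<le> (C / N) * (C / N)"
    proof (intro mult_mono)
      show "cmod (u N t) \<le> C / N"
        using hierarchy_decay[OF N t] by (simp add: C_def)
      have "cmod (u (Suc N) t) \<le> C / Suc N"
        using hierarchy_decay[of "Suc N" t] t by (simp add: C_def)
      also have "\<dots> \<le> C / N"
        using C N by (intro divide_left_mono) auto
      finally show "cmod (u (Suc N) t) \<le> C / N" .
    qed (use C in auto)
    finally have "2 * K * (- Re (cnj (u N t) * u (Suc N) t)) \<le> 2 * K * ((C / N) * (C / N))"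
      using pos by (intro mult_left_mono) auto
    \<comment> \<open>Since 1/n \<le> n, the dissipation dominates the energy itself, with a rate
      that does not depend on N.\<close>
    have "E N t \<le> (\<Sum>n=1..N. n * (cmod (u n t))\<^sup>2)"
      unfolding E_def
    proof (rule sum_mono)
      fix n assume "n \<in> {1..N}"
      then have n: "real n \<ge> 1"
        by simp
      have "(cmod (u n t))\<^sup>2 / n \<le> (cmod (u n t))\<^sup>2 / 1"
        using n by (intro divide_left_mono) auto
      moreover have "1 * (cmod (u n t))\<^sup>2 \<le> n * (cmod (u n t))\<^sup>2"
        using n by (intro mult_right_mono) auto
      ultimately show "(cmod (u n t))\<^sup>2 / n \<le> n * (cmod (u n t))\<^sup>2"
        by simp
    qed
    then have "2 * \<epsilon>\<^sup>2 * E N t \<le> 2 * \<epsilon>\<^sup>2 * (\<Sum>n=1..N. n * (cmod (u n t))\<^sup>2)"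
      by (intro mult_left_mono) auto
    then show "- 2 * K * Re (cnj (u N t) * u (Suc N) t) - 2 * \<epsilon>\<^sup>2 * (\<Sum>n=1..N. n * (cmod (u n t))\<^sup>2) \<le>
        2 * K * C\<^sup>2 / (real N)\<^sup>2 - 2 * \<epsilon>\<^sup>2 * E N t"
    proof -
      have "2 * K * ((C / N) * (C / N)) = 2 * K * C\<^sup>2 / (real N)\<^sup>2"
        by (simp add: power2_eq_square)
      moreover have "2 * K * (- Re (cnj (u N t) * u (Suc N) t)) = - 2 * K * Re (cnj (u N t) * u (Suc N) t)"
        by (simp only: mult_minus_left mult_minus_right)
      ultimately show ?thesis
        using \<open>2 * K * (- Re (cnj (u N t) * u (Suc N) t)) \<le> 2 * K * ((C / N) * (C / N))\<close>
          \<open>2 * \<epsilon>\<^sup>2 * E N t \<le> 2 * \<epsilon>\<^sup>2 * (\<Sum>n=1..N. n * (cmod (u n t))\<^sup>2)\<close> by linarith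
    qed
  qed (use pos t in auto)
  have "((\<lambda>t. (cmod (u n t))\<^sup>2) \<longlongrightarrow> 0) at_top"
  proof (rule order_tendstoI)
    fix e :: real assume e: "e > 0"
    have "(\<lambda>N. (2 * K * C\<^sup>2 / (real N)\<^sup>2) / (2 * \<epsilon>\<^sup>2)) \<longlonglongrightarrow> 0"
      using pos by real_asymp
    then have "\<forall>\<^sub>F N in sequentially. (2 * K * C\<^sup>2 / (real N)\<^sup>2) / (2 * \<epsilon>\<^sup>2) < e / (2 * n)"
      using e n by (intro order_tendstoD) auto
    moreover have "\<forall>\<^sub>F N in sequentially. N \<ge> n"
      by (rule eventually_ge_at_top)
    ultimately obtain N where N: "(2 * K * C\<^sup>2 / (real N)\<^sup>2) / (2 * \<epsilon>\<^sup>2) < e / (2 * n)" "N \<ge> n"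
      using eventually_happens'[OF sequentially_bot eventually_conj] by blast
    define c where "c = (2 * K * C\<^sup>2 / (real N)\<^sup>2) / (2 * \<epsilon>\<^sup>2)"
    have "((\<lambda>t. exp (- (2 * \<epsilon>\<^sup>2) * (t - 1)) * (E N 1 - c)) \<longlongrightarrow> 0) at_top"
      using pos by real_asymp
    then have "\<forall>\<^sub>F t in at_top. exp (- (2 * \<epsilon>\<^sup>2) * (t - 1)) * (E N 1 - c) < e / (2 * n)"
      using e n by (intro order_tendstoD) auto
    then show "\<forall>\<^sub>F t in at_top. (cmod (u n t))\<^sup>2 < e"
      using eventually_ge_at_top[of 1]
    proof eventually_elim
      case (elim t)
      have "(cmod (u n t))\<^sup>2 / n \<le> E N t"
        unfolding E_def using N n by (intro member_le_sum[where f = "\<lambda>n. (cmod (u n t))\<^sup>2 / real n"]) auto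
      also have "\<dots> < e / (2 * n) + e / (2 * n)"
        using est[of N t] elim N n by (simp add: c_def)
      finally show ?case
        using n by (simp add: field_simps)
    qed
  qed (auto intro!: always_eventually elim: less_le_trans)
  then have "((\<lambda>t. sqrt ((cmod (u n t))\<^sup>2)) \<longlongrightarrow> sqrt 0) at_top"
    by (rule tendsto_real_sqrt)
  then show ?thesis
    by (simp add: tendsto_norm_zero_iff)
qed

end

section \<open>The von Mises distribution\<close>

definition von_mises_mass :: "real \<Rightarrow> real" where
  "von_mises_mass \<kappa> = (\<integral>\<theta>. indicator {-pi..pi} \<theta> * exp (\<kappa> * cos \<theta>) \<partial>lborel)"

definition von_mises :: "real \<Rightarrow> real measure" where
  "von_mises \<kappa> = density lborel (\<lambda>\<theta>. ennreal (indicator {-pi..pi} \<theta> * exp (\<kappa> * cos \<theta>) / von_mises_mass \<kappa>))"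

lemma integrable_von_mises:
  fixes f :: "real \<Rightarrow> 'a::{banach, second_countable_topology}"
  assumes "continuous_on {-pi..pi} f"
  shows "integrable lborel (\<lambda>\<theta>. indicator {-pi..pi} \<theta> *\<^sub>R f \<theta>)"
  using assms by (intro borel_integrable_compact) auto

lemma integrable_von_mises_density: "integrable lborel (\<lambda>\<theta>. indicator {-pi..pi} \<theta> * exp (\<kappa> * cos \<theta>))"
proof -
  have "continuous_on {-pi..pi} (\<lambda>\<theta>. exp (\<kappa> * cos \<theta>))"
    by (intro continuous_intros)
  from integrable_von_mises[OF this] show ?thesis
    by simp
qed

lemma von_mises_mass_pos: "von_mises_mass \<kappa> > 0"
proof -
  have "(\<integral>\<theta>. indicator {-pi..pi} \<theta> * exp (- \<bar>\<kappa>\<bar>) \<partial>lborel) \<le> von_mises_mass \<kappa>"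
    unfolding von_mises_mass_def
  proof (rule integral_mono)
    show "integrable lborel (\<lambda>\<theta>. indicator {-pi..pi} \<theta> * exp (- \<bar>\<kappa>\<bar>))"
      using integrable_von_mises[of "\<lambda>_. exp (- \<bar>\<kappa>\<bar>)"] by simp
    show "integrable lborel (\<lambda>\<theta>. indicator {-pi..pi} \<theta> * exp (\<kappa> * cos \<theta>))"
      by (rule integrable_von_mises_density)
    show "indicator {-pi..pi} \<theta> * exp (- \<bar>\<kappa>\<bar>) \<le> indicator {-pi..pi} \<theta> * exp (\<kappa> * cos \<theta>)" for \<theta>
    proof (intro mult_left_mono)
      have "\<bar>\<kappa> * cos \<theta>\<bar> \<le> \<bar>\<kappa>\<bar> * 1"
        unfolding abs_mult by (intro mult_left_mono) auto
      then show "exp (- \<bar>\<kappa>\<bar>) \<le> exp (\<kappa> * cos \<theta>)"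
        by simp
    qed simp
  qed
  moreover have "(\<integral>\<theta>. indicator {-pi..pi} \<theta> * exp (- \<bar>\<kappa>\<bar>) \<partial>lborel) = 2 * pi * exp (- \<bar>\<kappa>\<bar>)"
    by simp
  ultimately show ?thesis
    using pi_gt_zero by (smt (verit) exp_gt_zero mult_pos_pos)
qed

lemma integral_von_mises:
  fixes f :: "real \<Rightarrow> 'a::{banach, second_countable_topology}"
  assumes [measurable]: "f \<in> borel_measurable borel"
  shows "(\<integral>\<theta>. f \<theta> \<partial>von_mises \<kappa>) = (\<integral>\<theta>. indicator {-pi..pi} \<theta> *\<^sub>R exp (\<kappa> * cos \<theta>) *\<^sub>R f \<theta> \<partial>lborel) /\<^sub>R von_mises_mass \<kappa>"
proof -
  have "(\<integral>\<theta>. f \<theta> \<partial>von_mises \<kappa>) = (\<integral>\<theta>. (indicator {-pi..pi} \<theta> * exp (\<kappa> * cos \<theta>) / von_mises_mass \<kappa>) *\<^sub>R f \<theta> \<partial>lborel)"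
    unfolding von_mises_def using von_mises_mass_pos[of \<kappa>]
    by (intro integral_density) (auto intro!: AE_I2)
  also have "\<dots> = (\<integral>\<theta>. (1 / von_mises_mass \<kappa>) *\<^sub>R (indicator {-pi..pi} \<theta> *\<^sub>R exp (\<kappa> * cos \<theta>) *\<^sub>R f \<theta>) \<partial>lborel)"
    by (intro Bochner_Integration.integral_cong) simp_all
  also have "\<dots> = (1 / von_mises_mass \<kappa>) *\<^sub>R (\<integral>\<theta>. indicator {-pi..pi} \<theta> *\<^sub>R exp (\<kappa> * cos \<theta>) *\<^sub>R f \<theta> \<partial>lborel)"
    by (rule integral_scaleR_right)
  finally show ?thesis
    by (simp add: inverse_eq_divide)
qed

lemma prob_space_von_mises: "prob_space (von_mises \<kappa>)"
proof
  have "emeasure (von_mises \<kappa>) (space (von_mises \<kappa>)) = (\<integral>\<^sup>+\<theta>. ennreal (indicator {-pi..pi} \<theta> * exp (\<kappa> * cos \<theta>) / von_mises_mass \<kappa>) \<partial>lborel)"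
    by (simp add: von_mises_def emeasure_density)
  also have "\<dots> = ennreal (\<integral>\<theta>. indicator {-pi..pi} \<theta> * exp (\<kappa> * cos \<theta>) / von_mises_mass \<kappa> \<partial>lborel)"
    using integrable_von_mises_density[of \<kappa>] von_mises_mass_pos[of \<kappa>]
    by (intro nn_integral_eq_integral) auto
  also have "\<dots> = ennreal (von_mises_mass \<kappa> / von_mises_mass \<kappa>)"
    by (simp add: von_mises_mass_def)
  finally show "emeasure (von_mises \<kappa>) (space (von_mises \<kappa>)) = 1"
    using von_mises_mass_pos[of \<kappa>] by simp
qed

lemma sets_von_mises [simp, measurable_cong]: "sets (von_mises \<kappa>) = sets borel"
  by (simp add: von_mises_def)

definition von_mises_moment :: "real \<Rightarrow> nat \<Rightarrow> complex" where
  "von_mises_moment \<kappa> n = (\<integral>\<theta>. cis (real n * \<theta>) \<partial>von_mises \<kappa>)"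

lemma von_mises_moment_0: "von_mises_moment \<kappa> 0 = 1"
  using prob_space.prob_space[OF prob_space_von_mises] by (simp add: von_mises_moment_def)

lemma cmod_von_mises_moment: "cmod (von_mises_moment \<kappa> n) \<le> 1"
proof -
  interpret prob_space "von_mises \<kappa>"
    by (rule prob_space_von_mises)
  show ?thesis
    using integral_norm_bound[of "von_mises \<kappa>" "\<lambda>\<theta>. cis (real n * \<theta>)"] by (simp add: von_mises_moment_def prob_space)
qed

text \<open>Integration by parts: exp (\<kappa> cos \<theta>) cis (n \<theta>) agrees at both ends
  of the period, so its derivative integrates to zero. After multiplication by 2 i, the sine becomes
  the difference of the neighbouring moments. The result is the moment hierarchy at rest.\<close>

lemma von_mises_moment_recursion:
  assumes "n > 0"
  shows "complex_of_real \<kappa> * (von_mises_moment \<kappa> (n - 1) - von_mises_moment \<kappa> (Suc n)) = 2 * of_nat n * von_mises_moment \<kappa> n"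
proof -
  define I where "I f = (\<integral>\<theta>. indicator {-pi..pi} \<theta> *\<^sub>R exp (\<kappa> * cos \<theta>) *\<^sub>R (f \<theta> :: complex) \<partial>lborel)" for f
  have I: "integrable lborel (\<lambda>\<theta>. indicator {-pi..pi} \<theta> *\<^sub>R exp (\<kappa> * cos \<theta>) *\<^sub>R f \<theta>)" if "continuous_on UNIV f" for f :: "real \<Rightarrow> complex"
    by (intro integrable_von_mises continuous_intros continuous_on_subset[OF that]) auto
  have m: "von_mises_moment \<kappa> k = I (\<lambda>\<theta>. cis (k * \<theta>)) /\<^sub>R von_mises_mass \<kappa>" for k
    unfolding von_mises_moment_def I_def by (rule integral_von_mises) measurable
  define f where "f \<theta> = - complex_of_real (\<kappa> * sin \<theta>) * cis (n * \<theta>) + \<i> * of_nat n * cis (n * \<theta>)" for \<theta> :: real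
  have "has_bochner_integral lborel (\<lambda>\<theta>. indicator {-pi..pi} \<theta> *\<^sub>R (exp (\<kappa> * cos \<theta>) *\<^sub>R f \<theta>))
      (exp (\<kappa> * cos pi) *\<^sub>R cis (n * pi) - exp (\<kappa> * cos (- pi)) *\<^sub>R cis (n * (- pi)))"
  proof (rule has_bochner_integral_FTC_Icc)
    fix \<theta> :: real
    have "((\<lambda>\<theta>. exp (\<kappa> * cos \<theta>)) has_real_derivative - (\<kappa> * sin \<theta>) * exp (\<kappa> * cos \<theta>)) (at \<theta> within {-pi..pi})"
      by (auto intro!: derivative_eq_intros)
    moreover have "((\<lambda>\<theta>. cis (n * \<theta>)) has_vector_derivative \<i> * of_nat n * cis (n * \<theta>)) (at \<theta> within {-pi..pi})"
      by (auto intro!: derivative_eq_intros simp: has_vector_derivative_def scaleR_conv_of_real)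
    ultimately show "((\<lambda>\<theta>. exp (\<kappa> * cos \<theta>) *\<^sub>R cis (n * \<theta>)) has_vector_derivative exp (\<kappa> * cos \<theta>) *\<^sub>R f \<theta>) (at \<theta> within {-pi..pi})"
      by (rule has_vector_derivative_eq_rhs[OF has_vector_derivative_scaleR])
        (simp add: f_def scaleR_conv_of_real algebra_simps)
  next
    show "continuous_on {-pi..pi} (\<lambda>\<theta>. exp (\<kappa> * cos \<theta>) *\<^sub>R f \<theta>)"
      unfolding f_def by (intro continuous_intros)
  qed simp
  moreover have "cis (n * (- pi)) = cis (n * pi)"
    by (simp add: complex_eq_iff)
  ultimately have "I f = 0"
    by (simp add: I_def has_bochner_integral_integral_eq)
  have "complex_of_real \<kappa> * (I (\<lambda>\<theta>. cis ((n - 1) * \<theta>)) - I (\<lambda>\<theta>. cis (Suc n * \<theta>))) - 2 * of_nat n * I (\<lambda>\<theta>. cis (n * \<theta>)) =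
      (\<integral>\<theta>. complex_of_real \<kappa> * (indicator {-pi..pi} \<theta> *\<^sub>R exp (\<kappa> * cos \<theta>) *\<^sub>R cis ((n - 1) * \<theta>)
        - indicator {-pi..pi} \<theta> *\<^sub>R exp (\<kappa> * cos \<theta>) *\<^sub>R cis (Suc n * \<theta>))
        - 2 * of_nat n * (indicator {-pi..pi} \<theta> *\<^sub>R exp (\<kappa> * cos \<theta>) *\<^sub>R cis (n * \<theta>)) \<partial>lborel)"
  proof -
    define A where "A c \<theta> = indicator {-pi..pi} \<theta> *\<^sub>R exp (\<kappa> * cos \<theta>) *\<^sub>R cis (c * \<theta>)" for c \<theta>
    have "integrable lborel (A c)" for c
      unfolding A_def by (intro I continuous_intros)
    then show ?thesis
      unfolding I_def A_def[symmetric] by simp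
  qed
  also have "\<dots> = (\<integral>\<theta>. 2 * \<i> * (indicator {-pi..pi} \<theta> *\<^sub>R exp (\<kappa> * cos \<theta>) *\<^sub>R f \<theta>) \<partial>lborel)"
  proof (intro Bochner_Integration.integral_cong refl)
    fix \<theta> :: real
    have "cis ((n - 1) * \<theta>) = cis (n * \<theta>) * cis (- \<theta>)" "cis (Suc n * \<theta>) = cis (n * \<theta>) * cis \<theta>"
      using assms by (simp_all add: cis_mult algebra_simps of_nat_diff)
    moreover have "cis (- \<theta>) - cis \<theta> = - 2 * \<i> * sin \<theta>"
      by (simp add: complex_eq_iff)
    ultimately have "cis ((n - 1) * \<theta>) - cis (Suc n * \<theta>) = cis (n * \<theta>) * (- 2 * \<i> * sin \<theta>)"
      by (metis right_diff_distrib)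
    note e = this
    show "complex_of_real \<kappa> * (indicator {-pi..pi} \<theta> *\<^sub>R exp (\<kappa> * cos \<theta>) *\<^sub>R cis ((n - 1) * \<theta>)
        - indicator {-pi..pi} \<theta> *\<^sub>R exp (\<kappa> * cos \<theta>) *\<^sub>R cis (Suc n * \<theta>))
        - 2 * of_nat n * (indicator {-pi..pi} \<theta> *\<^sub>R exp (\<kappa> * cos \<theta>) *\<^sub>R cis (n * \<theta>)) =
      2 * \<i> * (indicator {-pi..pi} \<theta> *\<^sub>R exp (\<kappa> * cos \<theta>) *\<^sub>R f \<theta>)"
      unfolding scaleR_diff_right[symmetric] e by (simp add: f_def scaleR_conv_of_real algebra_simps)
  qed
  also have "\<dots> = 2 * \<i> * I f"
    unfolding I_def by (rule integral_mult_right_zero)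
  also have "\<dots> = 0"
    by (simp add: \<open>I f = 0\<close>)
  finally have "complex_of_real \<kappa> * (I (\<lambda>\<theta>. cis ((n - 1) * \<theta>)) - I (\<lambda>\<theta>. cis (Suc n * \<theta>))) = 2 * of_nat n * I (\<lambda>\<theta>. cis (n * \<theta>))"
    by simp
  then show ?thesis
    unfolding m scaleR_diff_right[symmetric] mult_scaleR_right by simp
qed

section \<open>Evolution of moments\<close>

lemma vector_derivative_lipschitz:
  fixes f :: "real \<Rightarrow> 'a::real_normed_vector"
  assumes "\<And>t. t \<ge> 0 \<Longrightarrow> (f has_vector_derivative f' t) (at t within {0..})"
    and "\<And>t. t \<ge> 0 \<Longrightarrow> norm (f' t) \<le> C" and "s \<ge> 0" "t \<ge> 0"
  shows "norm (f s - f t) \<le> C * norm (s - t)"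
proof (rule differentiable_bound[where S = "{0..}" and f' = "\<lambda>t h. h *\<^sub>R f' t"])
  show "(f has_derivative (\<lambda>h. h *\<^sub>R f' t)) (at t within {0..})" if "t \<in> {0..}" for t
    using assms(1)[of t] that by (simp add: has_vector_derivative_def)
  show "onorm (\<lambda>h. h *\<^sub>R f' t) \<le> C" if "t \<in> {0..}" for t
  proof (rule onorm_le)
    fix h :: real
    have "\<bar>h\<bar> * norm (f' t) \<le> \<bar>h\<bar> * C"
      using assms(2)[of t] that by (intro mult_left_mono) auto
    then show "norm (h *\<^sub>R f' t) \<le> C * norm h"
      by (simp add: mult.commute)
  qed
qed (use assms in auto)

text \<open>The bound on the derivative makes the paths Lipschitz, so the normalized remainders are
  dominated by 2 C and converge to 0 pathwise. The factor \<open>W\<close> does not vary in time; it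
  will be a phase of the noise at a fixed later time.\<close>

lemma (in prob_space) expectation_has_vector_derivative:
  fixes Y D :: "real \<Rightarrow> 'a \<Rightarrow> complex"
  assumes W [measurable]: "W \<in> borel_measurable M" and W1: "\<And>\<omega>. cmod (W \<omega>) \<le> 1"
    and Y: "\<And>t. t \<ge> 0 \<Longrightarrow> Y t \<in> borel_measurable M" and D: "\<And>t. t \<ge> 0 \<Longrightarrow> D t \<in> borel_measurable M"
    and deriv: "AE \<omega> in M. \<forall>t\<ge>0. ((\<lambda>t. Y t \<omega>) has_vector_derivative D t \<omega>) (at t within {0..}) \<and> cmod (Y t \<omega>) \<le> B \<and> cmod (D t \<omega>) \<le> C"
    and t: "t \<ge> 0"
  shows "((\<lambda>t. \<integral>\<omega>. W \<omega> * Y t \<omega> \<partial>M) has_vector_derivative (\<integral>\<omega>. W \<omega> * D t \<omega> \<partial>M)) (at t within {0..})"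
proof -
  have [measurable]: "D t \<in> borel_measurable M" "Y t \<in> borel_measurable M"
    using D Y t by auto
  have intY: "integrable M (\<lambda>\<omega>. W \<omega> * Y s \<omega>)" if "s \<ge> 0" for s
  proof (rule integrable_const_bound[of _ "1 * B"])
    show "AE \<omega> in M. norm (W \<omega> * Y s \<omega>) \<le> 1 * B"
      using deriv unfolding norm_mult by eventually_elim (intro mult_mono W1, use that in auto)
    show "(\<lambda>\<omega>. W \<omega> * Y s \<omega>) \<in> borel_measurable M"
      using Y[OF that] by simp
  qed
  have intD: "integrable M (\<lambda>\<omega>. W \<omega> * D t \<omega>)"
  proof (rule integrable_const_bound[of _ "1 * C"])
    show "AE \<omega> in M. norm (W \<omega> * D t \<omega>) \<le> 1 * C"
      using deriv unfolding norm_mult by eventually_elim (intro mult_mono W1, use t in auto)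
  qed measurable
  have "((\<lambda>s. norm ((\<integral>\<omega>. W \<omega> * Y s \<omega> \<partial>M) - (\<integral>\<omega>. W \<omega> * Y t \<omega> \<partial>M) - (s - t) *\<^sub>R (\<integral>\<omega>. W \<omega> * D t \<omega> \<partial>M)) / norm (s - t)) \<longlongrightarrow> 0) (at t within {0..})"
    unfolding tendsto_at_iff_sequentially comp_def
  proof (intro allI impI)
    fix X :: "nat \<Rightarrow> real" assume X: "\<forall>i. X i \<in> {0..} - {t}" "X \<longlonglongrightarrow> t"
    then have X0: "X i \<ge> 0" "X i \<noteq> t" for i
      by auto
    have [measurable]: "Y (X i) \<in> borel_measurable M" for i
      using Y X0 by auto
    define q where "q i \<omega> = cmod (Y (X i) \<omega> - Y t \<omega> - (X i - t) *\<^sub>R D t \<omega>) / norm (X i - t)" for i \<omega>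
    have q_bound: "AE \<omega> in M. norm (q i \<omega>) \<le> 2 * C" for i
      using deriv
    proof eventually_elim
      case (elim \<omega>)
      have "cmod (Y (X i) \<omega> - Y t \<omega> - (X i - t) *\<^sub>R D t \<omega>) \<le> cmod (Y (X i) \<omega> - Y t \<omega>) + norm (X i - t) * cmod (D t \<omega>)"
        using norm_triangle_ineq4[of "Y (X i) \<omega> - Y t \<omega>" "(X i - t) *\<^sub>R D t \<omega>"] by simp
      also have "\<dots> \<le> C * norm (X i - t) + norm (X i - t) * C"
        using elim X0[of i] t by (intro add_mono mult_left_mono vector_derivative_lipschitz[where f' = "\<lambda>t. D t \<omega>"]) auto
      finally show ?case
        using X0(2)[of i] by (simp add: q_def field_simps)
    qed
    have "(\<lambda>i. \<integral>\<omega>. q i \<omega> \<partial>M) \<longlonglongrightarrow> (\<integral>\<omega>. 0 \<partial>M)"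
    proof (rule integral_dominated_convergence[where w = "\<lambda>_. 2 * C"])
      show "AE \<omega> in M. (\<lambda>i. q i \<omega>) \<longlonglongrightarrow> 0"
        using deriv
      proof eventually_elim
        case (elim \<omega>)
        then have "((\<lambda>s. norm (Y s \<omega> - Y t \<omega> - (s - t) *\<^sub>R D t \<omega>) / norm (s - t)) \<longlongrightarrow> 0) (at t within {0..})"
          using t unfolding has_vector_derivative_def has_derivative_iff_norm by blast
        then show ?case
          using X unfolding tendsto_at_iff_sequentially comp_def q_def by blast
      qed
      show "AE \<omega> in M. norm (q i \<omega>) \<le> 2 * C" for i
        by (rule q_bound)
    qed (auto simp: q_def)
    then have lim: "(\<lambda>i. \<integral>\<omega>. q i \<omega> \<partial>M) \<longlonglongrightarrow> 0"
      by simp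
    show "(\<lambda>i. norm ((\<integral>\<omega>. W \<omega> * Y (X i) \<omega> \<partial>M) - (\<integral>\<omega>. W \<omega> * Y t \<omega> \<partial>M) - (X i - t) *\<^sub>R (\<integral>\<omega>. W \<omega> * D t \<omega> \<partial>M)) / norm (X i - t)) \<longlonglongrightarrow> 0"
    proof (rule Lim_null_comparison[OF always_eventually lim], rule allI)
      fix i
      have "(\<integral>\<omega>. W \<omega> * Y (X i) \<omega> \<partial>M) - (\<integral>\<omega>. W \<omega> * Y t \<omega> \<partial>M) - (X i - t) *\<^sub>R (\<integral>\<omega>. W \<omega> * D t \<omega> \<partial>M) =
        (\<integral>\<omega>. W \<omega> * Y (X i) \<omega> - W \<omega> * Y t \<omega> - (X i - t) *\<^sub>R (W \<omega> * D t \<omega>) \<partial>M)"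
        using intY[of t] intY[of "X i"] intD t X0[of i] by simp
      also have "norm \<dots> \<le> (\<integral>\<omega>. norm (X i - t) * q i \<omega> \<partial>M)"
      proof (rule order_trans[OF integral_norm_bound integral_mono])
        show "integrable M (\<lambda>\<omega>. cmod (W \<omega> * Y (X i) \<omega> - W \<omega> * Y t \<omega> - (X i - t) *\<^sub>R (W \<omega> * D t \<omega>)))"
          using intY[of t] intY[of "X i"] intD t X0[of i] by simp
        have "integrable M (q i)"
          by (rule integrable_const_bound[OF q_bound]) (simp add: q_def)
        then show "integrable M (\<lambda>\<omega>. norm (X i - t) * q i \<omega>)"
          by simp
        fix \<omega>
        have "W \<omega> * Y (X i) \<omega> - W \<omega> * Y t \<omega> - (X i - t) *\<^sub>R (W \<omega> * D t \<omega>) = W \<omega> * (Y (X i) \<omega> - Y t \<omega> - (X i - t) *\<^sub>R D t \<omega>)"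
          by (simp add: algebra_simps)
        also have "cmod \<dots> \<le> 1 * cmod (Y (X i) \<omega> - Y t \<omega> - (X i - t) *\<^sub>R D t \<omega>)"
          unfolding norm_mult by (intro mult_right_mono W1) auto
        finally show "cmod (W \<omega> * Y (X i) \<omega> - W \<omega> * Y t \<omega> - (X i - t) *\<^sub>R (W \<omega> * D t \<omega>)) \<le> norm (X i - t) * q i \<omega>"
          using X0(2)[of i] by (simp add: q_def)
      qed
      also have "\<dots> = norm (X i - t) * (\<integral>\<omega>. q i \<omega> \<partial>M)"
        by simp
      finally show "norm (norm ((\<integral>\<omega>. W \<omega> * Y (X i) \<omega> \<partial>M) - (\<integral>\<omega>. W \<omega> * Y t \<omega> \<partial>M) - (X i - t) *\<^sub>R (\<integral>\<omega>. W \<omega> * D t \<omega> \<partial>M)) / norm (X i - t)) \<le> (\<integral>\<omega>. q i \<omega> \<partial>M)"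
        using X0(2)[of i] by (simp add: divide_le_eq mult.commute)
    qed
  qed
  then show ?thesis
    unfolding has_vector_derivative_def has_derivative_iff_norm by (simp add: bounded_linear_scaleR_left)
qed

context brownian_pair
begin

text \<open>Setting \<open>Z\<close> to 0 where it exceeds the bound keeps it measurable with
  respect to the past and changes it on a null set only.\<close>

lemma expectation_difference_increment_AE:
  fixes Z :: "'w \<Rightarrow> complex"
  assumes sT: "0 \<le> s" "s \<le> T" and Z [measurable]: "Z \<in> borel_measurable (F s)" and B: "AE \<omega> in M. cmod (Z \<omega>) \<le> B" "B \<ge> 0"
  shows "(\<integral>\<omega>. Z \<omega> * cis (\<theta> * ((\<beta>\<^sub>1 T \<omega> - \<beta>\<^sub>2 T \<omega>) - (\<beta>\<^sub>1 s \<omega> - \<beta>\<^sub>2 s \<omega>))) \<partial>M) =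
    complex_of_real (exp (- \<theta>\<^sup>2 * (T - s))) * (\<integral>\<omega>. Z \<omega> \<partial>M)"
proof -
  define Z' where "Z' \<omega> = (if cmod (Z \<omega>) \<le> B then Z \<omega> else 0)" for \<omega>
  have Z'F: "Z' \<in> borel_measurable (F s)"
    unfolding Z'_def by measurable
  have [measurable]: "Z \<in> borel_measurable M" "Z' \<in> borel_measurable M"
    "\<beta>\<^sub>1 T \<in> borel_measurable M" "\<beta>\<^sub>2 T \<in> borel_measurable M" "\<beta>\<^sub>1 s \<in> borel_measurable M" "\<beta>\<^sub>2 s \<in> borel_measurable M"
    using measurable_F_M[OF Z sT(1)] measurable_F_M[OF Z'F sT(1)] sT
      brownian_motion_measurable(2)[OF brownian_1] brownian_motion_measurable(2)[OF brownian_2] by auto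
  have eq: "AE \<omega> in M. Z \<omega> = Z' \<omega>"
    using B(1) by eventually_elim (simp add: Z'_def)
  have "(\<integral>\<omega>. Z \<omega> * cis (\<theta> * ((\<beta>\<^sub>1 T \<omega> - \<beta>\<^sub>2 T \<omega>) - (\<beta>\<^sub>1 s \<omega> - \<beta>\<^sub>2 s \<omega>))) \<partial>M) =
      (\<integral>\<omega>. Z' \<omega> * cis (\<theta> * ((\<beta>\<^sub>1 T \<omega> - \<beta>\<^sub>2 T \<omega>) - (\<beta>\<^sub>1 s \<omega> - \<beta>\<^sub>2 s \<omega>))) \<partial>M)"
    using eq by (intro integral_cong_AE) auto
  also have "\<dots> = complex_of_real (exp (- \<theta>\<^sup>2 * (T - s))) * (\<integral>\<omega>. Z' \<omega> \<partial>M)"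
    by (rule expectation_difference_increment[OF sT Z'F, of B]) (simp add: Z'_def B(2))
  also have "(\<integral>\<omega>. Z' \<omega> \<partial>M) = (\<integral>\<omega>. Z \<omega> \<partial>M)"
    using eq by (intro integral_cong_AE) auto
  finally show ?thesis .
qed

text \<open>With \<open>T\<close> fixed, \<open>s \<mapsto> E (exp (i \<theta> b\<^sub>T) Y\<^sub>s)\<close> can be differentiated under the expectation, and
  conditioning on the past of \<open>s\<close> replaces \<open>exp (i \<theta> b\<^sub>T)\<close> by a multiple of \<open>exp (i \<theta> b\<^sub>s)\<close>. This
  replaces Ito's formula.\<close>

lemma phase_expectation_ode:
  fixes Y D :: "real \<Rightarrow> 'w \<Rightarrow> complex"
  assumes Y: "\<And>t. t \<ge> 0 \<Longrightarrow> Y t \<in> borel_measurable (F t)" and D: "\<And>t. t \<ge> 0 \<Longrightarrow> D t \<in> borel_measurable (F t)"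
    and deriv: "AE \<omega> in M. \<forall>t\<ge>0. ((\<lambda>t. Y t \<omega>) has_vector_derivative D t \<omega>) (at t within {0..}) \<and> cmod (Y t \<omega>) \<le> B \<and> cmod (D t \<omega>) \<le> C"
    and t: "t \<ge> 0"
  shows "((\<lambda>t. \<integral>\<omega>. cis (\<theta> * (\<beta>\<^sub>1 t \<omega> - \<beta>\<^sub>2 t \<omega>)) * Y t \<omega> \<partial>M) has_vector_derivative
    (\<integral>\<omega>. cis (\<theta> * (\<beta>\<^sub>1 t \<omega> - \<beta>\<^sub>2 t \<omega>)) * D t \<omega> \<partial>M) - complex_of_real (\<theta>\<^sup>2) * (\<integral>\<omega>. cis (\<theta> * (\<beta>\<^sub>1 t \<omega> - \<beta>\<^sub>2 t \<omega>)) * Y t \<omega> \<partial>M)) (at t within {0..})"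
proof -
  define b where "b t \<omega> = \<beta>\<^sub>1 t \<omega> - \<beta>\<^sub>2 t \<omega>" for t \<omega>
  have bF: "b s \<in> borel_measurable (F s)" if "s \<ge> 0" for s
    unfolding b_def using brownian_motion_measurable(1)[OF brownian_1 that order_refl]
      brownian_motion_measurable(1)[OF brownian_2 that order_refl] by measurable
  have bM: "b s \<in> borel_measurable M" if "s \<ge> 0" for s
    using measurable_F_M[OF bF that] that by simp
  \<comment> \<open>Any horizon beyond \<open>t\<close> serves: the derivative at \<open>t\<close>
    is a local matter, and the shift to the past is applied for times up to
    \<open>T\<close>.\<close>
  define T where "T = t + 1"
  have T: "T \<ge> 0" "t < T"
    using t by (simp_all add: T_def)
  have shift: "(\<integral>\<omega>. cis (\<theta> * b T \<omega>) * V s \<omega> \<partial>M) = complex_of_real (exp (- \<theta>\<^sup>2 * (T - s))) * (\<integral>\<omega>. cis (\<theta> * b s \<omega>) * V s \<omega> \<partial>M)"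
    if s: "0 \<le> s" "s \<le> T" and V: "V s \<in> borel_measurable (F s)" "AE \<omega> in M. cmod (V s \<omega>) \<le> B'" for s B' and V :: "real \<Rightarrow> 'w \<Rightarrow> complex"
  proof -
    note [measurable] = V(1) bF[OF s(1)]
    have "(\<integral>\<omega>. cis (\<theta> * b T \<omega>) * V s \<omega> \<partial>M) = (\<integral>\<omega>. (cis (\<theta> * b s \<omega>) * V s \<omega>) * cis (\<theta> * (b T \<omega> - b s \<omega>)) \<partial>M)"
    proof (intro Bochner_Integration.integral_cong refl)
      fix \<omega>
      have "cis (\<theta> * b T \<omega>) = cis (\<theta> * b s \<omega>) * cis (\<theta> * (b T \<omega> - b s \<omega>))"
        by (simp add: cis_mult algebra_simps)
      then show "cis (\<theta> * b T \<omega>) * V s \<omega> = (cis (\<theta> * b s \<omega>) * V s \<omega>) * cis (\<theta> * (b T \<omega> - b s \<omega>))"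
        by simp
    qed
    also have "\<dots> = complex_of_real (exp (- \<theta>\<^sup>2 * (T - s))) * (\<integral>\<omega>. cis (\<theta> * b s \<omega>) * V s \<omega> \<partial>M)"
      unfolding b_def
    proof (rule expectation_difference_increment_AE[OF s])
      show "(\<lambda>\<omega>. cis (\<theta> * (\<beta>\<^sub>1 s \<omega> - \<beta>\<^sub>2 s \<omega>)) * V s \<omega>) \<in> borel_measurable (F s)"
        unfolding b_def[symmetric] by measurable
      show "AE \<omega> in M. cmod (cis (\<theta> * (\<beta>\<^sub>1 s \<omega> - \<beta>\<^sub>2 s \<omega>)) * V s \<omega>) \<le> \<bar>B'\<bar>"
        using V(2) by eventually_elim (simp add: norm_mult)
    qed simp
    finally show ?thesis .
  qed
  define h where "h s = (\<integral>\<omega>. cis (\<theta> * b T \<omega>) * Y s \<omega> \<partial>M)" for s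
  define N where "N s = (\<integral>\<omega>. cis (\<theta> * b s \<omega>) * Y s \<omega> \<partial>M)" for s
  have [measurable]: "b T \<in> borel_measurable M"
    using bM T by simp
  have "(h has_vector_derivative (\<integral>\<omega>. cis (\<theta> * b T \<omega>) * D t \<omega> \<partial>M)) (at t within {0..})"
    unfolding h_def
  proof (rule expectation_has_vector_derivative[OF _ _ _ _ deriv t])
    show "Y t \<in> borel_measurable M" "D t \<in> borel_measurable M" if "t \<ge> 0" for t
      using measurable_F_M Y D that by blast+
  qed auto
  also have "(\<integral>\<omega>. cis (\<theta> * b T \<omega>) * D t \<omega> \<partial>M) = complex_of_real (exp (- \<theta>\<^sup>2 * (T - t))) * (\<integral>\<omega>. cis (\<theta> * b t \<omega>) * D t \<omega> \<partial>M)"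
    using deriv t T by (intro shift[of t D C] D) auto
  finally have h: "(h has_vector_derivative complex_of_real (exp (- \<theta>\<^sup>2 * (T - t))) * (\<integral>\<omega>. cis (\<theta> * b t \<omega>) * D t \<omega> \<partial>M)) (at t within {0..})" .
  have hN: "h s = complex_of_real (exp (- \<theta>\<^sup>2 * (T - s))) * N s" if "0 \<le> s" "s \<le> T" for s
    unfolding h_def N_def using deriv that by (intro shift[of s Y B] Y) auto
  have E: "((\<lambda>s. complex_of_real (exp (\<theta>\<^sup>2 * (T - s)))) has_vector_derivative complex_of_real (- \<theta>\<^sup>2 * exp (\<theta>\<^sup>2 * (T - t)))) (at t within {0..})"
    by (intro has_vector_derivative_of_real) (auto intro!: derivative_eq_intros simp flip: has_real_derivative_iff_has_vector_derivative)
  \<comment> \<open>The exponential undoes the factor produced by conditioning. Its own derivative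
    is the origin of the damping term \<open>- \<theta>\<^sup>2\<close>, which Ito's formula would
    produce as the second-order term.\<close>
  have "((\<lambda>s. complex_of_real (exp (\<theta>\<^sup>2 * (T - s))) * h s) has_vector_derivative
      (\<integral>\<omega>. cis (\<theta> * b t \<omega>) * D t \<omega> \<partial>M) - complex_of_real (\<theta>\<^sup>2) * N t) (at t within {0..})"
    using has_vector_derivative_mult[OF E h]
  proof (rule has_vector_derivative_eq_rhs)
    have ee: "complex_of_real (exp (\<theta>\<^sup>2 * (T - t))) * complex_of_real (exp (- \<theta>\<^sup>2 * (T - t))) = 1"
      by (simp flip: of_real_mult exp_add)
    have e2: "complex_of_real (exp (\<theta>\<^sup>2 * (T - t))) * h t = N t"
      by (simp only: hN[OF t less_imp_le[OF T(2)]] mult.assoc[symmetric] ee mult_1_left)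
    show "complex_of_real (exp (\<theta>\<^sup>2 * (T - t))) * (complex_of_real (exp (- \<theta>\<^sup>2 * (T - t))) * (\<integral>\<omega>. cis (\<theta> * b t \<omega>) * D t \<omega> \<partial>M)) +
        complex_of_real (- \<theta>\<^sup>2 * exp (\<theta>\<^sup>2 * (T - t))) * h t = (\<integral>\<omega>. cis (\<theta> * b t \<omega>) * D t \<omega> \<partial>M) - complex_of_real (\<theta>\<^sup>2) * N t"
      by (simp only: of_real_mult of_real_minus mult.assoc e2) (simp only: mult.assoc[symmetric] ee, simp)
  qed
  then have "((\<lambda>s. complex_of_real (exp (\<theta>\<^sup>2 * (T - s))) * h s) has_vector_derivative
      (\<integral>\<omega>. cis (\<theta> * b t \<omega>) * D t \<omega> \<partial>M) - complex_of_real (\<theta>\<^sup>2) * N t) (at t within {0..T})"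
    using at_within_atLeast[OF t T(2)] by simp
  then have "(N has_vector_derivative (\<integral>\<omega>. cis (\<theta> * b t \<omega>) * D t \<omega> \<partial>M) - complex_of_real (\<theta>\<^sup>2) * N t) (at t within {0..T})"
  proof (rule has_vector_derivative_transform[rotated 2])
    show "t \<in> {0..T}"
      using t T by simp
    fix s assume "s \<in> {0..T}"
    then have "h s = complex_of_real (exp (- \<theta>\<^sup>2 * (T - s))) * N s"
      by (intro hN) auto
    moreover have "complex_of_real (exp (\<theta>\<^sup>2 * (T - s))) * complex_of_real (exp (- \<theta>\<^sup>2 * (T - s))) = 1"
      by (simp flip: of_real_mult exp_add)
    ultimately show "N s = complex_of_real (exp (\<theta>\<^sup>2 * (T - s))) * h s"
      by (simp only: mult.assoc[symmetric] mult_1_left)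
  qed
  then show ?thesis
    unfolding N_def[abs_def] b_def using at_within_atLeast[OF t T(2)] by simp
qed

end

section \<open>The overlap process\<close>

text \<open>The overlap itself has paths as rough as the noise. The equation is therefore imposed on
  its product with the opposite noise phase, which is differentiable in time; this is the pathwise
  form of the Stratonovich equation.\<close>

locale overlap_process = brownian_pair M F \<beta>\<^sub>1 \<beta>\<^sub>2
  for M :: "'w measure" and F :: "real \<Rightarrow> 'w measure" and \<beta>\<^sub>1 \<beta>\<^sub>2 :: "real \<Rightarrow> 'w \<Rightarrow> real" +
  fixes K \<epsilon> :: real and z :: "real \<Rightarrow> 'w \<Rightarrow> complex" and z\<^sub>0 :: complex
  assumes K: "K > 0" and \<epsilon>: "\<epsilon> > 0"
    and z_measurable_F: "\<And>t. t \<ge> 0 \<Longrightarrow> z t \<in> borel_measurable (F t)"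
    and z_ode: "AE \<omega> in M. z 0 \<omega> = z\<^sub>0 \<and> continuous_on {0..} (\<lambda>t. z t \<omega>) \<and> (\<forall>t\<ge>0. cmod (z t \<omega>) \<le> 1 \<and>
      ((\<lambda>t. cis (- (\<epsilon> * (\<beta>\<^sub>1 t \<omega> - \<beta>\<^sub>2 t \<omega>))) * z t \<omega>) has_vector_derivative
        complex_of_real K * (cis (- (\<epsilon> * (\<beta>\<^sub>1 t \<omega> - \<beta>\<^sub>2 t \<omega>))) * (1 - (z t \<omega>)\<^sup>2))) (at t within {0..}))"
begin

lemma z_measurable: "t \<ge> 0 \<Longrightarrow> z t \<in> borel_measurable M"
  using measurable_F_M[OF z_measurable_F] .

lemma z_bound: "t \<ge> 0 \<Longrightarrow> AE \<omega> in M. cmod (z t \<omega>) \<le> 1"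
  using z_ode by eventually_elim auto

lemma integrable_polynomial:
  fixes R :: "'w \<Rightarrow> real"
  assumes t: "t \<ge> 0" and R: "R \<in> borel_measurable M" "AE \<omega> in M. 0 \<le> R \<omega> \<and> R \<omega> \<le> 1"
    and p: "continuous_on UNIV p" "\<And>w. cmod w \<le> 1 \<Longrightarrow> cmod (p w) \<le> B"
  shows "integrable M (\<lambda>\<omega>. complex_of_real (R \<omega>) * p (z t \<omega>))"
proof (rule integrable_const_bound[of _ "1 * B"])
  have [measurable]: "p \<in> borel_measurable borel" "z t \<in> borel_measurable M"
    using p(1) z_measurable[OF t] by (auto intro: borel_measurable_continuous_onI)
  note [measurable] = R(1)
  show "(\<lambda>\<omega>. complex_of_real (R \<omega>) * p (z t \<omega>)) \<in> borel_measurable M"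
    by measurable
  show "AE \<omega> in M. norm (complex_of_real (R \<omega>) * p (z t \<omega>)) \<le> 1 * B"
    using R(2) z_bound[OF t] unfolding norm_mult by eventually_elim (intro mult_mono p(2), auto)
qed

text \<open>The overlap is turned into a differentiable path \<open>c\<close> by the noise phase
  \<open>e\<close>, and \<open>phase_expectation_ode\<close> with frequency n \<epsilon> is applied
  to \<open>R\<close> times the n-th power of \<open>c\<close>, which turns the phase back. The
  weight \<open>R\<close> is 1 with \<open>a = 0\<close> for plain moments, and a power of the
  defect in the proof that |z| tends to 1.\<close>

lemma weighted_moment_ode:
  fixes R :: "real \<Rightarrow> 'w \<Rightarrow> real"
  assumes R: "\<And>t. t \<ge> 0 \<Longrightarrow> R t \<in> borel_measurable (F t)"
    and R_ode: "AE \<omega> in M. \<forall>t\<ge>0. 0 \<le> R t \<omega> \<and> R t \<omega> \<le> 1 \<and>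
      ((\<lambda>t. R t \<omega>) has_real_derivative - 2 * K * a * Re (z t \<omega>) * R t \<omega>) (at t within {0..})"
    and a: "a \<ge> 0" and t: "t \<ge> 0"
  shows "((\<lambda>t. \<integral>\<omega>. complex_of_real (R t \<omega>) * z t \<omega> ^ n \<partial>M) has_vector_derivative
    (\<integral>\<omega>. complex_of_real (R t \<omega>) * (of_nat n * complex_of_real K * z t \<omega> ^ (n - 1) * (1 - (z t \<omega>)\<^sup>2)
       - complex_of_real (2 * K * a * Re (z t \<omega>)) * z t \<omega> ^ n) \<partial>M)
    - complex_of_real ((real n * \<epsilon>)\<^sup>2) * (\<integral>\<omega>. complex_of_real (R t \<omega>) * z t \<omega> ^ n \<partial>M)) (at t within {0..})"
proof -
  define e where "e t \<omega> = cis (- (\<epsilon> * (\<beta>\<^sub>1 t \<omega> - \<beta>\<^sub>2 t \<omega>)))" for t \<omega>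
  define c where "c t \<omega> = e t \<omega> * z t \<omega>" for t \<omega>
  define Y where "Y t \<omega> = complex_of_real (R t \<omega>) * c t \<omega> ^ n" for t \<omega>
  define D where "D t \<omega> = complex_of_real (R t \<omega>) * (of_nat n * c t \<omega> ^ (n - 1) * (complex_of_real K * (e t \<omega> * (1 - (z t \<omega>)\<^sup>2))))
     + complex_of_real (- 2 * K * a * Re (z t \<omega>) * R t \<omega>) * c t \<omega> ^ n" for t \<omega>
  have eF: "e t \<in> borel_measurable (F t)" if "t \<ge> 0" for t
    unfolding e_def using brownian_motion_measurable(1)[OF brownian_1 that order_refl]
      brownian_motion_measurable(1)[OF brownian_2 that order_refl] by measurable
  have ode: "((\<lambda>t. \<integral>\<omega>. cis (real n * \<epsilon> * (\<beta>\<^sub>1 t \<omega> - \<beta>\<^sub>2 t \<omega>)) * Y t \<omega> \<partial>M) has_vector_derivative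
    (\<integral>\<omega>. cis (real n * \<epsilon> * (\<beta>\<^sub>1 t \<omega> - \<beta>\<^sub>2 t \<omega>)) * D t \<omega> \<partial>M) -
    complex_of_real ((real n * \<epsilon>)\<^sup>2) * (\<integral>\<omega>. cis (real n * \<epsilon> * (\<beta>\<^sub>1 t \<omega> - \<beta>\<^sub>2 t \<omega>)) * Y t \<omega> \<partial>M)) (at t within {0..})"
  proof (rule phase_expectation_ode[OF _ _ _ t])
    fix t :: real assume t: "t \<ge> 0"
    note [measurable] = R[OF t] z_measurable_F[OF t] eF[OF t]
    have [measurable]: "c t \<in> borel_measurable (F t)"
      unfolding c_def by measurable
    show "Y t \<in> borel_measurable (F t)" "D t \<in> borel_measurable (F t)"
      unfolding Y_def D_def by measurable
  next
    show "AE \<omega> in M. \<forall>t\<ge>0. ((\<lambda>t. Y t \<omega>) has_vector_derivative D t \<omega>) (at t within {0..}) \<and>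
        cmod (Y t \<omega>) \<le> 1 \<and> cmod (D t \<omega>) \<le> 2 * n * K + 2 * K * a"
      using z_ode R_ode
    proof eventually_elim
      case (elim \<omega>)
      show ?case
      proof (intro allI impI conjI)
        fix t :: real assume t: "t \<ge> 0"
        have "((\<lambda>t. c t \<omega>) has_vector_derivative complex_of_real K * (e t \<omega> * (1 - (z t \<omega>)\<^sup>2))) (at t within {0..})"
          using elim t unfolding c_def e_def by blast
        moreover have "((\<lambda>x. x ^ n) has_field_derivative of_nat n * c t \<omega> ^ (n - 1)) (at (c t \<omega>) within (\<lambda>t. c t \<omega>) ` {0..})"
          by (auto intro!: derivative_eq_intros)
        ultimately have cn: "((\<lambda>t. c t \<omega> ^ n) has_vector_derivative
            complex_of_real K * (e t \<omega> * (1 - (z t \<omega>)\<^sup>2)) * (of_nat n * c t \<omega> ^ (n - 1))) (at t within {0..})"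
          by (rule field_vector_diff_chain_within[unfolded comp_def])
        have Rd: "((\<lambda>t. complex_of_real (R t \<omega>)) has_vector_derivative complex_of_real (- 2 * K * a * Re (z t \<omega>) * R t \<omega>)) (at t within {0..})"
          using elim t by (intro has_vector_derivative_of_real) (simp add: has_real_derivative_iff_has_vector_derivative)
        show "((\<lambda>t. Y t \<omega>) has_vector_derivative D t \<omega>) (at t within {0..})"
          unfolding Y_def D_def using has_vector_derivative_mult[OF Rd cn]
          by (rule has_vector_derivative_eq_rhs) (simp add: mult_ac)
        have z1: "cmod (z t \<omega>) \<le> 1" and R01: "0 \<le> R t \<omega>" "R t \<omega> \<le> 1"
          using elim t by auto
        have c1: "cmod (c t \<omega> ^ k) \<le> 1" for k
          using z1 by (simp add: c_def e_def norm_mult norm_power power_le_one)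
        show "cmod (Y t \<omega>) \<le> 1"
          using mult_mono[OF R01(2) c1[of n]] R01 by (simp add: Y_def norm_mult)
        have "cmod (1 - (z t \<omega>)\<^sup>2) \<le> 2"
          using norm_triangle_ineq4[of 1 "(z t \<omega>)\<^sup>2"] z1 power_le_one[of "cmod (z t \<omega>)" 2] by (simp add: norm_power)
        moreover have "real n * cmod (c t \<omega> ^ (n - 1)) \<le> real n * 1"
          by (intro mult_left_mono c1) simp
        ultimately have "R t \<omega> * (n * cmod (c t \<omega> ^ (n - 1)) * (K * cmod (1 - (z t \<omega>)\<^sup>2))) \<le> 1 * (n * 1 * (K * 2))"
          using R01 K by (intro mult_mono[of "R t \<omega>" 1] mult_mono[of "real n * cmod (c t \<omega> ^ (n - 1))"]) auto
        moreover have "2 * K * a * \<bar>Re (z t \<omega>)\<bar> * R t \<omega> * cmod (c t \<omega> ^ n) \<le> 2 * K * a * 1 * 1 * 1"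
          using R01 c1 K a z1 abs_Re_le_cmod[of "z t \<omega>"] by (intro mult_mono) auto
        ultimately have *: "R t \<omega> * (n * cmod (c t \<omega> ^ (n - 1)) * (K * cmod (1 - (z t \<omega>)\<^sup>2))) +
            2 * K * a * \<bar>Re (z t \<omega>)\<bar> * R t \<omega> * cmod (c t \<omega> ^ n) \<le> 2 * n * K + 2 * K * a"
          by linarith
        show "cmod (D t \<omega>) \<le> 2 * n * K + 2 * K * a"
        proof -
          have "cmod (complex_of_real (R t \<omega>) * (of_nat n * c t \<omega> ^ (n - 1) * (complex_of_real K * (e t \<omega> * (1 - (z t \<omega>)\<^sup>2))))) =
              R t \<omega> * (n * cmod (c t \<omega> ^ (n - 1)) * (K * cmod (1 - (z t \<omega>)\<^sup>2)))"
            using K R01 by (simp add: norm_mult e_def)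
          moreover have "cmod (complex_of_real (- 2 * K * a * Re (z t \<omega>) * R t \<omega>) * c t \<omega> ^ n) =
              2 * K * a * \<bar>Re (z t \<omega>)\<bar> * R t \<omega> * cmod (c t \<omega> ^ n)"
            using K a R01 by (simp add: norm_mult abs_mult)
          ultimately show ?thesis
            using * norm_triangle_ineq[of "complex_of_real (R t \<omega>) * (of_nat n * c t \<omega> ^ (n - 1) * (complex_of_real K * (e t \<omega> * (1 - (z t \<omega>)\<^sup>2))))"
              "complex_of_real (- 2 * K * a * Re (z t \<omega>) * R t \<omega>) * c t \<omega> ^ n"]
            unfolding D_def by linarith
        qed
      qed
    qed
  qed
  have cis_e: "cis (real n * \<epsilon> * (\<beta>\<^sub>1 t \<omega> - \<beta>\<^sub>2 t \<omega>)) * e t \<omega> ^ n = 1" for t \<omega>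
    by (simp add: e_def Complex.DeMoivre cis_mult algebra_simps)
  have Yeq: "cis (real n * \<epsilon> * (\<beta>\<^sub>1 t \<omega> - \<beta>\<^sub>2 t \<omega>)) * Y t \<omega> = complex_of_real (R t \<omega>) * z t \<omega> ^ n" for t \<omega>
  proof -
    have "cis (real n * \<epsilon> * (\<beta>\<^sub>1 t \<omega> - \<beta>\<^sub>2 t \<omega>)) * Y t \<omega> =
        (cis (real n * \<epsilon> * (\<beta>\<^sub>1 t \<omega> - \<beta>\<^sub>2 t \<omega>)) * e t \<omega> ^ n) * (complex_of_real (R t \<omega>) * z t \<omega> ^ n)"
      by (simp add: Y_def c_def power_mult_distrib mult_ac)
    then show ?thesis
      by (simp add: cis_e)
  qed
  have Deq: "cis (real n * \<epsilon> * (\<beta>\<^sub>1 t \<omega> - \<beta>\<^sub>2 t \<omega>)) * D t \<omega> = complex_of_real (R t \<omega>) * (of_nat n * complex_of_real K * z t \<omega> ^ (n - 1) * (1 - (z t \<omega>)\<^sup>2)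
       - complex_of_real (2 * K * a * Re (z t \<omega>)) * z t \<omega> ^ n)" for t \<omega>
  proof -
    \<comment> \<open>The phase in the derivative of \<open>c\<close> completes the power n - 1 to
      n. For n = 0 the exponent \<open>n - 1\<close> is truncated, but the term carries the factor
      n.\<close>
    have "D t \<omega> = e t \<omega> ^ n * (complex_of_real (R t \<omega>) * (of_nat n * complex_of_real K * z t \<omega> ^ (n - 1) * (1 - (z t \<omega>)\<^sup>2)
       - complex_of_real (2 * K * a * Re (z t \<omega>)) * z t \<omega> ^ n))"
      by (cases n) (simp_all add: D_def c_def power_mult_distrib algebra_simps)
    then have "cis (real n * \<epsilon> * (\<beta>\<^sub>1 t \<omega> - \<beta>\<^sub>2 t \<omega>)) * D t \<omega> =
       (cis (real n * \<epsilon> * (\<beta>\<^sub>1 t \<omega> - \<beta>\<^sub>2 t \<omega>)) * e t \<omega> ^ n) * (complex_of_real (R t \<omega>) * (of_nat n * complex_of_real K * z t \<omega> ^ (n - 1) * (1 - (z t \<omega>)\<^sup>2)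
       - complex_of_real (2 * K * a * Re (z t \<omega>)) * z t \<omega> ^ n))"
      by (simp only: mult.assoc)
    then show ?thesis
      by (simp only: cis_e mult_1_left)
  qed
  show ?thesis
    using ode unfolding Yeq Deq .
qed

section \<open>The moments of the overlap\<close>

lemma integrable_power:
  assumes "t \<ge> 0"
  shows "integrable M (\<lambda>\<omega>. z t \<omega> ^ n)"
proof -
  have "continuous_on UNIV (\<lambda>w::complex. w ^ n)"
    by (intro continuous_intros)
  from integrable_polynomial[OF assms _ _ this, of "\<lambda>_. 1" 1] show ?thesis
    by (simp add: norm_power power_le_one)
qed

lemma moment_bound:
  assumes "t \<ge> 0"
  shows "cmod (\<integral>\<omega>. z t \<omega> ^ n \<partial>M) \<le> 1"
proof -
  have "cmod (\<integral>\<omega>. z t \<omega> ^ n \<partial>M) \<le> (\<integral>\<omega>. cmod (z t \<omega> ^ n) \<partial>M)"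
    by (rule integral_norm_bound)
  also have "\<dots> \<le> (\<integral>\<omega>. 1 \<partial>M)"
  proof (rule integral_mono_AE)
    show "AE \<omega> in M. cmod (z t \<omega> ^ n) \<le> 1"
      using z_bound[OF assms] by eventually_elim (simp add: norm_power power_le_one)
  qed (use integrable_power[OF assms] in auto)
  finally show ?thesis
    by (simp add: prob_space)
qed

lemma moment_ode:
  assumes n: "n > 0" and t: "t \<ge> 0"
  shows "((\<lambda>t. \<integral>\<omega>. z t \<omega> ^ n \<partial>M) has_vector_derivative
    complex_of_real (n * K) * ((\<integral>\<omega>. z t \<omega> ^ (n - 1) \<partial>M) - (\<integral>\<omega>. z t \<omega> ^ Suc n \<partial>M))
      - complex_of_real (\<epsilon>\<^sup>2 * n\<^sup>2) * (\<integral>\<omega>. z t \<omega> ^ n \<partial>M)) (at t within {0..})"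
proof -
  have "((\<lambda>t. \<integral>\<omega>. complex_of_real 1 * z t \<omega> ^ n \<partial>M) has_vector_derivative
    (\<integral>\<omega>. complex_of_real 1 * (of_nat n * complex_of_real K * z t \<omega> ^ (n - 1) * (1 - (z t \<omega>)\<^sup>2)
       - complex_of_real (2 * K * 0 * Re (z t \<omega>)) * z t \<omega> ^ n) \<partial>M)
    - complex_of_real ((real n * \<epsilon>)\<^sup>2) * (\<integral>\<omega>. complex_of_real 1 * z t \<omega> ^ n \<partial>M)) (at t within {0..})"
    by (rule weighted_moment_ode[OF _ _ _ t]) auto
  moreover have "(\<integral>\<omega>. of_nat n * complex_of_real K * z t \<omega> ^ (n - 1) * (1 - (z t \<omega>)\<^sup>2) \<partial>M) =
      complex_of_real (n * K) * ((\<integral>\<omega>. z t \<omega> ^ (n - 1) \<partial>M) - (\<integral>\<omega>. z t \<omega> ^ Suc n \<partial>M))"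
  proof -
    have "of_nat n * complex_of_real K * w ^ (n - 1) * (1 - w\<^sup>2) = complex_of_real (n * K) * (w ^ (n - 1) - w ^ Suc n)" for w
      using n by (cases n) (simp_all add: algebra_simps power2_eq_square)
    then show ?thesis
      using integrable_power[OF t, of "n - 1"] integrable_power[OF t, of "Suc n"]
      by (simp only:) (simp del: power_Suc)
  qed
  ultimately show ?thesis
    by (simp add: power_mult_distrib mult.commute)
qed

text \<open>The von Mises moments with parameter 2 K / \<epsilon>^2 are a stationary solution of the
  same hierarchy, so the differences satisfy the homogeneous one, are bounded by 2 and vanish at
  level 0.\<close>

lemma moment_tendsto:
  "((\<lambda>t. \<integral>\<omega>. z t \<omega> ^ n \<partial>M) \<longlongrightarrow> von_mises_moment (2 * K / \<epsilon>\<^sup>2) n) at_top"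
proof (cases "n = 0")
  case True
  then show ?thesis
    by (simp add: von_mises_moment_0 prob_space)
next
  case False
  define m where "m = von_mises_moment (2 * K / \<epsilon>\<^sup>2)"
  define u where "u n t = (\<integral>\<omega>. z t \<omega> ^ n \<partial>M) - m n" for n t
  have "(u n \<longlongrightarrow> 0) at_top"
  proof (rule hierarchy_tendsto_0[OF K \<epsilon>])
    show "u 0 t = 0" for t
      by (simp add: u_def m_def von_mises_moment_0 prob_space)
    show "cmod (u n t) \<le> 2" if "t \<ge> 0" for n t
      using norm_triangle_ineq4[of "\<integral>\<omega>. z t \<omega> ^ n \<partial>M" "m n"] moment_bound[OF that, of n] cmod_von_mises_moment[of "2 * K / \<epsilon>\<^sup>2" n]
      by (simp add: u_def m_def)
    show "(u n has_vector_derivative complex_of_real (n * K) * (u (n - 1) t - u (Suc n) t) - complex_of_real (\<epsilon>\<^sup>2 * n\<^sup>2) * u n t) (at t within {0..})"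
      if n: "n > 0" and t: "t \<ge> 0" for n t
    proof -
      have "complex_of_real (2 * K / \<epsilon>\<^sup>2) * (m (n - 1) - m (Suc n)) = 2 * of_nat n * m n"
        unfolding m_def by (rule von_mises_moment_recursion[OF n])
      \<comment> \<open>The factor \<epsilon>^2 n / 2 turns the coefficients of the recursion into n
        K and \<epsilon>^2 n^2, those of the hierarchy.\<close>
      then have "(complex_of_real (\<epsilon>\<^sup>2 * n / 2) * complex_of_real (2 * K / \<epsilon>\<^sup>2)) * (m (n - 1) - m (Suc n)) = (complex_of_real (\<epsilon>\<^sup>2 * n / 2) * (2 * of_nat n)) * m n"
        by (simp only: mult.assoc)
      moreover have "complex_of_real (\<epsilon>\<^sup>2 * n / 2) * complex_of_real (2 * K / \<epsilon>\<^sup>2) = complex_of_real (n * K)"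
        by (simp only: of_real_mult[symmetric] of_real_eq_iff) (use \<epsilon> in \<open>simp add: field_simps\<close>)
      moreover have "complex_of_real (\<epsilon>\<^sup>2 * n / 2) * (2 * of_nat n) = complex_of_real (\<epsilon>\<^sup>2 * n\<^sup>2)"
        by (simp add: power2_eq_square)
      ultimately have eq: "complex_of_real (n * K) * (m (n - 1) - m (Suc n)) = complex_of_real (\<epsilon>\<^sup>2 * n\<^sup>2) * m n"
        by (simp only:)
      show ?thesis
        unfolding u_def[abs_def]
        by (rule has_vector_derivative_eq_rhs[OF has_vector_derivative_diff[OF moment_ode[OF n t] has_vector_derivative_const]])
          (use eq in \<open>simp add: algebra_simps\<close>)
    qed
  qed (use False in simp)
  then have "((\<lambda>t. u n t + m n) \<longlongrightarrow> 0 + m n) at_top"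
    by (intro tendsto_intros)
  then show ?thesis
    by (simp add: u_def m_def)
qed

text \<open>The modulus does not see the noise phase, so it is differentiable along each path even
  though the overlap is not.\<close>

lemma overlap_defect_ode:
  "AE \<omega> in M. \<forall>t\<ge>0. ((\<lambda>t. 1 - (cmod (z t \<omega>))\<^sup>2) has_real_derivative
    - 2 * K * Re (z t \<omega>) * (1 - (cmod (z t \<omega>))\<^sup>2)) (at t within {0..})"
  using z_ode
proof eventually_elim
  case (elim \<omega>)
  show ?case
  proof (intro allI impI)
    fix t :: real assume t: "t \<ge> 0"
    let ?e = "\<lambda>t. cis (- (\<epsilon> * (\<beta>\<^sub>1 t \<omega> - \<beta>\<^sub>2 t \<omega>)))"
    have "((\<lambda>t. (cmod (?e t * z t \<omega>))\<^sup>2) has_real_derivative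
        2 * Re (cnj (?e t * z t \<omega>) * (complex_of_real K * (?e t * (1 - (z t \<omega>)\<^sup>2))))) (at t within {0..})"
      using elim t by (intro has_real_derivative_cmod_squared) blast
    moreover have "cnj (?e t * z t \<omega>) * (complex_of_real K * (?e t * (1 - (z t \<omega>)\<^sup>2))) =
        complex_of_real K * (cnj (z t \<omega>) - complex_of_real ((cmod (z t \<omega>))\<^sup>2) * z t \<omega>)"
    proof -
      have "cnj (?e t * z t \<omega>) * (complex_of_real K * (?e t * (1 - (z t \<omega>)\<^sup>2))) =
          complex_of_real K * (cnj (z t \<omega>) * (1 - (z t \<omega>)\<^sup>2)) * (?e t * cnj (?e t))"
        by (simp add: mult_ac)
      also have "?e t * cnj (?e t) = 1"
        by (simp add: cis_cnj cis_mult)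
      also have "cnj (z t \<omega>) * (1 - (z t \<omega>)\<^sup>2) = cnj (z t \<omega>) - complex_of_real ((cmod (z t \<omega>))\<^sup>2) * z t \<omega>"
        unfolding complex_norm_square by (simp add: algebra_simps power2_eq_square)
      finally show ?thesis
        by simp
    qed
    moreover have "Re (complex_of_real K * (cnj w - complex_of_real r * w)) = K * Re w * (1 - r)" for w r
      by (simp add: algebra_simps)
    moreover have "cmod (?e t * z t \<omega>) = cmod (z t \<omega>)" for t
      by (simp add: norm_mult)
    ultimately have "((\<lambda>t. (cmod (z t \<omega>))\<^sup>2) has_real_derivative 2 * (K * Re (z t \<omega>) * (1 - (cmod (z t \<omega>))\<^sup>2))) (at t within {0..})"
      by (simp only:)
    from DERIV_diff[OF DERIV_const this, of 1]
    show "((\<lambda>t. 1 - (cmod (z t \<omega>))\<^sup>2) has_real_derivative - 2 * K * Re (z t \<omega>) * (1 - (cmod (z t \<omega>))\<^sup>2)) (at t within {0..})"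
      by (simp add: mult.assoc)
  qed
qed

text \<open>Along a path the defect either vanishes identically or is never zero. The explicit
  exponential also allows small powers of it to be differentiated.\<close>

lemma overlap_defect_solution:
  "AE \<omega> in M. \<forall>t\<ge>0. 1 - (cmod (z t \<omega>))\<^sup>2 = (1 - (cmod z\<^sub>0)\<^sup>2) * exp (integral {0..t} (\<lambda>t. - 2 * K * Re (z t \<omega>)))"
  using z_ode overlap_defect_ode
proof eventually_elim
  case (elim \<omega>)
  have cont: "continuous_on {0..} (\<lambda>t. - 2 * K * Re (z t \<omega>))"
    using elim(1) by (intro continuous_intros) auto
  have init: "z 0 \<omega> = z\<^sub>0"
    using elim(1) by blast
  show ?case
  proof (intro allI impI)
    fix t :: real assume t: "t \<ge> 0"
    have "1 - (cmod (z t \<omega>))\<^sup>2 = (1 - (cmod (z 0 \<omega>))\<^sup>2) * exp (integral {0..t} (\<lambda>t. - 2 * K * Re (z t \<omega>)))"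
      by (rule linear_ode_solution[OF cont _ t]) (use elim(2) in blast)
    then show "1 - (cmod (z t \<omega>))\<^sup>2 = (1 - (cmod z\<^sub>0)\<^sup>2) * exp (integral {0..t} (\<lambda>t. - 2 * K * Re (z t \<omega>)))"
      by (simp only: init)
  qed
qed

text \<open>The rate \<open>Re z\<close> at which the overlap tends to the unit circle changes sign. It is compensated
  by the generator applied to \<open>- Re z\<close>, up to \<open>1 - Re z\<^sup>2\<close>, which degenerates at \<open>z = \<plusminus>1\<close> only; the small
  multiple \<open>\<eta>\<close> of \<open>Re z\<^sup>2\<close> removes this degeneracy.\<close>

definition \<eta> :: real where "\<eta> = K * \<epsilon>\<^sup>2 / (4 * \<epsilon> ^ 4 + 2 * K\<^sup>2)"

text \<open>Solves 2 K a (1 + \<eta>) = \<eta> \<epsilon>^2 for the power a. The errors quadratic in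
  the weight rate then consume one \<eta> \<epsilon>^2 of the dissipation supplied by \<eta> Re z^2.
  The same relation keeps the corrector at most \<eta> in size.\<close>

definition exponent :: real where "exponent = \<eta> * \<epsilon>\<^sup>2 / (2 * K * (1 + \<eta>))"

lemma \<eta>: "0 < \<eta>" "\<eta> \<le> 1/2"
proof -
  have d: "4 * \<epsilon> ^ 4 + 2 * K\<^sup>2 > 0"
    using K \<epsilon> by (intro add_pos_pos) auto
  then show "0 < \<eta>"
    using K \<epsilon> by (simp add: \<eta>_def)
  have "2 * (K * \<epsilon>\<^sup>2) \<le> K\<^sup>2 + (\<epsilon>\<^sup>2)\<^sup>2"
    using sum_squares_bound[of K "\<epsilon>\<^sup>2"] by simp
  also have "\<dots> \<le> 4 * \<epsilon> ^ 4 + 2 * K\<^sup>2"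
  proof -
    have "\<epsilon> ^ 4 = (\<epsilon>\<^sup>2)\<^sup>2"
      by (simp flip: power_mult)
    then show ?thesis
      using zero_le_power2[of K] zero_le_power2[of "\<epsilon>\<^sup>2"] by linarith
  qed
  finally show "\<eta> \<le> 1/2"
    using d by (simp add: \<eta>_def divide_le_eq)
qed

lemma exponent: "0 < exponent" "exponent \<le> 1" "2 * K * exponent * (1 + \<eta>) = \<eta> * \<epsilon>\<^sup>2"
proof -
  show "0 < exponent"
    using K \<epsilon> \<eta> by (simp add: exponent_def)
  show eq: "2 * K * exponent * (1 + \<eta>) = \<eta> * \<epsilon>\<^sup>2"
    using K \<eta> by (simp add: exponent_def)
  have d: "4 * \<epsilon> ^ 4 + 2 * K\<^sup>2 > 0"
    using K \<epsilon> by (intro add_pos_pos) auto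
  have "\<eta> * \<epsilon>\<^sup>2 = K * (\<epsilon> ^ 4 / (4 * \<epsilon> ^ 4 + 2 * K\<^sup>2))"
    by (simp add: \<eta>_def power4_eq_xxxx power2_eq_square)
  also have "\<dots> \<le> K * 1"
    using K d \<epsilon> by (intro mult_left_mono) (auto simp: divide_le_eq)
  also have "\<dots> \<le> 2 * K * (1 + \<eta>)"
    using K \<eta> by (simp add: algebra_simps)
  finally show "exponent \<le> 1"
    using K \<eta> by (simp add: exponent_def divide_le_eq)
qed

definition weight :: "real \<Rightarrow> 'w \<Rightarrow> real" where
  "weight t \<omega> = (1 - (cmod (z t \<omega>))\<^sup>2) powr exponent"

lemma weight_measurable_F: "t \<ge> 0 \<Longrightarrow> weight t \<in> borel_measurable (F t)"
  unfolding weight_def using z_measurable_F[of t] by measurable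

lemma weight_bounds:
  assumes "t \<ge> 0"
  shows "AE \<omega> in M. 0 \<le> weight t \<omega> \<and> weight t \<omega> \<le> 1 \<and> 1 - (cmod (z t \<omega>))\<^sup>2 \<le> weight t \<omega>"
  using z_bound[OF assms]
proof eventually_elim
  case (elim \<omega>)
  define x where "x = 1 - (cmod (z t \<omega>))\<^sup>2"
  have x: "0 \<le> x" "x \<le> 1"
    using elim by (simp_all add: x_def power_le_one)
  have "x = x powr 1"
    using x by simp
  also have "\<dots> \<le> x powr exponent"
    using x exponent by (intro powr_mono') auto
  finally show ?case
    using x exponent(1) by (simp add: weight_def x_def[symmetric] powr_le1)
qed

text \<open>A power of the explicit solution is again a constant times an exponential, so it is
  differentiated without dividing by the defect.\<close>

lemma weight_ode:
  assumes z0: "cmod z\<^sub>0 < 1"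
  shows "AE \<omega> in M. \<forall>t\<ge>0. 0 \<le> weight t \<omega> \<and> weight t \<omega> \<le> 1 \<and>
    ((\<lambda>t. weight t \<omega>) has_real_derivative - 2 * K * exponent * Re (z t \<omega>) * weight t \<omega>) (at t within {0..})"
  using z_ode overlap_defect_solution
proof eventually_elim
  case (elim \<omega>)
  define I where "I t = integral {0..t} (\<lambda>t. - 2 * K * Re (z t \<omega>))" for t
  have cont: "continuous_on {0..} (\<lambda>t. - 2 * K * Re (z t \<omega>))"
    using elim by (intro continuous_intros) auto
  have I: "(I has_real_derivative - 2 * K * Re (z t \<omega>)) (at t within {0..})" if "t \<ge> 0" for t
    using has_vector_derivative_integral_atLeast[OF cont that]
    by (simp add: I_def[abs_def] has_real_derivative_iff_has_vector_derivative)
  define d where "d = (1 - (cmod z\<^sub>0)\<^sup>2) powr exponent"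
  have z0': "1 - (cmod z\<^sub>0)\<^sup>2 \<ge> 0"
    using z0 by (simp add: power_le_one)
  have w: "weight t \<omega> = d * exp (exponent * I t)" if "t \<ge> 0" for t
    using elim that z0' by (simp add: weight_def I_def d_def powr_mult exp_powr_real mult.commute)
  show ?case
  proof (intro allI impI conjI)
    fix t :: real assume t: "t \<ge> 0"
    show "0 \<le> weight t \<omega>"
      by (simp add: weight_def)
    show "weight t \<omega> \<le> 1"
    proof -
      have "cmod (z t \<omega>) \<le> 1"
        using elim(1) t by blast
      then show ?thesis
        using exponent(1) unfolding weight_def by (intro powr_le1) (simp_all add: power_le_one)
    qed
    have "((\<lambda>t. d * exp (exponent * I t)) has_real_derivative d * (exp (exponent * I t) * (exponent * (- 2 * K * Re (z t \<omega>))))) (at t within {0..})"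
      by (intro DERIV_cmult DERIV_chain2[OF DERIV_exp] I t)
    also have "d * (exp (exponent * I t) * (exponent * (- 2 * K * Re (z t \<omega>)))) = - 2 * K * exponent * Re (z t \<omega>) * weight t \<omega>"
      unfolding w[OF t] by simp
    finally have "((\<lambda>t. d * exp (exponent * I t)) has_real_derivative - 2 * K * exponent * Re (z t \<omega>) * weight t \<omega>) (at t within {0..})" .
    then show "((\<lambda>t. weight t \<omega>) has_real_derivative - 2 * K * exponent * Re (z t \<omega>) * weight t \<omega>) (at t within {0..})"
      by (rule has_field_derivative_transform_within[where d = 1]) (use t w in auto)
  qed
qed

end

lemma cmod_one_minus_bound:
  fixes w :: complex
  assumes "cmod w \<le> 1"
  shows "(cmod (1 - w))\<^sup>2 \<le> 2 * (1 - Re w)"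
proof -
  have "(cmod (1 - w))\<^sup>2 = 1 - 2 * Re w + (cmod w)\<^sup>2"
    unfolding cmod_power2 by (simp add: power2_eq_square algebra_simps)
  moreover have "(cmod w)\<^sup>2 \<le> 1"
    using assms by (simp add: power_le_one)
  ultimately show ?thesis
    by simp
qed

context overlap_process
begin

text \<open>The left side is the drift of the weight times 1 + \<kappa> (- Re w + \<eta> Re w^2),
  divided by the weight, where \<kappa> = 2 K \<open>exponent\<close> / \<epsilon>^2. This \<kappa>
  is chosen so that the noise term of - Re w cancels the rate - 2 K \<open>exponent\<close> Re w,
  which has no sign. There remain - K s with s = 1 - Re w^2, terms of second order in the exponent,
  and the contribution of \<eta> Re w^2, whose noise term is negative exactly where s is
  small.\<close>

lemma lyapunov_pointwise:
  assumes w: "cmod w \<le> 1"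
  shows "- 2 * K * exponent * Re w + 2 * K * exponent / \<epsilon>\<^sup>2 *
      (- (Re (complex_of_real K * (1 - w\<^sup>2) - complex_of_real (2 * K * exponent * Re w) * w) - \<epsilon>\<^sup>2 * Re w)
       + \<eta> * (Re (2 * complex_of_real K * w * (1 - w\<^sup>2) - complex_of_real (2 * K * exponent * Re w) * w\<^sup>2) - 4 * \<epsilon>\<^sup>2 * Re (w\<^sup>2)))
    \<le> - (4 * K * exponent * \<eta>)"
proof -
  let ?a = exponent
  define s where "s = 1 - Re (w\<^sup>2)"
  have w2: "cmod (w\<^sup>2) \<le> 1"
    using w by (simp add: norm_power power_le_one)
  have s: "s \<ge> 0"
    using complex_Re_le_cmod[of "w\<^sup>2"] w2 by (simp add: s_def)
  have Rew: "\<bar>Re w\<bar> \<le> 1" "\<bar>Re (w\<^sup>2)\<bar> \<le> 1"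
    using abs_Re_le_cmod[of w] abs_Re_le_cmod[of "w\<^sup>2"] w w2 by linarith+
  have 1: "2 * K * ?a * Re w * Re w \<le> 2 * K * ?a"
  proof -
    have "Re w * Re w \<le> 1"
      using Rew(1) abs_le_square_iff[of "Re w" 1] by (simp add: power2_eq_square)
    then show ?thesis
      using K exponent by (simp add: mult.assoc mult_left_le)
  qed
  have 2: "- (2 * K * ?a * Re w * Re (w\<^sup>2)) \<le> 2 * K * ?a"
  proof -
    have "\<bar>Re w * Re (w\<^sup>2)\<bar> \<le> 1 * 1"
      unfolding abs_mult by (intro mult_mono Rew) auto
    then have "- (Re w * Re (w\<^sup>2)) \<le> 1"
      by linarith
    then have "2 * K * ?a * (- (Re w * Re (w\<^sup>2))) \<le> 2 * K * ?a * 1"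
      using K exponent by (intro mult_left_mono) auto
    then show ?thesis
      by (simp only: mult.assoc mult_minus_right mult_1_right)
  qed
  \<comment> \<open>Young's inequality, balanced so that its constant is one \<epsilon>^2 out of the
    4 \<epsilon>^2 of noise damping; the rest is absorbed by s because |1 - w^2|^2 \<le> 2
    s.\<close>
  have 3: "2 * K * Re (w * (1 - w\<^sup>2)) \<le> \<epsilon>\<^sup>2 + 2 * K\<^sup>2 / \<epsilon>\<^sup>2 * s"
  proof -
    have "Re (w * (1 - w\<^sup>2)) \<le> cmod w * cmod (1 - w\<^sup>2)"
      using complex_Re_le_cmod[of "w * (1 - w\<^sup>2)"] by (simp only: norm_mult)
    also have "\<dots> \<le> 1 * cmod (1 - w\<^sup>2)"
      using w by (intro mult_right_mono) auto
    finally have "2 * K * Re (w * (1 - w\<^sup>2)) \<le> 2 * K * cmod (1 - w\<^sup>2)"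
      using K by simp
    also have "\<dots> = 2 * \<epsilon> * (K / \<epsilon> * cmod (1 - w\<^sup>2))"
      using \<epsilon> by simp
    also have "\<dots> \<le> \<epsilon>\<^sup>2 + (K / \<epsilon> * cmod (1 - w\<^sup>2))\<^sup>2"
      by (rule sum_squares_bound)
    also have "(K / \<epsilon> * cmod (1 - w\<^sup>2))\<^sup>2 = K\<^sup>2 / \<epsilon>\<^sup>2 * (cmod (1 - w\<^sup>2))\<^sup>2"
      by (simp add: power_mult_distrib power_divide)
    also have "\<dots> \<le> K\<^sup>2 / \<epsilon>\<^sup>2 * (2 * s)"
      unfolding s_def using cmod_one_minus_bound[OF w2] by (intro mult_left_mono) auto
    finally show ?thesis
      by (simp add: mult_ac)
  qed
  have d: "4 * \<epsilon> ^ 4 + 2 * K\<^sup>2 > 0"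
    using K \<epsilon> by (intro add_pos_pos) auto
  \<comment> \<open>The defining equation of \<eta>: it makes the total coefficient of s
    vanish.\<close>
  have \<eta>K: "\<eta> * (4 * \<epsilon>\<^sup>2 + 2 * K\<^sup>2 / \<epsilon>\<^sup>2) = K"
  proof -
    have "4 * \<epsilon>\<^sup>2 + 2 * K\<^sup>2 / \<epsilon>\<^sup>2 = (4 * \<epsilon> ^ 4 + 2 * K\<^sup>2) / \<epsilon>\<^sup>2"
      using \<epsilon> by (simp add: field_simps power4_eq_xxxx power2_eq_square)
    then show ?thesis
      using d \<epsilon> by (simp add: \<eta>_def)
  qed
  have "- (K * s) + 2 * K * ?a * Re w * Re w + \<eta> * (2 * K * Re (w * (1 - w\<^sup>2)) - 2 * K * ?a * Re w * Re (w\<^sup>2) - 4 * \<epsilon>\<^sup>2 * (1 - s))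
      \<le> - (K * s) + 2 * K * ?a + \<eta> * ((\<epsilon>\<^sup>2 + 2 * K\<^sup>2 / \<epsilon>\<^sup>2 * s) + 2 * K * ?a - 4 * \<epsilon>\<^sup>2 * (1 - s))"
  proof -
    have "\<eta> * (2 * K * Re (w * (1 - w\<^sup>2)) - 2 * K * ?a * Re w * Re (w\<^sup>2) - 4 * \<epsilon>\<^sup>2 * (1 - s)) \<le>
        \<eta> * ((\<epsilon>\<^sup>2 + 2 * K\<^sup>2 / \<epsilon>\<^sup>2 * s) + 2 * K * ?a - 4 * \<epsilon>\<^sup>2 * (1 - s))"
    proof (rule mult_left_mono)
      show "2 * K * Re (w * (1 - w\<^sup>2)) - 2 * K * ?a * Re w * Re (w\<^sup>2) - 4 * \<epsilon>\<^sup>2 * (1 - s)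
          \<le> (\<epsilon>\<^sup>2 + 2 * K\<^sup>2 / \<epsilon>\<^sup>2 * s) + 2 * K * ?a - 4 * \<epsilon>\<^sup>2 * (1 - s)"
        by (intro diff_right_mono) (use 2 3 in linarith)
    qed (use \<eta> in simp)
    then show ?thesis
      using 1 by linarith
  qed
  \<comment> \<open>Of the 4 \<eta> \<epsilon>^2, one went to Young's inequality and one pays for
    the terms with the exponent; two are left.\<close>
  also have "\<dots> = (\<eta> * (4 * \<epsilon>\<^sup>2 + 2 * K\<^sup>2 / \<epsilon>\<^sup>2) - K) * s + 2 * K * ?a * (1 + \<eta>) - 3 * (\<eta> * \<epsilon>\<^sup>2)"
    by (simp add: algebra_simps)
  also have "\<dots> = - (2 * (\<eta> * \<epsilon>\<^sup>2))"
    unfolding \<eta>K exponent(3) by simp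
  finally have "2 * K * ?a / \<epsilon>\<^sup>2 * (- (K * s) + 2 * K * ?a * Re w * Re w + \<eta> * (2 * K * Re (w * (1 - w\<^sup>2)) - 2 * K * ?a * Re w * Re (w\<^sup>2) - 4 * \<epsilon>\<^sup>2 * (1 - s)))
     \<le> 2 * K * ?a / \<epsilon>\<^sup>2 * (- (2 * (\<eta> * \<epsilon>\<^sup>2)))"
    using K exponent(1) by (intro mult_left_mono) auto
  also have "\<dots> = - (4 * K * ?a * \<eta>)"
    using \<epsilon> by simp
  also have "2 * K * ?a / \<epsilon>\<^sup>2 * (- (K * s) + 2 * K * ?a * Re w * Re w + \<eta> * (2 * K * Re (w * (1 - w\<^sup>2)) - 2 * K * ?a * Re w * Re (w\<^sup>2) - 4 * \<epsilon>\<^sup>2 * (1 - s))) =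
     - 2 * K * ?a * Re w + 2 * K * ?a / \<epsilon>\<^sup>2 *
      (- (Re (complex_of_real K * (1 - w\<^sup>2) - complex_of_real (2 * K * ?a * Re w) * w) - \<epsilon>\<^sup>2 * Re w)
       + \<eta> * (Re (2 * complex_of_real K * w * (1 - w\<^sup>2) - complex_of_real (2 * K * ?a * Re w) * w\<^sup>2) - 4 * \<epsilon>\<^sup>2 * Re (w\<^sup>2)))"
  proof -
    have e1: "Re (complex_of_real K * (1 - w\<^sup>2) - complex_of_real (2 * K * ?a * Re w) * w) = K * s - 2 * K * ?a * Re w * Re w"
      by (simp add: s_def)
    have e2: "Re (2 * complex_of_real K * w * (1 - w\<^sup>2) - complex_of_real (2 * K * ?a * Re w) * w\<^sup>2) =
        2 * K * Re (w * (1 - w\<^sup>2)) - 2 * K * ?a * Re w * Re (w\<^sup>2)"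
      by (simp add: algebra_simps)
    have e3: "Re (w\<^sup>2) = 1 - s"
      by (simp add: s_def)
    have "2 * K * ?a / \<epsilon>\<^sup>2 * (\<epsilon>\<^sup>2 * Re w) = 2 * K * ?a * Re w"
      using \<epsilon> by simp
    moreover have "c * (- p + x + q) = - 2 * u + c * (- (p - x - v) + q)" if "c * v = 2 * u" for c p x q u v :: real
      using that by (simp add: algebra_simps)
    ultimately show ?thesis
      unfolding e1 e2 e3 by (simp only: mult.assoc mult_minus_left)
  qed
  finally show ?thesis .
qed

lemma integrable_continuous_polynomial:
  fixes R :: "'w \<Rightarrow> real" and p :: "complex \<Rightarrow> complex"
  assumes t: "t \<ge> 0" and R: "R \<in> borel_measurable M" "AE \<omega> in M. 0 \<le> R \<omega> \<and> R \<omega> \<le> 1"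
    and p: "continuous_on UNIV p"
  shows "integrable M (\<lambda>\<omega>. complex_of_real (R \<omega>) * p (z t \<omega>))"
proof -
  have "bounded (p ` cball 0 1)"
    by (intro compact_imp_bounded compact_continuous_image continuous_on_subset[OF p]) auto
  then obtain B where "\<forall>w\<in>cball 0 1. cmod (p w) \<le> B"
    unfolding bounded_iff by blast
  then have "cmod (p w) \<le> B" if "cmod w \<le> 1" for w
    using that by simp
  then show ?thesis
    by (rule integrable_polynomial[OF t R p])
qed

lemma weight_measurable: "t \<ge> 0 \<Longrightarrow> weight t \<in> borel_measurable M"
  using measurable_F_M[OF weight_measurable_F] .

lemma weight_AE: "t \<ge> 0 \<Longrightarrow> AE \<omega> in M. 0 \<le> weight t \<omega> \<and> weight t \<omega> \<le> 1"
  using weight_bounds[of t] by (rule eventually_mono) auto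

lemma integrable_weight:
  assumes "t \<ge> 0"
  shows "integrable M (weight t)"
proof (rule integrable_const_bound[OF _ weight_measurable[OF assms]])
  show "AE \<omega> in M. norm (weight t \<omega>) \<le> 1"
    using weight_AE[OF assms] by (rule eventually_mono) auto
qed

text \<open>Expectations of the weight alone obey no useful inequality, since Re z changes sign. The
  functional \<open>Q\<close>, the expectation of the weight times a multiplier between 1/2 and 2,
  is comparable to it and decays. Time starts at 1 since two-sided derivatives are available at
  positive times only.\<close>

lemma weight_expectation_decay:
  assumes z0: "cmod z\<^sub>0 < 1"
  shows "\<exists>C l. l > 0 \<and> (\<forall>t\<ge>1. (\<integral>\<omega>. weight t \<omega> \<partial>M) \<le> C * exp (- l * (t - 1)))"
proof -
  define \<kappa> where "\<kappa> = 2 * K * exponent / \<epsilon>\<^sup>2"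
  have \<kappa>: "\<kappa> > 0" "\<kappa> * (1 + \<eta>) = \<eta>"
    using K \<epsilon> exponent by (simp_all add: \<kappa>_def)
  note int = integrable_continuous_polynomial[OF _ weight_measurable weight_AE]
  have ode: "((\<lambda>t. \<integral>\<omega>. complex_of_real (weight t \<omega>) * z t \<omega> ^ n \<partial>M) has_vector_derivative
    (\<integral>\<omega>. complex_of_real (weight t \<omega>) * (of_nat n * complex_of_real K * z t \<omega> ^ (n - 1) * (1 - (z t \<omega>)\<^sup>2)
       - complex_of_real (2 * K * exponent * Re (z t \<omega>)) * z t \<omega> ^ n - complex_of_real ((real n * \<epsilon>)\<^sup>2) * z t \<omega> ^ n) \<partial>M)) (at t)"
    if t: "t > 0" for n t
  proof -
    have 1: "integrable M (\<lambda>\<omega>. complex_of_real (weight t \<omega>) * (of_nat n * complex_of_real K * z t \<omega> ^ (n - 1) * (1 - (z t \<omega>)\<^sup>2)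
       - complex_of_real (2 * K * exponent * Re (z t \<omega>)) * z t \<omega> ^ n))"
      using t by (intro int[where p = "\<lambda>w. of_nat n * complex_of_real K * w ^ (n - 1) * (1 - w\<^sup>2)
       - complex_of_real (2 * K * exponent * Re w) * w ^ n"] continuous_intros) auto
    have 2: "integrable M (\<lambda>\<omega>. complex_of_real (weight t \<omega>) * z t \<omega> ^ n)"
      using t by (intro int[where p = "\<lambda>w. w ^ n"] continuous_intros) auto
    have "((\<lambda>t. \<integral>\<omega>. complex_of_real (weight t \<omega>) * z t \<omega> ^ n \<partial>M) has_vector_derivative
      (\<integral>\<omega>. complex_of_real (weight t \<omega>) * (of_nat n * complex_of_real K * z t \<omega> ^ (n - 1) * (1 - (z t \<omega>)\<^sup>2)
       - complex_of_real (2 * K * exponent * Re (z t \<omega>)) * z t \<omega> ^ n) \<partial>M)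
      - complex_of_real ((real n * \<epsilon>)\<^sup>2) * (\<integral>\<omega>. complex_of_real (weight t \<omega>) * z t \<omega> ^ n \<partial>M)) (at t within {0..})"
      using t exponent(1) by (intro weighted_moment_ode[OF weight_measurable_F weight_ode[OF z0]]) auto
    moreover have "(\<integral>\<omega>. complex_of_real (weight t \<omega>) * (of_nat n * complex_of_real K * z t \<omega> ^ (n - 1) * (1 - (z t \<omega>)\<^sup>2)
       - complex_of_real (2 * K * exponent * Re (z t \<omega>)) * z t \<omega> ^ n) \<partial>M)
      - complex_of_real ((real n * \<epsilon>)\<^sup>2) * (\<integral>\<omega>. complex_of_real (weight t \<omega>) * z t \<omega> ^ n \<partial>M) =
      (\<integral>\<omega>. complex_of_real (weight t \<omega>) * (of_nat n * complex_of_real K * z t \<omega> ^ (n - 1) * (1 - (z t \<omega>)\<^sup>2)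
       - complex_of_real (2 * K * exponent * Re (z t \<omega>)) * z t \<omega> ^ n)
      - complex_of_real ((real n * \<epsilon>)\<^sup>2) * (complex_of_real (weight t \<omega>) * z t \<omega> ^ n) \<partial>M)"
      using Bochner_Integration.integral_diff[OF 1 integrable_mult_right[OF 2]] by (simp only: integral_mult_right_zero)
    moreover have "complex_of_real x * y - a * (complex_of_real x * v) = complex_of_real x * (y - a * v)" for x y a v
      by (simp add: algebra_simps)
    ultimately show ?thesis
      by (simp only: at_within_atLeast_0[OF t])
  qed
  define E where "E n t = (\<integral>\<omega>. complex_of_real (weight t \<omega>) * z t \<omega> ^ n \<partial>M)" for n t
  \<comment> \<open>The drift of the weight times the n-th power, divided by the weight: the motion
    of the overlap, the rate of the weight, and the damping by noise, in this order.\<close>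
  define p where "p n w = of_nat n * complex_of_real K * w ^ (n - 1) * (1 - w\<^sup>2)
       - complex_of_real (2 * K * exponent * Re w) * w ^ n - complex_of_real ((real n * \<epsilon>)\<^sup>2) * w ^ n" for n w
  have pc: "continuous_on UNIV (p n)" for n
    unfolding p_def by (intro continuous_intros)
  have E': "(E n has_vector_derivative (\<integral>\<omega>. complex_of_real (weight t \<omega>) * p n (z t \<omega>) \<partial>M)) (at t)" if "t > 0" for n t
    unfolding E_def[abs_def] p_def by (rule ode[OF that])
  define P where "P w = p 0 w + complex_of_real \<kappa> * (- p 1 w + complex_of_real \<eta> * p 2 w)" for w
  define Q where "Q t = E 0 t + complex_of_real \<kappa> * (- E 1 t + complex_of_real \<eta> * E 2 t)" for t
  have Q': "((\<lambda>t. Re (Q t)) has_real_derivative (\<integral>\<omega>. weight t \<omega> * Re (P (z t \<omega>)) \<partial>M)) (at t)" if t: "t > 0" for t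
  proof -
    have i: "integrable M (\<lambda>\<omega>. complex_of_real (weight t \<omega>) * p n (z t \<omega>))" for n
      using t by (intro int pc) auto
    have "(Q has_vector_derivative (\<integral>\<omega>. complex_of_real (weight t \<omega>) * p 0 (z t \<omega>) \<partial>M) +
        complex_of_real \<kappa> * (- (\<integral>\<omega>. complex_of_real (weight t \<omega>) * p 1 (z t \<omega>) \<partial>M) +
          complex_of_real \<eta> * (\<integral>\<omega>. complex_of_real (weight t \<omega>) * p 2 (z t \<omega>) \<partial>M))) (at t)"
      unfolding Q_def[abs_def]
      by (intro has_vector_derivative_add has_vector_derivative_mult_right has_vector_derivative_minus E' t)
    also have "(\<integral>\<omega>. complex_of_real (weight t \<omega>) * p 0 (z t \<omega>) \<partial>M) +
        complex_of_real \<kappa> * (- (\<integral>\<omega>. complex_of_real (weight t \<omega>) * p 1 (z t \<omega>) \<partial>M) +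
          complex_of_real \<eta> * (\<integral>\<omega>. complex_of_real (weight t \<omega>) * p 2 (z t \<omega>) \<partial>M)) =
        (\<integral>\<omega>. complex_of_real (weight t \<omega>) * p 0 (z t \<omega>) +
        complex_of_real \<kappa> * (- (complex_of_real (weight t \<omega>) * p 1 (z t \<omega>)) +
          complex_of_real \<eta> * (complex_of_real (weight t \<omega>) * p 2 (z t \<omega>))) \<partial>M)"
      using i[of 0] i[of 1] i[of 2] by simp
    also have "\<dots> = (\<integral>\<omega>. complex_of_real (weight t \<omega>) * P (z t \<omega>) \<partial>M)"
      by (intro Bochner_Integration.integral_cong refl) (simp add: P_def algebra_simps)
    finally have "((\<lambda>t. Re (Q t)) has_vector_derivative Re (\<integral>\<omega>. complex_of_real (weight t \<omega>) * P (z t \<omega>) \<partial>M)) (at t)"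
      by (rule bounded_linear.has_vector_derivative[OF bounded_linear_Re])
    also have "Re (\<integral>\<omega>. complex_of_real (weight t \<omega>) * P (z t \<omega>) \<partial>M) = (\<integral>\<omega>. Re (complex_of_real (weight t \<omega>) * P (z t \<omega>)) \<partial>M)"
      using t by (intro integral_Re[symmetric] int) (auto simp: P_def[abs_def] intro!: continuous_intros pc)
    finally show ?thesis
      by (simp add: has_real_derivative_iff_has_vector_derivative)
  qed
  have P: "Re (P w) \<le> - (4 * K * exponent * \<eta>)" if "cmod w \<le> 1" for w
  proof -
    have p0: "Re (p 0 w) = - 2 * K * exponent * Re w"
      by (simp add: p_def)
    have p1: "Re (p 1 w) = Re (complex_of_real K * (1 - w\<^sup>2) - complex_of_real (2 * K * exponent * Re w) * w) - \<epsilon>\<^sup>2 * Re w"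
      by (simp add: p_def)
    have p2: "Re (p 2 w) = Re (2 * complex_of_real K * w * (1 - w\<^sup>2) - complex_of_real (2 * K * exponent * Re w) * w\<^sup>2) - 4 * \<epsilon>\<^sup>2 * Re (w\<^sup>2)"
      by (simp add: p_def power_mult_distrib)
    have "Re (P w) = Re (p 0 w) + \<kappa> * (- Re (p 1 w) + \<eta> * Re (p 2 w))"
      by (simp add: P_def)
    then show ?thesis
      using lyapunov_pointwise[OF that] by (simp only: p0 p1 p2 \<kappa>_def)
  qed
  have ReQ: "Re (Q t) = (\<integral>\<omega>. weight t \<omega> * (1 + \<kappa> * (- Re (z t \<omega>) + \<eta> * Re ((z t \<omega>)\<^sup>2))) \<partial>M)" if t: "t \<ge> 0" for t
  proof -
    have i: "integrable M (\<lambda>\<omega>. complex_of_real (weight t \<omega>) * z t \<omega> ^ n)" for n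
      using t by (intro int[where p = "\<lambda>w. w ^ n"] continuous_intros) auto
    have "Re (Q t) = Re (\<integral>\<omega>. complex_of_real (weight t \<omega>) * z t \<omega> ^ 0 +
        complex_of_real \<kappa> * (- (complex_of_real (weight t \<omega>) * z t \<omega> ^ 1) +
          complex_of_real \<eta> * (complex_of_real (weight t \<omega>) * z t \<omega> ^ 2)) \<partial>M)"
      unfolding Q_def E_def using i[of 0] i[of 1] i[of 2] by simp
    also have "\<dots> = (\<integral>\<omega>. Re (complex_of_real (weight t \<omega>) * z t \<omega> ^ 0 +
        complex_of_real \<kappa> * (- (complex_of_real (weight t \<omega>) * z t \<omega> ^ 1) +
          complex_of_real \<eta> * (complex_of_real (weight t \<omega>) * z t \<omega> ^ 2))) \<partial>M)"
      using i[of 0] i[of 1] i[of 2] by (intro integral_Re[symmetric]) simp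
    also have "\<dots> = (\<integral>\<omega>. weight t \<omega> * (1 + \<kappa> * (- Re (z t \<omega>) + \<eta> * Re ((z t \<omega>)\<^sup>2))) \<partial>M)"
      by (intro Bochner_Integration.integral_cong refl) (simp add: algebra_simps)
    finally show ?thesis .
  qed
  \<comment> \<open>The relation \<kappa> (1 + \<eta>) = \<eta> bounds the corrector by \<eta>,
    hence by 1/2.\<close>
  have g: "1/2 \<le> 1 + \<kappa> * (- Re w + \<eta> * Re (w\<^sup>2))" "1 + \<kappa> * (- Re w + \<eta> * Re (w\<^sup>2)) \<le> 2" if w: "cmod w \<le> 1" for w
  proof -
    have "\<bar>Re w\<bar> \<le> 1" "\<bar>Re (w\<^sup>2)\<bar> \<le> 1"
      using abs_Re_le_cmod[of w] abs_Re_le_cmod[of "w\<^sup>2"] w power_le_one[OF norm_ge_zero w, of 2]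
      unfolding norm_power by linarith+
    then have "\<bar>- Re w\<bar> \<le> 1" "\<bar>\<eta> * Re (w\<^sup>2)\<bar> \<le> \<eta> * 1"
      unfolding abs_mult using \<eta> by (auto intro!: mult_mono)
    then have "\<bar>- Re w + \<eta> * Re (w\<^sup>2)\<bar> \<le> 1 + \<eta>"
      by linarith
    then have "\<kappa> * \<bar>- Re w + \<eta> * Re (w\<^sup>2)\<bar> \<le> \<kappa> * (1 + \<eta>)"
      using \<kappa>(1) by (intro mult_left_mono) auto
    then have "\<bar>\<kappa> * (- Re w + \<eta> * Re (w\<^sup>2))\<bar> \<le> \<eta>"
      using \<kappa> by (simp add: abs_mult)
    then show "1/2 \<le> 1 + \<kappa> * (- Re w + \<eta> * Re (w\<^sup>2))" "1 + \<kappa> * (- Re w + \<eta> * Re (w\<^sup>2)) \<le> 2"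
      using \<eta> by linarith+
  qed
  have real_int: "integrable M (\<lambda>\<omega>. weight t \<omega> * r (z t \<omega>))" if t: "t \<ge> 0" and r: "continuous_on UNIV r" for t and r :: "complex \<Rightarrow> real"
  proof -
    have "integrable M (\<lambda>\<omega>. complex_of_real (weight t \<omega>) * complex_of_real (r (z t \<omega>)))"
      by (intro int[OF t t t, where p = "\<lambda>w. complex_of_real (r w)"] continuous_on_of_real r)
    from integrable_Re[OF this] show ?thesis
      by simp
  qed
  have bounds: "(\<integral>\<omega>. weight t \<omega> \<partial>M) \<le> 2 * Re (Q t)" "Re (Q t) \<le> 2 * (\<integral>\<omega>. weight t \<omega> \<partial>M)" if t: "t \<ge> 0" for t
  proof -
    have i: "integrable M (\<lambda>\<omega>. weight t \<omega> * (1 + \<kappa> * (- Re (z t \<omega>) + \<eta> * Re ((z t \<omega>)\<^sup>2))))"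
      by (intro real_int[OF t, of "\<lambda>w. 1 + \<kappa> * (- Re w + \<eta> * Re (w\<^sup>2))"] continuous_intros)
    have "(\<integral>\<omega>. weight t \<omega> * (1/2) \<partial>M) \<le> Re (Q t)"
      unfolding ReQ[OF t]
    proof (rule integral_mono_AE)
      show "AE \<omega> in M. weight t \<omega> * (1/2) \<le> weight t \<omega> * (1 + \<kappa> * (- Re (z t \<omega>) + \<eta> * Re ((z t \<omega>)\<^sup>2)))"
        using weight_AE[OF t] z_bound[OF t] by eventually_elim (rule mult_left_mono[OF g(1)], simp_all)
    qed (use i integrable_weight[OF t] in simp_all)
    then show "(\<integral>\<omega>. weight t \<omega> \<partial>M) \<le> 2 * Re (Q t)"
      by simp
    have "Re (Q t) \<le> (\<integral>\<omega>. weight t \<omega> * 2 \<partial>M)"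
      unfolding ReQ[OF t]
    proof (rule integral_mono_AE)
      show "AE \<omega> in M. weight t \<omega> * (1 + \<kappa> * (- Re (z t \<omega>) + \<eta> * Re ((z t \<omega>)\<^sup>2))) \<le> weight t \<omega> * 2"
        using weight_AE[OF t] z_bound[OF t] by eventually_elim (rule mult_left_mono[OF g(2)], simp_all)
    qed (use i integrable_weight[OF t] in simp_all)
    then show "Re (Q t) \<le> 2 * (\<integral>\<omega>. weight t \<omega> \<partial>M)"
      by simp
  qed
  \<comment> \<open>Half of the pointwise drift bound: the other half is lost in comparing
    \<open>Q\<close> with the expected weight.\<close>
  define l where "l = 2 * K * exponent * \<eta>"
  have l: "l > 0"
    using K exponent \<eta> by (simp add: l_def)
  have dQ: "(\<integral>\<omega>. weight t \<omega> * Re (P (z t \<omega>)) \<partial>M) \<le> 0 - l * Re (Q t)" if t: "t \<ge> 1" for t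
  proof -
    have t0: "t \<ge> 0"
      using t by simp
    have "(\<integral>\<omega>. weight t \<omega> * Re (P (z t \<omega>)) \<partial>M) \<le> (\<integral>\<omega>. weight t \<omega> * (- (2 * l)) \<partial>M)"
    proof (rule integral_mono_AE)
      show "integrable M (\<lambda>\<omega>. weight t \<omega> * Re (P (z t \<omega>)))"
        unfolding P_def by (rule real_int[OF t0, of "\<lambda>w. Re (p 0 w + complex_of_real \<kappa> * (- p 1 w + complex_of_real \<eta> * p 2 w))"]) (intro continuous_intros pc)
      show "AE \<omega> in M. weight t \<omega> * Re (P (z t \<omega>)) \<le> weight t \<omega> * (- (2 * l))"
        using weight_AE[OF t0] z_bound[OF t0]
      proof eventually_elim
        case (elim \<omega>)
        have "Re (P (z t \<omega>)) \<le> - (2 * l)"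
          using P[of "z t \<omega>"] elim by (simp add: l_def mult.assoc)
        then show ?case
          using elim by (intro mult_left_mono) auto
      qed
    qed (use integrable_weight[OF t0] in simp)
    also have "\<dots> = - (2 * l) * (\<integral>\<omega>. weight t \<omega> \<partial>M)"
      by simp
    also have "\<dots> \<le> 0 - l * Re (Q t)"
      using bounds(2)[OF t0] l mult_left_mono[OF bounds(2)[OF t0], of l] by simp
    finally show ?thesis .
  qed
  have decay: "(\<integral>\<omega>. weight t \<omega> \<partial>M) \<le> 2 * Re (Q 1) * exp (- l * (t - 1))" if t: "t \<ge> 1" for t
  proof -
    have "Re (Q t) \<le> exp (- l * (t - 1)) * (Re (Q 1) - 0 / l) + 0 / l"
      by (rule linear_differential_inequality[OF Q' dQ l t]) auto
    then show ?thesis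
      using bounds(1)[of t] t by (simp add: mult.commute)
  qed
  show ?thesis
    using l decay by blast
qed

text \<open>As Re z is at least -1, the defect grows at most at rate 2 K. Smallness at integer times
  therefore extends to the unit interval that follows.\<close>

lemma overlap_defect_bound:
  "AE \<omega> in M. \<forall>s t. 1 \<le> s \<and> s \<le> t \<longrightarrow> 1 - (cmod (z t \<omega>))\<^sup>2 \<le> exp (2 * K * (t - s)) * (1 - (cmod (z s \<omega>))\<^sup>2)"
  using z_ode overlap_defect_ode
proof eventually_elim
  case (elim \<omega>)
  define d where "d t = 1 - (cmod (z t \<omega>))\<^sup>2" for t
  have z1: "cmod (z t \<omega>) \<le> 1" if "t \<ge> 0" for t
    using elim(1) that by blast
  have d': "(d has_real_derivative - 2 * K * Re (z t \<omega>) * d t) (at t)" if "t > 0" for t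
    using elim(2) that at_within_atLeast_0[OF that] unfolding d_def by (metis less_imp_le)
  show ?case
  proof (intro allI impI, elim conjE)
    fix s t :: real assume st: "1 \<le> s" "s \<le> t"
    have "d t * exp (- 2 * K * t) \<le> d s * exp (- 2 * K * s)"
    proof (rule DERIV_nonpos_imp_nonincreasing[OF st(2)])
      fix x assume x: "s \<le> x" "x \<le> t"
      then have x0: "x > 0"
        using st by simp
      have "((\<lambda>x. d x * exp (- 2 * K * x)) has_real_derivative
          d x * (exp (- 2 * K * x) * (- 2 * K)) + - 2 * K * Re (z x \<omega>) * d x * exp (- 2 * K * x)) (at x)"
        by (rule DERIV_cong[OF DERIV_mult'[OF d'[OF x0] DERIV_chain2[OF DERIV_exp DERIV_cmult_Id]]]) simp
      moreover have "d x * (exp (- 2 * K * x) * (- 2 * K)) + - 2 * K * Re (z x \<omega>) * d x * exp (- 2 * K * x) =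
          - (2 * K * (1 + Re (z x \<omega>)) * d x * exp (- 2 * K * x))"
        by (simp add: algebra_simps)
      moreover have "2 * K * (1 + Re (z x \<omega>)) * d x * exp (- 2 * K * x) \<ge> 0"
        using K z1[of x] x0 abs_Re_le_cmod[of "z x \<omega>"]
        by (intro mult_nonneg_nonneg) (auto simp: d_def power_le_one)
      ultimately show "\<exists>y. ((\<lambda>x. d x * exp (- 2 * K * x)) has_real_derivative y) (at x) \<and> y \<le> 0"
        by (intro exI conjI) auto
    qed
    then have "exp (2 * K * t) * (d t * exp (- 2 * K * t)) \<le> exp (2 * K * t) * (d s * exp (- 2 * K * s))"
      by (intro mult_left_mono) auto
    then have "d t \<le> exp (2 * K * (t - s)) * d s"
      by (simp add: exp_minus exp_diff right_diff_distrib field_simps)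
    then show "1 - (cmod (z t \<omega>))\<^sup>2 \<le> exp (2 * K * (t - s)) * (1 - (cmod (z s \<omega>))\<^sup>2)"
      by (simp add: d_def)
  qed
qed

lemma overlap_defect_zero:
  assumes "\<not> cmod z\<^sub>0 < 1"
  shows "AE \<omega> in M. \<forall>t\<ge>0. cmod (z t \<omega>) = 1"
  using z_ode overlap_defect_solution
proof eventually_elim
  case (elim \<omega>)
  have "cmod z\<^sub>0 = 1"
    using conjunct1[OF elim(1)] spec[OF conjunct2[OF conjunct2[OF elim(1)]], of 0] assms by simp
  show ?case
  proof (intro allI impI)
    fix t :: real assume "t \<ge> 0"
    then have "1 - (cmod (z t \<omega>))\<^sup>2 = (1 - (cmod z\<^sub>0)\<^sup>2) * exp (integral {0..t} (\<lambda>t. - 2 * K * Re (z t \<omega>)))"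
      using elim(2) by blast
    then have "(cmod (z t \<omega>))\<^sup>2 = 1\<^sup>2"
      by (simp add: \<open>cmod z\<^sub>0 = 1\<close>)
    then show "cmod (z t \<omega>) = 1"
      by (rule power2_eq_imp_eq) simp_all
  qed
qed

text \<open>The expected weights at integer times are summable, so the sum of the weights is almost
  surely finite and its terms tend to 0. The weight dominates the defect because its exponent is at
  most 1 and the defect lies in [0, 1].\<close>

lemma overlap_defect_AE_tendsto: "AE \<omega> in M. ((\<lambda>t. 1 - (cmod (z t \<omega>))\<^sup>2) \<longlongrightarrow> 0) at_top"
proof (cases "cmod z\<^sub>0 < 1")
  case False
  show ?thesis
    using overlap_defect_zero[OF False]
  proof eventually_elim
    case (elim \<omega>)
    have "\<forall>\<^sub>F t in at_top. 1 - (cmod (z t \<omega>))\<^sup>2 = 0"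
    proof (rule eventually_mono[OF eventually_ge_at_top[of 0]])
      fix t :: real assume "0 \<le> t"
      with elim have "cmod (z t \<omega>) = 1"
        by blast
      then show "1 - (cmod (z t \<omega>))\<^sup>2 = 0"
        by simp
    qed
    then show ?case
      by (rule tendsto_eventually)
  qed
next
  case True
  from weight_expectation_decay[OF True] obtain C l
    where Cl: "l > 0 \<and> (\<forall>t\<ge>1. (\<integral>\<omega>. weight t \<omega> \<partial>M) \<le> C * exp (- l * (t - 1)))"
    by (elim exE)
  have l: "l > 0"
    using Cl by (rule conjunct1)
  have C: "(\<integral>\<omega>. weight t \<omega> \<partial>M) \<le> C * exp (- l * (t - 1))" if "t \<ge> 1" for t
    using that by (rule mp[OF spec[OF conjunct2[OF Cl]]])
  have [measurable]: "weight (real (Suc n)) \<in> borel_measurable M" for n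
    by (rule weight_measurable) simp
  have "0 \<le> (\<integral>\<omega>. weight 1 \<omega> \<partial>M)"
    by (rule integral_nonneg_AE) (simp add: weight_def)
  then have C0: "C \<ge> 0"
    using C[of 1] by simp
  have meas: "(\<lambda>\<omega>. \<Sum>n. ennreal (weight (real (Suc n)) \<omega>)) \<in> borel_measurable M"
    by measurable
  have "(\<integral>\<^sup>+\<omega>. (\<Sum>n. ennreal (weight (real (Suc n)) \<omega>)) \<partial>M) = (\<Sum>n. \<integral>\<^sup>+\<omega>. ennreal (weight (real (Suc n)) \<omega>) \<partial>M)"
    by (rule nn_integral_suminf) measurable
  also have "\<dots> \<le> (\<Sum>n. ennreal (C * exp (- l) ^ n))"
  proof (intro suminf_le)
    fix n
    have "(\<integral>\<^sup>+\<omega>. ennreal (weight (real (Suc n)) \<omega>) \<partial>M) = ennreal (\<integral>\<omega>. weight (real (Suc n)) \<omega> \<partial>M)"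
      by (intro nn_integral_eq_integral integrable_weight) (auto simp: weight_def)
    also have "\<dots> \<le> ennreal (C * exp (- l) ^ n)"
      using C[of "real (Suc n)"] by (intro ennreal_leI) (simp add: exp_of_nat_mult[symmetric] mult.commute)
    finally show "(\<integral>\<^sup>+\<omega>. ennreal (weight (real (Suc n)) \<omega>) \<partial>M) \<le> ennreal (C * exp (- l) ^ n)" .
  qed auto
  also have "\<dots> = ennreal (\<Sum>n. C * exp (- l) ^ n)"
    using l C0 by (intro suminf_ennreal2 summable_mult summable_geometric) auto
  also have "\<dots> < \<infinity>"
    by simp
  finally have "AE \<omega> in M. (\<Sum>n. ennreal (weight (real (Suc n)) \<omega>)) \<noteq> \<infinity>"
    by (intro nn_integral_PInf_AE meas) simp
  moreover have "AE \<omega> in M. \<forall>n. 1 - (cmod (z (real (Suc n)) \<omega>))\<^sup>2 \<le> weight (real (Suc n)) \<omega>"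
    unfolding AE_all_countable
  proof
    fix n
    show "AE \<omega> in M. 1 - (cmod (z (real (Suc n)) \<omega>))\<^sup>2 \<le> weight (real (Suc n)) \<omega>"
      by (rule eventually_mono[OF weight_bounds[of "real (Suc n)"]]) simp_all
  qed
  ultimately show ?thesis
    using overlap_defect_bound z_ode
  proof eventually_elim
    case (elim \<omega>)
    note defect = elim(3) and z_le = conjunct2[OF conjunct2[OF elim(4)]] and weight_le = elim(2)
    have "summable (\<lambda>n. weight (real (Suc n)) \<omega>)"
      using elim(1) by (intro summable_suminf_not_top) (auto simp: weight_def)
    then have "(\<lambda>n. weight (real (Suc n)) \<omega>) \<longlonglongrightarrow> 0"
      by (rule summable_LIMSEQ_zero)
    then have "(\<lambda>n. weight (real n) \<omega>) \<longlonglongrightarrow> 0"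
      by (rule LIMSEQ_imp_Suc)
    moreover have "filterlim (\<lambda>t. nat \<lfloor>t\<rfloor>) at_top (at_top :: real filter)"
      by (intro filterlim_compose[OF filterlim_nat_sequentially filterlim_floor_sequentially])
    ultimately have "((\<lambda>t::real. weight (real (nat \<lfloor>t\<rfloor>)) \<omega>) \<longlongrightarrow> 0) at_top"
      by (rule filterlim_compose[of "\<lambda>n. weight (real n) \<omega>"])
    then have "((\<lambda>t::real. exp (2 * K) * weight (real (nat \<lfloor>t\<rfloor>)) \<omega>) \<longlongrightarrow> exp (2 * K) * 0) at_top"
      by (intro tendsto_intros)
    then have lim: "((\<lambda>t::real. exp (2 * K) * weight (real (nat \<lfloor>t\<rfloor>)) \<omega>) \<longlongrightarrow> 0) at_top"
      by simp
    show ?case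
    proof (rule tendsto_sandwich[OF _ _ tendsto_const lim])
      show "\<forall>\<^sub>F t in at_top. 0 \<le> 1 - (cmod (z t \<omega>))\<^sup>2"
        using eventually_ge_at_top[of 0] by eventually_elim (use elim(4) in \<open>simp add: power_le_one\<close>)
      show "\<forall>\<^sub>F t in at_top. 1 - (cmod (z t \<omega>))\<^sup>2 \<le> exp (2 * K) * weight (real (nat \<lfloor>t\<rfloor>)) \<omega>"
        using eventually_ge_at_top[of 1]
      proof eventually_elim
        case (elim t)
        define k where "k = nat \<lfloor>t\<rfloor>"
        have k: "1 \<le> real k" "real k \<le> t" "t - real k \<le> 1"
          using elim by (simp_all add: k_def) linarith+
        have "1 - (cmod (z t \<omega>))\<^sup>2 \<le> exp (2 * K * (t - real k)) * (1 - (cmod (z (real k) \<omega>))\<^sup>2)"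
          using defect k by blast
        also have "\<dots> \<le> exp (2 * K) * weight (real k) \<omega>"
        proof (intro mult_mono)
          show "exp (2 * K * (t - real k)) \<le> exp (2 * K)"
            using K k by simp
          obtain n where "k = Suc n"
            using k by (cases k) auto
          then show "1 - (cmod (z (real k) \<omega>))\<^sup>2 \<le> weight (real k) \<omega>"
            using weight_le by blast
          have "cmod (z (real k) \<omega>) \<le> 1"
            using z_le by simp
          then show "0 \<le> 1 - (cmod (z (real k) \<omega>))\<^sup>2"
            by (simp add: power_le_one)
        qed simp
        finally show ?case
          by (simp add: k_def)
      qed
    qed
  qed
qed

end

section \<open>Convergence in law\<close>

lemma one_minus_power_le:
  fixes x :: real
  assumes "0 \<le> x" "x \<le> 1"
  shows "1 - x ^ k \<le> real k * (1 - x)"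
  using Bernoulli_inequality[of "x - 1" k] assms by (simp add: algebra_simps)

context overlap_process
begin

lemma integrable_mixed:
  assumes "t \<ge> 0"
  shows "integrable M (\<lambda>\<omega>. z t \<omega> ^ j * cnj (z t \<omega>) ^ k)"
proof -
  have "integrable M (\<lambda>\<omega>. complex_of_real 1 * (z t \<omega> ^ j * cnj (z t \<omega>) ^ k))"
    using assms by (intro integrable_continuous_polynomial[where p = "\<lambda>w. w ^ j * cnj w ^ k"] continuous_intros) auto
  then show ?thesis
    by simp
qed

lemma overlap_defect_tendsto:
  assumes T: "\<And>i. T i \<ge> 0" "filterlim T at_top sequentially"
  shows "(\<lambda>i. \<integral>\<omega>. 1 - (cmod (z (T i) \<omega>))\<^sup>2 \<partial>M) \<longlonglongrightarrow> 0"
proof -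
  have [measurable]: "z (T i) \<in> borel_measurable M" for i
    using z_measurable[OF T(1)] .
  have "(\<lambda>i. \<integral>\<omega>. 1 - (cmod (z (T i) \<omega>))\<^sup>2 \<partial>M) \<longlonglongrightarrow> (\<integral>\<omega>. 0 \<partial>M)"
  proof (rule integral_dominated_convergence[where w = "\<lambda>_. 1"])
    show "AE \<omega> in M. (\<lambda>i. 1 - (cmod (z (T i) \<omega>))\<^sup>2) \<longlonglongrightarrow> 0"
      using overlap_defect_AE_tendsto by eventually_elim (rule filterlim_compose[OF _ T(2)])
    show "AE \<omega> in M. norm (1 - (cmod (z (T i) \<omega>))\<^sup>2) \<le> 1" for i
      using z_bound[OF T(1)[of i]] by eventually_elim (simp add: power_le_one)
  qed auto
  then show ?thesis
    by simp
qed

text \<open>On the circle, w^j times the k-th power of the conjugate is w^(j-k). In the disk the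
  discrepancy has modulus |w|^(j-k) (1 - |w|^(2 k)), at most k times the defect by Bernoulli's
  inequality, and the expected defect tends to 0.\<close>

lemma mixed_moment_tendsto_le:
  assumes T: "\<And>i. T i \<ge> 0" "filterlim T at_top sequentially" and jk: "k \<le> j"
  shows "(\<lambda>i. \<integral>\<omega>. z (T i) \<omega> ^ j * cnj (z (T i) \<omega>) ^ k \<partial>M) \<longlonglongrightarrow> (\<integral>\<theta>. cis \<theta> ^ j * cnj (cis \<theta>) ^ k \<partial>von_mises (2 * K / \<epsilon>\<^sup>2))"
proof -
  have "(\<lambda>i. (\<integral>\<omega>. z (T i) \<omega> ^ j * cnj (z (T i) \<omega>) ^ k \<partial>M) - (\<integral>\<omega>. z (T i) \<omega> ^ (j - k) \<partial>M)) \<longlonglongrightarrow> 0"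
  proof (rule Lim_null_comparison[OF always_eventually], rule allI)
    show "(\<lambda>i. real k * (\<integral>\<omega>. 1 - (cmod (z (T i) \<omega>))\<^sup>2 \<partial>M)) \<longlonglongrightarrow> 0"
      using tendsto_mult_right_zero[OF overlap_defect_tendsto[OF T]] by simp
    fix i
    have [measurable]: "z (T i) \<in> borel_measurable M"
      using z_measurable[OF T(1)] .
    have "(\<integral>\<omega>. z (T i) \<omega> ^ j * cnj (z (T i) \<omega>) ^ k \<partial>M) - (\<integral>\<omega>. z (T i) \<omega> ^ (j - k) \<partial>M) =
        (\<integral>\<omega>. z (T i) \<omega> ^ j * cnj (z (T i) \<omega>) ^ k - z (T i) \<omega> ^ (j - k) \<partial>M)"
      by (intro Bochner_Integration.integral_diff[symmetric] integrable_mixed integrable_power T)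
    also have "cmod \<dots> \<le> (\<integral>\<omega>. cmod (z (T i) \<omega> ^ j * cnj (z (T i) \<omega>) ^ k - z (T i) \<omega> ^ (j - k)) \<partial>M)"
      by (rule integral_norm_bound)
    also have "\<dots> \<le> (\<integral>\<omega>. real k * (1 - (cmod (z (T i) \<omega>))\<^sup>2) \<partial>M)"
    proof (rule integral_mono_AE)
      show "integrable M (\<lambda>\<omega>. cmod (z (T i) \<omega> ^ j * cnj (z (T i) \<omega>) ^ k - z (T i) \<omega> ^ (j - k)))"
        by (intro integrable_norm Bochner_Integration.integrable_diff integrable_mixed integrable_power T)
      have "AE \<omega> in M. norm (1 - (cmod (z (T i) \<omega>))\<^sup>2) \<le> 1"
        using z_bound[OF T(1)[of i]] by eventually_elim (simp add: power_le_one)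
      then have "integrable M (\<lambda>\<omega>. 1 - (cmod (z (T i) \<omega>))\<^sup>2)"
        by (rule integrable_const_bound) measurable
      then show "integrable M (\<lambda>\<omega>. real k * (1 - (cmod (z (T i) \<omega>))\<^sup>2))"
        by (rule integrable_mult_right)
      show "AE \<omega> in M. cmod (z (T i) \<omega> ^ j * cnj (z (T i) \<omega>) ^ k - z (T i) \<omega> ^ (j - k)) \<le> real k * (1 - (cmod (z (T i) \<omega>))\<^sup>2)"
        using z_bound[OF T(1)[of i]]
      proof eventually_elim
        case (elim \<omega>)
        define w where "w = z (T i) \<omega>"
        have w: "cmod w \<le> 1"
          using elim by (simp add: w_def)
        have "w ^ j = w ^ (j - k) * w ^ k"
          using jk by (simp flip: power_add)
        then have "w ^ j * cnj w ^ k - w ^ (j - k) = - (w ^ (j - k) * (1 - (w * cnj w) ^ k))"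
          by (simp add: power_mult_distrib algebra_simps)
        also have "w * cnj w = complex_of_real ((cmod w)\<^sup>2)"
          by (rule complex_norm_square[symmetric])
        also have "1 - complex_of_real ((cmod w)\<^sup>2) ^ k = complex_of_real (1 - ((cmod w)\<^sup>2) ^ k)"
          by simp
        also have "cmod (- (w ^ (j - k) * complex_of_real (1 - ((cmod w)\<^sup>2) ^ k))) = cmod w ^ (j - k) * \<bar>1 - ((cmod w)\<^sup>2) ^ k\<bar>"
          by (simp only: norm_minus_cancel norm_mult norm_power norm_of_real)
        also have "\<dots> \<le> 1 * \<bar>1 - ((cmod w)\<^sup>2) ^ k\<bar>"
          using w by (intro mult_right_mono power_le_one) auto
        also have "\<dots> = 1 - ((cmod w)\<^sup>2) ^ k"
          using w by (simp add: power_le_one)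
        also have "\<dots> \<le> real k * (1 - (cmod w)\<^sup>2)"
          using w by (intro one_minus_power_le) (auto simp: power_le_one)
        finally show ?case
          by (simp add: w_def)
      qed
    qed
    also have "\<dots> = real k * (\<integral>\<omega>. 1 - (cmod (z (T i) \<omega>))\<^sup>2 \<partial>M)"
      by (rule integral_mult_right_zero)
    finally show "cmod ((\<integral>\<omega>. z (T i) \<omega> ^ j * cnj (z (T i) \<omega>) ^ k \<partial>M) - (\<integral>\<omega>. z (T i) \<omega> ^ (j - k) \<partial>M)) \<le>
      real k * (\<integral>\<omega>. 1 - (cmod (z (T i) \<omega>))\<^sup>2 \<partial>M)" .
  qed
  from tendsto_add[OF this filterlim_compose[OF moment_tendsto[of "j - k"] T(2)]]
  have "(\<lambda>i. \<integral>\<omega>. z (T i) \<omega> ^ j * cnj (z (T i) \<omega>) ^ k \<partial>M) \<longlonglongrightarrow> von_mises_moment (2 * K / \<epsilon>\<^sup>2) (j - k)"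
    by simp
  moreover have "cis (real (j - k) * \<theta>) = cis \<theta> ^ j * cnj (cis \<theta>) ^ k" for \<theta>
    using jk by (simp add: Complex.DeMoivre cis_cnj cis_mult of_nat_diff algebra_simps)
  ultimately show ?thesis
    by (simp only: von_mises_moment_def)
qed

text \<open>Complex conjugation exchanges the two exponents and reduces the remaining case to the
  previous one.\<close>

lemma mixed_moment_tendsto:
  assumes T: "\<And>i. T i \<ge> 0" "filterlim T at_top sequentially"
  shows "(\<lambda>i. \<integral>\<omega>. z (T i) \<omega> ^ j * cnj (z (T i) \<omega>) ^ k \<partial>M) \<longlonglongrightarrow> (\<integral>\<theta>. cis \<theta> ^ j * cnj (cis \<theta>) ^ k \<partial>von_mises (2 * K / \<epsilon>\<^sup>2))"
proof (cases "k \<le> j")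
  case True
  then show ?thesis
    by (rule mixed_moment_tendsto_le[OF T])
next
  case False
  then have "(\<lambda>i. cnj (\<integral>\<omega>. z (T i) \<omega> ^ k * cnj (z (T i) \<omega>) ^ j \<partial>M)) \<longlonglongrightarrow> cnj (\<integral>\<theta>. cis \<theta> ^ k * cnj (cis \<theta>) ^ j \<partial>von_mises (2 * K / \<epsilon>\<^sup>2))"
    by (intro tendsto_cnj mixed_moment_tendsto_le T) simp
  then show ?thesis
    unfolding Bochner_Integration.integral_cnj[symmetric] by (simp add: mult.commute)
qed

lemma Re_power_expand:
  "complex_of_real (Re w ^ m) = (\<Sum>i\<le>m. (of_nat (m choose i) / 2 ^ m) * (w ^ i * cnj w ^ (m - i)))"
proof -
  have "complex_of_real (Re w ^ m) = ((w + cnj w) / 2) ^ m"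
    by (simp add: complex_add_cnj)
  also have "\<dots> = (\<Sum>i\<le>m. of_nat (m choose i) * w ^ i * cnj w ^ (m - i)) / 2 ^ m"
    by (simp add: power_divide binomial_ring)
  finally show ?thesis
    by (simp add: sum_divide_distrib mult.assoc)
qed

lemma Re_moment_tendsto:
  assumes T: "\<And>i. T i \<ge> 0" "filterlim T at_top sequentially"
  shows "(\<lambda>i. \<integral>\<omega>. Re (z (T i) \<omega>) ^ m \<partial>M) \<longlonglongrightarrow> (\<integral>\<theta>. cos \<theta> ^ m \<partial>von_mises (2 * K / \<epsilon>\<^sup>2))"
proof -
  interpret V: prob_space "von_mises (2 * K / \<epsilon>\<^sup>2)"
    by (rule prob_space_von_mises)
  have [measurable]: "(\<lambda>\<theta>. cnj (cis \<theta>)) \<in> borel_measurable borel"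
    by (intro borel_measurable_continuous_onI continuous_intros)
  have V: "integrable (von_mises (2 * K / \<epsilon>\<^sup>2)) (\<lambda>\<theta>. cis \<theta> ^ j * cnj (cis \<theta>) ^ k)" for j k
    by (rule V.integrable_const_bound[of _ 1]) (auto simp: norm_mult norm_power)
  have "complex_of_real (\<integral>\<omega>. Re (z (T i) \<omega>) ^ m \<partial>M) =
      (\<Sum>n\<le>m. (of_nat (m choose n) / 2 ^ m) * (\<integral>\<omega>. z (T i) \<omega> ^ n * cnj (z (T i) \<omega>) ^ (m - n) \<partial>M))" for i
  proof -
    have "complex_of_real (\<integral>\<omega>. Re (z (T i) \<omega>) ^ m \<partial>M) =
        (\<integral>\<omega>. (\<Sum>n\<le>m. (of_nat (m choose n) / 2 ^ m) * (z (T i) \<omega> ^ n * cnj (z (T i) \<omega>) ^ (m - n))) \<partial>M)"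
      unfolding integral_complex_of_real[symmetric] Re_power_expand ..
    also have "\<dots> = (\<Sum>n\<le>m. \<integral>\<omega>. (of_nat (m choose n) / 2 ^ m) * (z (T i) \<omega> ^ n * cnj (z (T i) \<omega>) ^ (m - n)) \<partial>M)"
      by (intro Bochner_Integration.integral_sum integrable_mult_right integrable_mixed T)
    finally show ?thesis
      by (simp only: integral_mult_right_zero)
  qed
  moreover have "complex_of_real (\<integral>\<theta>. cos \<theta> ^ m \<partial>von_mises (2 * K / \<epsilon>\<^sup>2)) =
      (\<Sum>n\<le>m. (of_nat (m choose n) / 2 ^ m) * (\<integral>\<theta>. cis \<theta> ^ n * cnj (cis \<theta>) ^ (m - n) \<partial>von_mises (2 * K / \<epsilon>\<^sup>2)))"
  proof -
    have "complex_of_real (\<integral>\<theta>. cos \<theta> ^ m \<partial>von_mises (2 * K / \<epsilon>\<^sup>2)) =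
        (\<integral>\<theta>. complex_of_real (Re (cis \<theta>) ^ m) \<partial>von_mises (2 * K / \<epsilon>\<^sup>2))"
      by (simp only: integral_complex_of_real cis.sel)
    also have "\<dots> = (\<integral>\<theta>. (\<Sum>n\<le>m. (of_nat (m choose n) / 2 ^ m) * (cis \<theta> ^ n * cnj (cis \<theta>) ^ (m - n))) \<partial>von_mises (2 * K / \<epsilon>\<^sup>2))"
      unfolding Re_power_expand ..
    also have "\<dots> = (\<Sum>n\<le>m. \<integral>\<theta>. (of_nat (m choose n) / 2 ^ m) * (cis \<theta> ^ n * cnj (cis \<theta>) ^ (m - n)) \<partial>von_mises (2 * K / \<epsilon>\<^sup>2))"
      by (intro Bochner_Integration.integral_sum integrable_mult_right V)
    finally show ?thesis
      by (simp only: integral_mult_right_zero)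
  qed
  moreover have "(\<lambda>i. \<Sum>n\<le>m. (of_nat (m choose n) / 2 ^ m) * (\<integral>\<omega>. z (T i) \<omega> ^ n * cnj (z (T i) \<omega>) ^ (m - n) \<partial>M)) \<longlonglongrightarrow>
      (\<Sum>n\<le>m. (of_nat (m choose n) / 2 ^ m) * (\<integral>\<theta>. cis \<theta> ^ n * cnj (cis \<theta>) ^ (m - n) \<partial>von_mises (2 * K / \<epsilon>\<^sup>2)))"
    by (intro tendsto_intros mixed_moment_tendsto T)
  ultimately have "(\<lambda>i. complex_of_real (\<integral>\<omega>. Re (z (T i) \<omega>) ^ m \<partial>M)) \<longlonglongrightarrow> complex_of_real (\<integral>\<theta>. cos \<theta> ^ m \<partial>von_mises (2 * K / \<epsilon>\<^sup>2))"
    by (simp only:)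
  then show ?thesis
    by (simp only: tendsto_of_real_iff)
qed

text \<open>Re z and cos both take values in the compact interval [-1, 1], so Weierstrass
  approximation makes polynomial moments sufficient, with an error that is uniform in time.\<close>

lemma expectation_continuous_tendsto:
  fixes f :: "real \<Rightarrow> real"
  assumes T: "\<And>i. T i \<ge> 0" "filterlim T at_top sequentially" and f: "continuous_on UNIV f"
  shows "(\<lambda>i. \<integral>\<omega>. f (Re (z (T i) \<omega>)) \<partial>M) \<longlonglongrightarrow> (\<integral>\<theta>. f (cos \<theta>) \<partial>von_mises (2 * K / \<epsilon>\<^sup>2))"
proof (rule LIMSEQ_I)
  fix e :: real assume e: "e > 0"
  interpret V: prob_space "von_mises (2 * K / \<epsilon>\<^sup>2)"
    by (rule prob_space_von_mises)
  obtain g where g: "real_polynomial_function g" "\<And>x. x \<in> {-1..1} \<Longrightarrow> \<bar>f x - g x\<bar> < e / 3"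
    using Stone_Weierstrass_real_polynomial_function[of "{-1..1}" f "e/3"] continuous_on_subset[OF f] e by auto
  obtain a N where gsum: "g = (\<lambda>x. \<Sum>m\<le>N. a m * x ^ m)"
    using g(1) unfolding real_polynomial_function_iff_sum by blast
  have g_cont: "continuous_on UNIV g"
    unfolding gsum by (intro continuous_intros)
  have [measurable]: "f \<in> borel_measurable borel" "g \<in> borel_measurable borel"
    using f g_cont by (auto intro: borel_measurable_continuous_onI)
  have bounded: "\<exists>B. \<forall>x\<in>{-1..1}. norm (q x) \<le> B" if "continuous_on UNIV q" for q :: "real \<Rightarrow> real"
    using compact_imp_bounded[OF compact_continuous_image[OF continuous_on_subset[OF that subset_UNIV] compact_Icc[of "-1" 1]]]
    unfolding bounded_iff by blast
  have Re1: "Re w \<in> {-1..1}" if "cmod w \<le> 1" for w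
    using abs_Re_le_cmod[of w] that by auto
  have M: "integrable M (\<lambda>\<omega>. q (Re (z (T i) \<omega>)))" if q: "continuous_on UNIV q" for q :: "real \<Rightarrow> real" and i
  proof -
    obtain B where B: "\<forall>x\<in>{-1..1}. norm (q x) \<le> B"
      using bounded[OF q] by blast
    have [measurable]: "z (T i) \<in> borel_measurable M" "q \<in> borel_measurable borel"
      using z_measurable[OF T(1)] q by (auto intro: borel_measurable_continuous_onI)
    have "AE \<omega> in M. norm (q (Re (z (T i) \<omega>))) \<le> B"
      using z_bound[OF T(1)[of i]] by eventually_elim (intro bspec[OF B] Re1)
    then show ?thesis
      by (rule integrable_const_bound) measurable
  qed
  have Vq: "integrable (von_mises (2 * K / \<epsilon>\<^sup>2)) (\<lambda>\<theta>. q (cos \<theta>))" if q: "continuous_on UNIV q" for q :: "real \<Rightarrow> real"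
  proof -
    obtain B where B: "\<forall>x\<in>{-1..1}. norm (q x) \<le> B"
      using bounded[OF q] by blast
    have [measurable]: "q \<in> borel_measurable borel"
      using q by (auto intro: borel_measurable_continuous_onI)
    have "AE \<theta> in von_mises (2 * K / \<epsilon>\<^sup>2). norm (q (cos \<theta>)) \<le> B"
      by (intro AE_I2 bspec[OF B]) simp
    then show ?thesis
      by (rule V.integrable_const_bound) measurable
  qed
  have pow: "continuous_on UNIV (\<lambda>x::real. c * x ^ m)" for m c
    by (intro continuous_intros)
  have "(\<lambda>i. \<Sum>m\<le>N. a m * (\<integral>\<omega>. Re (z (T i) \<omega>) ^ m \<partial>M)) \<longlonglongrightarrow> (\<Sum>m\<le>N. a m * (\<integral>\<theta>. cos \<theta> ^ m \<partial>von_mises (2 * K / \<epsilon>\<^sup>2)))"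
    by (intro tendsto_intros Re_moment_tendsto T)
  moreover have "(\<Sum>m\<le>N. a m * (\<integral>\<omega>. Re (z (T i) \<omega>) ^ m \<partial>M)) = (\<integral>\<omega>. g (Re (z (T i) \<omega>)) \<partial>M)" for i
    unfolding gsum using Bochner_Integration.integral_sum[of "{..N}" M "\<lambda>m \<omega>. a m * Re (z (T i) \<omega>) ^ m", OF M[OF pow]] by simp
  moreover have "(\<Sum>m\<le>N. a m * (\<integral>\<theta>. cos \<theta> ^ m \<partial>von_mises (2 * K / \<epsilon>\<^sup>2))) = (\<integral>\<theta>. g (cos \<theta>) \<partial>von_mises (2 * K / \<epsilon>\<^sup>2))"
    unfolding gsum using Bochner_Integration.integral_sum[of "{..N}" "von_mises (2 * K / \<epsilon>\<^sup>2)" "\<lambda>m \<theta>. a m * cos \<theta> ^ m", OF Vq[OF pow]] by simp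
  ultimately have "(\<lambda>i. \<integral>\<omega>. g (Re (z (T i) \<omega>)) \<partial>M) \<longlonglongrightarrow> (\<integral>\<theta>. g (cos \<theta>) \<partial>von_mises (2 * K / \<epsilon>\<^sup>2))"
    by simp
  then obtain n0 where n0: "\<And>i. i \<ge> n0 \<Longrightarrow> norm ((\<integral>\<omega>. g (Re (z (T i) \<omega>)) \<partial>M) - (\<integral>\<theta>. g (cos \<theta>) \<partial>von_mises (2 * K / \<epsilon>\<^sup>2))) < e / 3"
    using LIMSEQ_D[of _ _ "e/3"] e by force
  have 1: "\<bar>(\<integral>\<omega>. f (Re (z (T i) \<omega>)) \<partial>M) - (\<integral>\<omega>. g (Re (z (T i) \<omega>)) \<partial>M)\<bar> \<le> e / 3" for i
  proof -
    have "(\<integral>\<omega>. f (Re (z (T i) \<omega>)) \<partial>M) - (\<integral>\<omega>. g (Re (z (T i) \<omega>)) \<partial>M) = (\<integral>\<omega>. f (Re (z (T i) \<omega>)) - g (Re (z (T i) \<omega>)) \<partial>M)"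
      by (intro Bochner_Integration.integral_diff[symmetric] M f g_cont)
    also have "\<bar>\<dots>\<bar> \<le> (\<integral>\<omega>. \<bar>f (Re (z (T i) \<omega>)) - g (Re (z (T i) \<omega>))\<bar> \<partial>M)"
      by (rule integral_abs_bound)
    also have "\<dots> \<le> (\<integral>\<omega>. e / 3 \<partial>M)"
    proof (rule integral_mono_AE)
      show "integrable M (\<lambda>\<omega>. \<bar>f (Re (z (T i) \<omega>)) - g (Re (z (T i) \<omega>))\<bar>)"
        by (intro integrable_abs Bochner_Integration.integrable_diff M f g_cont)
      show "AE \<omega> in M. \<bar>f (Re (z (T i) \<omega>)) - g (Re (z (T i) \<omega>))\<bar> \<le> e / 3"
        using z_bound[OF T(1)[of i]] by eventually_elim (intro less_imp_le[OF g(2)] Re1)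
    qed simp
    finally show ?thesis
      by (simp add: prob_space)
  qed
  have 2: "\<bar>(\<integral>\<theta>. f (cos \<theta>) \<partial>von_mises (2 * K / \<epsilon>\<^sup>2)) - (\<integral>\<theta>. g (cos \<theta>) \<partial>von_mises (2 * K / \<epsilon>\<^sup>2))\<bar> \<le> e / 3"
  proof -
    have "(\<integral>\<theta>. f (cos \<theta>) \<partial>von_mises (2 * K / \<epsilon>\<^sup>2)) - (\<integral>\<theta>. g (cos \<theta>) \<partial>von_mises (2 * K / \<epsilon>\<^sup>2)) =
        (\<integral>\<theta>. f (cos \<theta>) - g (cos \<theta>) \<partial>von_mises (2 * K / \<epsilon>\<^sup>2))"
      by (intro Bochner_Integration.integral_diff[symmetric] Vq f g_cont)
    also have "\<bar>\<dots>\<bar> \<le> (\<integral>\<theta>. \<bar>f (cos \<theta>) - g (cos \<theta>)\<bar> \<partial>von_mises (2 * K / \<epsilon>\<^sup>2))"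
      by (rule integral_abs_bound)
    also have "\<dots> \<le> (\<integral>\<theta>. e / 3 \<partial>von_mises (2 * K / \<epsilon>\<^sup>2))"
    proof (rule integral_mono)
      show "integrable (von_mises (2 * K / \<epsilon>\<^sup>2)) (\<lambda>\<theta>. \<bar>f (cos \<theta>) - g (cos \<theta>)\<bar>)"
        by (intro integrable_abs Bochner_Integration.integrable_diff Vq f g_cont)
      show "\<bar>f (cos \<theta>) - g (cos \<theta>)\<bar> \<le> e / 3" for \<theta>
        by (intro less_imp_le[OF g(2)]) simp
    qed simp
    finally show ?thesis
      by (simp add: V.prob_space)
  qed
  show "\<exists>n0. \<forall>i\<ge>n0. norm ((\<integral>\<omega>. f (Re (z (T i) \<omega>)) \<partial>M) - (\<integral>\<theta>. f (cos \<theta>) \<partial>von_mises (2 * K / \<epsilon>\<^sup>2))) < e"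
  proof (intro exI allI impI)
    fix i assume "i \<ge> n0"
    have triangle: "\<bar>a - d\<bar> < e" if "\<bar>a - b\<bar> \<le> e / 3" "\<bar>b - c\<bar> < e / 3" "\<bar>d - c\<bar> \<le> e / 3" for a b c d :: real
      using that by linarith
    show "norm ((\<integral>\<omega>. f (Re (z (T i) \<omega>)) \<partial>M) - (\<integral>\<theta>. f (cos \<theta>) \<partial>von_mises (2 * K / \<epsilon>\<^sup>2))) < e"
      unfolding real_norm_def by (rule triangle[OF 1 n0[OF \<open>i \<ge> n0\<close>, unfolded real_norm_def] 2])
  qed
qed

end

text \<open>For r = \<epsilon>^2 / K the parameter 2 / r is 2 K / \<epsilon>^2, the only combination
  of the coefficients that enters. The square root is the distance of two unit vectors with overlap
  \<open>cis \<theta>\<close>.\<close>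

definition limit_law :: "real \<Rightarrow> real measure" where
  "limit_law r = distr (von_mises (2 / r)) borel (\<lambda>\<theta>. sqrt (2 - 2 * cos \<theta>))"

lemma real_distribution_limit_law: "real_distribution (limit_law r)"
  unfolding limit_law_def
  by (intro prob_space.real_distribution_distr prob_space_von_mises) measurable

context overlap_process
begin

lemma distance_weak_conv:
  assumes X: "\<And>t. t \<ge> 0 \<Longrightarrow> X t \<in> borel_measurable M"
    and Xz: "\<And>t. t \<ge> 0 \<Longrightarrow> AE \<omega> in M. X t \<omega> = sqrt (2 - 2 * Re (z t \<omega>))"
  shows "weak_conv_along (\<lambda>t. distr M borel (X t)) (limit_law (\<epsilon>\<^sup>2 / K)) at_top"
  unfolding weak_conv_along_def
proof (intro allI impI)
  fix x assume x: "isCont (cdf (limit_law (\<epsilon>\<^sup>2 / K))) x"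
  interpret L: real_distribution "limit_law (\<epsilon>\<^sup>2 / K)"
    by (rule real_distribution_limit_law)
  show "((\<lambda>t. cdf (distr M borel (X t)) x) \<longlongrightarrow> cdf (limit_law (\<epsilon>\<^sup>2 / K)) x) at_top"
  proof (rule tendsto_at_topI_sequentially)
    fix S :: "nat \<Rightarrow> real" assume S: "filterlim S at_top sequentially"
    \<comment> \<open>Convergence as t grows is tested along sequences. The process is controlled at
      nonnegative times only, and a sequence tending to infinity has finitely many negative
      terms.\<close>
    define T where "T i = max 0 (S i)" for i
    have ev: "\<forall>\<^sub>F i in sequentially. S i = T i"
      using filterlim_at_top[THEN iffD1, OF S, rule_format, of 0] by eventually_elim (simp add: T_def)
    have T: "T i \<ge> 0" "filterlim T at_top sequentially" for i
      using filterlim_cong[OF refl refl ev, THEN iffD1, OF S] by (simp add: T_def, blast)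
    have Xm [measurable]: "X (T i) \<in> borel_measurable M" for i
      using X[OF T(1)] .
    \<comment> \<open>Continuous ramps suffice as test functions, and composed with the distance
      formula they remain continuous functions of the real part of the overlap.\<close>
    have "weak_conv_m (\<lambda>i. distr M borel (X (T i))) (limit_law (\<epsilon>\<^sup>2 / K))"
    proof (rule integral_cts_step_conv_imp_weak_conv)
      show "real_distribution (distr M borel (X (T i)))" for i
        by (intro real_distribution_distr Xm)
      show "real_distribution (limit_law (\<epsilon>\<^sup>2 / K))"
        by (rule real_distribution_limit_law)
      fix a b :: real assume ab: "a < b"
      have cts: "continuous_on UNIV (cts_step a b)"
        using cts_step_uniformly_continuous[OF ab] by (rule uniformly_continuous_imp_continuous)
      have [measurable]: "cts_step a b \<in> borel_measurable borel"
        using cts by (rule borel_measurable_continuous_onI)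
      have "(\<lambda>i. \<integral>\<omega>. cts_step a b (sqrt (2 - 2 * Re (z (T i) \<omega>))) \<partial>M) \<longlonglongrightarrow>
          (\<integral>\<theta>. cts_step a b (sqrt (2 - 2 * cos \<theta>)) \<partial>von_mises (2 * K / \<epsilon>\<^sup>2))"
      proof (rule expectation_continuous_tendsto[OF T, of "\<lambda>x. cts_step a b (sqrt (2 - 2 * x))"])
        show "continuous_on UNIV (\<lambda>x. cts_step a b (sqrt (2 - 2 * x)))"
          by (rule continuous_on_compose2[OF cts]) (auto intro!: continuous_intros)
      qed
      moreover have "(\<integral>\<omega>. cts_step a b (sqrt (2 - 2 * Re (z (T i) \<omega>))) \<partial>M) = (\<integral>y. cts_step a b y \<partial>distr M borel (X (T i)))" for i
      proof -
        have [measurable]: "z (T i) \<in> borel_measurable M"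
          using z_measurable[OF T(1)] .
        have "(\<integral>y. cts_step a b y \<partial>distr M borel (X (T i))) = (\<integral>\<omega>. cts_step a b (X (T i) \<omega>) \<partial>M)"
          by (rule integral_distr) measurable
        also have "\<dots> = (\<integral>\<omega>. cts_step a b (sqrt (2 - 2 * Re (z (T i) \<omega>))) \<partial>M)"
        proof (rule integral_cong_AE)
          show "AE \<omega> in M. cts_step a b (X (T i) \<omega>) = cts_step a b (sqrt (2 - 2 * Re (z (T i) \<omega>)))"
            using Xz[OF T(1)[of i]] by eventually_elim simp
        qed measurable
        finally show ?thesis ..
      qed
      moreover have "(\<integral>\<theta>. cts_step a b (sqrt (2 - 2 * cos \<theta>)) \<partial>von_mises (2 * K / \<epsilon>\<^sup>2)) = (\<integral>y. cts_step a b y \<partial>limit_law (\<epsilon>\<^sup>2 / K))"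
        unfolding limit_law_def by (subst integral_distr) simp_all
      ultimately show "(\<lambda>i. \<integral>y. cts_step a b y \<partial>distr M borel (X (T i))) \<longlonglongrightarrow> (\<integral>y. cts_step a b y \<partial>limit_law (\<epsilon>\<^sup>2 / K))"
        by simp
    qed
    then have "(\<lambda>i. cdf (distr M borel (X (T i))) x) \<longlonglongrightarrow> cdf (limit_law (\<epsilon>\<^sup>2 / K)) x"
      using x by (simp add: weak_conv_m_def weak_conv_def)
    moreover have "\<forall>\<^sub>F i in sequentially. cdf (distr M borel (X (T i))) x = cdf (distr M borel (X (S i))) x"
      using ev by eventually_elim simp
    ultimately show "(\<lambda>i. cdf (distr M borel (X (S i))) x) \<longlonglongrightarrow> cdf (limit_law (\<epsilon>\<^sup>2 / K)) x"
      by (rule Lim_transform_eventually)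
  qed
qed

end

section \<open>From solutions of the system to the overlap process\<close>

lemma norm_diff_cis_L2:
  fixes f g :: "'a::euclidean_space L2"
  assumes "norm f = 1" "norm g = 1"
  shows "norm (f - cis \<theta> *\<^sub>C g) = sqrt (2 - 2 * Re (cis (- \<theta>) * cinner_L2 f g))"
proof -
  have "(norm (f - cis \<theta> *\<^sub>C g))\<^sup>2 = 2 - 2 * Re (cis (- \<theta>) * cinner_L2 f g)"
    using assms unfolding norm_diff_squared_L2 by (simp add: norm_scaleC_L2 cinner_L2_scaleC_right cis_cnj)
  then show ?thesis
    by (metis norm_ge_zero real_sqrt_unique)
qed

lemma cinner_gauge_transform:
  "cinner_L2 (gauge_transform \<epsilon> \<beta>\<^sub>1 \<psi>\<^sub>1 t \<omega>) (gauge_transform \<epsilon> \<beta>\<^sub>2 \<psi>\<^sub>2 t \<omega>) =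
    cis (- (\<epsilon> * (\<beta>\<^sub>1 t \<omega> - \<beta>\<^sub>2 t \<omega>))) * cinner_L2 (\<psi>\<^sub>1 t \<omega>) (\<psi>\<^sub>2 t \<omega>)"
  by (simp add: gauge_transform_def cinner_L2_scaleC_left cinner_L2_scaleC_right cis_cnj cis_mult algebra_simps flip: mult.assoc)

text \<open>The gauge transforms multiply the components by phases: norms are unchanged, and the
  overlap acquires exactly the phase that the equation in \<open>overlap_process\<close>
  carries.\<close>

lemma solution_pathwise:
  fixes f\<^sub>1 f\<^sub>2 :: "'a::euclidean_space L2"
  assumes bp: "brownian_pair M F \<beta>\<^sub>1 \<beta>\<^sub>2" and f: "norm f\<^sub>1 = 1" "norm f\<^sub>2 = 1"
    and sol: "schroedinger_lohe_solution M F \<beta>\<^sub>1 \<beta>\<^sub>2 K \<epsilon> f\<^sub>1 f\<^sub>2 \<psi>\<^sub>1 \<psi>\<^sub>2"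
  shows "AE \<omega> in M. cinner_L2 (\<psi>\<^sub>1 0 \<omega>) (\<psi>\<^sub>2 0 \<omega>) = cinner_L2 f\<^sub>1 f\<^sub>2 \<and>
    continuous_on {0..} (\<lambda>t. cinner_L2 (\<psi>\<^sub>1 t \<omega>) (\<psi>\<^sub>2 t \<omega>)) \<and>
    (\<forall>t\<ge>0. norm (\<psi>\<^sub>1 t \<omega>) = 1 \<and> norm (\<psi>\<^sub>2 t \<omega>) = 1 \<and>
      ((\<lambda>t. cis (- (\<epsilon> * (\<beta>\<^sub>1 t \<omega> - \<beta>\<^sub>2 t \<omega>))) * cinner_L2 (\<psi>\<^sub>1 t \<omega>) (\<psi>\<^sub>2 t \<omega>)) has_vector_derivative
        complex_of_real K * (cis (- (\<epsilon> * (\<beta>\<^sub>1 t \<omega> - \<beta>\<^sub>2 t \<omega>))) * (1 - (cinner_L2 (\<psi>\<^sub>1 t \<omega>) (\<psi>\<^sub>2 t \<omega>))\<^sup>2))) (at t within {0..}))"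
proof -
  interpret brownian_pair M F \<beta>\<^sub>1 \<beta>\<^sub>2
    by (rule bp)
  have b1: "AE \<omega> in M. continuous_on {0..} (\<lambda>t. \<beta>\<^sub>1 t \<omega>)"
    using brownian_1 unfolding brownian_motion_def by (elim conjE) (erule eventually_mono, simp)
  have b2: "AE \<omega> in M. continuous_on {0..} (\<lambda>t. \<beta>\<^sub>2 t \<omega>)"
    using brownian_2 unfolding brownian_motion_def by (elim conjE) (erule eventually_mono, simp)
  show ?thesis
    using b1 b2 conjunct2[OF sol[unfolded schroedinger_lohe_solution_def]]
  proof eventually_elim
    case (elim \<omega>)
    define b where "b t = \<beta>\<^sub>1 t \<omega> - \<beta>\<^sub>2 t \<omega>" for t
    define u where "u t = gauge_transform \<epsilon> \<beta>\<^sub>1 \<psi>\<^sub>1 t \<omega>" for t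
    define v where "v t = gauge_transform \<epsilon> \<beta>\<^sub>2 \<psi>\<^sub>2 t \<omega>" for t
    have \<psi>: "continuous_on {0..} (\<lambda>t. \<psi>\<^sub>1 t \<omega>)" "continuous_on {0..} (\<lambda>t. \<psi>\<^sub>2 t \<omega>)"
      using continuous_on_fst[OF conjunct1[OF elim(3)]] continuous_on_snd[OF conjunct1[OF elim(3)]] by simp_all
    have init: "\<psi>\<^sub>1 0 \<omega> = f\<^sub>1" "\<psi>\<^sub>2 0 \<omega> = f\<^sub>2"
      using elim(3) by simp_all
    have mild: "mild_equation K \<epsilon> b u v" "mild_equation K \<epsilon> (\<lambda>t. - b t) v u"
      using elim(3) by (simp_all add: b_def[abs_def] u_def[abs_def] v_def[abs_def])
    have b: "continuous_on {0..} b" and b': "continuous_on {0..} (\<lambda>t. - b t)"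
      unfolding b_def by (intro continuous_intros elim)+
    have uv: "continuous_on {0..} u" "continuous_on {0..} v"
      unfolding u_def v_def gauge_transform_def
      by (intro bounded_bilinear.continuous_on[OF bounded_bilinear_scaleC_L2] continuous_intros elim \<psi>)+
    have norm_uv: "norm (u t) = norm (\<psi>\<^sub>1 t \<omega>)" "norm (v t) = norm (\<psi>\<^sub>2 t \<omega>)" for t
      by (simp_all add: u_def v_def gauge_transform_def norm_scaleC_L2)
    have norm0: "norm (u 0) = 1" "norm (v 0) = 1"
      using f by (simp_all add: norm_uv init)
    have uv_inner: "cinner_L2 (u t) (v t) = cis (- (\<epsilon> * b t)) * cinner_L2 (\<psi>\<^sub>1 t \<omega>) (\<psi>\<^sub>2 t \<omega>)" for t
      unfolding u_def v_def b_def by (rule cinner_gauge_transform)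
    show ?case
    proof (intro conjI allI impI)
      show "cinner_L2 (\<psi>\<^sub>1 0 \<omega>) (\<psi>\<^sub>2 0 \<omega>) = cinner_L2 f\<^sub>1 f\<^sub>2"
        by (simp add: init)
      show "continuous_on {0..} (\<lambda>t. cinner_L2 (\<psi>\<^sub>1 t \<omega>) (\<psi>\<^sub>2 t \<omega>))"
        by (intro bounded_bilinear.continuous_on[OF bounded_bilinear_cinner_L2] \<psi>)
      fix t :: real assume t: "t \<ge> 0"
      show "norm (\<psi>\<^sub>1 t \<omega>) = 1"
        using mild_solution_norm[OF b uv mild(1) norm0(1) t] by (simp add: norm_uv)
      show "norm (\<psi>\<^sub>2 t \<omega>) = 1"
        using mild_solution_norm[OF b' uv(2,1) mild(2) norm0(2) t] by (simp add: norm_uv)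
      \<comment> \<open>One of the two phases from the square cancels against the coefficient, so a
        single phase can be factored out.\<close>
      have "K *\<^sub>R (cis (- (\<epsilon> * b t)) - cis (\<epsilon> * b t) * (cis (- (\<epsilon> * b t)) * w)\<^sup>2) =
          complex_of_real K * (cis (- (\<epsilon> * b t)) * (1 - w\<^sup>2))" for w
      proof -
        have "cis (\<epsilon> * b t) * (cis (- (\<epsilon> * b t)) * w)\<^sup>2 = (cis (\<epsilon> * b t) * cis (- (\<epsilon> * b t))) * (cis (- (\<epsilon> * b t)) * w\<^sup>2)"
          by (simp only: power2_eq_square mult_ac)
        also have "cis (\<epsilon> * b t) * cis (- (\<epsilon> * b t)) = 1"
          by (simp add: cis_mult)
        finally show ?thesis
          by (simp only: scaleR_conv_of_real mult_1_left mult_1_right right_diff_distrib)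
      qed
      with mild_solution_overlap[OF b uv mild norm0 t]
      show "((\<lambda>t. cis (- (\<epsilon> * (\<beta>\<^sub>1 t \<omega> - \<beta>\<^sub>2 t \<omega>))) * cinner_L2 (\<psi>\<^sub>1 t \<omega>) (\<psi>\<^sub>2 t \<omega>)) has_vector_derivative
        complex_of_real K * (cis (- (\<epsilon> * (\<beta>\<^sub>1 t \<omega> - \<beta>\<^sub>2 t \<omega>))) * (1 - (cinner_L2 (\<psi>\<^sub>1 t \<omega>) (\<psi>\<^sub>2 t \<omega>))\<^sup>2))) (at t within {0..})"
        unfolding uv_inner b_def[symmetric] by simp
    qed
  qed
qed

lemma solution_overlap_process:
  fixes f\<^sub>1 f\<^sub>2 :: "'a::euclidean_space L2"
  assumes bp: "brownian_pair M F \<beta>\<^sub>1 \<beta>\<^sub>2" and pos: "K > 0" "\<epsilon> > 0" and f: "norm f\<^sub>1 = 1" "norm f\<^sub>2 = 1"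
    and sol: "schroedinger_lohe_solution M F \<beta>\<^sub>1 \<beta>\<^sub>2 K \<epsilon> f\<^sub>1 f\<^sub>2 \<psi>\<^sub>1 \<psi>\<^sub>2"
  shows "overlap_process M F \<beta>\<^sub>1 \<beta>\<^sub>2 K \<epsilon> (\<lambda>t \<omega>. cinner_L2 (\<psi>\<^sub>1 t \<omega>) (\<psi>\<^sub>2 t \<omega>)) (cinner_L2 f\<^sub>1 f\<^sub>2)"
proof (intro overlap_process.intro bp overlap_process_axioms.intro pos)
  fix t :: real assume t: "t \<ge> 0"
  have "(\<lambda>\<omega>. (\<psi>\<^sub>1 t \<omega>, \<psi>\<^sub>2 t \<omega>)) \<in> borel_measurable (F t)"
    using sol t unfolding schroedinger_lohe_solution_def by blast
  moreover have "(\<lambda>p :: 'a L2 \<times> 'a L2. cinner_L2 (fst p) (snd p)) \<in> borel_measurable borel"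
    by (intro borel_measurable_continuous_onI bounded_bilinear.continuous_on[OF bounded_bilinear_cinner_L2] continuous_intros)
  ultimately show "(\<lambda>\<omega>. cinner_L2 (\<psi>\<^sub>1 t \<omega>) (\<psi>\<^sub>2 t \<omega>)) \<in> borel_measurable (F t)"
    by (rule measurable_compose[of "\<lambda>\<omega>. (\<psi>\<^sub>1 t \<omega>, \<psi>\<^sub>2 t \<omega>)" _ borel "\<lambda>p. cinner_L2 (fst p) (snd p)", simplified])
next
  show "AE \<omega> in M. cinner_L2 (\<psi>\<^sub>1 0 \<omega>) (\<psi>\<^sub>2 0 \<omega>) = cinner_L2 f\<^sub>1 f\<^sub>2 \<and>
    continuous_on {0..} (\<lambda>t. cinner_L2 (\<psi>\<^sub>1 t \<omega>) (\<psi>\<^sub>2 t \<omega>)) \<and>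
    (\<forall>t\<ge>0. cmod (cinner_L2 (\<psi>\<^sub>1 t \<omega>) (\<psi>\<^sub>2 t \<omega>)) \<le> 1 \<and>
      ((\<lambda>t. cis (- (\<epsilon> * (\<beta>\<^sub>1 t \<omega> - \<beta>\<^sub>2 t \<omega>))) * cinner_L2 (\<psi>\<^sub>1 t \<omega>) (\<psi>\<^sub>2 t \<omega>)) has_vector_derivative
        complex_of_real K * (cis (- (\<epsilon> * (\<beta>\<^sub>1 t \<omega> - \<beta>\<^sub>2 t \<omega>))) * (1 - (cinner_L2 (\<psi>\<^sub>1 t \<omega>) (\<psi>\<^sub>2 t \<omega>))\<^sup>2))) (at t within {0..}))"
    using solution_pathwise[OF bp f sol]
  proof eventually_elim
    case (elim \<omega>)
    have "cmod (cinner_L2 (\<psi>\<^sub>1 t \<omega>) (\<psi>\<^sub>2 t \<omega>)) \<le> 1" if "t \<ge> 0" for t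
    proof -
      have "norm (\<psi>\<^sub>1 t \<omega>) = 1 \<and> norm (\<psi>\<^sub>2 t \<omega>) = 1"
        using elim that by blast
      then show ?thesis
        using cinner_L2_bound[of "\<psi>\<^sub>1 t \<omega>" "\<psi>\<^sub>2 t \<omega>"] by simp
    qed
    with elim show ?case
      by blast
  qed
qed

text \<open>The argument of the overlap w is the optimal angle and gives the distance sqrt (2 - 2
  |w|); since |w| \<le> 1, the quantity 1 - |w| is at most the defect 1 - |w|^2.\<close>

lemma phase_distance_tendsto:
  fixes f g :: "real \<Rightarrow> 'a::euclidean_space L2"
  assumes norm: "\<And>t. t \<ge> 0 \<Longrightarrow> norm (f t) = 1" "\<And>t. t \<ge> 0 \<Longrightarrow> norm (g t) = 1"
    and lim: "((\<lambda>t. 1 - (cmod (cinner_L2 (f t) (g t)))\<^sup>2) \<longlongrightarrow> 0) at_top"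
  shows "((\<lambda>t. INF \<theta>. norm (f t - cis \<theta> *\<^sub>C g t)) \<longlongrightarrow> 0) at_top"
proof -
  have bdd: "bdd_below (range (\<lambda>\<theta>. norm (f t - cis \<theta> *\<^sub>C g t)))" for t
    by (intro bdd_belowI[of _ 0]) auto
  have lim2: "((\<lambda>t. sqrt (2 * (1 - (cmod (cinner_L2 (f t) (g t)))\<^sup>2))) \<longlongrightarrow> 0) at_top"
    using tendsto_real_sqrt[OF tendsto_mult_right_zero[OF lim, of 2]] by simp
  show ?thesis
  proof (rule tendsto_sandwich[OF _ _ tendsto_const lim2])
    show "\<forall>\<^sub>F t in at_top. 0 \<le> (INF \<theta>. norm (f t - cis \<theta> *\<^sub>C g t))"
      by (intro always_eventually allI cINF_greatest) auto
    show "\<forall>\<^sub>F t in at_top. (INF \<theta>. norm (f t - cis \<theta> *\<^sub>C g t)) \<le> sqrt (2 * (1 - (cmod (cinner_L2 (f t) (g t)))\<^sup>2))"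
      using eventually_ge_at_top[of 0]
    proof eventually_elim
      case (elim t)
      define w where "w = cinner_L2 (f t) (g t)"
      have w: "cmod w \<le> 1"
        using cinner_L2_bound[of "f t" "g t"] norm elim by (simp add: w_def)
      have "(INF \<theta>. norm (f t - cis \<theta> *\<^sub>C g t)) \<le> norm (f t - cis (Arg w) *\<^sub>C g t)"
        by (intro cINF_lower bdd) simp
      also have "\<dots> = sqrt (2 - 2 * Re (cis (- Arg w) * w))"
        unfolding w_def using norm elim by (intro norm_diff_cis_L2) auto
      also have "cis (- Arg w) * w = complex_of_real (cmod w)"
        by (subst (2) rcis_cmod_Arg[of w, symmetric]) (simp add: rcis_def cis_mult mult.left_commute)
      also have "sqrt (2 - 2 * Re (complex_of_real (cmod w))) \<le> sqrt (2 * (1 - (cmod w)\<^sup>2))"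
        using w mult_left_le[of "cmod w" "cmod w"] by (intro real_sqrt_le_mono) (simp add: power2_eq_square)
      finally show ?case
        by (simp add: w_def)
    qed
  qed
qed

text \<open>The order of the quantifiers carries the claim on dependence: the family of laws is
  chosen before the probability space, the coefficients and the initial data, and is evaluated at
  \<epsilon>^2 / K only.\<close>

theorem theorem4:
  shows "\<exists>\<nu> :: real \<Rightarrow> real measure.
    (\<forall>r>0. real_distribution (\<nu> r)) \<and>
    (\<forall>(M :: 'w measure) F \<beta>\<^sub>1 \<beta>\<^sub>2 K \<epsilon> (f\<^sub>1 :: 'a::euclidean_space L2) f\<^sub>2 \<psi>\<^sub>1 \<psi>\<^sub>2.
       brownian_pair M F \<beta>\<^sub>1 \<beta>\<^sub>2 \<and> K > 0 \<and> \<epsilon> > 0 \<and> norm f\<^sub>1 = 1 \<and> norm f\<^sub>2 = 1 \<and>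
       schroedinger_lohe_solution M F \<beta>\<^sub>1 \<beta>\<^sub>2 K \<epsilon> f\<^sub>1 f\<^sub>2 \<psi>\<^sub>1 \<psi>\<^sub>2 \<longrightarrow>
         weak_conv_along (\<lambda>t. distr M borel (\<lambda>\<omega>. norm (\<psi>\<^sub>1 t \<omega> - \<psi>\<^sub>2 t \<omega>))) (\<nu> (\<epsilon>\<^sup>2 / K)) at_top \<and>
         (AE \<omega> in M. ((\<lambda>t. INF \<theta>. norm (\<psi>\<^sub>1 t \<omega> - cis \<theta> *\<^sub>C \<psi>\<^sub>2 t \<omega>)) \<longlongrightarrow> 0) at_top))"
proof (intro exI[of _ limit_law] conjI allI impI real_distribution_limit_law; elim conjE)
  fix M :: "'w measure" and F \<beta>\<^sub>1 \<beta>\<^sub>2 K \<epsilon> and f\<^sub>1 f\<^sub>2 :: "'a L2" and \<psi>\<^sub>1 \<psi>\<^sub>2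
  assume bp: "brownian_pair M F \<beta>\<^sub>1 \<beta>\<^sub>2" and pos: "K > 0" "\<epsilon> > 0" and f: "norm f\<^sub>1 = 1" "norm f\<^sub>2 = 1"
    and sol: "schroedinger_lohe_solution M F \<beta>\<^sub>1 \<beta>\<^sub>2 K \<epsilon> f\<^sub>1 f\<^sub>2 \<psi>\<^sub>1 \<psi>\<^sub>2"
  interpret overlap_process M F \<beta>\<^sub>1 \<beta>\<^sub>2 K \<epsilon> "\<lambda>t \<omega>. cinner_L2 (\<psi>\<^sub>1 t \<omega>) (\<psi>\<^sub>2 t \<omega>)" "cinner_L2 f\<^sub>1 f\<^sub>2"
    by (rule solution_overlap_process[OF bp pos f sol])
  note path = solution_pathwise[OF bp f sol]
  show "weak_conv_along (\<lambda>t. distr M borel (\<lambda>\<omega>. norm (\<psi>\<^sub>1 t \<omega> - \<psi>\<^sub>2 t \<omega>))) (limit_law (\<epsilon>\<^sup>2 / K)) at_top"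
  proof (rule distance_weak_conv)
    fix t :: real assume t: "t \<ge> 0"
    have "(\<lambda>\<omega>. (\<psi>\<^sub>1 t \<omega>, \<psi>\<^sub>2 t \<omega>)) \<in> borel_measurable (F t)"
      using sol t unfolding schroedinger_lohe_solution_def by blast
    then have "(\<lambda>\<omega>. (\<psi>\<^sub>1 t \<omega>, \<psi>\<^sub>2 t \<omega>)) \<in> borel_measurable M"
      using t by (rule measurable_F_M)
    moreover have "(\<lambda>p :: 'a L2 \<times> 'a L2. norm (fst p - snd p)) \<in> borel_measurable borel"
      by (intro borel_measurable_continuous_onI continuous_intros)
    ultimately show "(\<lambda>\<omega>. norm (\<psi>\<^sub>1 t \<omega> - \<psi>\<^sub>2 t \<omega>)) \<in> borel_measurable M"
      by (rule measurable_compose[of "\<lambda>\<omega>. (\<psi>\<^sub>1 t \<omega>, \<psi>\<^sub>2 t \<omega>)" _ borel "\<lambda>p. norm (fst p - snd p)", simplified])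
    show "AE \<omega> in M. norm (\<psi>\<^sub>1 t \<omega> - \<psi>\<^sub>2 t \<omega>) = sqrt (2 - 2 * Re (cinner_L2 (\<psi>\<^sub>1 t \<omega>) (\<psi>\<^sub>2 t \<omega>)))"
      using path
    proof eventually_elim
      case (elim \<omega>)
      with t have "norm (\<psi>\<^sub>1 t \<omega>) = 1" "norm (\<psi>\<^sub>2 t \<omega>) = 1"
        by blast+
      from norm_diff_cis_L2[OF this, of 0] show ?case
        by (simp add: scaleC_one_L2)
    qed
  qed
  show "AE \<omega> in M. ((\<lambda>t. INF \<theta>. norm (\<psi>\<^sub>1 t \<omega> - cis \<theta> *\<^sub>C \<psi>\<^sub>2 t \<omega>)) \<longlongrightarrow> 0) at_top"
    using path overlap_defect_AE_tendsto
  proof eventually_elim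
    case (elim \<omega>)
    show ?case
      by (rule phase_distance_tendsto[OF _ _ elim(2)]) (use elim(1) in blast)+
  qed
qed

end
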